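(* Let $\beta_1,\dots,\beta_7\in(0,1)$ satisfy $$\beta_4+\sum_{\ell=1}^4\beta_\ell=2,\quad \beta_2+\beta_3<\beta_1,\quad \beta_4<\tfrac13,\quad \beta_4+\sum_{\ell=5}^7\beta_\ell=2,\quad \beta_4+\beta_5<1.$$ Set $$\beta_{1,\ell}:=\begin{cases}\beta_\ell&\ell=1,2,3,4\\0&\ell=5,6,7\end{cases},\qquad \beta_{2,\ell}:=\begin{cases}0&\ell=1,2,3,4\\ \beta_\ell&\ell=5,6,7.\end{cases}$$ Let $P_1,\dots,P_4\in\mathbb{R}^2$ be distinct points such that the problem $$-\Delta u=\prod_{\ell=1}^4\frac{1}{|x-P_\ell|^{2\beta_\ell}}\,e^{2u}\quad\text{in }\mathbb{R}^2,\qquad u(x)=-2\beta_4\log|x|+O(1)\quad\text{as }|x|\to\infty,$$ has no continuous solution. Let $P_5\in\mathbb{R}^2\setminus\{P_1,\dots,P_4\}$ be fixed. Then for $|P_6|,|P_7|$ large, $P_6\neq P_7$ (that is, there is $R>0$ such that for all $P_6\ne P_7$ in $\mathbb{R}^2$ with $|P_6|,|P_7|\ge R$), there exists no continuous solution $(u_1,u_2)$ to $$\begin{cases}-\Delta u_1=2K_1e^{2u_1}-K_2e^{2u_2}&\text{in }\mathbb{R}^2,\\ -\Delta u_2=2K_2e^{2u_2}-K_1e^{2u_1}&\text{in }\mathbb{R}^2,\end{cases}\qquad K_i(x):=\prod_{\ell=1}^7\frac{1}{|x-P_\ell|^{2\beta_{i,\ell}}},$$ such that $$u_i(x)=-\beta_4\log|x|+O(1)\quad\text{as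 }|x|\to\infty,\quad i=1,2.$$
   Context: Equations are understood in the sense of distributions on $\mathbb{R}^2$. *)

theory Defs
  imports "HOL-Analysis.Analysis" "HOL-Library.Landau_Symbols"
begin

definition partial_deriv ::
    "'a::euclidean_space \<Rightarrow> ('a \<Rightarrow> real) \<Rightarrow> 'a \<Rightarrow> real" where
  "partial_deriv b f x = frechet_derivative f (at x) b"

definition laplacian :: "('a::euclidean_space \<Rightarrow> real) \<Rightarrow> 'a \<Rightarrow> real" where
  "laplacian f x = (\<Sum>b\<in>Basis. partial_deriv b (partial_deriv b f) x)"

primrec C_k :: "nat \<Rightarrow> ('a::euclidean_space \<Rightarrow> real) \<Rightarrow> bool" where
  "C_k 0 f \<longleftrightarrow> continuous_on UNIV f"
| "C_k (Suc k) f \<longleftrightarrow> f differentiable_on UNIV \<and> (\<forall>b\<in>Basis. C_k k (partial_deriv b f))"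

definition test_function :: "('a::euclidean_space \<Rightarrow> real) \<Rightarrow> bool" where
  "test_function \<phi> \<longleftrightarrow> (\<forall>k. C_k k \<phi>) \<and> compact (closure {x. \<phi> x \<noteq> 0})"

definition locally_integrable :: "('a::euclidean_space \<Rightarrow> real) \<Rightarrow> bool" where
  "locally_integrable f \<longleftrightarrow> (\<forall>S. compact S \<longrightarrow> f absolutely_integrable_on S)"

(* -\<Delta>u = f in the sense of distributions on the whole space.  Local integrability is part
   of the definition because the Bochner integral of a non-integrable function is 0. *)
definition neg_laplacian_distr ::
    "('a::euclidean_space \<Rightarrow> real) \<Rightarrow> ('a \<Rightarrow> real) \<Rightarrow> bool" where
  "neg_laplacian_distr u f \<longleftrightarrow>
     locally_integrable u \<and> locally_integrable f \<and>
     (\<forall>\<phi>. test_function \<phi> \<longrightarrow>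
        (LINT x|lebesgue. u x * (- laplacian \<phi> x)) = (LINT x|lebesgue. f x * \<phi> x))"

definition sing_exponent :: "(nat \<Rightarrow> real) \<Rightarrow> nat \<Rightarrow> nat \<Rightarrow> real" where
  "sing_exponent \<beta> i l =
     (if i = 1 then (if l \<in> {1..4} then \<beta> l else 0)
      else (if l \<in> {5..7} then \<beta> l else 0))"

(* At x = P l the l-th factor is 1 / 0 = 0, also when its exponent is 0 (0 powr 0 = 0).
   This concerns finitely many points only and is not seen by distributions. *)
definition sing_weight ::
    "nat set \<Rightarrow> (nat \<Rightarrow> 'a::real_normed_vector) \<Rightarrow> (nat \<Rightarrow> real) \<Rightarrow> 'a \<Rightarrow> real" where
  "sing_weight I P b x = (\<Prod>l\<in>I. 1 / norm (x - P l) powr (2 * b l))"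

definition log_asymptotics :: "real \<Rightarrow> ('a::real_normed_vector \<Rightarrow> real) \<Rightarrow> bool" where
  "log_asymptotics c u \<longleftrightarrow> (\<lambda>x. u x - c * ln (norm x)) \<in> O[at_infinity](\<lambda>_. 1)"

definition liouville_solution ::
    "(nat \<Rightarrow> real) \<Rightarrow> (nat \<Rightarrow> real^2) \<Rightarrow> (real^2 \<Rightarrow> real) \<Rightarrow> bool" where
  "liouville_solution \<beta> P u \<longleftrightarrow>
     continuous_on UNIV u \<and>
     neg_laplacian_distr u (\<lambda>x. sing_weight {1..4} P \<beta> x * exp (2 * u x)) \<and>
     log_asymptotics (- 2 * \<beta> 4) u"

definition toda_solution ::
    "(nat \<Rightarrow> real) \<Rightarrow> (nat \<Rightarrow> real^2) \<Rightarrow> (real^2 \<Rightarrow> real) \<Rightarrow> (real^2 \<Rightarrow> real) \<Rightarrow> bool" where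
  "toda_solution \<beta> P u1 u2 \<longleftrightarrow>
     (let K = (\<lambda>i. sing_weight {1..7} P (sing_exponent \<beta> i)) in
       continuous_on UNIV u1 \<and> continuous_on UNIV u2 \<and>
       neg_laplacian_distr u1 (\<lambda>x. 2 * K 1 x * exp (2 * u1 x) - K 2 x * exp (2 * u2 x)) \<and>
       neg_laplacian_distr u2 (\<lambda>x. 2 * K 2 x * exp (2 * u2 x) - K 1 x * exp (2 * u1 x)) \<and>
       log_asymptotics (- \<beta> 4) u1 \<and> log_asymptotics (- \<beta> 4) u2)"

end

(* If the theorem fails, there are solutions (u1, u2) with P6, P7 tending to infinity.  Up to the
   constant of the fundamental solution, f = K1 exp(2 u1) and h = K2 exp(2 u2) both have mass beta 4,
   and u1, u2 are combinations of the logarithmic potentials V of f and U of h, plus constants.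
   Jensen's inequality for exp(4 V) bounds f away from P1, P2, P3.  As beta 4 + beta 5 < 1, the
   density h and its potential U tend to 0 locally uniformly: its mass escapes to infinity.
   Comparing f with its dilations about P l gives a local Pohozaev inequality: if f is small away
   from the points, its mass M near P l satisfies M (1 - beta l) = M^2 up to a small error.  Since
   M <= beta 4, which is below 1 - beta 2 and 1 - beta 3 but above 1 - beta 1, this would leave no mass
   at P2, P3 and less than beta 4 at P1, which is impossible.  So the constant factor
   of f is bounded below; then f cannot concentrate a mass (1 - beta l) / 2 or more at P l, as it would
   dominate a multiple of 1 / |x - P l|^2 there.  Hence the V are equi-Hoelder, and a limit of 2 V
   plus a constant solves the Liouville problem. *)

theory Submission
  imports Defs "HOL-Complex_Analysis.Great_Picard" "HOL-Real_Asymp.Real_Asymp"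
begin

section \<open>Kernel estimates in the plane\<close>

text \<open>Repulsion and attraction enter asymmetrically. The kernel \<open>ln (ratio x y)\<close>
  is at least \<open>- ln (1 + norm x)\<close>, so a potential is bounded below by its mass alone,
  and the coupling factors \<open>exp (-2 * pot _)\<close> need no information on the other density.
  Only \<open>exp (4 * pot _)\<close> can blow up. By Jensen it is controlled by an average of poles
  of order 4 * mass, and such a pole merging with a singularity of order 2 * \<beta> l stays
  integrable when 2 * \<beta> l + 4 * mass < 2. With the full mass \<beta> 4 this reads 6 * \<beta>
  4 < 2 at \<open>P 4\<close>, which is the hypothesis \<beta> 4 < 1/3. At the other points it may
  fail, and there the mass of a small disc must be controlled first. All compactness is carried by
  one quantity, the weighted Riesz bound \<open>riesz a C f\<close>: it yields upper bounds, Hoelder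
  continuity and asymptotics of \<open>pot f\<close>. The Pohozaev argument uses finite dilations
  and the convexity of exp, so no derivative of a solution is taken. The integral representation
  comes from testing with a smoothly truncated logarithm.\<close>

type_synonym plane = "real^2"

lemma emeasure_cball_plane:
  "r \<ge> 0 \<Longrightarrow> emeasure lborel (cball (c::plane) r) = ennreal (pi * r\<^sup>2)"
  by (simp add: emeasure_cball unit_ball_vol_2)

lemma emeasure_ball_plane:
  "r \<ge> 0 \<Longrightarrow> emeasure lborel (ball (c::plane) r) = ennreal (pi * r\<^sup>2)"
  by (simp add: emeasure_ball unit_ball_vol_2)

lemma lborel_distr_uminus_euclidean: "distr lborel borel uminus = (lborel :: 'a::euclidean_space measure)"
proof -
  have "lborel = density (distr lborel borel (\<lambda>x::'a. 0 + (-1) *\<^sub>R x)) (\<lambda>_. \<bar>-1::real\<bar>^DIM('a))"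
    by (rule lborel_affine) simp
  then show ?thesis by (simp add: density_1)
qed

lemma nn_integral_translate:
  fixes g :: "'a::euclidean_space \<Rightarrow> ennreal"
  assumes [measurable]: "g \<in> borel_measurable borel"
  shows "(\<integral>\<^sup>+y. g (y - a) \<partial>lborel) = (\<integral>\<^sup>+y. g y \<partial>lborel)"
    and "(\<integral>\<^sup>+y. g (a - y) \<partial>lborel) = (\<integral>\<^sup>+y. g y \<partial>lborel)"
proof -
  show 1: "(\<integral>\<^sup>+y. g (y - a) \<partial>lborel) = (\<integral>\<^sup>+y. g y \<partial>lborel)" for a
    by (subst (2) lborel_distr_plus[of "-a", symmetric], subst nn_integral_distr) auto
  have "(\<integral>\<^sup>+y. g (a - y) \<partial>lborel) = (\<integral>\<^sup>+y. g (- (y - a)) \<partial>lborel)" by simp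
  also have "\<dots> = (\<integral>\<^sup>+y. g (- y) \<partial>lborel)"
    by (subst (2) lborel_distr_plus[of "-a", symmetric], subst nn_integral_distr) auto
  also have "\<dots> = (\<integral>\<^sup>+y. g y \<partial>lborel)"
    by (subst (2) lborel_distr_uminus_euclidean[symmetric], subst nn_integral_distr) auto
  finally show "(\<integral>\<^sup>+y. g (a - y) \<partial>lborel) = (\<integral>\<^sup>+y. g y \<partial>lborel)" .
qed

text \<open>Model profile for kernels with several poles: exponent t governs the unit disc, exponent
  s its complement. At z = 0 the value is 0, because \<open>0 powr _ = 0\<close>; this affects a
  null set only.\<close>

definition bend :: "real \<Rightarrow> real \<Rightarrow> plane \<Rightarrow> real" where
  "bend t s z = min 1 (norm z) powr (-t) * max 1 (norm z) powr (-s)"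

lemma bend_nonneg [simp]: "0 \<le> bend t s z"
  by (simp add: bend_def)

lemma bend_measurable [measurable]: "bend t s \<in> borel_measurable borel"
  unfolding bend_def by measurable

lemma exists_dyadic:
  assumes "r \<ge> (1::real)"
  shows "\<exists>k. 2 ^ k \<le> r \<and> r < 2 ^ Suc k"
proof -
  obtain n where n: "r < 2 ^ n" using real_arch_pow[of 2 r] by auto
  define N where "N = (LEAST n. r < 2 ^ n)"
  have N: "r < 2 ^ N" unfolding N_def by (rule LeastI[of _ n]) (rule n)
  have "N \<noteq> 0" using N assms by (auto intro: ccontr)
  then obtain k where k: "N = Suc k" by (cases N) auto
  have "\<not> r < 2 ^ k" using not_less_Least[of k "\<lambda>n. r < 2 ^ n"] k unfolding N_def by auto
  then show ?thesis using N k by force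
qed

text \<open>Domination by multiples of indicators of dyadic discs (\<open>h1\<close> shrinking,
  \<open>h2\<close> growing) requires only the area of a disc, not polar coordinates. The two
  resulting series are geometric with ratios \<open>2 powr (t - 2)\<close> and
  \<open>2 powr (2 - s)\<close>.\<close>

lemma bend_integrable:
  assumes t: "0 \<le> t" "t < 2" and s: "s > 2"
  shows "(\<integral>\<^sup>+z. ennreal (bend t s z) \<partial>lborel) < \<infinity>"
proof -
  define h1 where "h1 k z = ennreal (2 powr (t * (real k + 1))) * indicator (cball 0 (2 powr - real k)) z" for k and z :: plane
  define h2 where "h2 k z = ennreal (2 powr (- s * real k)) * indicator (cball 0 (2 powr (real k + 1))) z" for k and z :: plane
  have [measurable]: "h1 k \<in> borel_measurable borel" "h2 k \<in> borel_measurable borel" for k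
    unfolding h1_def h2_def
    by (intro borel_measurable_times_ennreal borel_measurable_const borel_measurable_indicator, simp)+
  have "ennreal (bend t s z) \<le> (\<Sum>k. h1 k z + h2 k z)" for z :: plane
  proof -
    have ex: "\<exists>k. ennreal (bend t s z) \<le> h1 k z + h2 k z"
    proof (cases "norm z \<ge> 1")
      case True
      then obtain k where k: "2 ^ k \<le> norm z" "norm z < 2 ^ Suc k" using exists_dyadic by blast
      have k': "2 powr (real k) \<le> norm z" "norm z \<le> 2 powr (real k + 1)"
        using k by (simp_all add: powr_realpow powr_add)
      have "bend t s z = norm z powr (- s)" using True by (simp add: bend_def)
      also have "\<dots> \<le> (2 powr real k) powr (- s)"
        using k' s by (intro powr_mono2') auto
      also have "\<dots> = 2 powr (- s * real k)" by (simp add: powr_powr mult.commute)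
      finally have "ennreal (bend t s z) \<le> h2 k z" unfolding h2_def using k' by (simp add: ennreal_leI)
      then show ?thesis by (intro exI[of _ k] add_increasing) simp_all
    next
      case False
      show ?thesis
      proof (cases "z = 0")
        case True then show ?thesis by (simp add: bend_def)
      next
        case nz: False
        have "1 / norm z \<ge> 1" using False nz by simp
        then obtain k where k: "2 ^ k \<le> 1 / norm z" "1 / norm z < 2 ^ Suc k" using exists_dyadic by blast
        have k1: "norm z \<le> 2 powr (- real k)" using k nz by (simp add: powr_minus powr_realpow field_simps)
        have "2 powr (- (real k + 1)) = inverse (2 * 2 ^ k)"
          by (simp add: powr_minus[of 2 "real k + 1"] powr_realpow powr_add del: minus_add_distrib)
        moreover have "inverse (2 * 2 ^ k) \<le> norm z"
        proof -
          have "1 \<le> norm z * (2 * 2 ^ k)" using k(2) nz by (simp add: divide_less_eq mult.commute)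
          then show ?thesis by (simp add: inverse_eq_divide divide_le_eq)
        qed
        ultimately have k2: "2 powr (- (real k + 1)) \<le> norm z" by simp
        have "bend t s z = norm z powr (- t)" using False by (simp add: bend_def)
        also have "\<dots> \<le> (2 powr (- (real k + 1))) powr (- t)"
          using k2 t by (intro powr_mono2') auto
        also have "\<dots> = 2 powr (t * (real k + 1))" by (simp add: powr_powr algebra_simps)
        finally have "ennreal (bend t s z) \<le> h1 k z" unfolding h1_def using k1 by (simp add: ennreal_leI)
        then show ?thesis by (intro exI[of _ k] add_increasing2) simp_all
      qed
    qed
    then obtain k where "ennreal (bend t s z) \<le> h1 k z + h2 k z" by blast
    also have "\<dots> = (\<Sum>j\<in>{k}. h1 j z + h2 j z)" by simp
    also have "\<dots> \<le> (\<Sum>j. h1 j z + h2 j z)" by (rule sum_le_suminf) auto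
    finally show ?thesis .
  qed
  then have "(\<integral>\<^sup>+z. ennreal (bend t s z) \<partial>lborel) \<le> (\<integral>\<^sup>+z. (\<Sum>k. h1 k z + h2 k z) \<partial>lborel)"
    by (intro nn_integral_mono) auto
  also have "\<dots> = (\<Sum>k. \<integral>\<^sup>+z. h1 k z + h2 k z \<partial>lborel)"
    by (rule nn_integral_suminf) measurable
  also have "\<dots> = (\<Sum>k. ennreal (2 powr t * pi * (2 powr (t - 2)) ^ k + 4 * pi * (2 powr (2 - s)) ^ k))"
  proof (rule suminf_cong)
    fix k
    have "(\<integral>\<^sup>+z. h1 k z \<partial>lborel) = ennreal (2 powr (t * (real k + 1)) * (pi * (2 powr - real k)\<^sup>2))"
      unfolding h1_def by (subst nn_integral_cmult_indicator) (simp_all add: emeasure_cball_plane ennreal_mult')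
    moreover have "2 powr (t * (real k + 1)) * (pi * (2 powr - real k)\<^sup>2) = 2 powr t * pi * (2 powr (t - 2)) ^ k"
    proof -
      have "2 powr (t * (real k + 1)) * (pi * (2 powr - real k)\<^sup>2) = pi * (2 powr (t * (real k + 1)) * 2 powr (- real k * real 2))"
        by (subst powr_power) (auto simp: mult.commute)
      also have "\<dots> = pi * 2 powr (t + (t - 2) * real k)"
        unfolding powr_add[symmetric] by (rule arg_cong[of _ _ "\<lambda>e. pi * 2 powr e"]) (simp add: algebra_simps)
      also have "\<dots> = 2 powr t * pi * (2 powr (t - 2)) ^ k"
        by (subst powr_power) (auto simp: powr_add mult.commute)
      finally show ?thesis .
    qed
    ultimately have 1: "(\<integral>\<^sup>+z. h1 k z \<partial>lborel) = ennreal (2 powr t * pi * (2 powr (t - 2)) ^ k)" by simp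
    have "(\<integral>\<^sup>+z. h2 k z \<partial>lborel) = ennreal (2 powr (- s * real k) * (pi * (2 powr (real k + 1))\<^sup>2))"
      unfolding h2_def by (subst nn_integral_cmult_indicator) (simp_all add: emeasure_cball_plane ennreal_mult')
    moreover have "2 powr (- s * real k) * (pi * (2 powr (real k + 1))\<^sup>2) = 4 * pi * (2 powr (2 - s)) ^ k"
    proof -
      have "2 powr (- s * real k) * (pi * (2 powr (real k + 1))\<^sup>2) = pi * (2 powr (- s * real k) * 2 powr ((real k + 1) * real 2))"
        by (subst powr_power) (auto simp: mult.commute)
      also have "\<dots> = pi * 2 powr (2 + (2 - s) * real k)"
        unfolding powr_add[symmetric] by (rule arg_cong[of _ _ "\<lambda>e. pi * 2 powr e"]) (simp add: algebra_simps)
      also have "\<dots> = 4 * pi * (2 powr (2 - s)) ^ k"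
        by (subst powr_power) (auto simp: powr_add mult.commute)
      finally show ?thesis .
    qed
    ultimately have 2: "(\<integral>\<^sup>+z. h2 k z \<partial>lborel) = ennreal (4 * pi * (2 powr (2 - s)) ^ k)" by simp
    show "(\<integral>\<^sup>+z. h1 k z + h2 k z \<partial>lborel) = ennreal (2 powr t * pi * (2 powr (t - 2)) ^ k + 4 * pi * (2 powr (2 - s)) ^ k)"
      by (subst nn_integral_add) (simp_all add: 1 2)
  qed
  also have "\<dots> < \<infinity>"
  proof -
    have "2 powr (t - 2) < 1" "2 powr (2 - s) < (1::real)" using t s by (auto intro: powr_less_one)
    then have "summable (\<lambda>k. 2 powr t * pi * (2 powr (t - 2)) ^ k + 4 * pi * (2 powr (2 - s)) ^ k)"
      by (intro summable_add summable_mult summable_geometric) auto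
    then have "(\<Sum>k. ennreal (2 powr t * pi * (2 powr (t - 2)) ^ k + 4 * pi * (2 powr (2 - s)) ^ k)) \<noteq> top"
      by (rule ennreal_suminf_neq_top) simp
    then show ?thesis by (simp only: infinity_ennreal_def top.not_eq_extremum)
  qed
  finally show ?thesis .
qed

text \<open>Replacing every base by the smallest of the three merges the product into one power, and
  this power is one of the summands. If a base is 0, the left side is 0 by the convention on
  \<open>powr\<close>.\<close>

lemma powr_prod3_le:
  fixes p q r :: real
  assumes "0 \<le> p" "0 \<le> q" "0 \<le> r" "0 \<le> a" "0 \<le> b" "0 \<le> c"
  shows "p powr (-a) * q powr (-b) * r powr (-c) \<le> p powr (-(a+b+c)) + q powr (-(a+b+c)) + r powr (-(a+b+c))"
proof (cases "p = 0 \<or> q = 0 \<or> r = 0")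
  case True then show ?thesis by auto
next
  case False
  define w where "w = min p (min q r)"
  have w: "w > 0" "w \<le> p" "w \<le> q" "w \<le> r" using False assms unfolding w_def by auto
  have "p powr (-a) * q powr (-b) * r powr (-c) \<le> w powr (-a) * w powr (-b) * w powr (-c)"
    using w assms by (intro mult_mono powr_mono2') auto
  also have "\<dots> = w powr (-(a+b+c))" by (simp add: powr_add[symmetric])
  also have "\<dots> \<le> p powr (-(a+b+c)) + q powr (-(a+b+c)) + r powr (-(a+b+c))"
    using w_def by (auto simp: min_def)
  finally show ?thesis .
qed

lemma powr_neg_le_one: "1 \<le> x \<Longrightarrow> 0 \<le> s \<Longrightarrow> x powr (-s) \<le> (1::real)"
  using powr_mono2'[of "-s" 1 x] by simp

lemma powr_neg_ge_one: "0 < x \<Longrightarrow> x \<le> 1 \<Longrightarrow> 0 \<le> s \<Longrightarrow> 1 \<le> x powr (-s :: real)"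
  using powr_mono2'[of "-s" x 1] by simp

text \<open>Either \<open>norm z < 1\<close>, and then the far factor of \<open>w\<close> is at most
  1, or the near factor of \<open>z\<close> equals 1, and then inserting the near factor of
  \<open>w\<close>, which is at least 1, only helps. The latter fails at w = 0, where
  \<open>powr\<close> gives 0.\<close>

lemma bend_cross:
  assumes t: "0 \<le> t" and s: "0 \<le> s" and w: "w \<noteq> 0"
  shows "min 1 (norm z) powr (-t) * max 1 (norm w) powr (-s) \<le> bend t s z + bend t s w"
proof (cases "norm z < 1")
  case True
  have "max 1 (norm w) powr (-s) \<le> 1" by (intro powr_neg_le_one s) auto
  then have "min 1 (norm z) powr (-t) * max 1 (norm w) powr (-s) \<le> min 1 (norm z) powr (-t) * 1"
    by (intro mult_left_mono) auto
  also have "\<dots> = bend t s z" using True by (simp add: bend_def)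
  finally show ?thesis by (smt (verit) bend_nonneg)
next
  case False
  have "1 \<le> min 1 (norm w) powr (-t)"
    using w by (intro powr_neg_ge_one t) auto
  then have "max 1 (norm w) powr (-s) \<le> bend t s w"
    unfolding bend_def by (metis mult_cancel_right1 mult_right_mono powr_ge_zero)
  moreover have "min 1 (norm z) powr (-t) = 1" using False by simp
  ultimately show ?thesis using bend_nonneg[of t s z] by (simp only: mult_1_left)
qed

lemma powr_split_min_max: "q powr e = min 1 q powr e * max 1 q powr (e::real)"
  by (auto simp: min_def max_def)

text \<open>The weights met later have polynomial decay and one singular point \<open>P\<close>; the
  two further poles come from the Riesz weight (at \<open>x\<close>) and from Jensen's inequality
  (at \<open>z\<close>).\<close>

definition kern3 :: "real \<Rightarrow> real \<Rightarrow> real \<Rightarrow> real \<Rightarrow> plane \<Rightarrow> plane \<Rightarrow> plane \<Rightarrow> plane \<Rightarrow> real" where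
  "kern3 \<sigma> \<tau> a b P x z y = (1 + norm y) powr (-\<sigma>) * min 1 (norm (y - P)) powr (-\<tau>)
     * norm (x - y) powr (-a) * norm (z - y) powr (-b)"

text \<open>Each distance is split into its part below 1 and its part above 1. By
  \<open>powr_prod3_le\<close> the near factors merge into a single pole of order t and the far
  factors into a single decay of order s. The nine mixed products are then absorbed by
  \<open>bend_cross\<close>.\<close>

lemma kern3_pointwise:
  assumes nn: "0 \<le> \<sigma>" "0 \<le> \<tau>" "0 \<le> a" "0 \<le> b"
    and y: "y \<noteq> 0" "y \<noteq> P" "y \<noteq> x" "y \<noteq> z"
  defines "t \<equiv> \<tau> + a + b" and "s \<equiv> \<sigma> + a + b"
  shows "kern3 \<sigma> \<tau> a b P x z y \<le>
    9 * (bend t s y + bend t s (y - P) + bend t s (x - y) + bend t s (z - y))"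
proof -
  define J where "J = bend t s"
  define p where "p = (\<lambda>v::plane. min 1 (norm v) powr (-t))"
  define n where "n = (\<lambda>v::plane. max 1 (norm v) powr (-s))"
  have ts: "0 \<le> t" "0 \<le> s" using nn by (auto simp: t_def s_def)
  have *: "kern3 \<sigma> \<tau> a b P x z y =
    (min 1 (norm (y - P)) powr (-\<tau>) * min 1 (norm (x - y)) powr (-a) * min 1 (norm (z - y)) powr (-b)) *
    ((1 + norm y) powr (-\<sigma>) * max 1 (norm (x - y)) powr (-a) * max 1 (norm (z - y)) powr (-b))"
    unfolding kern3_def
    by (subst powr_split_min_max[of "norm (x - y)"], subst powr_split_min_max[of "norm (z - y)"]) (simp add: mult_ac)
  have A: "min 1 (norm (y - P)) powr (-\<tau>) * min 1 (norm (x - y)) powr (-a) * min 1 (norm (z - y)) powr (-b)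
    \<le> p (y - P) + p (x - y) + p (z - y)"
    unfolding t_def p_def using nn by (intro powr_prod3_le) auto
  have "(1 + norm y) powr (-\<sigma>) * max 1 (norm (x - y)) powr (-a) * max 1 (norm (z - y)) powr (-b)
    \<le> (1 + norm y) powr (-s) + n (x - y) + n (z - y)"
    unfolding s_def n_def using nn by (intro powr_prod3_le) auto
  also have "(1 + norm y) powr (-s) \<le> n y" unfolding n_def using ts by (intro powr_mono2') auto
  finally have B: "(1 + norm y) powr (-\<sigma>) * max 1 (norm (x - y)) powr (-a) * max 1 (norm (z - y)) powr (-b)
    \<le> n y + n (x - y) + n (z - y)" by simp
  have c: "p v * n w \<le> J v + J w" if "w \<noteq> 0" for v w
    using bend_cross[OF ts that, of v] unfolding p_def n_def J_def by simp
  have "kern3 \<sigma> \<tau> a b P x z y \<le> (p (y - P) + p (x - y) + p (z - y)) * (n y + n (x - y) + n (z - y))"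
    unfolding * using A B by (intro mult_mono) (auto simp: p_def n_def add_nonneg_nonneg)
  also have "\<dots> \<le> 3 * J y + 3 * J (y - P) + 6 * J (x - y) + 6 * J (z - y)"
    using c[of y "y - P"] c[of y "x - y"] c[of y "z - y"]
      c[of "x - y" "y - P"] c[of "x - y" "x - y"] c[of "x - y" "z - y"]
      c[of "z - y" "y - P"] c[of "z - y" "x - y"] c[of "z - y" "z - y"] y
    by (simp add: algebra_simps)
  also have "\<dots> \<le> 9 * (J y + J (y - P) + J (x - y) + J (z - y))"
    using bend_nonneg[of t s] unfolding J_def by (smt (verit))
  finally show ?thesis unfolding J_def .
qed

lemma kern3_measurable [measurable]: "kern3 \<sigma> \<tau> a b P x z \<in> borel_measurable borel"
  unfolding kern3_def[abs_def] by measurable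

lemma kern3_nonneg [simp]: "0 \<le> kern3 \<sigma> \<tau> a b P x z y"
  by (simp add: kern3_def)

lemma AE_lborel_neq: "AE y in lborel. y \<noteq> (c::'a::euclidean_space)"
  by (simp add: AE_lborel_singleton)

text \<open>Uniformity in \<open>P\<close>, \<open>x\<close>, \<open>z\<close> is translation
  invariance: the four profiles in the pointwise bound have the same integral I, so 36 = 9 *
  4.\<close>

lemma kern3_bound:
  assumes nn: "0 \<le> \<sigma>" "0 \<le> \<tau>" "0 \<le> a" "0 \<le> b" and t: "\<tau> + a + b < 2" and s: "\<sigma> + a + b > 2"
  shows "\<exists>C\<ge>0. \<forall>P x z. (\<integral>\<^sup>+y. ennreal (kern3 \<sigma> \<tau> a b P x z y) \<partial>lborel) \<le> ennreal C"
proof -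
  define J where "J = bend (\<tau> + a + b) (\<sigma> + a + b)"
  define I where "I = (\<integral>\<^sup>+z. ennreal (J z) \<partial>lborel)"
  have fin: "I < \<infinity>" unfolding J_def I_def using nn t s by (intro bend_integrable) auto
  have [measurable]: "J \<in> borel_measurable borel" unfolding J_def by simp
  have J0: "0 \<le> J v" for v by (simp add: J_def)
  have "(\<integral>\<^sup>+y. ennreal (kern3 \<sigma> \<tau> a b P x z y) \<partial>lborel) \<le> 36 * I" for P x z
  proof -
    have "(\<integral>\<^sup>+y. ennreal (kern3 \<sigma> \<tau> a b P x z y) \<partial>lborel)
      \<le> (\<integral>\<^sup>+y. 9 * (ennreal (J y) + ennreal (J (y - P)) + ennreal (J (x - y)) + ennreal (J (z - y))) \<partial>lborel)"
    proof (rule nn_integral_mono_AE)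
      show "AE y in lborel. ennreal (kern3 \<sigma> \<tau> a b P x z y) \<le>
         9 * (ennreal (J y) + ennreal (J (y - P)) + ennreal (J (x - y)) + ennreal (J (z - y)))"
        using AE_lborel_neq[of 0] AE_lborel_neq[of P] AE_lborel_neq[of x] AE_lborel_neq[of z]
      proof eventually_elim
        case (elim y)
        have "kern3 \<sigma> \<tau> a b P x z y \<le> 9 * (J y + J (y - P) + J (x - y) + J (z - y))"
          unfolding J_def by (rule kern3_pointwise) (use nn elim in auto)
        then have "ennreal (kern3 \<sigma> \<tau> a b P x z y) \<le> ennreal (9 * (J y + J (y - P) + J (x - y) + J (z - y)))"
          by (rule ennreal_leI)
        also have "\<dots> = 9 * (ennreal (J y) + ennreal (J (y - P)) + ennreal (J (x - y)) + ennreal (J (z - y)))"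
          using J0 by (subst ennreal_mult) (auto simp: ennreal_plus[symmetric] simp del: ennreal_plus)
        finally show ?case .
      qed
    qed
    also have "\<dots> = 9 * (I + I + I + I)"
      using nn_integral_translate[of "\<lambda>z. ennreal (J z)"]
      by (simp add: nn_integral_cmult nn_integral_add I_def)
    also have "\<dots> = 36 * I"
    proof -
      obtain i where "I = ennreal i" "i \<ge> 0" using fin by (cases I) auto
      then show ?thesis
        by (simp add: ennreal_plus[symmetric] ennreal_mult[symmetric] ennreal_numeral[symmetric] del: ennreal_plus ennreal_numeral)
    qed
    finally show ?thesis .
  qed
  moreover obtain C where "36 * I = ennreal C" "C \<ge> 0"
    using fin by (cases "36 * I") (auto simp: ennreal_mult_eq_top_iff)
  ultimately show ?thesis by auto
qed

text \<open>\<open>ln (ratio x y)\<close> is the logarithmic kernel normalised by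
  \<open>ln (1 + norm y)\<close>. For fixed \<open>x\<close> it tends to 0 as y tends to infinity,
  so potentials of finite mass converge there, and mass that escapes to infinity contributes nothing
  in the limit.\<close>

definition ratio :: "plane \<Rightarrow> plane \<Rightarrow> real" where
  "ratio x y = (1 + norm y) / norm (x - y)"

lemma ratio_nonneg [simp]: "0 \<le> ratio x y"
  by (simp add: ratio_def)

lemma ratio_measurable [measurable]:
  "(\<lambda>y. ratio x y) \<in> borel_measurable borel"
  "(\<lambda>x. ratio x y) \<in> borel_measurable borel"
  "(\<lambda>p. ratio (fst p) (snd p)) \<in> borel_measurable (borel \<Otimes>\<^sub>M borel)"
  unfolding ratio_def by measurable

text \<open>The growth of \<open>ratio y z\<close> in \<open>z\<close> is the only new point
  compared with \<open>kern3_bound\<close>. Since 1 + |z| is at most twice the maximum of 1 + |y|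
  and |z - y|, it is traded either for growth in \<open>y\<close> (first kernel, less decay) or for
  cancelling the pole (second kernel).\<close>

lemma ratio_kernel_bound:
  assumes nn: "0 \<le> \<tau>" "0 \<le> a" "0 \<le> b" and t: "\<tau> + a + b < 2" and s: "\<sigma> > 2" "\<sigma> \<ge> a + b"
  shows "\<exists>C\<ge>0. \<forall>P x z. (\<integral>\<^sup>+y. ennreal (ratio x y powr a * (1 + norm y) powr (-\<sigma>)
     * min 1 (norm (y - P)) powr (-\<tau>) * ratio y z powr b) \<partial>lborel) \<le> ennreal C"
proof -
  obtain C1 where C1: "C1 \<ge> 0" "\<And>P x z. (\<integral>\<^sup>+y. ennreal (kern3 (\<sigma> - a - b) \<tau> a b P x z y) \<partial>lborel) \<le> ennreal C1"
    using kern3_bound[of "\<sigma> - a - b" \<tau> a b] nn t s by auto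
  obtain C2 where C2: "C2 \<ge> 0" "\<And>P x z. (\<integral>\<^sup>+y. ennreal (kern3 (\<sigma> - a) \<tau> a 0 P x z y) \<partial>lborel) \<le> ennreal C2"
    using kern3_bound[of "\<sigma> - a" \<tau> a 0] nn t s by auto
  have "(\<integral>\<^sup>+y. ennreal (ratio x y powr a * (1 + norm y) powr (-\<sigma>)
     * min 1 (norm (y - P)) powr (-\<tau>) * ratio y z powr b) \<partial>lborel) \<le> ennreal (2 powr b * C1 + 2 powr b * C2)" for P x z
  proof -
    have pw: "ratio x y powr a * (1 + norm y) powr (-\<sigma>) * min 1 (norm (y - P)) powr (-\<tau>) * ratio y z powr b
       \<le> 2 powr b * kern3 (\<sigma> - a - b) \<tau> a b P x z y + 2 powr b * kern3 (\<sigma> - a) \<tau> a 0 P x z y"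
      if "y \<noteq> z" for y
    proof -
      define n q where "n = 1 + norm y" and "q = norm (z - y)"
      have n: "n \<ge> 1" and q: "q > 0" unfolding n_def q_def using that by auto
      have "1 + norm z \<le> n + q" unfolding n_def q_def using norm_triangle_sub[of z y] by simp
      also have "\<dots> \<le> 2 * max n q" by simp
      finally have "(1 + norm z) powr b \<le> (2 * max n q) powr b" using nn by (intro powr_mono2) auto
      also have "\<dots> \<le> 2 powr b * (n powr b + q powr b)"
        using n q by (simp add: powr_mult max_def)
      finally have z: "(1 + norm z) powr b \<le> 2 powr b * (n powr b + q powr b)" .
      have "ratio y z powr b = (1 + norm z) powr b * q powr (-b)"
        unfolding ratio_def q_def using q by (simp add: powr_divide powr_minus_divide norm_minus_commute)
      also have "\<dots> \<le> (2 powr b * (n powr b + q powr b)) * q powr (-b)"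
        using z by (intro mult_right_mono) auto
      also have "\<dots> = 2 powr b * (n powr b * q powr (-b)) + 2 powr b"
        using q by (simp add: algebra_simps powr_minus)
      finally have r: "ratio y z powr b \<le> 2 powr b * (n powr b * q powr (-b)) + 2 powr b" .
      have rx: "ratio x y powr a = n powr a * norm (x - y) powr (-a)"
        unfolding ratio_def n_def by (simp add: powr_divide powr_minus_divide)
      have "ratio x y powr a * (1 + norm y) powr (-\<sigma>) * min 1 (norm (y - P)) powr (-\<tau>) * ratio y z powr b
        \<le> ratio x y powr a * (1 + norm y) powr (-\<sigma>) * min 1 (norm (y - P)) powr (-\<tau>) * (2 powr b * (n powr b * q powr (-b)) + 2 powr b)"
        using r by (intro mult_left_mono) auto
      also have "\<dots> = 2 powr b * (((n powr a * n powr (-\<sigma>) * n powr b) * min 1 (norm (y - P)) powr (-\<tau>) * norm (x - y) powr (-a) * q powr (-b))) +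
        2 powr b * (((n powr a * n powr (-\<sigma>)) * min 1 (norm (y - P)) powr (-\<tau>) * norm (x - y) powr (-a)))"
        unfolding rx n_def[symmetric] by (simp add: algebra_simps)
      also have "n powr a * n powr (-\<sigma>) * n powr b = n powr (-(\<sigma> - a - b))"
        unfolding powr_add[symmetric] by (rule arg_cong[of _ _ "\<lambda>e. n powr e"]) simp
      also have "n powr a * n powr (-\<sigma>) = n powr (-(\<sigma> - a))"
        by (simp add: powr_add[symmetric])
      finally show ?thesis unfolding kern3_def n_def q_def using q q_def by simp
    qed
    have "(\<integral>\<^sup>+y. ennreal (ratio x y powr a * (1 + norm y) powr (-\<sigma>)
     * min 1 (norm (y - P)) powr (-\<tau>) * ratio y z powr b) \<partial>lborel) \<le>
      (\<integral>\<^sup>+y. ennreal (2 powr b) * ennreal (kern3 (\<sigma> - a - b) \<tau> a b P x z y) + ennreal (2 powr b) * ennreal (kern3 (\<sigma> - a) \<tau> a 0 P x z y) \<partial>lborel)"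
    proof (rule nn_integral_mono_AE)
      show "AE y in lborel. ennreal (ratio x y powr a * (1 + norm y) powr (-\<sigma>)
     * min 1 (norm (y - P)) powr (-\<tau>) * ratio y z powr b) \<le>
       ennreal (2 powr b) * ennreal (kern3 (\<sigma> - a - b) \<tau> a b P x z y) + ennreal (2 powr b) * ennreal (kern3 (\<sigma> - a) \<tau> a 0 P x z y)"
        using AE_lborel_neq[of z]
      proof eventually_elim
        case (elim y)
        show ?case using ennreal_leI[OF pw[OF elim]] by (simp add: ennreal_plus ennreal_mult)
      qed
    qed
    also have "\<dots> = ennreal (2 powr b) * (\<integral>\<^sup>+y. ennreal (kern3 (\<sigma> - a - b) \<tau> a b P x z y) \<partial>lborel) +
       ennreal (2 powr b) * (\<integral>\<^sup>+y. ennreal (kern3 (\<sigma> - a) \<tau> a 0 P x z y) \<partial>lborel)"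
      by (simp add: nn_integral_add nn_integral_cmult)
    also have "\<dots> \<le> ennreal (2 powr b) * ennreal C1 + ennreal (2 powr b) * ennreal C2"
      by (intro add_mono mult_left_mono C1 C2) auto
    also have "\<dots> = ennreal (2 powr b * C1 + 2 powr b * C2)"
      using C1 C2 by (simp add: ennreal_plus ennreal_mult)
    finally show ?thesis .
  qed
  then show ?thesis using C1 C2 by (intro exI[of _ "2 powr b * C1 + 2 powr b * C2"]) auto
qed

section \<open>Logarithmic potentials\<close>

text \<open>Concavity of t^a gives 1 + t \<le> (1 + t^a)^(1/a); taking logarithms leaves ln (1 +
  t^a) / a. This turns logarithmic kernels into Riesz kernels of any small order.\<close>

lemma ln_one_plus_le_powr:
  assumes "0 \<le> t" "0 < a" "a \<le> (1::real)"
  shows "ln (1 + t) \<le> t powr a / a"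
proof (cases "t = 0")
  case False
  then have t: "t > 0" using assms by simp
  have "1 + t \<le> (1 + t powr a) powr (1 / a)"
  proof (cases "t \<le> 1")
    case True
    have "1 + t \<le> 1 + t powr a" using True t assms powr_mono'[of a 1 t] by simp
    also have "\<dots> = (1 + t powr a) powr 1" by (simp add: add_nonneg_pos)
    also have "\<dots> \<le> (1 + t powr a) powr (1 / a)" using assms by (intro powr_mono) auto
    finally show ?thesis .
  next
    case False
    have "(1 + t) powr a = (1 + t) * (1 + t) powr (a - 1)"
      using t by (simp add: powr_diff)
    also have "\<dots> = 1 * (1 + t) powr (a - 1) + t * (1 + t) powr (a - 1)" by (simp add: algebra_simps)
    also have "\<dots> \<le> 1 * 1 + t * t powr (a - 1)"
      using t assms powr_neg_le_one[of "1 + t" "1 - a"] powr_mono2'[of "a - 1" t "1 + t"]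
      by (intro add_mono mult_left_mono) auto
    also have "\<dots> = 1 + t powr a" using t by (simp add: powr_diff)
    finally have "((1 + t) powr a) powr (1 / a) \<le> (1 + t powr a) powr (1 / a)"
      using assms by (intro powr_mono2) auto
    then show ?thesis using assms t by (simp add: powr_powr)
  qed
  then have "ln (1 + t) \<le> ln ((1 + t powr a) powr (1 / a))"
    using t by (subst ln_le_cancel_iff) (auto simp: add_pos_nonneg)
  also have "\<dots> = ln (1 + t powr a) / a" using t by (simp add: ln_powr add_pos_nonneg)
  also have "\<dots> \<le> t powr a / a" using assms by (intro divide_right_mono ln_add_one_self_le_self) auto
  finally show ?thesis .
qed (use assms in auto)

lemma one_plus_norm_pos [simp]: "0 < 1 + norm (x :: 'a::real_normed_vector)" "1 + norm x \<noteq> 0"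
  using norm_ge_zero[of x] by linarith+

lemma holder_imp_continuous:
  fixes u :: "plane \<Rightarrow> real"
  assumes a: "0 < a" and h: "\<And>x y. \<bar>u x - u y\<bar> \<le> K * norm (x - y) powr a"
  shows "continuous_on UNIV u"
  unfolding continuous_on_eq_continuous_at[OF open_UNIV] isCont_def
proof safe
  fix x
  show "u \<midarrow>x\<rightarrow> u x"
  proof (rule LIM_zero_cancel, rule Lim_null_comparison)
    show "\<forall>\<^sub>F y in at x. norm (u y - u x) \<le> K * norm (y - x) powr a" using h by (intro always_eventually) auto
    have "((\<lambda>y. K * norm (y - x) powr a) \<longlongrightarrow> K * norm (x - x) powr a) (at x)" using a by (intro tendsto_intros) auto
    then show "((\<lambda>y. K * norm (y - x) powr a) \<longlongrightarrow> 0) (at x)" by simp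
  qed
qed

text \<open>The factor 1 / (2 pi) of the fundamental solution is left out; it will be put into the
  densities as the constant \<open>cn\<close>. Where the integrand is not integrable the value is
  0.\<close>

definition pot :: "(plane \<Rightarrow> real) \<Rightarrow> plane \<Rightarrow> real" where
  "pot f x = (LINT y|lborel. f y * ln (ratio x y))"

text \<open>The pole of \<open>ratio x y powr a\<close> at y = x measures how far \<open>f\<close>
  is from concentrating and gives Hoelder continuity of order \<open>a\<close>; the extra weight
  \<open>(1 + norm y) powr a\<close> controls the logarithmic moment and hence the behaviour at
  infinity. The bound is uniform in \<open>x\<close>, additive over pieces of the plane and stable
  under restriction.\<close>

definition riesz :: "real \<Rightarrow> real \<Rightarrow> (plane \<Rightarrow> real) \<Rightarrow> bool" where
  "riesz a C f \<longleftrightarrow> f \<in> borel_measurable borel \<and> (\<forall>y. 0 \<le> f y) \<and>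
     (\<forall>x. (\<integral>\<^sup>+y. ennreal (ratio x y powr a * (1 + norm y) powr a * f y) \<partial>lborel) \<le> ennreal C)"

lemma nn_le_integral:
  fixes f :: "'a \<Rightarrow> real"
  assumes m: "f \<in> borel_measurable M" and nn: "\<And>x. 0 \<le> f x" and le: "(\<integral>\<^sup>+x. ennreal (f x) \<partial>M) \<le> ennreal C" and C: "0 \<le> C"
  shows "integrable M f" and "integral\<^sup>L M f \<le> C"
proof -
  show "integrable M f"
    using m nn le by (intro integrableI_nonneg) (auto intro: le_less_trans)
  then show "integral\<^sup>L M f \<le> C"
    using le nn C by (subst (asm) nn_integral_eq_integral) auto
qed

lemma ratio_pos: "x \<noteq> y \<Longrightarrow> 0 < ratio x y"
  by (simp add: ratio_def add_pos_nonneg)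

lemma inverse_le_ratio: "1 / norm (x - y) \<le> ratio x y"
  unfolding ratio_def by (intro divide_right_mono) auto

lemma norm_le_ratio:
  assumes "x \<noteq> y" shows "1 / (1 + norm x) \<le> ratio x y"
proof -
  have "norm (x - y) \<le> norm x + norm y" by (rule norm_triangle_ineq4)
  also have "\<dots> \<le> (1 + norm x) * (1 + norm y)" by (simp add: algebra_simps)
  finally show ?thesis using assms unfolding ratio_def by (simp add: divide_simps add_pos_nonneg mult.commute)
qed

lemma ln_ratio_ge:
  assumes "x \<noteq> y" shows "- ln (1 + norm x) \<le> ln (ratio x y)"
proof -
  have "ln (1 / (1 + norm x)) \<le> ln (ratio x y)"
    using norm_le_ratio[OF assms] ratio_pos[OF assms] by (subst ln_le_cancel_iff) (auto simp: add_pos_nonneg)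
  then show ?thesis by (simp add: ln_div add_pos_nonneg)
qed

lemma ln_le_powr:
  assumes "0 < r" "0 < a" "a \<le> (1::real)" shows "ln r \<le> r powr a / a"
proof -
  have "ln r \<le> ln (1 + r)" using assms by simp
  also have "\<dots> \<le> r powr a / a" using assms by (intro ln_one_plus_le_powr) auto
  finally show ?thesis .
qed

lemma abs_ln_ratio_le:
  assumes "x \<noteq> y" "0 < a" "a \<le> 1" shows "\<bar>ln (ratio x y)\<bar> \<le> ratio x y powr a / a + ln (1 + norm x)"
proof -
  have "0 \<le> ratio x y powr a / a" "0 \<le> ln (1 + norm x)" using assms by auto
  then show ?thesis
    using ln_ratio_ge[OF assms(1)] ln_le_powr[OF ratio_pos[OF assms(1)] assms(2,3)] by linarith
qed

text \<open>The normalisation cancels in the difference, which is the logarithm of |x' - y| / |x -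
  y|, at most 1 + |x - x'| / |x - y| by the triangle inequality. With a = 1 this gives Lipschitz
  bounds, with small \<open>a\<close> Hoelder bounds.\<close>

lemma ln_ratio_diff_le:
  assumes "x \<noteq> y" "x' \<noteq> y" "0 < a" "a \<le> 1"
  shows "ln (ratio x y) - ln (ratio x' y) \<le> norm (x - x') powr a * (1 / norm (x - y)) powr a / a"
proof -
  have "ln (ratio x y) - ln (ratio x' y) = ln (norm (x' - y) / norm (x - y))"
    using assms unfolding ratio_def by (simp add: ln_div add_pos_nonneg)
  also have "norm (x' - y) \<le> norm (x - y) + norm (x - x')"
    using norm_triangle_ineq[of "x - y" "x' - x"] by (simp add: norm_minus_commute)
  then have "ln (norm (x' - y) / norm (x - y)) \<le> ln (1 + norm (x - x') / norm (x - y))"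
    using assms by (subst ln_le_cancel_iff) (auto simp: field_simps add_nonneg_pos)
  also have "\<dots> \<le> (norm (x - x') / norm (x - y)) powr a / a"
    using assms by (intro ln_one_plus_le_powr) auto
  also have "\<dots> = norm (x - x') powr a * (1 / norm (x - y)) powr a / a"
    using powr_mult[of "norm (x - x')" "1 / norm (x - y)" a] by simp
  finally show ?thesis .
qed

context
  fixes a C :: real and f :: "plane \<Rightarrow> real"
  assumes r: "riesz a C f" and a: "0 < a" "a \<le> 1" and C: "0 \<le> C"
begin

lemma riesz_measurable [measurable]: "f \<in> borel_measurable borel"
  using r by (simp add: riesz_def)

lemma riesz_nonneg: "0 \<le> f y"
  using r by (simp add: riesz_def)

lemma riesz_weight:
  shows "integrable lborel (\<lambda>y. ratio x y powr a * (1 + norm y) powr a * f y)"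
    and "(LINT y|lborel. ratio x y powr a * (1 + norm y) powr a * f y) \<le> C"
  using r nn_le_integral[of "\<lambda>y. ratio x y powr a * (1 + norm y) powr a * f y" lborel C] C
  unfolding riesz_def by auto

lemma riesz_dominated:
  assumes [measurable]: "g \<in> borel_measurable borel"
    and le: "\<And>y. y \<noteq> x \<Longrightarrow> y \<noteq> 0 \<Longrightarrow> \<bar>g y\<bar> \<le> ratio x y powr a * (1 + norm y) powr a * f y"
  shows "integrable lborel g" "(LINT y|lborel. \<bar>g y\<bar>) \<le> C"
proof -
  have ae: "AE y in lborel. \<bar>g y\<bar> \<le> ratio x y powr a * (1 + norm y) powr a * f y"
    using AE_lborel_neq[of x] AE_lborel_neq[of 0] by eventually_elim (rule le)
  show g: "integrable lborel g"
    by (rule Bochner_Integration.integrable_bound[OF riesz_weight(1)[of x]]) (use ae in \<open>auto simp: riesz_nonneg\<close>)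
  have "(LINT y|lborel. \<bar>g y\<bar>) \<le> (LINT y|lborel. ratio x y powr a * (1 + norm y) powr a * f y)"
    using g ae by (intro integral_mono_AE riesz_weight) auto
  then show "(LINT y|lborel. \<bar>g y\<bar>) \<le> C" using riesz_weight(2)[of x] by simp
qed

lemma weight_ge_one: "1 \<le> (1 + norm (y::plane)) powr a"
  using a by (intro ge_one_powr_ge_zero) auto

text \<open>Evaluating the Riesz bound at x = 0 therefore already controls the total mass and the
  moment of order \<open>a\<close>.\<close>

lemma ratio0_ge_one: "y \<noteq> 0 \<Longrightarrow> 1 \<le> ratio 0 y powr a"
  using a by (intro ge_one_powr_ge_zero) (auto simp: ratio_def divide_simps)

lemma riesz_integrable: "integrable lborel f"
  and riesz_integral_le: "(LINT y|lborel. f y) \<le> C"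
proof -
  have le: "\<bar>f y\<bar> \<le> ratio 0 y powr a * (1 + norm y) powr a * f y" if "y \<noteq> 0" "y \<noteq> 0" for y
    using mult_mono[OF ratio0_ge_one weight_ge_one, of y y] riesz_nonneg[of y] that
    by (simp add: mult_left_le mult_le_cancel_right1)
  from riesz_dominated[of f 0, OF _ le]
  show "integrable lborel f" "(LINT y|lborel. f y) \<le> C" by (simp_all add: riesz_nonneg)
qed

lemma riesz_ratio: "integrable lborel (\<lambda>y. ratio x y powr a * f y)"
  and riesz_ratio_le: "(LINT y|lborel. ratio x y powr a * f y) \<le> C"
proof -
  have le: "\<bar>ratio x y powr a * f y\<bar> \<le> ratio x y powr a * (1 + norm y) powr a * f y" if "y \<noteq> x" "y \<noteq> 0" for y
    using weight_ge_one[of y] riesz_nonneg[of y] by (simp add: abs_mult mult_right_mono mult_left_le mult_le_cancel_left1)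
  from riesz_dominated[of "\<lambda>y. ratio x y powr a * f y" x, OF _ le]
  show "integrable lborel (\<lambda>y. ratio x y powr a * f y)" "(LINT y|lborel. ratio x y powr a * f y) \<le> C"
    by (simp_all add: riesz_nonneg abs_mult)
qed

lemma riesz_moment: "integrable lborel (\<lambda>y. (1 + norm y) powr a * f y)"
  and riesz_moment_le: "(LINT y|lborel. (1 + norm y) powr a * f y) \<le> C"
proof -
  have le: "\<bar>(1 + norm y) powr a * f y\<bar> \<le> ratio 0 y powr a * (1 + norm y) powr a * f y" if "y \<noteq> 0" "y \<noteq> 0" for y
    using ratio0_ge_one[of y] weight_ge_one[of y] riesz_nonneg[of y] that by (simp add: abs_mult mult_right_mono mult_le_cancel_right1)
  from riesz_dominated[of "\<lambda>y. (1 + norm y) powr a * f y" 0, OF _ le]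
  show "integrable lborel (\<lambda>y. (1 + norm y) powr a * f y)" "(LINT y|lborel. (1 + norm y) powr a * f y) \<le> C"
    by (simp_all add: riesz_nonneg abs_mult)
qed

lemma riesz_log: "integrable lborel (\<lambda>y. f y * ln (ratio x y))"
proof (rule Bochner_Integration.integrable_bound)
  show "integrable lborel (\<lambda>y. ratio x y powr a * f y / a + ln (1 + norm x) * f y)"
    by (intro Bochner_Integration.integrable_add integrable_divide riesz_ratio integrable_mult_right riesz_integrable)
  show "AE y in lborel. norm (f y * ln (ratio x y)) \<le> norm (ratio x y powr a * f y / a + ln (1 + norm x) * f y)"
    using AE_lborel_neq[of x]
  proof eventually_elim
    case (elim y)
    have "norm (f y * ln (ratio x y)) \<le> f y * (ratio x y powr a / a + ln (1 + norm x))"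
      using abs_ln_ratio_le[of x y a] a elim riesz_nonneg[of y] by (simp add: abs_mult mult_left_mono)
    also have "\<dots> = ratio x y powr a * f y / a + ln (1 + norm x) * f y" by (simp add: algebra_simps)
    finally show ?case by (simp only: real_norm_def)
  qed
qed measurable

text \<open>Since |x - y| \<le> (1 + |x|) (1 + |y|), the kernel has a lower bound independent of
  \<open>y\<close>. Only the mass enters, not \<open>C\<close>; this is the bound that makes the
  coupling terms harmless.\<close>

lemma pot_ge: "pot f x \<ge> - ln (1 + norm x) * (LINT y|lborel. f y)"
proof -
  have "- ln (1 + norm x) * (LINT y|lborel. f y) = (LINT y|lborel. - ln (1 + norm x) * f y)" by simp
  also have "\<dots> \<le> pot f x" unfolding pot_def
  proof (rule integral_mono_AE)
    show "AE y in lborel. - ln (1 + norm x) * f y \<le> f y * ln (ratio x y)"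
      using AE_lborel_neq[of x]
    proof eventually_elim
      case (elim y)
      then show ?case using mult_left_mono[OF ln_ratio_ge[of x y] riesz_nonneg[of y]] by (simp add: mult.commute)
    qed
  qed (use riesz_log riesz_integrable in auto)
  finally show ?thesis .
qed

lemma pot_le: "pot f x \<le> C / a"
proof -
  have "pot f x \<le> (LINT y|lborel. ratio x y powr a * f y / a)" unfolding pot_def
  proof (rule integral_mono_AE)
    show "AE y in lborel. f y * ln (ratio x y) \<le> ratio x y powr a * f y / a"
      using AE_lborel_neq[of x]
    proof eventually_elim
      case (elim y)
      then show ?case using mult_left_mono[OF ln_le_powr[OF ratio_pos[of x y] a] riesz_nonneg[of y]] by (simp add: mult.commute)
    qed
  qed (use riesz_log riesz_ratio in auto)
  also have "\<dots> \<le> C / a" using riesz_ratio_le[of x] a by (simp add: divide_right_mono)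
  finally show ?thesis .
qed

text \<open>After adding \<open>ln (norm x)\<close> the kernel becomes ln (|x| (1 + |y|) / |x - y|).
  For |x| \<ge> 1 this is nonnegative and at most ln (1 + |y|) + ln (1 + \<open>ratio x y\<close>),
  and both terms are covered by the Riesz bound.\<close>

lemma pot_far:
  assumes x: "norm x \<ge> 1"
  shows "0 \<le> pot f x + ln (norm x) * (LINT y|lborel. f y)"
    and "pot f x + ln (norm x) * (LINT y|lborel. f y) \<le> 2 * C / a"
proof -
  have eq: "pot f x + ln (norm x) * (LINT y|lborel. f y) = (LINT y|lborel. f y * (ln (ratio x y) + ln (norm x)))"
    unfolding pot_def using riesz_log[of x] riesz_integrable by (simp add: ring_distribs mult.commute)
  have int: "integrable lborel (\<lambda>y. f y * (ln (ratio x y) + ln (norm x)))"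
    using riesz_log[of x] riesz_integrable by (simp add: ring_distribs)
  have pw: "0 \<le> ln (ratio x y) + ln (norm x) \<and> ln (ratio x y) + ln (norm x) \<le> (1 + norm y) powr a / a + ratio x y powr a / a"
    if y: "y \<noteq> x" for y
  proof -
    have n: "norm (x - y) > 0" "norm x > 0" using y x by auto
    have "norm (x - y) \<le> norm x + norm y" by (rule norm_triangle_ineq4)
    also have "\<dots> \<le> (1 + norm y) * norm x" using x mult_mono[of 1 "norm x" "norm y" "norm y"] by (simp add: algebra_simps)
    finally have 1: "1 \<le> ratio x y * norm x" using n unfolding ratio_def by (simp add: divide_simps)
    have lneq: "ln (ratio x y) + ln (norm x) = ln (ratio x y * norm x)"
      using ratio_pos[of x y] y n by (simp add: ln_mult)
    have "norm x \<le> norm y + norm (x - y)" using norm_triangle_sub[of x y] by simp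
    then have "norm x / norm (x - y) \<le> 1 + ratio x y" using n unfolding ratio_def by (simp add: field_simps)
    then have "ratio x y * norm x \<le> (1 + norm y) * (1 + ratio x y)"
      unfolding ratio_def by (metis (no_types, opaque_lifting) add_nonneg_nonneg mult_left_mono norm_ge_zero times_divide_eq_left times_divide_eq_right zero_le_one)
    then have "ln (ratio x y * norm x) \<le> ln ((1 + norm y) * (1 + ratio x y))"
      using 1 by (subst ln_le_cancel_iff) auto
    also have "\<dots> = ln (1 + norm y) + ln (1 + ratio x y)"
      using ratio_nonneg[of x y] by (simp add: ln_mult add_nonneg_eq_0_iff)
    also have "\<dots> \<le> (1 + norm y) powr a / a + ratio x y powr a / a"
      using a ln_le_powr[of "1 + norm y" a] by (intro add_mono ln_one_plus_le_powr) (auto simp: add_pos_nonneg)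
    finally show ?thesis using 1 lneq by simp
  qed
  have ae: "AE y in lborel. 0 \<le> f y * (ln (ratio x y) + ln (norm x)) \<and> f y * (ln (ratio x y) + ln (norm x)) \<le>
     (1 + norm y) powr a * f y / a + ratio x y powr a * f y / a"
    using AE_lborel_neq[of x]
  proof eventually_elim
    case (elim y)
    show ?case using mult_left_mono[OF conjunct2[OF pw[OF elim]] riesz_nonneg[of y]]
        mult_nonneg_nonneg[OF riesz_nonneg[of y] conjunct1[OF pw[OF elim]]]
      by (simp add: algebra_simps)
  qed
  show "0 \<le> pot f x + ln (norm x) * (LINT y|lborel. f y)"
    unfolding eq using ae by (intro integral_nonneg_AE) auto
  have "pot f x + ln (norm x) * (LINT y|lborel. f y) \<le> (LINT y|lborel. (1 + norm y) powr a * f y / a + ratio x y powr a * f y / a)"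
    unfolding eq using ae int riesz_moment riesz_ratio[of x] by (intro integral_mono_AE) auto
  also have "\<dots> = (LINT y|lborel. (1 + norm y) powr a * f y) / a + (LINT y|lborel. ratio x y powr a * f y) / a"
    using riesz_moment riesz_ratio[of x] by simp
  also have "\<dots> \<le> C / a + C / a"
    using a riesz_moment_le riesz_ratio_le by (intro add_mono divide_right_mono) auto
  finally show "pot f x + ln (norm x) * (LINT y|lborel. f y) \<le> 2 * C / a" by simp
qed

lemma pot_holder_aux: "pot f x - pot f x' \<le> C / a * norm (x - x') powr a"
proof -
  have "pot f x - pot f x' = (LINT y|lborel. f y * (ln (ratio x y) - ln (ratio x' y)))"
    unfolding pot_def using riesz_log by (simp add: right_diff_distrib)
  also have "\<dots> \<le> (LINT y|lborel. (norm (x - x') powr a / a) * (ratio x y powr a * f y))"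
  proof (rule integral_mono_AE)
    show "AE y in lborel. f y * (ln (ratio x y) - ln (ratio x' y)) \<le> (norm (x - x') powr a / a) * (ratio x y powr a * f y)"
      using AE_lborel_neq[of x] AE_lborel_neq[of x']
    proof eventually_elim
      case (elim y)
      have "ln (ratio x y) - ln (ratio x' y) \<le> norm (x - x') powr a * (1 / norm (x - y)) powr a / a"
        using elim a by (intro ln_ratio_diff_le) auto
      also have "\<dots> \<le> norm (x - x') powr a * ratio x y powr a / a"
        using a inverse_le_ratio by (intro divide_right_mono mult_left_mono powr_mono2) auto
      finally have "f y * (ln (ratio x y) - ln (ratio x' y)) \<le> f y * (norm (x - x') powr a * ratio x y powr a / a)"
        by (intro mult_left_mono riesz_nonneg)
      then show ?case by (simp add: mult_ac)
    qed
    show "integrable lborel (\<lambda>y. f y * (ln (ratio x y) - ln (ratio x' y)))"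
      using riesz_log[of x] riesz_log[of x'] by (simp add: right_diff_distrib)
    show "integrable lborel (\<lambda>y. norm (x - x') powr a / a * (ratio x y powr a * f y))"
      by (intro integrable_mult_right riesz_ratio)
  qed
  also have "\<dots> = norm (x - x') powr a / a * (LINT y|lborel. ratio x y powr a * f y)" by simp
  also have "\<dots> \<le> norm (x - x') powr a / a * C" using a by (intro mult_left_mono riesz_ratio_le) auto
  finally show ?thesis by (simp add: mult_ac)
qed

lemma pot_holder: "\<bar>pot f x - pot f x'\<bar> \<le> C / a * norm (x - x') powr a"
  using pot_holder_aux[of x x'] pot_holder_aux[of x' x] by (simp add: abs_le_iff norm_minus_commute)

lemma pot_continuous: "continuous_on UNIV (pot f)"
  by (rule holder_imp_continuous[OF a(1) pot_holder])

lemma pot_diff_eq: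
  "pot f x - pot f x' = (LINT y|lborel. f y * (ln (ratio x y) - ln (ratio x' y)))"
  unfolding pot_def using riesz_log by (simp add: right_diff_distrib)

end

lemma riesz_restrict:
  assumes r: "riesz a C f" and S: "S \<in> sets borel"
  shows "riesz a C (\<lambda>y. indicator S y * f y)"
  unfolding riesz_def
proof (intro conjI allI)
  have [measurable]: "f \<in> borel_measurable borel" using r unfolding riesz_def by blast
  have f0: "0 \<le> f y" for y using r unfolding riesz_def by blast
  show "(\<lambda>y. indicator S y * f y) \<in> borel_measurable borel" using S by simp
  show "0 \<le> indicator S y * f y" for y by (simp add: f0)
  fix x
  have "(\<integral>\<^sup>+y. ennreal (ratio x y powr a * (1 + norm y) powr a * (indicator S y * f y)) \<partial>lborel) \<le>
      (\<integral>\<^sup>+y. ennreal (ratio x y powr a * (1 + norm y) powr a * f y) \<partial>lborel)"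
    by (intro nn_integral_mono ennreal_leI mult_left_mono) (auto simp: f0 indicator_def)
  then show "(\<integral>\<^sup>+y. ennreal (ratio x y powr a * (1 + norm y) powr a * (indicator S y * f y)) \<partial>lborel) \<le> ennreal C"
    using r unfolding riesz_def by (meson order_trans)
qed

lemma pot_split:
  assumes r: "riesz a C f" and a: "0 < a" "a \<le> 1" and C: "0 \<le> C" and S: "S \<in> sets borel"
  shows "pot f x = pot (\<lambda>y. indicator S y * f y) x + pot (\<lambda>y. indicator (- S) y * f y) x"
proof -
  have S': "- S \<in> sets borel" using borel_comp[OF S] .
  have "pot (\<lambda>y. indicator S y * f y) x + pot (\<lambda>y. indicator (- S) y * f y) x
    = (LINT y|lborel. indicator S y * f y * ln (ratio x y) + indicator (- S) y * f y * ln (ratio x y))"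
    unfolding pot_def using riesz_log[OF riesz_restrict[OF r S] a C] riesz_log[OF riesz_restrict[OF r S'] a C] by simp
  also have "\<dots> = pot f x" unfolding pot_def
    by (intro Bochner_Integration.integral_cong) (auto simp: indicator_def)
  finally show ?thesis by simp
qed

text \<open>Jensen's inequality for a measure whose mass is only bounded by \<open>M0\<close>: the
  missing mass is thought of as sitting where the kernel vanishes. This accounts for the summand 1
  and lets the exponent be \<open>t * M0\<close> whatever the actual mass is.\<close>

lemma exp_pot_le:
  assumes [measurable]: "f \<in> borel_measurable borel" and nn: "\<And>y. 0 \<le> f y"
    and M: "(\<integral>\<^sup>+y. ennreal (f y) \<partial>lborel) \<le> ennreal M0" and M0: "0 < M0"
  shows "ennreal (exp (t * pot f x)) \<le> 1 + ennreal (1 / M0) * (\<integral>\<^sup>+y. ennreal (ratio x y powr (t * M0) * f y) \<partial>lborel)"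
proof (cases "integrable lborel (\<lambda>y. f y * ln (ratio x y)) \<and> integrable lborel (\<lambda>y. ratio x y powr (t * M0) * f y)")
  \<comment> \<open>Two degenerate cases: if the logarithmic integrand is not integrable,
    \<open>pot f x\<close> is 0 by default and the summand 1 suffices; if the power is not
    integrable, the right side is infinite.\<close>
  case False
  then consider "\<not> integrable lborel (\<lambda>y. f y * ln (ratio x y))" | "\<not> integrable lborel (\<lambda>y. ratio x y powr (t * M0) * f y)" by blast
  then show ?thesis
  proof cases
    case 1
    then have "pot f x = 0" unfolding pot_def by (rule not_integrable_integral_eq)
    then show ?thesis by simp
  next
    case 2
    have "(\<integral>\<^sup>+y. ennreal (ratio x y powr (t * M0) * f y) \<partial>lborel) = \<infinity>"
    proof (rule ccontr)
      assume "\<not> ?thesis"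
      then have "integrable lborel (\<lambda>y. ratio x y powr (t * M0) * f y)"
        by (intro integrableI_nonneg) (auto simp: nn less_top[symmetric])
      with 2 show False by simp
    qed
    then show ?thesis using M0 by (simp add: ennreal_mult_top)
  qed
next
  case True
  define c where "c = pot f x"
  define u where "u = t * c"
  define I where "I = (LINT y|lborel. ratio x y powr (t * M0) * f y)"
  define M where "M = (LINT y|lborel. f y)"
  have fi: "integrable lborel f" and MM0: "M \<le> M0"
    using nn_le_integral[of f lborel M0] M M0 nn unfolding M_def by auto
  have M_nn: "0 \<le> M" unfolding M_def using nn by simp
  have "exp u * (M * (1 - u) + t * M0 * c) = (LINT y|lborel. exp u * (f y * (1 - u) + t * M0 * (f y * ln (ratio x y))))"
    unfolding M_def c_def pot_def using fi True by simp
  also have "\<dots> \<le> I" unfolding I_def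
  proof (rule integral_mono_AE)
    show "integrable lborel (\<lambda>y. exp u * (f y * (1 - u) + t * M0 * (f y * ln (ratio x y))))"
      using fi True by (intro integrable_mult_right Bochner_Integration.integrable_add integrable_mult_left) auto
    show "AE y in lborel. exp u * (f y * (1 - u) + t * M0 * (f y * ln (ratio x y))) \<le> ratio x y powr (t * M0) * f y"
      using AE_lborel_neq[of x]
    proof eventually_elim
      case (elim y)
      \<comment> \<open>The tangent to exp at \<open>u\<close>, evaluated at the kernel value
        \<open>L\<close> and integrated against \<open>f\<close>, is the direct proof of Jensen's
        inequality.\<close>
      define L where "L = t * M0 * ln (ratio x y)"
      have "1 + (L - u) \<le> exp (L - u)" by (rule exp_ge_add_one_self)
      then have "exp u * (1 + (L - u)) \<le> exp u * exp (L - u)" by simp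
      also have "\<dots> = exp L" by (simp add: exp_diff)
      also have "\<dots> = ratio x y powr (t * M0)"
        using ratio_pos[of x y] elim by (simp add: L_def powr_def)
      finally have "exp u * (1 + (L - u)) * f y \<le> ratio x y powr (t * M0) * f y"
        by (intro mult_right_mono nn)
      then show ?case by (simp add: L_def algebra_simps)
    qed
  qed (use True in auto)
  finally have 1: "exp u * (M * (1 - u) + u * M0) \<le> I" by (simp add: u_def mult_ac)
  \<comment> \<open>Contribution of the missing mass \<open>M0 - M\<close>: the tangent at
    \<open>u\<close>, evaluated at 0, lies below exp 0 = 1.\<close>
  have "(M0 - M) * (exp u * (1 - u)) \<le> M0"
  proof (cases "1 - u \<ge> 0")
    case True
    have "1 - u \<le> exp (- u)" using exp_ge_add_one_self[of "-u"] by simp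
    then have "exp u * (1 - u) \<le> exp u * exp (- u)" by simp
    then have "exp u * (1 - u) \<le> 1" by (simp add: exp_minus)
    then have "(M0 - M) * (exp u * (1 - u)) \<le> (M0 - M) * 1" using MM0 by (intro mult_left_mono) auto
    then show ?thesis using M_nn by simp
  next
    case False
    then have "exp u * (1 - u) \<le> 0" by (simp add: mult_nonneg_nonpos)
    then have "(M0 - M) * (exp u * (1 - u)) \<le> 0" using MM0 by (simp add: mult_nonneg_nonpos)
    then show ?thesis using M0 by simp
  qed
  then have "exp u * M0 \<le> M0 + exp u * (M * (1 - u) + u * M0)" by (simp add: algebra_simps)
  then have "exp u * M0 \<le> M0 + I" using 1 by simp
  then have "exp u \<le> 1 + I / M0" using M0 by (simp add: field_simps)
  moreover have "I \<ge> 0" unfolding I_def by (simp add: nn)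
  ultimately have "ennreal (exp u) \<le> 1 + ennreal (1 / M0) * ennreal I"
    using M0 by (subst ennreal_mult[symmetric]) (auto simp: ennreal_plus[symmetric] ennreal_1[symmetric] intro!: ennreal_leI simp del: ennreal_plus ennreal_1)
  also have "ennreal I = (\<integral>\<^sup>+y. ennreal (ratio x y powr (t * M0) * f y) \<partial>lborel)"
    unfolding I_def using True nn by (subst nn_integral_eq_integral) auto
  finally show ?thesis by (simp add: u_def c_def)
qed

text \<open>\<open>exp_pot_le\<close> turns \<open>exp (4 * pot f y)\<close> into an average over
  \<open>z\<close> of poles of order \<open>4 * M0\<close>. After exchanging the integrals,
  \<open>ratio_kernel_bound\<close> with b = 4 * M0 applies uniformly in \<open>z\<close>. The
  condition on \<tau> + a + 4 * M0 is integrability when all poles coincide. The constant depends on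
  neither \<open>f\<close> nor \<open>P\<close>, \<open>D\<close>, \<open>x\<close>, which is what
  makes later estimates uniform along the sequence.\<close>

lemma jensen_kernel:
  assumes nn: "0 \<le> \<tau>" "0 \<le> a" "0 < M0" and t: "\<tau> + a + 4 * M0 < 2" and s: "\<sigma> > 2" "\<sigma> \<ge> a + 4 * M0"
  shows "\<exists>C\<ge>0. \<forall>f P k D Ck x. f \<in> borel_measurable borel \<longrightarrow> (\<forall>y. 0 \<le> f y) \<longrightarrow>
     (\<integral>\<^sup>+y. ennreal (f y) \<partial>lborel) \<le> ennreal M0 \<longrightarrow> 0 \<le> Ck \<longrightarrow>
     (\<forall>y. y \<in> D \<longrightarrow> y \<noteq> P \<longrightarrow> k y \<le> Ck * ((1 + norm y) powr (-\<sigma>) * min 1 (norm (y - P)) powr (-\<tau>))) \<longrightarrow>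
     (\<integral>\<^sup>+y. indicator D y * ennreal (ratio x y powr a * k y * exp (4 * pot f y)) \<partial>lborel) \<le> ennreal (C * Ck)"
proof -
  obtain C0 where C0: "C0 \<ge> 0" "\<And>P x z. (\<integral>\<^sup>+y. ennreal (ratio x y powr a * (1 + norm y) powr (-\<sigma>)
     * min 1 (norm (y - P)) powr (-\<tau>) * ratio y z powr 0) \<partial>lborel) \<le> ennreal C0"
    using ratio_kernel_bound[of \<tau> a 0 \<sigma>] nn t s by auto
  obtain C1 where C1: "C1 \<ge> 0" "\<And>P x z. (\<integral>\<^sup>+y. ennreal (ratio x y powr a * (1 + norm y) powr (-\<sigma>)
     * min 1 (norm (y - P)) powr (-\<tau>) * ratio y z powr (4 * M0)) \<partial>lborel) \<le> ennreal C1"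
    using ratio_kernel_bound[of \<tau> a "4 * M0" \<sigma>] nn t s by auto
  show ?thesis
  proof (intro exI[of _ "C0 + C1"] conjI allI impI)
    fix f :: "plane \<Rightarrow> real" and P :: plane and k D Ck and x :: plane
    assume [measurable]: "f \<in> borel_measurable borel" and f0: "\<forall>y. 0 \<le> f y"
      and M: "(\<integral>\<^sup>+y. ennreal (f y) \<partial>lborel) \<le> ennreal M0" and Ck: "0 \<le> Ck"
      and k: "\<forall>y. y \<in> D \<longrightarrow> y \<noteq> P \<longrightarrow> k y \<le> Ck * ((1 + norm y) powr (-\<sigma>) * min 1 (norm (y - P)) powr (-\<tau>))"
    define W where "W y = ratio x y powr a * (1 + norm y) powr (-\<sigma>) * min 1 (norm (y - P)) powr (-\<tau>)" for y
    have W0: "0 \<le> W y" for y by (simp add: W_def)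
    have [measurable]: "W \<in> borel_measurable borel" unfolding W_def by measurable
    define G where "G y = (\<integral>\<^sup>+z. ennreal (ratio y z powr (4 * M0) * f z) \<partial>lborel)" for y
    have [measurable]: "(\<lambda>p. ratio (fst p) (snd p)) \<in> borel_measurable (lborel \<Otimes>\<^sub>M lborel)"
      unfolding ratio_def by measurable
    have [measurable]: "G \<in> borel_measurable borel"
      unfolding G_def ratio_def by measurable
    have "(\<integral>\<^sup>+y. indicator D y * ennreal (ratio x y powr a * k y * exp (4 * pot f y)) \<partial>lborel)
      \<le> (\<integral>\<^sup>+y. ennreal Ck * (ennreal (W y * ratio y 0 powr 0) + ennreal (1 / M0) * (ennreal (W y) * G y)) \<partial>lborel)"
    proof (rule nn_integral_mono_AE)
      show "AE y in lborel. indicator D y * ennreal (ratio x y powr a * k y * exp (4 * pot f y)) \<le>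
         ennreal Ck * (ennreal (W y * ratio y 0 powr 0) + ennreal (1 / M0) * (ennreal (W y) * G y))"
        using AE_lborel_neq[of P] AE_lborel_neq[of 0]
      proof eventually_elim
        case (elim y)
        show ?case
        proof (cases "y \<in> D")
          case True
          have e: "ennreal (exp (4 * pot f y)) \<le> 1 + ennreal (1 / M0) * G y"
            unfolding G_def using f0 M nn by (intro exp_pot_le) auto
          have "ratio x y powr a * k y \<le> Ck * W y"
            using mult_left_mono[OF k[rule_format, OF True elim(1)], of "ratio x y powr a"]
            by (simp add: W_def mult_ac)
          then have "ratio x y powr a * k y * exp (4 * pot f y) \<le> (Ck * W y) * exp (4 * pot f y)"
            by (intro mult_right_mono) auto
          then have "ennreal (ratio x y powr a * k y * exp (4 * pot f y)) \<le> ennreal (Ck * W y) * ennreal (exp (4 * pot f y))"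
            using Ck W0 by (subst ennreal_mult[symmetric]) (auto intro: ennreal_leI)
          also have "\<dots> \<le> ennreal (Ck * W y) * (1 + ennreal (1 / M0) * G y)"
            by (intro mult_left_mono e) auto
          also have "\<dots> = ennreal Ck * (ennreal (W y) + ennreal (1 / M0) * (ennreal (W y) * G y))"
            using Ck W0 by (simp add: ennreal_mult ring_distribs mult_ac)
          also have "W y = W y * ratio y 0 powr 0" using ratio_pos[of y 0] elim by simp
          finally show ?thesis using True ratio_pos[of y 0] elim by simp
        qed simp
      qed
    qed
    also have "\<dots> = ennreal Ck * ((\<integral>\<^sup>+y. ennreal (W y * ratio y 0 powr 0) \<partial>lborel) + ennreal (1 / M0) * (\<integral>\<^sup>+y. ennreal (W y) * G y \<partial>lborel))"
      by (simp add: nn_integral_cmult nn_integral_add)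
    also have "(\<integral>\<^sup>+y. ennreal (W y) * G y \<partial>lborel) = (\<integral>\<^sup>+y. (\<integral>\<^sup>+z. ennreal (f z) * ennreal (W y * ratio y z powr (4 * M0)) \<partial>lborel) \<partial>lborel)"
      unfolding G_def using W0 f0
      by (subst nn_integral_cmult[symmetric]) (auto simp: ennreal_mult mult_ac ratio_def intro!: nn_integral_cong)
    \<comment> \<open>Tonelli: with \<open>z\<close> outside, the inner integral is the kernel bound
      \<open>C1\<close>, and the outer mass \<open>M0\<close> cancels the factor 1 / M0 of Jensen's
      inequality.\<close>
    also have "\<dots> = (\<integral>\<^sup>+z. (\<integral>\<^sup>+y. ennreal (f z) * ennreal (W y * ratio y z powr (4 * M0)) \<partial>lborel) \<partial>lborel)"
      by (rule lborel_pair.Fubini') (simp add: ratio_def case_prod_unfold)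
    also have "\<dots> \<le> (\<integral>\<^sup>+z. ennreal (f z) * ennreal C1 \<partial>lborel)"
    proof (rule nn_integral_mono)
      fix z :: plane
      have "(\<integral>\<^sup>+y. ennreal (f z) * ennreal (W y * ratio y z powr (4 * M0)) \<partial>lborel) = ennreal (f z) * (\<integral>\<^sup>+y. ennreal (W y * ratio y z powr (4 * M0)) \<partial>lborel)"
        by (rule nn_integral_cmult) (simp add: ratio_def)
      then show "(\<integral>\<^sup>+y. ennreal (f z) * ennreal (W y * ratio y z powr (4 * M0)) \<partial>lborel) \<le> ennreal (f z) * ennreal C1"
        using mult_left_mono[OF C1(2)[of x P z], of "ennreal (f z)"] by (simp add: W_def)
    qed
    also have "\<dots> \<le> ennreal M0 * ennreal C1"
      by (subst nn_integral_multc) (auto intro: mult_right_mono M)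
    finally have "(\<integral>\<^sup>+y. indicator D y * ennreal (ratio x y powr a * k y * exp (4 * pot f y)) \<partial>lborel)
      \<le> ennreal Ck * ((\<integral>\<^sup>+y. ennreal (W y * ratio y 0 powr 0) \<partial>lborel) + ennreal (1 / M0) * (ennreal M0 * ennreal C1))"
      by (simp add: mult_left_mono add_left_mono)
    also have "\<dots> \<le> ennreal Ck * (ennreal C0 + ennreal (1 / M0) * (ennreal M0 * ennreal C1))"
      using C0(2)[of x P 0] by (intro mult_left_mono add_right_mono) (auto simp: W_def)
    also have "\<dots> = ennreal ((C0 + C1) * Ck)"
      using Ck C0 C1 nn by (simp add: ennreal_mult[symmetric] ennreal_plus[symmetric] mult.commute del: ennreal_plus)
    finally show "(\<integral>\<^sup>+y. indicator D y * ennreal (ratio x y powr a * k y * exp (4 * pot f y)) \<partial>lborel) \<le> ennreal ((C0 + C1) * Ck)" .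
  qed (use C0 C1 in auto)
qed

lemma pred_ball [measurable]: "Measurable.pred borel (\<lambda>x::'a::metric_space. x \<in> ball c r)"
  unfolding pred_def by (simp flip: ball_def)

section \<open>A local Pohozaev inequality\<close>

text \<open>Multiplying the two mixed distances removes the first-order change of the logarithmic
  kernel under a dilation apart from the factor \<open>l\<close>; what remains is quadratic in l -
  1. For a single mixed distance the error would be of first order.\<close>

lemma dilation_symmetrised:
  fixes x y :: "'a::real_inner"
  assumes l: "0 < l"
  shows "norm (l *\<^sub>R x - y) * norm (l *\<^sub>R y - x) \<le> l * (norm (x - y))\<^sup>2 + (l - 1)\<^sup>2 * (norm x * norm y)"
proof -
  define p q c where "p = (norm x)\<^sup>2" and "q = (norm y)\<^sup>2" and "c = x \<bullet> y"
  define g where "g = norm x * norm y"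
  have g: "g \<ge> 0" "g\<^sup>2 = p * q" by (simp_all add: g_def p_def q_def power_mult_distrib)
  have cg: "c + g \<ge> 0" using Cauchy_Schwarz_ineq2[of x y] by (simp add: c_def g_def)
  have pq: "2 * g \<le> p + q" unfolding g_def p_def q_def using sum_squares_bound[of "norm x" "norm y"] by simp
  have a: "(norm (l *\<^sub>R x - y))\<^sup>2 = l\<^sup>2 * p - 2 * l * c + q"
    unfolding p_def q_def c_def power2_norm_eq_inner
    by (simp add: inner_diff inner_commute power2_eq_square algebra_simps)
  have b: "(norm (l *\<^sub>R y - x))\<^sup>2 = l\<^sup>2 * q - 2 * l * c + p"
    unfolding p_def q_def c_def power2_norm_eq_inner
    by (simp add: inner_diff inner_commute power2_eq_square algebra_simps)
  have d: "(norm (x - y))\<^sup>2 = p + q - 2 * c"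
    by (simp add: power2_norm_eq_inner p_def q_def c_def inner_diff inner_commute algebra_simps)
  \<comment> \<open>Cauchy-Schwarz makes the first factor nonnegative, the arithmetic-geometric mean
    inequality the second nonpositive. Up to the relation \<open>g\<^sup>2 = p * q\<close>, the
    difference of the squares of both sides of the claim is a nonpositive multiple of this
    product.\<close>
  have "(c + g) * (2 * g - (p + q)) \<le> 0" using cg pq by (simp add: mult_nonneg_nonpos)
  then have key: "2 * g\<^sup>2 + 2 * c * g - (p + q) * (c + g) \<le> 0" by (simp add: algebra_simps power2_eq_square)
  have "(l * (p + q - 2 * c) + (l - 1)\<^sup>2 * g)\<^sup>2 - (l\<^sup>2 * p - 2 * l * c + q) * (l\<^sup>2 * q - 2 * l * c + p)
     = - 2 * l * (l - 1)\<^sup>2 * (2 * g\<^sup>2 + 2 * c * g - (p + q) * (c + g))"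
  proof -
    have "(l * (p + q - 2 * c) + (l - 1)\<^sup>2 * g)\<^sup>2 - (l\<^sup>2 * p - 2 * l * c + q) * (l\<^sup>2 * q - 2 * l * c + p)
      - (- 2 * l * (l - 1)\<^sup>2 * (2 * g\<^sup>2 + 2 * c * g - (p + q) * (c + g)))
      = (4 * l * (l - 1)\<^sup>2 + ((l - 1)\<^sup>2)\<^sup>2) * (g\<^sup>2 - p * q)"
      by (simp add: power2_eq_square algebra_simps)
    then show ?thesis using g(2) by simp
  qed
  note eq = this
  have aux: "X - Y = Z \<Longrightarrow> 0 \<le> Z \<Longrightarrow> Y \<le> X" for X Y Z :: real by simp
  have "0 \<le> 2 * l * (l - 1)\<^sup>2" using l by simp
  from mult_nonneg_nonpos[OF this key]
  have "0 \<le> - 2 * l * (l - 1)\<^sup>2 * (2 * g\<^sup>2 + 2 * c * g - (p + q) * (c + g))" by (simp only: mult_minus_left neg_0_le_iff_le)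
  note aux[OF eq this]
  then have "(norm (l *\<^sub>R x - y) * norm (l *\<^sub>R y - x))\<^sup>2 \<le> (l * (norm (x - y))\<^sup>2 + (l - 1)\<^sup>2 * g)\<^sup>2"
    unfolding power_mult_distrib a b d .
  moreover have "0 \<le> l * (norm (x - y))\<^sup>2 + (l - 1)\<^sup>2 * g" using l g(1) by simp
  ultimately show ?thesis unfolding g_def by (rule power2_le_imp_le)
qed

text \<open>With |x| \<le> |y|, one has |x - y| \<le> 2 |y|, so the negative powers of |y| can be
  exchanged for powers of |x - y| and |x|, leaving two separate singularities of order 2 b < 2. The
  exponent 3/4 has two constraints: it exceeds 1/2, so that (s^2)^(3/4) is o(s) in the dilation
  argument, and it stays below 1.\<close>

lemma energy_pointwise:
  fixes x y :: "'a::real_normed_vector"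
  assumes xy: "x \<noteq> 0" "y \<noteq> 0" "x \<noteq> y" and b: "3/4 \<le> b" "b < 1"
  shows "norm x powr (-2*b) * norm y powr (-2*b) * (norm x * norm y / (norm (x - y))\<^sup>2) powr (3/4)
     \<le> 2 * (norm x powr (-2*b) + norm y powr (-2*b)) * norm (x - y) powr (-2*b)"
proof -
  have main: "norm x powr (-2*b) * norm y powr (-2*b) * (norm x * norm y / (norm (x - y))\<^sup>2) powr (3/4)
     \<le> 2 * norm x powr (-2*b) * norm (x - y) powr (-2*b)"
    if xy: "x \<noteq> 0" "y \<noteq> 0" "x \<noteq> y" and le: "norm x \<le> norm y" for x y :: 'a
  proof -
    define r s d where "r = norm x" and "s = norm y" and "d = norm (x - y)"
    have pos: "r > 0" "s > 0" "d > 0" and rs: "r \<le> s" using xy le by (auto simp: r_def s_def d_def)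
    have d: "d \<le> 2 * s" unfolding d_def s_def using norm_triangle_ineq4[of x y] le by simp
    define e where "e = 2 * b - 3/2"
    have e: "0 \<le> e" "e \<le> 1" using b by (auto simp: e_def)
    have "s powr (-e) \<le> (d / 2) powr (-e)" using d pos e by (intro powr_mono2') auto
    also have "\<dots> = 2 powr e * d powr (-e)" using pos by (simp add: powr_divide powr_minus divide_simps)
    also have "\<dots> \<le> 2 * d powr (-e)" using e powr_mono[of e 1 2] by (intro mult_right_mono) auto
    finally have s1: "s powr (-e) \<le> 2 * d powr (-e)" .
    have s2: "s powr (-3/4) \<le> r powr (-3/4)" using rs pos by (intro powr_mono2') auto
    have d2: "(d\<^sup>2) powr (3/4) = d powr (3/2)" using pos powr_powr[of d 2 "3/4"] by (simp add: powr_numeral)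
    have "r powr (-2*b) * s powr (-2*b) * (r * s / d\<^sup>2) powr (3/4) = r powr (-2*b) * r powr (3/4) * (s powr (-e) * s powr (-3/4)) * d powr (-3/2)"
    proof -
      have "(r * s / d\<^sup>2) powr (3/4) = r powr (3/4) * s powr (3/4) * d powr (-3/2)"
        using pos by (simp add: powr_divide powr_mult d2 powr_minus divide_simps)
      moreover have "s powr (-2*b) * s powr (3/4) = s powr (-e) * s powr (-3/4)"
        by (simp add: powr_add[symmetric] e_def)
      ultimately show ?thesis by (simp add: algebra_simps)
    qed
    also have "\<dots> \<le> r powr (-2*b) * r powr (3/4) * ((2 * d powr (-e)) * r powr (-3/4)) * d powr (-3/2)"
      using s1 s2 by (intro mult_left_mono mult_right_mono mult_mono) auto
    also have "\<dots> = 2 * (r powr (-2*b) * (r powr (3/4) * r powr (-3/4))) * (d powr (-e) * d powr (-3/2))"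
      by (simp add: algebra_simps)
    also have "r powr (3/4) * r powr (-3/4) = 1" using pos by (simp add: powr_add[symmetric])
    also have "d powr (-e) * d powr (-3/2) = d powr (-2*b)" by (simp add: powr_add[symmetric] e_def)
    finally show ?thesis by (simp add: r_def s_def d_def)
  qed
  show ?thesis
  proof (cases "norm x \<le> norm y")
    case True
    have "0 \<le> 2 * norm y powr (-2*b) * norm (x - y) powr (-2*b)" by simp
    moreover have "2 * (norm x powr (-2*b) + norm y powr (-2*b)) * norm (x - y) powr (-2*b) =
      2 * norm x powr (-2*b) * norm (x - y) powr (-2*b) + 2 * norm y powr (-2*b) * norm (x - y) powr (-2*b)"
      by (simp add: algebra_simps)
    ultimately show ?thesis using main[OF xy True] by linarith
  next
    case False
    have "0 \<le> 2 * norm x powr (-2*b) * norm (x - y) powr (-2*b)" by simp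
    moreover have "2 * (norm x powr (-2*b) + norm y powr (-2*b)) * norm (x - y) powr (-2*b) =
      2 * norm x powr (-2*b) * norm (x - y) powr (-2*b) + 2 * norm y powr (-2*b) * norm (y - x) powr (-2*b)"
      by (simp add: algebra_simps norm_minus_commute)
    moreover have "norm x powr (-2*b) * norm y powr (-2*b) * (norm x * norm y / (norm (x - y))\<^sup>2) powr (3/4)
      = norm y powr (-2*b) * norm x powr (-2*b) * (norm y * norm x / (norm (y - x))\<^sup>2) powr (3/4)"
      by (simp add: mult_ac norm_minus_commute)
    moreover have "norm y powr (-2*b) * norm x powr (-2*b) * (norm y * norm x / (norm (y - x))\<^sup>2) powr (3/4)
     \<le> 2 * norm y powr (-2*b) * norm (y - x) powr (-2*b)"
      using xy False by (intro main) auto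
    ultimately show ?thesis by linarith
  qed
qed

text \<open>On a disc the weight (1 + |y|)^(-3) is bounded below, so the global kernel estimate with
  an artificial decay of order 3 applies; it also gives uniformity in \<open>x\<close>.\<close>

lemma local_singular_bound:
  fixes Q :: plane
  assumes "0 \<le> t" "t < 2"
  shows "\<exists>C\<ge>0. \<forall>x. (\<integral>\<^sup>+y. indicator (ball Q r) y * ennreal (norm (x - y) powr (-t)) \<partial>lborel) \<le> ennreal C"
proof -
  obtain C where C: "C \<ge> 0" "\<And>P x z. (\<integral>\<^sup>+y. ennreal (kern3 3 0 t 0 P x z y) \<partial>lborel) \<le> ennreal C"
    using kern3_bound[of 3 0 t 0] assms by auto
  define K where "K = (1 + norm Q + \<bar>r\<bar>) powr 3"
  have "(\<integral>\<^sup>+y. indicator (ball Q r) y * ennreal (norm (x - y) powr (-t)) \<partial>lborel) \<le> ennreal (K * C)" for x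
  proof -
    have "(\<integral>\<^sup>+y. indicator (ball Q r) y * ennreal (norm (x - y) powr (-t)) \<partial>lborel)
      \<le> (\<integral>\<^sup>+y. ennreal K * ennreal (kern3 3 0 t 0 Q x x y) \<partial>lborel)"
    proof (rule nn_integral_mono_AE)
      show "AE y in lborel. indicator (ball Q r) y * ennreal (norm (x - y) powr (-t)) \<le> ennreal K * ennreal (kern3 3 0 t 0 Q x x y)"
        using AE_lborel_neq[of x] AE_lborel_neq[of Q]
      proof eventually_elim
        case (elim y)
        show ?case
        proof (cases "y \<in> ball Q r")
          case True
          then have "norm y \<le> norm Q + \<bar>r\<bar>" using norm_triangle_sub[of y Q] by (simp add: dist_norm norm_minus_commute)
          then have "(1 + norm y) powr 3 \<le> K" unfolding K_def by (intro powr_mono2) auto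
          then have "1 \<le> K * (1 + norm y) powr (-3)" by (simp add: powr_minus divide_simps)
          then have "norm (x - y) powr (-t) \<le> (K * (1 + norm y) powr (-3)) * norm (x - y) powr (-t)"
            by (metis mult_cancel_right1 mult_right_mono powr_ge_zero)
          also have "\<dots> = K * kern3 3 0 t 0 Q x x y" using elim by (simp add: kern3_def min_def)
          finally show ?thesis using True
            by (simp add: ennreal_mult[symmetric] K_def ennreal_leI)
        qed simp
      qed
    qed
    also have "\<dots> \<le> ennreal K * ennreal C" by (subst nn_integral_cmult) (auto intro: mult_left_mono C)
    finally show ?thesis using C by (simp add: ennreal_mult K_def)
  qed
  then show ?thesis using C by (intro exI[of _ "K * C"]) (auto simp: K_def)
qed

lemma nn_integral_ball_dilation:
  fixes Q :: plane and f :: "plane \<Rightarrow> real"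
  assumes l: "0 < l" and [measurable]: "f \<in> borel_measurable borel" and nn: "\<And>x. 0 \<le> f x"
  shows "(\<integral>\<^sup>+x. ennreal (indicator (ball Q d) x * (l\<^sup>2 * f (Q + l *\<^sub>R (x - Q)))) \<partial>lborel)
       = (\<integral>\<^sup>+x. ennreal (indicator (ball Q (l * d)) x * f x) \<partial>lborel)"
proof -
  define T where "T x = (Q - l *\<^sub>R Q) + l *\<^sub>R x" for x
  have T: "T x = Q + l *\<^sub>R (x - Q)" for x by (simp add: T_def algebra_simps)
  have [measurable]: "T \<in> borel_measurable borel" unfolding T_def by measurable
  have lb: "lborel = density (distr lborel borel T) (\<lambda>_. ennreal (\<bar>l\<bar>^DIM(plane)))"
    unfolding T_def using l by (intro lborel_affine) auto
  have mem: "T x \<in> ball Q (l * d) \<longleftrightarrow> x \<in> ball Q d" for x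
    using l by (simp add: T dist_norm norm_minus_commute[of Q])
  have "(\<integral>\<^sup>+x. ennreal (indicator (ball Q (l * d)) x * f x) \<partial>lborel) =
    (\<integral>\<^sup>+x. ennreal (\<bar>l\<bar>^DIM(plane)) * ennreal (indicator (ball Q (l * d)) (T x) * f (T x)) \<partial>lborel)"
  proof -
    have "(\<integral>\<^sup>+x. ennreal (indicator (ball Q (l * d)) x * f x) \<partial>lborel) =
      (\<integral>\<^sup>+x. ennreal (indicator (ball Q (l * d)) x * f x) \<partial>density (distr lborel borel T) (\<lambda>_. ennreal (\<bar>l\<bar>^DIM(plane))))"
      using lb by (rule arg_cong)
    also have "\<dots> = (\<integral>\<^sup>+x. ennreal (\<bar>l\<bar>^DIM(plane)) * ennreal (indicator (ball Q (l * d)) x * f x) \<partial>distr lborel borel T)"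
      by (rule nn_integral_density) measurable
    also have "\<dots> = (\<integral>\<^sup>+x. ennreal (\<bar>l\<bar>^DIM(plane)) * ennreal (indicator (ball Q (l * d)) (T x) * f (T x)) \<partial>lborel)"
      by (rule nn_integral_distr) measurable
    finally show ?thesis .
  qed
  also have "\<dots> = (\<integral>\<^sup>+x. ennreal (indicator (ball Q d) x * (l\<^sup>2 * f (Q + l *\<^sub>R (x - Q)))) \<partial>lborel)"
    using mem nn l
    by (intro nn_integral_cong) (auto simp: ennreal_mult'[symmetric] T indicator_def)
  finally show ?thesis by simp
qed

text \<open>The mass of the dilated disc is the integral over the original disc of
  \<open>l\<^sup>2 * f (\<Phi> x)\<close>. The quotient of this by \<open>f x\<close> is exp z,
  where z collects (2 - 2 b) ln l from the Jacobian and the singular weight, the change of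
  \<open>G\<close>, and four times the change of the potential. Convexity, exp z - 1 \<ge> z, gives
  a lower bound that is linear in z, and symmetrisation turns the self-interaction into - ln l * M^2
  / 2 up to an error of order |s|^(3/2).\<close>

lemma dilation_inequality:
  fixes f :: "plane \<Rightarrow> real" and Q :: plane and G :: "plane \<Rightarrow> real"
  assumes r: "riesz a C f" and a: "0 < a" "a \<le> 1" and C: "0 \<le> C" and b: "0 < b" "b < 1" and d: "0 < \<delta>"
    and eq: "\<And>x. x \<in> ball Q (2 * \<delta>) \<Longrightarrow> x \<noteq> Q \<Longrightarrow> f x = norm (x - Q) powr (-2*b) * exp (G x + 4 * pot f x)"
    and lip: "\<And>x y. x \<in> ball Q (2 * \<delta>) \<Longrightarrow> y \<in> ball Q (2 * \<delta>) \<Longrightarrow> \<bar>G x - G y\<bar> \<le> L * norm (x - y)"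
    and C1: "0 \<le> C1"
    and outer: "\<And>x. x \<in> ball Q \<delta> \<Longrightarrow> (\<integral>\<^sup>+y. ennreal (indicator (- ball Q \<delta>) y * f y / norm (x - y)) \<partial>lborel) \<le> ennreal C1"
  defines "fB \<equiv> (\<lambda>x. indicator (ball Q \<delta>) x * f x)"
  defines "M \<equiv> (LINT x|lborel. fB x)"
  shows "\<exists>E\<ge>0. \<forall>s. \<bar>s\<bar> < 1/2 \<longrightarrow>
    M * (2 - 2*b) * ln (1 + s) - \<bar>s\<bar> * \<delta> * (L + 4 * C1) * M - 2 * M\<^sup>2 * ln (1 + s) - E * \<bar>s\<bar> powr (3/2)
      \<le> (LINT x|lborel. indicator (ball Q ((1 + s) * \<delta>)) x * f x) - M"
proof -
  note [measurable] = riesz_measurable[OF r a C]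
  have f0: "0 \<le> f x" for x by (rule riesz_nonneg[OF r a C])
  have fB0: "0 \<le> fB x" for x by (simp add: fB_def f0)
  have fint: "integrable lborel f" by (rule riesz_integrable[OF r a C])
  have [measurable]: "fB \<in> borel_measurable borel" unfolding fB_def by measurable
  have rB: "riesz a C fB" unfolding fB_def by (rule riesz_restrict[OF r]) simp
  have fBint: "integrable lborel fB" by (rule riesz_integrable[OF rB a C])
  define fc where "fc = (\<lambda>x. indicator (- ball Q \<delta>) x * f x)"
  have fc0: "0 \<le> fc x" for x by (simp add: fc_def f0)
  have [measurable]: "fc \<in> borel_measurable borel" unfolding fc_def by measurable
  have rc: "riesz a C fc" unfolding fc_def by (rule riesz_restrict[OF r]) simp
  have pot_eq: "pot f x = pot fB x + pot fc x" for x
    unfolding fB_def fc_def by (rule pot_split[OF r a C]) simp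
  \<comment> \<open>\<open>energy_pointwise\<close> requires an exponent of at least 3/4; on a
    bounded disc a larger exponent only changes the constant \<open>Cf\<close>.\<close>
  define b' where "b' = max b (3/4)"
  have b': "3/4 \<le> b'" "b' < 1" "b \<le> b'" using b by (auto simp: b'_def)
  have L: "0 \<le> L"
  proof -
    obtain u :: plane where u: "norm u = \<delta>" using d vector_choose_size[of \<delta>] by auto
    have "Q + u \<in> ball Q (2 * \<delta>)" "Q \<in> ball Q (2 * \<delta>)" using d u by (auto simp: dist_norm)
    from lip[OF this] have "0 \<le> L * \<delta>" using u by simp
    then show ?thesis using d by (simp add: zero_le_mult_iff)
  qed
  define Cf where "Cf = exp (G Q + L * (2 * \<delta>) + 4 * (C / a)) * (2 * \<delta>) powr (2 * b' - 2 * b)"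
  have Cf0: "0 \<le> Cf" by (simp add: Cf_def)
  have f_le: "f x \<le> Cf * norm (x - Q) powr (-2*b')" if x: "x \<in> ball Q (2 * \<delta>)" "x \<noteq> Q" for x
  proof -
    have n: "norm (x - Q) < 2 * \<delta>" "norm (x - Q) > 0" using x by (auto simp: dist_norm norm_minus_commute)
    have "G x - G Q \<le> L * norm (x - Q)" using lip[OF x(1), of Q] d by auto
    also have "\<dots> \<le> L * (2 * \<delta>)" using L n by (intro mult_left_mono) auto
    finally have "exp (G x + 4 * pot f x) \<le> exp (G Q + L * (2 * \<delta>) + 4 * (C / a))"
      using pot_le[OF r a C, of x] by simp
    moreover have "norm (x - Q) powr (-2*b) = norm (x - Q) powr (-2*b') * norm (x - Q) powr (2*b' - 2*b)"
      using n by (simp add: powr_add[symmetric])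
    moreover have "norm (x - Q) powr (2*b' - 2*b) \<le> (2 * \<delta>) powr (2*b' - 2*b)"
      using n b' by (intro powr_mono2) auto
    ultimately have "f x \<le> norm (x - Q) powr (-2*b') * (2 * \<delta>) powr (2*b' - 2*b) * exp (G Q + L * (2 * \<delta>) + 4 * (C / a))"
      unfolding eq[OF x] by (intro mult_mono) (auto intro: mult_left_mono)
    then show ?thesis by (simp add: Cf_def mult_ac)
  qed
  \<comment> \<open>The quantity that multiplies \<open>s\<^sup>2\<close> in the symmetrised kernel.
    It is unbounded near the diagonal, so its logarithmic contribution is estimated by its power
    3/4, whose energy integral is finite.\<close>
  define \<rho> where "\<rho> x y = norm (x - Q) * norm (y - Q) / (norm (x - y))\<^sup>2" for x y :: plane
  define err where "err = (\<lambda>(x, y). fB x * fB y * \<rho> x y powr (3/4))"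
  let ?P = "lborel \<Otimes>\<^sub>M lborel :: (plane \<times> plane) measure"
  have [measurable]: "err \<in> borel_measurable ?P"
    unfolding err_def \<rho>_def by measurable
  have err0: "0 \<le> err p" for p by (cases p) (simp add: err_def fB0)
  have err_int: "integrable ?P err"
  proof (rule integrableI_nonneg)
    obtain K where K: "K \<ge> 0" "\<And>x. (\<integral>\<^sup>+y. indicator (ball Q \<delta>) y * ennreal (norm (x - y) powr (-(2*b'))) \<partial>lborel) \<le> ennreal K"
      using local_singular_bound[of "2*b'" Q \<delta>] b' by auto
    define w where "w x = (indicator (ball Q \<delta>) x :: ennreal)" for x
    have [measurable]: "w \<in> borel_measurable borel" unfolding w_def by measurable
    define c where "c = Cf * Cf * 2"
    have [measurable]: "(\<lambda>x. ennreal (norm (x - Q) powr (-2*b'))) \<in> borel_measurable borel" by measurable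
    have "(\<integral>\<^sup>+p. ennreal (err p) \<partial>?P) = (\<integral>\<^sup>+x. \<integral>\<^sup>+y. ennreal (err (x, y)) \<partial>lborel \<partial>lborel)"
      by (rule lborel.nn_integral_fst[symmetric]) measurable
    also have "\<dots> \<le> (\<integral>\<^sup>+x. \<integral>\<^sup>+y. ennreal c * (w x * ennreal (norm (x - Q) powr (-2*b')) * (w y * ennreal (norm (x - y) powr (-(2*b'))))
        + w y * ennreal (norm (y - Q) powr (-2*b')) * (w x * ennreal (norm (y - x) powr (-(2*b'))))) \<partial>lborel \<partial>lborel)"
    proof (rule nn_integral_mono_AE)
      show "AE x in lborel. (\<integral>\<^sup>+y. ennreal (err (x, y)) \<partial>lborel) \<le> (\<integral>\<^sup>+y. ennreal c * (w x * ennreal (norm (x - Q) powr (-2*b')) * (w y * ennreal (norm (x - y) powr (-(2*b'))))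
        + w y * ennreal (norm (y - Q) powr (-2*b')) * (w x * ennreal (norm (y - x) powr (-(2*b'))))) \<partial>lborel)"
        using AE_lborel_neq[of Q]
      proof eventually_elim
        case (elim x)
        show ?case
        proof (rule nn_integral_mono_AE)
          show "AE y in lborel. ennreal (err (x, y)) \<le> ennreal c * (w x * ennreal (norm (x - Q) powr (-2*b')) * (w y * ennreal (norm (x - y) powr (-(2*b'))))
            + w y * ennreal (norm (y - Q) powr (-2*b')) * (w x * ennreal (norm (y - x) powr (-(2*b')))))"
            using AE_lborel_neq[of Q] AE_lborel_neq[of x]
          proof eventually_elim
            case (elim y)
            show ?case
            proof (cases "x \<in> ball Q \<delta> \<and> y \<in> ball Q \<delta>")
              case True
              then have xy: "x \<in> ball Q (2 * \<delta>)" "y \<in> ball Q (2 * \<delta>)" using d by auto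
              have "err (x, y) \<le> (Cf * norm (x - Q) powr (-2*b')) * (Cf * norm (y - Q) powr (-2*b')) * \<rho> x y powr (3/4)"
                unfolding err_def using True f_le[OF xy(1) \<open>x \<noteq> Q\<close>] f_le[OF xy(2) \<open>y \<noteq> Q\<close>] f0 Cf0
                by (auto simp: fB_def intro!: mult_right_mono mult_mono)
              also have "\<dots> = Cf * Cf * (norm (x - Q) powr (-2*b') * norm (y - Q) powr (-2*b') * \<rho> x y powr (3/4))"
                by (simp add: mult_ac)
              also have "\<dots> \<le> Cf * Cf * (2 * (norm (x - Q) powr (-2*b') + norm (y - Q) powr (-2*b')) * norm (x - y) powr (-2*b'))"
                using energy_pointwise[of "x - Q" "y - Q" b'] \<open>x \<noteq> Q\<close> elim b' Cf0
                by (intro mult_left_mono) (auto simp: \<rho>_def)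
              also have "\<dots> = c * (norm (x - Q) powr (-2*b') * norm (x - y) powr (-(2*b')) + norm (y - Q) powr (-2*b') * norm (y - x) powr (-(2*b')))"
                by (simp add: c_def algebra_simps norm_minus_commute)
              finally have "ennreal (err (x, y)) \<le> ennreal (c * (norm (x - Q) powr (-2*b') * norm (x - y) powr (-(2*b')) + norm (y - Q) powr (-2*b') * norm (y - x) powr (-(2*b'))))"
                by (rule ennreal_leI)
              also have "\<dots> = ennreal c * (w x * ennreal (norm (x - Q) powr (-2*b')) * (w y * ennreal (norm (x - y) powr (-(2*b'))))
                + w y * ennreal (norm (y - Q) powr (-2*b')) * (w x * ennreal (norm (y - x) powr (-(2*b')))))"
                using True Cf0 by (simp add: ennreal_mult ennreal_plus w_def c_def)
              finally show ?thesis .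
            next
              case False
              then have "err (x, y) = 0" by (auto simp: err_def fB_def indicator_def)
              then show ?thesis by simp
            qed
          qed
        qed
      qed
    qed
    also have "\<dots> = ennreal c * ((\<integral>\<^sup>+x. \<integral>\<^sup>+y. w x * ennreal (norm (x - Q) powr (-2*b')) * (w y * ennreal (norm (x - y) powr (-(2*b')))) \<partial>lborel \<partial>lborel)
        + (\<integral>\<^sup>+x. \<integral>\<^sup>+y. w y * ennreal (norm (y - Q) powr (-2*b')) * (w x * ennreal (norm (y - x) powr (-(2*b')))) \<partial>lborel \<partial>lborel))"
      by (simp add: nn_integral_cmult nn_integral_add)
    also have "(\<integral>\<^sup>+x. \<integral>\<^sup>+y. w y * ennreal (norm (y - Q) powr (-2*b')) * (w x * ennreal (norm (y - x) powr (-(2*b')))) \<partial>lborel \<partial>lborel)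
      = (\<integral>\<^sup>+y. \<integral>\<^sup>+x. w y * ennreal (norm (y - Q) powr (-2*b')) * (w x * ennreal (norm (y - x) powr (-(2*b')))) \<partial>lborel \<partial>lborel)"
      by (rule lborel_pair.Fubini') (simp add: case_prod_unfold)
    also have "(\<integral>\<^sup>+x. \<integral>\<^sup>+y. w x * ennreal (norm (x - Q) powr (-2*b')) * (w y * ennreal (norm (x - y) powr (-(2*b')))) \<partial>lborel \<partial>lborel) \<le> ennreal K * ennreal K"
    proof -
      have "(\<integral>\<^sup>+x. \<integral>\<^sup>+y. w x * ennreal (norm (x - Q) powr (-2*b')) * (w y * ennreal (norm (x - y) powr (-(2*b')))) \<partial>lborel \<partial>lborel)
        \<le> (\<integral>\<^sup>+x. w x * ennreal (norm (Q - x) powr (-(2*b'))) * ennreal K \<partial>lborel)"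
      proof (rule nn_integral_mono)
        fix x
        have "(\<integral>\<^sup>+y. w x * ennreal (norm (x - Q) powr (-2*b')) * (w y * ennreal (norm (x - y) powr (-(2*b')))) \<partial>lborel)
         = w x * ennreal (norm (x - Q) powr (-2*b')) * (\<integral>\<^sup>+y. w y * ennreal (norm (x - y) powr (-(2*b'))) \<partial>lborel)"
          by (rule nn_integral_cmult) simp
        also have "\<dots> \<le> w x * ennreal (norm (x - Q) powr (-2*b')) * ennreal K"
          using K(2)[of x] by (intro mult_left_mono) (auto simp: w_def)
        finally show "(\<integral>\<^sup>+y. w x * ennreal (norm (x - Q) powr (-2*b')) * (w y * ennreal (norm (x - y) powr (-(2*b')))) \<partial>lborel)
          \<le> w x * ennreal (norm (Q - x) powr (-(2*b'))) * ennreal K" by (simp add: norm_minus_commute)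
      qed
      also have "\<dots> = (\<integral>\<^sup>+x. w x * ennreal (norm (Q - x) powr (-(2*b'))) \<partial>lborel) * ennreal K"
        by (rule nn_integral_multc) simp
      also have "\<dots> \<le> ennreal K * ennreal K" using K(2)[of Q] by (intro mult_right_mono) (auto simp: w_def)
      finally show ?thesis .
    qed
    finally have "(\<integral>\<^sup>+p. ennreal (err p) \<partial>?P) \<le> ennreal c * (ennreal K * ennreal K + ennreal K * ennreal K)"
      by (simp add: mult_left_mono add_mono order_trans)
    also have "\<dots> < \<infinity>" by (simp add: ennreal_mult_less_top)
    finally show "(\<integral>\<^sup>+p. ennreal (err p) \<partial>?P) < \<infinity>" .
  qed (use err0 in auto)
  define E0 where "E0 = (LINT p|?P. err p)"
  have E0: "0 \<le> E0" unfolding E0_def using err0 by simp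
  have M0: "0 \<le> M" unfolding M_def using fB0 by simp
  show ?thesis
  \<comment> \<open>The self-interaction enters with factor 4, that is twice its symmetrised form,
    and each symmetrised form costs 8/3 * E0; hence 16/3.\<close>
  proof (intro exI[of _ "16/3 * E0"] conjI allI impI)
    fix s :: real assume s: "\<bar>s\<bar> < 1/2"
    define l where "l = 1 + s"
    have l: "1/2 < l" "l < 3/2" using s unfolding l_def by auto
    define \<Phi> where "\<Phi> x = Q + l *\<^sub>R (x - Q)" for x
    have [measurable]: "\<Phi> \<in> borel_measurable borel" unfolding \<Phi>_def by measurable
    have \<Phi>_ball: "\<Phi> x \<in> ball Q (2 * \<delta>)" if "x \<in> ball Q \<delta>" for x
    proof -
      have "norm (\<Phi> x - Q) = l * norm (x - Q)" unfolding \<Phi>_def using l by simp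
      also have "\<dots> \<le> (3/2) * \<delta>" using that l by (intro mult_mono) (auto simp: dist_norm norm_minus_commute)
      finally show ?thesis using d by (simp add: dist_norm norm_minus_commute)
    qed
    have \<Phi>_dist: "norm (\<Phi> x - x) = \<bar>s\<bar> * norm (x - Q)" for x
    proof -
      have "\<Phi> x - x = s *\<^sub>R (x - Q)" unfolding \<Phi>_def l_def by (simp add: algebra_simps)
      then show ?thesis by simp
    qed
    define e where "e x y = ln (ratio (\<Phi> x) y) - ln (ratio x y)" for x y
    define I where "I = (\<lambda>(x, y). fB x * fB y * e x y)"
    have [measurable]: "I \<in> borel_measurable ?P" unfolding I_def e_def ratio_def by measurable
    have log_int: "integrable lborel (\<lambda>y. fB y * e x y)" for x
      using riesz_log[OF rB a C, of "\<Phi> x"] riesz_log[OF rB a C, of x]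
      by (simp add: e_def right_diff_distrib)
    have pot_e: "pot fB (\<Phi> x) - pot fB x = (LINT y|lborel. fB y * e x y)" for x
      unfolding e_def by (rule pot_diff_eq[OF rB a C])
    \<comment> \<open>Absolute integrability on the product is what permits exchanging the roles of
      x and y below; it follows from the Riesz bounds at \<open>x\<close> and at
      \<open>\<Phi> x\<close>, taken uniformly over the disc.\<close>
    have I_int: "integrable ?P I"
    proof (rule lborel_pair.Fubini_integrable)
      define R where "R = norm Q + 2 * \<delta>"
      have inR: "norm z \<le> R" if "z \<in> ball Q (2 * \<delta>)" for z
        using that norm_triangle_sub[of z Q] by (simp add: R_def dist_norm norm_minus_commute)
      define K where "K = C / a + C / a + 2 * ln (1 + R) * C"
      have Rnn: "0 \<le> R" using d by (simp add: R_def)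
      have K0: "0 \<le> K" unfolding K_def using a C Rnn by simp
      have bnd: "(LINT y|lborel. norm (I (x, y))) \<le> K * fB x" for x
      proof (cases "x \<in> ball Q \<delta>")
        case False
        then show ?thesis by (simp add: I_def fB_def)
      next
        case True
        have n: "norm x \<le> R" "norm (\<Phi> x) \<le> R" using inR[OF \<Phi>_ball[OF True]] inR[of x] True d by auto
        have "(LINT y|lborel. norm (I (x, y))) = (LINT y|lborel. fB x * \<bar>fB y * e x y\<bar>)"
          using fB0 by (intro Bochner_Integration.integral_cong) (auto simp: I_def abs_mult)
        also have "\<dots> \<le> (LINT y|lborel. fB x * (ratio (\<Phi> x) y powr a * fB y / a + ratio x y powr a * fB y / a + 2 * ln (1 + R) * fB y))"
        proof (rule integral_mono_AE)
          show "integrable lborel (\<lambda>y. fB x * \<bar>fB y * e x y\<bar>)" using log_int by (intro integrable_mult_right) auto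
          show "integrable lborel (\<lambda>y. fB x * (ratio (\<Phi> x) y powr a * fB y / a + ratio x y powr a * fB y / a + 2 * ln (1 + R) * fB y))"
            using riesz_ratio[OF rB a C] fBint by (intro integrable_mult_right Bochner_Integration.integrable_add) auto
          show "AE y in lborel. fB x * \<bar>fB y * e x y\<bar> \<le> fB x * (ratio (\<Phi> x) y powr a * fB y / a + ratio x y powr a * fB y / a + 2 * ln (1 + R) * fB y)"
            using AE_lborel_neq[of x] AE_lborel_neq[of "\<Phi> x"]
          proof eventually_elim
            case (elim y)
            have "\<bar>e x y\<bar> \<le> \<bar>ln (ratio (\<Phi> x) y)\<bar> + \<bar>ln (ratio x y)\<bar>" unfolding e_def by linarith
            also have "\<dots> \<le> (ratio (\<Phi> x) y powr a / a + ln (1 + norm (\<Phi> x))) + (ratio x y powr a / a + ln (1 + norm x))"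
              using elim a by (intro add_mono abs_ln_ratio_le) auto
            also have "\<dots> \<le> (ratio (\<Phi> x) y powr a / a + ln (1 + R)) + (ratio x y powr a / a + ln (1 + R))"
              using n by (intro add_mono order_refl) (auto simp: add_pos_nonneg Rnn intro!: ln_mono)
            finally have "fB y * \<bar>e x y\<bar> \<le> fB y * ((ratio (\<Phi> x) y powr a / a + ln (1 + R)) + (ratio x y powr a / a + ln (1 + R)))"
              by (intro mult_left_mono fB0)
            also have "\<dots> = ratio (\<Phi> x) y powr a * fB y / a + ratio x y powr a * fB y / a + 2 * ln (1 + R) * fB y"
              by (simp add: algebra_simps)
            finally show ?case using fB0 by (intro mult_left_mono) (simp_all add: abs_mult)
          qed
        qed
        also have "\<dots> = fB x * ((LINT y|lborel. ratio (\<Phi> x) y powr a * fB y) / a + (LINT y|lborel. ratio x y powr a * fB y) / a + 2 * ln (1 + R) * (LINT y|lborel. fB y))"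
          using riesz_ratio[OF rB a C] fBint by simp
        also have "\<dots> \<le> fB x * K" unfolding K_def
          using fB0 a Rnn
          by (intro mult_left_mono add_mono divide_right_mono riesz_ratio_le[OF rB a C] riesz_integral_le[OF rB a C]) auto
        finally show ?thesis by (simp add: mult.commute)
      qed
      show "integrable lborel (\<lambda>x. LINT y|lborel. norm (I (x, y)))"
      proof (rule Bochner_Integration.integrable_bound[of _ "\<lambda>x. K * fB x"])
        show "AE x in lborel. norm (LINT y|lborel. norm (I (x, y))) \<le> norm (K * fB x)"
          using bnd fB0 K0 by (intro AE_I2) (simp add: abs_mult)
      qed (use fBint in auto)
      show "AE x in lborel. integrable lborel (\<lambda>y. I (x, y))"
        using log_int by (intro AE_I2) (simp add: I_def mult.assoc)
    qed measurable
    have I_fst: "(LINT y|lborel. I (x, y)) = fB x * (pot fB (\<Phi> x) - pot fB x)" for x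
      unfolding pot_e by (simp add: I_def mult.assoc)
    \<comment> \<open>Mass outside the disc acts on it through a Lipschitz potential, with constant
      the integral of f / |x - y|, so moving by |s| * \<delta> costs only a multiple of |s| *
      \<delta> * C1.\<close>
    have tail: "pot fc (\<Phi> x) - pot fc x \<ge> - (\<bar>s\<bar> * \<delta> * C1)" if x: "x \<in> ball Q \<delta>" for x
    proof -
      have J: "integrable lborel (\<lambda>y. fc y / norm (x - y))" "(LINT y|lborel. fc y / norm (x - y)) \<le> C1"
        using nn_le_integral[of "\<lambda>y. fc y / norm (x - y)" lborel C1] outer[OF x] C1 fc0 unfolding fc_def by auto
      have "pot fc x - pot fc (\<Phi> x) = (LINT y|lborel. fc y * (ln (ratio x y) - ln (ratio (\<Phi> x) y)))"
        by (rule pot_diff_eq[OF rc a C])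
      also have "\<dots> \<le> (LINT y|lborel. norm (x - \<Phi> x) * (fc y / norm (x - y)))"
      proof (rule integral_mono_AE)
        show "integrable lborel (\<lambda>y. fc y * (ln (ratio x y) - ln (ratio (\<Phi> x) y)))"
          using riesz_log[OF rc a C, of "\<Phi> x"] riesz_log[OF rc a C, of x] by (simp add: right_diff_distrib)
        show "integrable lborel (\<lambda>y. norm (x - \<Phi> x) * (fc y / norm (x - y)))" using J by (intro integrable_mult_right)
        show "AE y in lborel. fc y * (ln (ratio x y) - ln (ratio (\<Phi> x) y)) \<le> norm (x - \<Phi> x) * (fc y / norm (x - y))"
          using AE_lborel_neq[of x] AE_lborel_neq[of "\<Phi> x"]
        proof eventually_elim
          case (elim y)
          have "ln (ratio x y) - ln (ratio (\<Phi> x) y) \<le> norm (x - \<Phi> x) powr 1 * (1 / norm (x - y)) powr 1 / 1"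
            using elim by (intro ln_ratio_diff_le) auto
          then have "fc y * (ln (ratio x y) - ln (ratio (\<Phi> x) y)) \<le> fc y * (norm (x - \<Phi> x) powr 1 * (1 / norm (x - y)) powr 1 / 1)"
            by (intro mult_left_mono fc0)
          then show ?case by (simp add: mult_ac)
        qed
      qed
      also have "\<dots> = norm (x - \<Phi> x) * (LINT y|lborel. fc y / norm (x - y))"
        by (rule integral_mult_right_zero)
      also have "\<dots> \<le> (\<bar>s\<bar> * \<delta>) * C1"
        using \<Phi>_dist[of x] x C1 J(2) d fc0
        by (intro mult_mono) (auto simp: norm_minus_commute dist_norm intro!: mult_left_mono)
      finally show ?thesis by simp
    qed
    \<comment> \<open>Collects every contribution to z except the self-interaction of the mass in
      the disc.\<close>
    define c where "c = (2 - 2*b) * ln l - \<bar>s\<bar> * \<delta> * (L + 4 * C1)"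
    define h where "h x = indicator (ball Q \<delta>) x * (l\<^sup>2 * f (\<Phi> x))" for x
    have pw: "c * fB x + 4 * (LINT y|lborel. I (x, y)) \<le> h x - fB x" if "x \<noteq> Q" for x
    proof (cases "x \<in> ball Q \<delta>")
      case False
      then show ?thesis by (simp add: I_fst fB_def h_def)
    next
      case True
      then have x2: "x \<in> ball Q (2 * \<delta>)" using d by auto
      have \<Phi>Q: "\<Phi> x \<noteq> Q" using that l by (simp add: \<Phi>_def)
      define z where "z = 2 * ln l - 2 * b * ln l + (G (\<Phi> x) - G x) + 4 * (pot f (\<Phi> x) - pot f x)"
      have "norm (\<Phi> x - Q) powr (-2*b) = l powr (-2*b) * norm (x - Q) powr (-2*b)"
        using l by (simp add: \<Phi>_def powr_mult)
      then have "l\<^sup>2 * f (\<Phi> x) = (l powr 2 * l powr (-2*b)) * norm (x - Q) powr (-2*b) * exp (G (\<Phi> x) + 4 * pot f (\<Phi> x))"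
        using l unfolding eq[OF \<Phi>_ball[OF True] \<Phi>Q] by (simp add: powr_numeral)
      also have "l powr 2 * l powr (-2*b) = exp (2 * ln l - 2 * b * ln l)"
        using l by (simp add: powr_def exp_add[symmetric])
      also have "exp (2 * ln l - 2 * b * ln l) * norm (x - Q) powr (-2*b) * exp (G (\<Phi> x) + 4 * pot f (\<Phi> x))
        = f x * exp z"
        unfolding eq[OF x2 that] z_def by (simp add: exp_add[symmetric] algebra_simps)
      finally have fz: "l\<^sup>2 * f (\<Phi> x) = f x * exp z" .
      have "G (\<Phi> x) - G x \<ge> - (L * norm (\<Phi> x - x))" using lip[OF \<Phi>_ball[OF True] x2] by linarith
      moreover have "L * norm (\<Phi> x - x) \<le> L * (\<bar>s\<bar> * \<delta>)"
        unfolding \<Phi>_dist using True L by (intro mult_left_mono) (auto simp: dist_norm norm_minus_commute)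
      ultimately have "G (\<Phi> x) - G x \<ge> - (\<bar>s\<bar> * \<delta> * L)" by (simp add: mult_ac)
      then have "c + 4 * (pot fB (\<Phi> x) - pot fB x) \<le> z"
        using tail[OF True] unfolding z_def c_def pot_eq by (simp add: algebra_simps)
      then have "fB x * (c + 4 * (pot fB (\<Phi> x) - pot fB x)) \<le> f x * z"
        using True f0[of x] by (simp add: fB_def mult_left_mono)
      \<comment> \<open>The convexity step: it keeps the inequality valid for positive and negative
        s at once.\<close>
      also have "\<dots> \<le> f x * (exp z - 1)"
        using exp_ge_add_one_self[of z] by (intro mult_left_mono f0) linarith
      also have "\<dots> = h x - fB x" using True fz by (simp add: h_def fB_def algebra_simps)
      finally show ?thesis by (simp add: I_fst algebra_simps)
    qed
    have h_eq: "integrable lborel h" "(LINT x|lborel. h x) = (LINT x|lborel. indicator (ball Q (l * \<delta>)) x * f x)"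
    proof -
      have h0: "0 \<le> h x" for x by (simp add: h_def f0)
      have [measurable]: "h \<in> borel_measurable borel" unfolding h_def by measurable
      have nn: "(\<integral>\<^sup>+x. ennreal (h x) \<partial>lborel) = (\<integral>\<^sup>+x. ennreal (indicator (ball Q (l * \<delta>)) x * f x) \<partial>lborel)"
        unfolding h_def \<Phi>_def using l by (intro nn_integral_ball_dilation) (auto simp: f0)
      have int2: "integrable lborel (\<lambda>x. indicator (ball Q (l * \<delta>)) x * f x)"
        by (rule Bochner_Integration.integrable_bound[OF fint]) (auto simp: indicator_def f0)
      have "(\<integral>\<^sup>+x. ennreal (h x) \<partial>lborel) = ennreal (LINT x|lborel. indicator (ball Q (l * \<delta>)) x * f x)"
        unfolding nn using int2 f0 by (intro nn_integral_eq_integral) auto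
      then have "has_bochner_integral lborel h (LINT x|lborel. indicator (ball Q (l * \<delta>)) x * f x)"
        using h0 f0 by (intro has_bochner_integral_nn_integral) auto
      then show "integrable lborel h" "(LINT x|lborel. h x) = (LINT x|lborel. indicator (ball Q (l * \<delta>)) x * f x)"
        by (simp_all add: has_bochner_integral_iff)
    qed
    have I_fst_int: "integrable lborel (\<lambda>x. LINT y|lborel. I (x, y))"
      by (rule lborel_pair.integrable_fst'[OF I_int])
    have I_eq: "(LINT x|lborel. LINT y|lborel. I (x, y)) = (LINT p|?P. I p)"
      by (rule lborel_pair.integral_fst'[OF I_int])
    have "c * M + 4 * (LINT p|?P. I p) = (LINT x|lborel. c * fB x + 4 * (LINT y|lborel. I (x, y)))"
      using fBint I_fst_int I_eq by (simp add: M_def)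
    also have "\<dots> \<le> (LINT x|lborel. h x - fB x)"
    proof (rule integral_mono_AE)
      show "AE x in lborel. c * fB x + 4 * (LINT y|lborel. I (x, y)) \<le> h x - fB x"
        using AE_lborel_neq[of Q] by eventually_elim (rule pw)
    qed (use fBint I_fst_int h_eq in auto)
    also have "\<dots> = (LINT x|lborel. indicator (ball Q (l * \<delta>)) x * f x) - M"
      using h_eq fBint by (simp add: M_def)
    finally have main: "c * M + 4 * (LINT p|?P. I p) \<le> (LINT x|lborel. indicator (ball Q (l * \<delta>)) x * f x) - M" .
    define N where "N = (\<lambda>(x, y). fB x * fB y)"
    have [measurable]: "N \<in> borel_measurable ?P" unfolding N_def by measurable
    have N_int: "integrable ?P N"
    proof (rule lborel_pair.Fubini_integrable)
      show "integrable lborel (\<lambda>x. LINT y|lborel. norm (N (x, y)))"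
        using fBint fB0 by (simp add: N_def abs_mult)
      show "AE x in lborel. integrable lborel (\<lambda>y. N (x, y))" using fBint by (simp add: N_def)
    qed measurable
    have N_eq: "(LINT p|?P. N p) = M\<^sup>2"
      by (subst lborel_pair.integral_fst'[OF N_int, symmetric]) (simp add: N_def M_def power2_eq_square)
    \<comment> \<open>The integrand with x and y exchanged. It has the same integral, and only the
      sum \<open>I + I'\<close> has a kernel controlled by
      \<open>dilation_symmetrised\<close>.\<close>
    define I' where "I' = (\<lambda>(x, y). I (y, x))"
    have I'_int: "integrable ?P I'" unfolding I'_def by (rule lborel_pair.integrable_product_swap[OF I_int])
    have I'_eq: "(LINT p|?P. I' p) = (LINT p|?P. I p)" unfolding I'_def by (rule lborel_pair.integral_product_swap) measurable
    \<comment> \<open>8/3 = 2 / (3/4): division by 3/4 comes from ln (1 + t) \<le> t^(3/4) / (3/4),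
      and the factor 2 bounds 2^(3/4), which appears because l > 1/2.\<close>
    define k where "k = 8/3 * \<bar>s\<bar> powr (3/2)"
    have "- ln l * M\<^sup>2 - k * E0 = (LINT p|?P. - ln l * N p - k * err p)"
      using N_int err_int N_eq by (simp add: E0_def)
    also have "\<dots> \<le> (LINT p|?P. I p + I' p)"
    proof (rule integral_mono_AE)
      show "integrable ?P (\<lambda>p. - ln l * N p - k * err p)" using N_int err_int by simp
      show "integrable ?P (\<lambda>p. I p + I' p)" using I_int I'_int by simp
      \<comment> \<open>Coinciding points must be excluded, since division by zero and
        \<open>ln 0\<close> would give meaningless kernel values there. The set of excluded pairs is
        null.\<close>
      have ae: "AE p in ?P. fst p \<noteq> snd p \<and> fst p \<noteq> Q \<and> snd p \<noteq> Q \<and> \<Phi> (fst p) \<noteq> snd p \<and> \<Phi> (snd p) \<noteq> fst p"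
      proof (rule lborel_pair.AE_pair_measure)
        have "continuous_on UNIV (\<lambda>p::plane \<times> plane. \<Phi> (fst p))" "continuous_on UNIV (\<lambda>p::plane \<times> plane. \<Phi> (snd p))"
          unfolding \<Phi>_def by (intro continuous_intros)+
        then have "open {p::plane \<times> plane. fst p \<noteq> snd p \<and> fst p \<noteq> Q \<and> snd p \<noteq> Q \<and> \<Phi> (fst p) \<noteq> snd p \<and> \<Phi> (snd p) \<noteq> fst p}"
          by (intro open_Collect_conj open_Collect_neq continuous_intros)
        then show "{p \<in> space ?P. fst p \<noteq> snd p \<and> fst p \<noteq> Q \<and> snd p \<noteq> Q \<and> \<Phi> (fst p) \<noteq> snd p \<and> \<Phi> (snd p) \<noteq> fst p} \<in> sets ?P"
          by (subst lborel_prod) (simp add: space_pair_measure)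
        have inv: "y = Q + (1 / l) *\<^sub>R (x - Q)" if "\<Phi> y = x" for x y
        proof -
          have "x - Q = l *\<^sub>R (y - Q)" using that by (auto simp: \<Phi>_def)
          then show ?thesis using l by simp
        qed
        show "AE x in lborel. AE y in lborel. fst (x, y) \<noteq> snd (x, y) \<and> fst (x, y) \<noteq> Q \<and> snd (x, y) \<noteq> Q \<and> \<Phi> (fst (x, y)) \<noteq> snd (x, y) \<and> \<Phi> (snd (x, y)) \<noteq> fst (x, y)"
          using AE_lborel_neq[of Q]
        proof eventually_elim
          case (elim x)
          show ?case using AE_lborel_neq[of Q] AE_lborel_neq[of x] AE_lborel_neq[of "\<Phi> x"] AE_lborel_neq[of "Q + (1 / l) *\<^sub>R (x - Q)"]
            by eventually_elim (use elim inv in auto)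
        qed
      qed
      show "AE p in ?P. - ln l * N p - k * err p \<le> I p + I' p"
        using ae
      proof eventually_elim
        case (elim p)
        obtain x y where p: "p = (x, y)" by (cases p)
        have ne: "x \<noteq> y" "x \<noteq> Q" "y \<noteq> Q" "\<Phi> x \<noteq> y" "\<Phi> y \<noteq> x" using elim p by auto
        have rho: "\<rho> x y > 0" using ne by (simp add: \<rho>_def)
        have pos: "norm (x - y) > 0" "norm (\<Phi> x - y) > 0" "norm (\<Phi> y - x) > 0" using ne by auto
        have prod: "norm (\<Phi> x - y) * norm (\<Phi> y - x) \<le> (norm (x - y))\<^sup>2 * (l * (1 + s\<^sup>2 * \<rho> x y / l))"
        proof -
          have "norm (l *\<^sub>R (x - Q) - (y - Q)) * norm (l *\<^sub>R (y - Q) - (x - Q)) \<le>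
            l * (norm ((x - Q) - (y - Q)))\<^sup>2 + (l - 1)\<^sup>2 * (norm (x - Q) * norm (y - Q))"
            using l by (intro dilation_symmetrised) auto
          moreover have "l *\<^sub>R (x - Q) - (y - Q) = \<Phi> x - y" "l *\<^sub>R (y - Q) - (x - Q) = \<Phi> y - x" "(x - Q) - (y - Q) = x - y" "l - 1 = s"
            by (simp_all add: \<Phi>_def algebra_simps l_def)
          ultimately have "norm (\<Phi> x - y) * norm (\<Phi> y - x) \<le> l * (norm (x - y))\<^sup>2 + s\<^sup>2 * (norm (x - Q) * norm (y - Q))"
            by (simp only:)
          also have "l * (norm (x - y))\<^sup>2 + s\<^sup>2 * (norm (x - Q) * norm (y - Q)) = (norm (x - y))\<^sup>2 * (l * (1 + s\<^sup>2 * \<rho> x y / l))"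
          proof -
            have "(norm (x - y))\<^sup>2 * (l * (1 + s\<^sup>2 * \<rho> x y / l)) = (norm (x - y))\<^sup>2 * (l + s\<^sup>2 * \<rho> x y)"
              using l by (simp add: field_simps)
            also have "\<dots> = l * (norm (x - y))\<^sup>2 + s\<^sup>2 * ((norm (x - y))\<^sup>2 * \<rho> x y)" by (simp add: algebra_simps)
            also have "(norm (x - y))\<^sup>2 * \<rho> x y = norm (x - Q) * norm (y - Q)" using pos by (simp add: \<rho>_def)
            finally show ?thesis by simp
          qed
          finally show ?thesis .
        qed
        have ly: "e x y + e y x = ln ((norm (x - y))\<^sup>2) - ln (norm (\<Phi> x - y) * norm (\<Phi> y - x))"
          using pos unfolding e_def ratio_def
          by (simp add: ln_div ln_mult power2_eq_square norm_minus_commute)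
        have "ln (norm (\<Phi> x - y) * norm (\<Phi> y - x)) \<le> ln ((norm (x - y))\<^sup>2 * (l * (1 + s\<^sup>2 * \<rho> x y / l)))"
          using prod pos by (intro ln_mono) (auto intro: mult_pos_pos)
        also have "\<dots> = ln ((norm (x - y))\<^sup>2) + (ln l + ln (1 + s\<^sup>2 * \<rho> x y / l))"
        proof -
          have "1 + s\<^sup>2 * \<rho> x y / l > 0" using rho l by (intro add_pos_nonneg) auto
          then show ?thesis using pos l by (simp add: ln_mult)
        qed
        finally have e1: "e x y + e y x \<ge> - ln l - ln (1 + s\<^sup>2 * \<rho> x y / l)" using ly by linarith
        have "ln (1 + s\<^sup>2 * \<rho> x y / l) \<le> (s\<^sup>2 * \<rho> x y / l) powr (3/4) / (3/4)"
          using rho l by (intro ln_one_plus_le_powr) auto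
        also have "(s\<^sup>2 * \<rho> x y / l) powr (3/4) \<le> (2 * (s\<^sup>2 * \<rho> x y)) powr (3/4)"
          using rho l divide_left_mono[of "1/2" l "s\<^sup>2 * \<rho> x y"] by (intro powr_mono2) auto
        also have "\<dots> = 2 powr (3/4) * (\<bar>s\<bar> powr (3/2) * \<rho> x y powr (3/4))"
        proof -
          have "s\<^sup>2 powr (3/4) = \<bar>s\<bar> powr (3/2)"
          proof (cases "s = 0")
            case False
            then have "\<bar>s\<bar> powr 2 = s\<^sup>2" by (simp add: powr_numeral)
            then show ?thesis using powr_powr[of "\<bar>s\<bar>" 2 "3/4"] by simp
          qed simp
          then show ?thesis using rho by (simp add: powr_mult)
        qed
        also have "\<dots> \<le> 2 * (\<bar>s\<bar> powr (3/2) * \<rho> x y powr (3/4))"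
          using powr_mono[of "3/4" 1 "2::real"] by (intro mult_right_mono) auto
        finally have "ln (1 + s\<^sup>2 * \<rho> x y / l) \<le> k * \<rho> x y powr (3/4)" by (simp add: k_def)
        then have "- ln l - k * \<rho> x y powr (3/4) \<le> e x y + e y x" using e1 by linarith
        then have "(fB x * fB y) * (- ln l - k * \<rho> x y powr (3/4)) \<le> (fB x * fB y) * (e x y + e y x)"
          using fB0 by (intro mult_left_mono) auto
        then show ?case unfolding p by (simp add: N_def err_def I_def I'_def algebra_simps)
      qed
    qed
    also have "\<dots> = 2 * (LINT p|?P. I p)" using I_int I'_int I'_eq by simp
    finally have sym: "2 * (LINT p|?P. I p) \<ge> - ln l * M\<^sup>2 - k * E0" .
    have "M * (2 - 2*b) * ln l - \<bar>s\<bar> * \<delta> * (L + 4 * C1) * M - 2 * M\<^sup>2 * ln l - 2 * (k * E0) \<le> c * M + 4 * (LINT p|?P. I p)"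
      using sym by (simp add: c_def algebra_simps)
    also note main
    finally show "M * (2 - 2*b) * ln (1 + s) - \<bar>s\<bar> * \<delta> * (L + 4 * C1) * M - 2 * M\<^sup>2 * ln (1 + s) - 16/3 * E0 * \<bar>s\<bar> powr (3/2)
      \<le> (LINT x|lborel. indicator (ball Q ((1 + s) * \<delta>)) x * f x) - M"
      by (simp add: k_def l_def mult_ac)
  qed (use E0 in simp)
qed

lemma ln_one_plus_over_tendsto:
  "((\<lambda>s. ln (1 + s) / s) \<longlongrightarrow> (1::real)) (at_right 0)"
  "((\<lambda>s. ln (1 - s) / s) \<longlongrightarrow> (-1::real)) (at_right 0)"
  by real_asymp+

text \<open>\<open>dilation_inequality\<close> is divided by s and s tends to 0 from both sides. For
  s > 0 the mass gained is at most \<open>S\<close> times the area of an annulus, whose derivative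
  at 0 is 2 pi \<delta>^2. For s < 0 the disc shrinks and the change is nonpositive, so the reverse
  inequality carries no such term. The error |s|^(3/2) disappears in both limits.\<close>

lemma pohozaev:
  fixes f :: "plane \<Rightarrow> real" and Q :: plane and G :: "plane \<Rightarrow> real"
  assumes r: "riesz a C f" and a: "0 < a" "a \<le> 1" and C: "0 \<le> C" and b: "0 < b" "b < 1" and d: "0 < \<delta>"
    and eq: "\<And>x. x \<in> ball Q (2 * \<delta>) \<Longrightarrow> x \<noteq> Q \<Longrightarrow> f x = norm (x - Q) powr (-2*b) * exp (G x + 4 * pot f x)"
    and lip: "\<And>x y. x \<in> ball Q (2 * \<delta>) \<Longrightarrow> y \<in> ball Q (2 * \<delta>) \<Longrightarrow> \<bar>G x - G y\<bar> \<le> L * norm (x - y)"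
    and C1: "0 \<le> C1"
    and outer: "\<And>x. x \<in> ball Q \<delta> \<Longrightarrow> (\<integral>\<^sup>+y. ennreal (indicator (- ball Q \<delta>) y * f y / norm (x - y)) \<partial>lborel) \<le> ennreal C1"
    and S: "0 \<le> S" "\<And>x. \<delta> \<le> norm (x - Q) \<Longrightarrow> norm (x - Q) < 2 * \<delta> \<Longrightarrow> f x \<le> S"
  defines "M \<equiv> (LINT x|lborel. indicator (ball Q \<delta>) x * f x)"
  shows "M * (1 - b) - M\<^sup>2 \<le> \<delta> * (L + 4 * C1) * M / 2 + pi * \<delta>\<^sup>2 * S"
    and "M\<^sup>2 - M * (1 - b) \<le> \<delta> * (L + 4 * C1) * M / 2"
proof -
  define D where "D s = (LINT x|lborel. indicator (ball Q ((1 + s) * \<delta>)) x * f x) - M" for s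
  define K where "K = \<delta> * (L + 4 * C1) * M"
  define M' where "M' = M * (2 - 2*b) - 2 * M\<^sup>2"
  define X where "X = M * (1 - b) - M\<^sup>2"
  define Y where "Y = pi * \<delta>\<^sup>2 * S"
  note [measurable] = riesz_measurable[OF r a C]
  have f0: "0 \<le> f x" for x by (rule riesz_nonneg[OF r a C])
  have fint: "integrable lborel f" by (rule riesz_integrable[OF r a C])
  have ballint: "integrable lborel (\<lambda>x. indicator (ball Q \<rho>) x * f x)" for \<rho>
    by (rule Bochner_Integration.integrable_bound[OF fint]) (auto simp: indicator_def f0)
  obtain E where E: "E \<ge> 0" "\<And>s. \<bar>s\<bar> < 1/2 \<Longrightarrow> M' * ln (1 + s) - \<bar>s\<bar> * K - E * \<bar>s\<bar> powr (3/2) \<le> D s"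
    using dilation_inequality[OF r a C b d eq lip C1 outer] unfolding M_def[symmetric] M'_def K_def D_def
    by (auto simp: algebra_simps)
  have sq: "((\<lambda>s. s powr (1/2)) \<longlongrightarrow> (0::real)) (at_right 0)" by real_asymp
  have psplit: "s powr (3/2) = s * s powr (1/2)" if "s > 0" for s :: real
    using that powr_add[of s 1 "1/2"] by simp
  have D_neg: "D (-s) \<le> 0" if "0 < s" "s < 1/2" for s
  proof -
    have "(1 - s) * \<delta> \<le> 1 * \<delta>" using that d by (intro mult_right_mono) auto
    then have "(LINT x|lborel. indicator (ball Q ((1 - s) * \<delta>)) x * f x) \<le> M"
      unfolding M_def using ballint f0 by (intro integral_mono) (auto simp: indicator_def)
    then show ?thesis by (simp add: D_def)
  qed
  have D_pos: "D s \<le> S * (pi * \<delta>\<^sup>2 * ((1 + s)\<^sup>2 - 1))" if s: "0 < s" "s < 1/2" for s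
  proof -
    define A where "A = ball Q ((1 + s) * \<delta>) - ball Q \<delta>"
    have sub: "ball Q \<delta> \<subseteq> ball Q ((1 + s) * \<delta>)" using s d by (intro subset_ball) auto
    have Ab: "A \<in> sets borel" unfolding A_def by auto
    have meas: "measure lborel A = pi * \<delta>\<^sup>2 * ((1 + s)\<^sup>2 - 1)"
    proof -
      have "measure lborel A = measure lborel (ball Q ((1 + s) * \<delta>)) - measure lborel (ball Q \<delta>)"
        unfolding A_def using sub d s by (intro measure_Diff) (auto simp: emeasure_ball_plane)
      also have "\<dots> = pi * ((1 + s) * \<delta>)\<^sup>2 - pi * \<delta>\<^sup>2"
        using d s by (simp add: measure_def emeasure_ball_plane)
      finally show ?thesis by (simp add: algebra_simps power2_eq_square)
    qed
    have fin: "emeasure lborel A < \<infinity>"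
      using emeasure_mono[of A "ball Q ((1 + s) * \<delta>)" lborel] s d unfolding A_def
      by (auto simp: emeasure_ball_plane intro: le_less_trans)
    have "D s = (LINT x|lborel. indicator (ball Q ((1 + s) * \<delta>)) x * f x - indicator (ball Q \<delta>) x * f x)"
      unfolding D_def M_def using ballint by simp
    also have "\<dots> = (LINT x|lborel. indicator A x * f x)"
      by (intro Bochner_Integration.integral_cong) (use sub in \<open>auto simp: A_def indicator_def\<close>)
    also have "\<dots> \<le> (LINT x|lborel. S * indicator A x)"
    proof (rule integral_mono)
      show "integrable lborel (\<lambda>x. indicator A x * f x)"
        using Ab by (intro Bochner_Integration.integrable_bound[OF fint]) (auto simp: indicator_def f0)
      show "integrable lborel (\<lambda>x. S * indicator A x)" using Ab fin by (intro integrable_mult_right) auto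
      show "indicator A x * f x \<le> S * indicator A x" for x
      proof (cases "x \<in> A")
        case True
        have "(1 + s) * \<delta> \<le> 2 * \<delta>" using s d by (intro mult_right_mono) auto
        then show ?thesis using True S(2)[of x] by (simp add: A_def dist_norm norm_minus_commute)
      qed simp
    qed
    also have "\<dots> = S * measure lborel A" using Ab by simp
    finally show ?thesis by (simp add: meas)
  qed
  have "((\<lambda>s. M' * (ln (1 + s) / s) - K - E * s powr (1/2)) \<longlongrightarrow> M' * 1 - K - E * 0) (at_right 0)"
    by (intro tendsto_intros ln_one_plus_over_tendsto sq)
  moreover have "((\<lambda>s. S * (pi * \<delta>\<^sup>2 * (2 + s))) \<longlongrightarrow> S * (pi * \<delta>\<^sup>2 * (2 + 0))) (at_right 0)"
    by (intro tendsto_intros)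
  moreover have "\<forall>\<^sub>F s in at_right 0. M' * (ln (1 + s) / s) - K - E * s powr (1/2) \<le> S * (pi * \<delta>\<^sup>2 * (2 + s))"
    unfolding eventually_at_right_field
  proof (intro exI[of _ "1/2"] conjI allI impI)
    fix s :: real assume s: "0 < s" "s < 1/2"
    have "M' * ln (1 + s) - s * K - E * (s * s powr (1/2)) \<le> S * (pi * \<delta>\<^sup>2 * ((1 + s)\<^sup>2 - 1))"
      using E(2)[of s] D_pos[of s] s psplit[of s] by simp
    also have "(1 + s)\<^sup>2 - 1 = s * (2 + s)" by (simp add: power2_eq_square algebra_simps)
    finally have "(M' * ln (1 + s) - s * K - E * (s * s powr (1/2))) / s \<le> S * (pi * \<delta>\<^sup>2 * (s * (2 + s))) / s"
      using s by (intro divide_right_mono) auto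
    then show "M' * (ln (1 + s) / s) - K - E * s powr (1/2) \<le> S * (pi * \<delta>\<^sup>2 * (2 + s))"
      using s by (simp add: diff_divide_distrib)
  qed simp
  ultimately have "M' * 1 - K - E * 0 \<le> S * (pi * \<delta>\<^sup>2 * (2 + 0))"
    by (intro tendsto_le[OF trivial_limit_at_right_real]) auto
  then have lim1: "M' - K \<le> 2 * Y" by (simp add: Y_def mult_ac)
  have M'_eq: "M' = 2 * X" by (simp add: M'_def X_def algebra_simps)
  show "M * (1 - b) - M\<^sup>2 \<le> \<delta> * (L + 4 * C1) * M / 2 + pi * \<delta>\<^sup>2 * S"
    using lim1 unfolding K_def[symmetric] X_def[symmetric] Y_def[symmetric] M'_eq by simp
  have "((\<lambda>s. M' * (ln (1 - s) / s) - K - E * s powr (1/2)) \<longlongrightarrow> M' * (-1) - K - E * 0) (at_right 0)"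
    by (intro tendsto_intros ln_one_plus_over_tendsto sq)
  moreover have "\<forall>\<^sub>F s in at_right 0. M' * (ln (1 - s) / s) - K - E * s powr (1/2) \<le> 0"
    unfolding eventually_at_right_field
  proof (intro exI[of _ "1/2"] conjI allI impI)
    fix s :: real assume s: "0 < s" "s < 1/2"
    have "M' * ln (1 - s) - s * K - E * (s * s powr (1/2)) \<le> 0"
      using E(2)[of "-s"] D_neg[of s] s psplit[of s] by simp
    then have "(M' * ln (1 - s) - s * K - E * (s * s powr (1/2))) / s \<le> 0"
      using s by (simp add: divide_nonpos_pos)
    then show "M' * (ln (1 - s) / s) - K - E * s powr (1/2) \<le> 0"
      using s by (simp add: diff_divide_distrib)
  qed simp
  ultimately have "M' * (-1) - K - E * 0 \<le> 0"
    by (intro tendsto_le[OF trivial_limit_at_right_real tendsto_const]) auto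
  then have "- X \<le> K / 2" using M'_eq by simp
  then show "M\<^sup>2 - M * (1 - b) \<le> \<delta> * (L + 4 * C1) * M / 2"
    unfolding K_def[symmetric] X_def by simp
qed

section \<open>Smooth cut-offs of one real variable\<close>

primrec Ck1 :: "nat \<Rightarrow> (real \<Rightarrow> real) \<Rightarrow> bool" where
  "Ck1 0 g \<longleftrightarrow> continuous_on UNIV g"
| "Ck1 (Suc k) g \<longleftrightarrow> (\<exists>g'. (\<forall>x. (g has_real_derivative g' x) (at x)) \<and> Ck1 k g')"

lemma Ck1_SucI: "\<forall>x. (g has_real_derivative g' x) (at x) \<Longrightarrow> Ck1 k g' \<Longrightarrow> Ck1 (Suc k) g"
  by auto

lemma Ck1_Suc_imp: "Ck1 (Suc k) g \<Longrightarrow> Ck1 k g"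
proof (induction k arbitrary: g)
  case 0
  then show ?case by (auto simp: continuous_on_eq_continuous_at intro: DERIV_isCont)
next
  case (Suc k)
  then show ?case by (metis Ck1.simps(2))
qed

lemma Ck1_const: "Ck1 k (\<lambda>_. c)"
proof (induction k arbitrary: c)
  case (Suc k)
  show ?case unfolding Ck1.simps by (intro exI[of _ "\<lambda>_. 0"] conjI Suc) auto
qed simp

lemma Ck1_add: "Ck1 k f \<Longrightarrow> Ck1 k g \<Longrightarrow> Ck1 k (\<lambda>x. f x + g x)"
proof (induction k arbitrary: f g)
  case 0 then show ?case by (auto intro: continuous_intros)
next
  case (Suc k)
  then obtain f' g' where "\<forall>x. (f has_real_derivative f' x) (at x)" "Ck1 k f'"
    "\<forall>x. (g has_real_derivative g' x) (at x)" "Ck1 k g'" by auto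
  then show ?case unfolding Ck1.simps by (intro exI[of _ "\<lambda>x. f' x + g' x"] conjI Suc.IH) (auto intro: DERIV_add)
qed

lemma Ck1_mult: "Ck1 k f \<Longrightarrow> Ck1 k g \<Longrightarrow> Ck1 k (\<lambda>x. f x * g x)"
proof (induction k arbitrary: f g)
  case 0 then show ?case by (auto intro: continuous_intros)
next
  case (Suc k)
  then obtain f' g' where d: "\<forall>x. (f has_real_derivative f' x) (at x)" "Ck1 k f'"
    "\<forall>x. (g has_real_derivative g' x) (at x)" "Ck1 k g'" by auto
  have "Ck1 k f" "Ck1 k g" using Suc.prems Ck1_Suc_imp by blast+
  then have "Ck1 k (\<lambda>x. f' x * g x + f x * g' x)" by (intro Ck1_add Suc.IH d)
  moreover have "\<forall>x. ((\<lambda>x. f x * g x) has_real_derivative f' x * g x + f x * g' x) (at x)"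
    using d by (auto intro!: derivative_eq_intros)
  ultimately show ?case by (rule Ck1_SucI[rotated])
qed

lemma Ck1_affine: "Ck1 k g \<Longrightarrow> Ck1 k (\<lambda>x. g (\<alpha> * x + \<beta>))"
proof (induction k arbitrary: g)
  case 0 then show ?case
    by (auto intro!: continuous_intros continuous_on_compose2[of UNIV g])
next
  case (Suc k)
  then obtain g' where d: "\<forall>x. (g has_real_derivative g' x) (at x)" "Ck1 k g'" by auto
  have "Ck1 k (\<lambda>x. \<alpha> * g' (\<alpha> * x + \<beta>))" by (intro Ck1_mult Ck1_const Suc.IH d)
  moreover have "\<forall>x. ((\<lambda>x. g (\<alpha> * x + \<beta>)) has_real_derivative \<alpha> * g' (\<alpha> * x + \<beta>)) (at x)"
  proof
    fix x
    have "((\<lambda>x. \<alpha> * x + \<beta>) has_real_derivative \<alpha>) (at x)" by (auto intro!: derivative_eq_intros)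
    from DERIV_chain'[OF this d(1)[rule_format]]
    show "((\<lambda>x. g (\<alpha> * x + \<beta>)) has_real_derivative \<alpha> * g' (\<alpha> * x + \<beta>)) (at x)" by (simp add: mult.commute)
  qed
  ultimately show ?case by (rule Ck1_SucI[rotated])
qed

text \<open>The classical flat function exp (-1/t). The powers of 1/t are included because the
  family is then closed under differentiation up to linear combinations, which gives smoothness by
  induction.\<close>

definition flat :: "nat \<Rightarrow> real \<Rightarrow> real" where
  "flat j t = (if t > 0 then exp (- 1 / t) / t ^ j else 0)"

lemma flat_tendsto: "(flat j \<longlongrightarrow> 0) (at 0)"
proof -
  have "((\<lambda>x::real. x ^ j / exp x) \<longlongrightarrow> 0) at_top" by (rule tendsto_power_div_exp_0)
  then have "((\<lambda>t::real. inverse t ^ j / exp (inverse t)) \<longlongrightarrow> 0) (at_right 0)"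
    by (rule filterlim_compose) (rule filterlim_inverse_at_top_right)
  moreover have "\<forall>\<^sub>F t in at_right 0. inverse t ^ j / exp (inverse t) = flat j t"
    unfolding eventually_at_right_field
    by (intro exI[of _ 1]) (auto simp: flat_def exp_minus divide_simps power_divide)
  ultimately have r: "(flat j \<longlongrightarrow> 0) (at_right 0)" by (rule Lim_transform_eventually)
  have "\<forall>\<^sub>F t in at_left 0. 0 = flat j t"
    unfolding eventually_at_left_field by (intro exI[of _ "-1"]) (auto simp: flat_def)
  then have "(flat j \<longlongrightarrow> 0) (at_left 0)" by (rule Lim_transform_eventually[OF tendsto_const])
  with r show ?thesis by (simp add: filterlim_split_at)
qed

lemma flat_deriv: "(flat j has_real_derivative (- real j * flat (Suc j) t + flat (Suc (Suc j)) t)) (at t)"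
proof -
  consider "t > 0" | "t = 0" | "t < 0" by linarith
  then show ?thesis
  proof cases
    case 1
    have "((\<lambda>t. exp (- 1 / t) / t ^ j) has_real_derivative
       ((exp (- 1 / t) * (1 / t\<^sup>2)) * t ^ j - exp (- 1 / t) * (real j * t ^ (j - 1))) / (t ^ j * t ^ j)) (at t)"
      using 1 by (auto intro!: derivative_eq_intros simp: power2_eq_square divide_simps)
    also have "((exp (- 1 / t) * (1 / t\<^sup>2)) * t ^ j - exp (- 1 / t) * (real j * t ^ (j - 1))) / (t ^ j * t ^ j)
      = - real j * flat (Suc j) t + flat (Suc (Suc j)) t"
      using 1 by (cases j) (auto simp: flat_def field_simps power2_eq_square)
    finally show ?thesis
    proof (rule DERIV_cong_ev[THEN iffD1, rotated -1])
      show "\<forall>\<^sub>F x in nhds t. exp (- 1 / x) / x ^ j = flat j x"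
        using eventually_nhds_in_open[of "{0<..}" t] 1 by (auto simp: flat_def elim!: eventually_mono)
    qed auto
  next
    case 2
    have "((\<lambda>h. (flat j (0 + h) - flat j 0) / h) \<longlongrightarrow> 0) (at 0)"
      by (rule Lim_transform_eventually[OF flat_tendsto[of "Suc j"]]) (auto simp: flat_def intro!: always_eventually)
    then show ?thesis using 2 by (simp add: DERIV_def flat_def)
  next
    case 3
    have "((\<lambda>t. 0) has_real_derivative 0) (at t)" by simp
    then have "(flat j has_real_derivative 0) (at t)"
    proof (rule DERIV_cong_ev[THEN iffD1, rotated -1])
      show "\<forall>\<^sub>F x in nhds t. 0 = flat j x"
        using eventually_nhds_in_open[of "{..<0}" t] 3 by (auto simp: flat_def elim!: eventually_mono)
    qed auto
    then show ?thesis using 3 by (simp add: flat_def)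
  qed
qed

lemma Ck1_flat: "Ck1 k (flat j)"
proof (induction k arbitrary: j)
  case 0 show ?case using flat_deriv by (auto simp: continuous_on_eq_continuous_at intro: DERIV_isCont)
next
  case (Suc k)
  have "Ck1 k (\<lambda>t. - real j * flat (Suc j) t + flat (Suc (Suc j)) t)"
    by (intro Ck1_add Ck1_mult Ck1_const Suc)
  then show ?case using flat_deriv by (intro Ck1_SucI allI)
qed

text \<open>Its support starts at 1, away from 0, so that everything built from it by integration is
  constant near 0 and yields smooth radial functions when applied to a squared distance.\<close>

definition bump :: "real \<Rightarrow> real" where
  "bump t = flat 0 (t - 1) * flat 0 (2 - t)"

lemma bump_nonneg: "0 \<le> bump t" by (simp add: bump_def flat_def)
lemma bump_zero: "t \<le> 1 \<or> 2 \<le> t \<Longrightarrow> bump t = 0" by (auto simp: bump_def flat_def)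
lemma bump_pos: "1 < t \<Longrightarrow> t < 2 \<Longrightarrow> 0 < bump t" by (auto simp: bump_def flat_def)
lemma bump_le_one: "bump t \<le> 1"
  by (auto simp: bump_def flat_def mult_le_one)

lemma Ck1_bump: "Ck1 k bump"
proof -
  have "Ck1 k (\<lambda>t. flat 0 (1 * t + (-1)) * flat 0 ((-1) * t + 2))"
    by (intro Ck1_mult Ck1_affine Ck1_flat)
  also have "(\<lambda>t. flat 0 (1 * t + (-1)) * flat 0 ((-1) * t + 2)) = bump"
    by (auto simp: bump_def fun_eq_iff)
  finally show ?thesis .
qed

lemma bump_continuous: "continuous_on A bump"
  using Ck1_bump[of 0] continuous_on_subset by auto

lemma deriv_zero_below_one:
  assumes "\<And>t. t < 1 \<Longrightarrow> g t = 0" "t < (1::real)"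
  shows "(g has_real_derivative 0) (at t)"
proof (rule has_field_derivative_transform_within_open[of "\<lambda>_. 0" _ _ "{..<1}"])
qed (use assms in auto)

definition prim :: "(real \<Rightarrow> real) \<Rightarrow> real \<Rightarrow> real" where
  "prim g t = integral {0..t} g"

lemma prim_zero: "(\<And>t. t < 1 \<Longrightarrow> g t = 0) \<Longrightarrow> t < 1 \<Longrightarrow> prim g t = 0"
  unfolding prim_def by (subst integral_cong[of _ g "\<lambda>_. 0"]) auto

lemma prim_deriv:
  assumes c: "continuous_on UNIV g" and z: "\<And>t. t < 1 \<Longrightarrow> g t = 0"
  shows "(prim g has_real_derivative g t) (at t)"
proof (cases "t < 1")
  case True
  have "prim g s = 0" if "s < 1" for s
    using prim_zero[OF z that] .
  then have "(prim g has_real_derivative 0) (at t)"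
    using True by (intro deriv_zero_below_one)
  then show ?thesis using z True by simp
next
  case False
  have "((\<lambda>u. integral {0..u} g) has_real_derivative g t) (at t within {0..t + 1})"
    using False c by (intro integral_has_real_derivative) (auto intro: continuous_on_subset)
  moreover have "at t within {0..t + 1} = at t" using False by (intro at_within_interior) auto
  ultimately show ?thesis by (simp add: prim_def[abs_def])
qed

lemma Ck1_prim:
  assumes "\<And>k. Ck1 k g" and z: "\<And>t. t < 1 \<Longrightarrow> g t = 0"
  shows "Ck1 k (prim g)"
proof (rule Ck1_Suc_imp)
  have "continuous_on UNIV g" using assms(1)[of 0] by simp
  then show "Ck1 (Suc k) (prim g)"
    by (intro Ck1_SucI[of _ g] allI assms(1) prim_deriv z)
qed

text \<open>Dividing by t is harmless at 0 because g vanishes below 1; with \<open>x / 0 = 0\<close>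
  the quotient is 0 on the whole half-line t < 1.\<close>

lemma div_id_deriv:
  assumes g: "\<And>x. (g has_real_derivative g' x) (at x)" and z: "\<And>t. t < 1 \<Longrightarrow> g t = 0"
  shows "((\<lambda>t. g t / t) has_real_derivative g' t / t - g t / t / t) (at t)"
proof (cases "t < 1")
  case True
  have "((\<lambda>t. g t / t) has_real_derivative 0) (at t)"
    using True z by (intro deriv_zero_below_one) auto
  moreover have "(g has_real_derivative 0) (at t)"
    using True z by (intro deriv_zero_below_one) auto
  then have "g' t = 0" using g DERIV_unique by blast
  ultimately show ?thesis using z True by simp
next
  case False
  then show ?thesis by (auto intro!: derivative_eq_intros g simp: field_simps)
qed

lemma Ck1_div_id:
  assumes "Ck1 k g" and z: "\<And>t. t < 1 \<Longrightarrow> g t = 0"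
  shows "Ck1 k (\<lambda>t. g t / t)"
  using assms
proof (induction k arbitrary: g)
  case 0
  have "isCont (\<lambda>t. g t / t) t" for t
  proof (cases "t < 1")
    case True
    have "\<forall>\<^sub>F s in nhds t. 0 = g s / s"
      using eventually_nhds_in_open[of "{..<1}" t] True 0 by (auto elim!: eventually_mono)
    then show ?thesis using isCont_cong[of "\<lambda>_. 0" "\<lambda>t. g t / t" t] by simp
  next
    case False
    then show ?thesis using 0 by (auto intro!: continuous_intros simp: continuous_on_eq_continuous_at)
  qed
  then show ?case by (simp add: continuous_on_eq_continuous_at)
next
  case (Suc k)
  then obtain g' where g': "\<And>x. (g has_real_derivative g' x) (at x)" "Ck1 k g'" by auto
  have z': "g' t = 0" if "t < 1" for t
    using deriv_zero_below_one[of g, OF Suc.prems(2) that] g'(1) DERIV_unique by blast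
  have "Ck1 k (\<lambda>t. g t / t)" using Suc Ck1_Suc_imp by blast
  then have "Ck1 k (\<lambda>t. g t / t / t)" by (rule Suc.IH[of "\<lambda>t. g t / t"]) (simp add: Suc.prems(2))
  moreover have "Ck1 k (\<lambda>t. g' t / t)" by (rule Suc.IH[OF g'(2) z'])
  ultimately have "Ck1 k (\<lambda>t. g' t / t + (-1) * (g t / t / t))"
    by (intro Ck1_add Ck1_mult Ck1_const)
  then have "Ck1 k (\<lambda>t. g' t / t - g t / t / t)" by simp
  then show ?case by (intro Ck1_SucI[of _ "\<lambda>t. g' t / t - g t / t / t"] allI div_id_deriv[of g g', OF g'(1) Suc.prems(2)])
qed

definition step :: "real \<Rightarrow> real" where "step = prim bump"
definition stepdiv :: "real \<Rightarrow> real" where "stepdiv t = step t / t"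
text \<open>A smooth logarithm: its derivative \<open>step t / t\<close> is 0 below 1 and
  \<open>kap / t\<close> above 2, so it interpolates between 0 and \<open>kap * ln t\<close> plus a
  constant.\<close>

definition logcut :: "real \<Rightarrow> real" where "logcut = prim stepdiv"
definition kap :: real where "kap = step 2"

lemma step_deriv: "(step has_real_derivative bump t) (at t)"
  unfolding step_def using bump_continuous bump_zero by (intro prim_deriv) auto

lemma step_zero: "t < 1 \<Longrightarrow> step t = 0"
  unfolding step_def using bump_zero by (intro prim_zero) auto

lemma step_mono: "s \<le> t \<Longrightarrow> step s \<le> step t"
  using step_deriv bump_nonneg by (intro DERIV_nonneg_imp_nondecreasing[of s t step]) auto

lemma step_const: "2 \<le> t \<Longrightarrow> step t = kap"
proof (cases "t = 2")
  case False
  assume "2 \<le> t"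
  then have t: "2 < t" using False by simp
  then show ?thesis unfolding kap_def
  proof (rule DERIV_isconst_end)
    show "continuous_on {2..t} step"
      by (intro continuous_at_imp_continuous_on ballI DERIV_isCont[OF step_deriv])
    show "(step has_real_derivative 0) (at x)" if "2 < x" "x < t" for x
      using step_deriv[of x] bump_zero[of x] that by simp
  qed
qed (simp add: kap_def)

lemma kap_pos: "0 < kap"
proof -
  have "step 1 < step 2"
    using step_deriv bump_pos by (intro DERIV_pos_imp_increasing_open[of 1 2 step]) (auto intro: DERIV_isCont continuous_at_imp_continuous_on)
  moreover have "0 \<le> step 1" using step_mono[of 0 1] step_zero[of 0] by simp
  ultimately show ?thesis by (simp add: kap_def)
qed

lemma step_bounds: "0 \<le> step t" "step t \<le> kap"
proof -
  show "0 \<le> step t" using step_mono[of 0 t] step_zero[of 0] step_zero[of t] by (cases "t < 1") auto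
  show "step t \<le> kap" using step_mono[of t "max t 2"] step_const[of "max t 2"] by simp
qed

lemma Ck1_step: "Ck1 k step"
  unfolding step_def using Ck1_bump bump_zero by (intro Ck1_prim) auto

lemma Ck1_stepdiv: "Ck1 k stepdiv"
  unfolding stepdiv_def[abs_def] by (intro Ck1_div_id Ck1_step step_zero)

lemma stepdiv_zero: "t < 1 \<Longrightarrow> stepdiv t = 0" by (simp add: stepdiv_def step_zero)

lemma Ck1_logcut: "Ck1 k logcut"
  unfolding logcut_def using Ck1_stepdiv stepdiv_zero by (intro Ck1_prim) auto

lemma logcut_deriv: "(logcut has_real_derivative stepdiv t) (at t)"
  unfolding logcut_def using Ck1_stepdiv[of 0] stepdiv_zero by (intro prim_deriv) auto

lemma stepdiv_deriv: "(stepdiv has_real_derivative bump t / t - step t / t / t) (at t)"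
  unfolding stepdiv_def[abs_def] by (intro div_id_deriv step_deriv step_zero)

lemma logcut_zero: "t < 1 \<Longrightarrow> logcut t = 0"
  unfolding logcut_def using stepdiv_zero by (intro prim_zero) auto

lemma logcut_ln: "2 \<le> t \<Longrightarrow> logcut t = logcut 2 + kap * (ln t - ln 2)"
proof -
  assume t: "2 \<le> t"
  have d: "((\<lambda>t. logcut t - kap * ln t) has_real_derivative 0) (at s)" if "2 \<le> s" for s
    using that by (auto intro!: derivative_eq_intros logcut_deriv simp: stepdiv_def step_const)
  have "logcut t - kap * ln t = logcut 2 - kap * ln 2"
  proof (cases "t = 2")
    case False
    then have "2 < t" using t by simp
    then show ?thesis
      using d by (intro DERIV_isconst_end[of 2 t "\<lambda>t. logcut t - kap * ln t"])
        (auto intro!: continuous_at_imp_continuous_on DERIV_isCont)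
  qed simp
  then show ?thesis by (simp add: algebra_simps)
qed

section \<open>Calculus of \<open>C_k\<close> functions and radial Laplacians\<close>

lemma partial_deriv_eq:
  assumes "(f has_derivative f') (at x)" shows "partial_deriv b f x = f' b"
  using frechet_derivative_at[OF assms] by (simp add: partial_deriv_def)

lemma C_k_Suc_imp: "C_k (Suc k) f \<Longrightarrow> C_k k f"
proof (induction k arbitrary: f)
  case 0
  then show ?case by (auto intro: differentiable_imp_continuous_on)
next
  case (Suc k)
  then show ?case by (metis C_k.simps(2))
qed

lemma C_k_const: "C_k k (\<lambda>_::'a::euclidean_space. c::real)"
proof (induction k arbitrary: c)
  case (Suc k)
  have "partial_deriv b (\<lambda>_::'a. c) = (\<lambda>_. 0)" for b
    by (rule ext, rule partial_deriv_eq[of _ "\<lambda>_. 0"]) simp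
  then show ?case using Suc[of 0] by (auto simp: differentiable_on_const)
qed simp

lemma C_k_diffI:
  fixes f :: "'a::euclidean_space \<Rightarrow> real"
  assumes "\<And>x. (f has_derivative f' x) (at x)" "\<And>b. b \<in> Basis \<Longrightarrow> C_k k (\<lambda>x. f' x b)"
  shows "C_k (Suc k) f"
proof -
  have "partial_deriv b f = (\<lambda>x. f' x b)" for b
    using partial_deriv_eq[OF assms(1)] by auto
  moreover have "f differentiable_on UNIV"
    using assms(1) by (auto simp: differentiable_on_def intro: differentiableI)
  ultimately show ?thesis using assms(2) by simp
qed

lemma C_k_SucD:
  assumes "C_k (Suc k) f"
  shows "(f has_derivative frechet_derivative f (at x)) (at x)" "b \<in> Basis \<Longrightarrow> C_k k (\<lambda>x. frechet_derivative f (at x) b)"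
  using assms by (auto simp: differentiable_on_def frechet_derivative_works partial_deriv_def[abs_def])

lemma C_k_add: "C_k k f \<Longrightarrow> C_k k g \<Longrightarrow> C_k k (\<lambda>x. f x + g x)"
proof (induction k arbitrary: f g)
  case 0 then show ?case by (auto intro: continuous_intros)
next
  case (Suc k)
  show ?case
  proof (rule C_k_diffI[of _ "\<lambda>x h. frechet_derivative f (at x) h + frechet_derivative g (at x) h"])
    show "((\<lambda>x. f x + g x) has_derivative (\<lambda>h. frechet_derivative f (at x) h + frechet_derivative g (at x) h)) (at x)" for x
      by (rule has_derivative_add[OF C_k_SucD(1)[OF Suc.prems(1)] C_k_SucD(1)[OF Suc.prems(2)]])
    show "C_k k (\<lambda>x. frechet_derivative f (at x) b + frechet_derivative g (at x) b)" if "b \<in> Basis" for b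
      by (rule Suc.IH[OF C_k_SucD(2)[OF Suc.prems(1) that] C_k_SucD(2)[OF Suc.prems(2) that]])
  qed
qed

lemma C_k_mult: "C_k k f \<Longrightarrow> C_k k g \<Longrightarrow> C_k k (\<lambda>x. f x * g x)"
proof (induction k arbitrary: f g)
  case 0 then show ?case by (auto intro: continuous_intros)
next
  case (Suc k)
  have c: "C_k k f" "C_k k g" using Suc.prems C_k_Suc_imp by blast+
  show ?case
  proof (rule C_k_diffI[of _ "\<lambda>x h. f x * frechet_derivative g (at x) h + frechet_derivative f (at x) h * g x"])
    show "((\<lambda>x. f x * g x) has_derivative (\<lambda>h. f x * frechet_derivative g (at x) h + frechet_derivative f (at x) h * g x)) (at x)" for x
      by (rule has_derivative_mult[OF C_k_SucD(1)[OF Suc.prems(1)] C_k_SucD(1)[OF Suc.prems(2)]])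
    show "C_k k (\<lambda>x. f x * frechet_derivative g (at x) b + frechet_derivative f (at x) b * g x)" if "b \<in> Basis" for b
      by (rule C_k_add[OF Suc.IH[OF c(1) C_k_SucD(2)[OF Suc.prems(2) that]] Suc.IH[OF C_k_SucD(2)[OF Suc.prems(1) that] c(2)]])
  qed
qed

lemma C_k_inner: "C_k k (\<lambda>y. (y - x) \<bullet> (b::'a::euclidean_space))"
proof (cases k)
  case 0 then show ?thesis by (auto intro!: continuous_intros)
next
  case (Suc j)
  show ?thesis unfolding Suc
    by (rule C_k_diffI[of _ "\<lambda>x h. h \<bullet> b"]) (auto intro!: derivative_eq_intros C_k_const)
qed

lemma radial_has_derivative:
  fixes x y :: "'a::real_inner"
  assumes "\<And>t. (g has_real_derivative g' t) (at t)"
  shows "((\<lambda>y. g ((y - x) \<bullet> (y - x))) has_derivative (\<lambda>h. g' ((y - x) \<bullet> (y - x)) * (2 * ((y - x) \<bullet> h)))) (at y)"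
proof -
  have "((\<lambda>y. (y - x) \<bullet> (y - x)) has_derivative (\<lambda>h. 2 * ((y - x) \<bullet> h))) (at y)"
    by (auto intro!: derivative_eq_intros simp: inner_commute)
  from has_derivative_compose[OF this, of g "(*) (g' ((y - x) \<bullet> (y - x)))"]
  show ?thesis using assms by (simp add: has_field_derivative_def)
qed

text \<open>Composition with the squared distance, a polynomial, avoids the singularity of the norm
  at the centre.\<close>

lemma C_k_radial: "Ck1 k g \<Longrightarrow> C_k k (\<lambda>y. g ((y - x) \<bullet> (y - x :: 'a::euclidean_space)))"
proof (induction k arbitrary: g)
  case 0 then show ?case
    by (auto intro!: continuous_intros continuous_on_compose2[of UNIV g])
next
  case (Suc k)
  then obtain g' where g': "\<And>t. (g has_real_derivative g' t) (at t)" "Ck1 k g'" by auto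
  show ?case
    by (rule C_k_diffI[OF radial_has_derivative[OF g'(1)]])
      (intro C_k_mult C_k_const C_k_inner Suc.IH g')
qed

text \<open>For g(s) with s the squared distance, each direction contributes 2 g' plus 4 g'' times a
  squared coordinate; in dimension two the sum is 4 (s g'' + g').\<close>

lemma laplacian_radial_diff:
  fixes x x' y :: plane
  assumes g: "\<And>t. (g has_real_derivative g' t) (at t)" and g': "\<And>t. (g' has_real_derivative g'' t) (at t)"
  shows "laplacian (\<lambda>y. g ((y - x) \<bullet> (y - x)) - g ((y - x') \<bullet> (y - x'))) y
    = 4 * (g'' ((y - x) \<bullet> (y - x)) * ((y - x) \<bullet> (y - x)) + g' ((y - x) \<bullet> (y - x)))
    - 4 * (g'' ((y - x') \<bullet> (y - x')) * ((y - x') \<bullet> (y - x')) + g' ((y - x') \<bullet> (y - x')))"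
proof -
  define s where "s x y = (y - x) \<bullet> (y - x)" for x y :: plane
  have 1: "partial_deriv b (\<lambda>y. g (s x y) - g (s x' y)) =
    (\<lambda>y. g' (s x y) * (2 * ((y - x) \<bullet> b)) - g' (s x' y) * (2 * ((y - x') \<bullet> b)))" for b
    unfolding s_def
    by (rule ext, rule partial_deriv_eq[OF has_derivative_diff[OF radial_has_derivative[OF g] radial_has_derivative[OF g]]])
  have d: "((\<lambda>y. g' (s x y) * (2 * ((y - x) \<bullet> b))) has_derivative
     (\<lambda>h. g' (s x y) * (2 * (h \<bullet> b)) + g'' (s x y) * (2 * ((y - x) \<bullet> h)) * (2 * ((y - x) \<bullet> b)))) (at y)" for b x y
    unfolding s_def
    by (rule has_derivative_mult[OF radial_has_derivative[OF g']]) (auto intro!: derivative_eq_intros)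
  have 2: "partial_deriv b (partial_deriv b (\<lambda>y. g (s x y) - g (s x' y))) y =
     (g' (s x y) * (2 * (b \<bullet> b)) + g'' (s x y) * (2 * ((y - x) \<bullet> b)) * (2 * ((y - x) \<bullet> b))) -
     (g' (s x' y) * (2 * (b \<bullet> b)) + g'' (s x' y) * (2 * ((y - x') \<bullet> b)) * (2 * ((y - x') \<bullet> b)))" for b
    unfolding 1 by (rule partial_deriv_eq[OF has_derivative_diff[OF d d]])
  have 3: "(\<Sum>b\<in>Basis. g' (s x y) * (2 * (b \<bullet> b)) + g'' (s x y) * (2 * ((y - x) \<bullet> b)) * (2 * ((y - x) \<bullet> b)))
     = 4 * (g'' (s x y) * s x y + g' (s x y))" for x :: plane
  proof -
    have "(\<Sum>b\<in>Basis. g' (s x y) * (2 * (b \<bullet> b)) + g'' (s x y) * (2 * ((y - x) \<bullet> b)) * (2 * ((y - x) \<bullet> b)))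
      = (\<Sum>b\<in>Basis. 2 * g' (s x y) + 4 * g'' (s x y) * (((y - x) \<bullet> b) * ((y - x) \<bullet> b)))"
      by (intro sum.cong) (auto simp: algebra_simps)
    also have "\<dots> = DIM(plane) * (2 * g' (s x y)) + 4 * g'' (s x y) * (\<Sum>b\<in>Basis. ((y - x) \<bullet> b) * ((y - x) \<bullet> b))"
      by (simp only: sum.distrib sum_distrib_left[symmetric] sum_constant)
    also have "(\<Sum>b\<in>Basis. ((y - x) \<bullet> b) * ((y - x) \<bullet> b)) = s x y"
      unfolding s_def by (rule euclidean_inner[symmetric])
    finally show ?thesis by (simp add: algebra_simps)
  qed
  have "laplacian (\<lambda>y. g (s x y) - g (s x' y)) y = 4 * (g'' (s x y) * s x y + g' (s x y)) - 4 * (g'' (s x' y) * s x' y + g' (s x' y))"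
    unfolding laplacian_def 2 sum_subtractf 3 ..
  then show ?thesis unfolding s_def .
qed

text \<open>A truncated logarithm: \<open>trunclog k s\<close> is \<open>- kap / 2 * ln s\<close> up to a constant for
  \<open>2/k\<^sup>2 \<le> s \<le> k\<^sup>2\<close>, is constant near \<open>0\<close>, and vanishes for large \<open>s\<close>.\<close>

definition trunclog :: "real \<Rightarrow> real \<Rightarrow> real" where
  "trunclog k s = (logcut (s / k\<^sup>2) - logcut (s * k\<^sup>2)) / 2 + 2 * kap * ln k"

definition trunclog1 :: "real \<Rightarrow> real \<Rightarrow> real" where
  "trunclog1 k s = (stepdiv (s / k\<^sup>2) / k\<^sup>2 - k\<^sup>2 * stepdiv (s * k\<^sup>2)) / 2"

text \<open>Left unsimplified, in the shape that the chain rule produces from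
  \<open>stepdiv_deriv\<close>; the cancellation takes place in
  \<open>trunclog_laplace\<close>.\<close>

definition trunclog2 :: "real \<Rightarrow> real \<Rightarrow> real" where
  "trunclog2 k s = ((bump (s / k\<^sup>2) / (s / k\<^sup>2) - step (s / k\<^sup>2) / (s / k\<^sup>2) / (s / k\<^sup>2)) / k\<^sup>2 / k\<^sup>2
      - k\<^sup>2 * (k\<^sup>2 * (bump (s * k\<^sup>2) / (s * k\<^sup>2) - step (s * k\<^sup>2) / (s * k\<^sup>2) / (s * k\<^sup>2)))) / 2"

lemma DERIV_scaled:
  assumes "\<And>t. (g has_real_derivative g' t) (at t)"
  shows "((\<lambda>s. g (s / c)) has_real_derivative g' (s / c) / c) (at s)"
    and "((\<lambda>s. g (s * c)) has_real_derivative g' (s * c) * c) (at s)"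
  using DERIV_chain2[OF assms DERIV_cdivide[OF DERIV_ident], of c s]
    DERIV_chain2[OF assms DERIV_cmult_right[OF DERIV_ident], of c s] by simp_all

lemma trunclog_deriv: "(trunclog k has_real_derivative trunclog1 k s) (at s)"
proof -
  have "(trunclog k has_real_derivative (stepdiv (s / k\<^sup>2) / k\<^sup>2 - stepdiv (s * k\<^sup>2) * k\<^sup>2) / 2 + 0) (at s)"
    unfolding trunclog_def[abs_def]
    by (intro DERIV_add DERIV_const DERIV_cdivide DERIV_diff DERIV_scaled logcut_deriv)
  then show ?thesis by (simp add: trunclog1_def mult.commute)
qed

lemma trunclog1_deriv: "(trunclog1 k has_real_derivative trunclog2 k s) (at s)"
  unfolding trunclog1_def[abs_def] trunclog2_def
  by (subst (3) mult.commute, intro DERIV_cdivide DERIV_diff DERIV_cmult DERIV_scaled stepdiv_deriv)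

lemma Ck1_trunclog: "Ck1 j (trunclog k)"
proof -
  have "Ck1 j (\<lambda>s. (1/2) * (logcut ((1 / k\<^sup>2) * s + 0) + (-1) * logcut (k\<^sup>2 * s + 0)) + 2 * kap * ln k)"
    by (intro Ck1_add Ck1_mult Ck1_const Ck1_affine[of _ logcut] Ck1_logcut)
  also have "(\<lambda>s. (1/2) * (logcut ((1 / k\<^sup>2) * s + 0) + (-1) * logcut (k\<^sup>2 * s + 0)) + 2 * kap * ln k) = trunclog k"
    by (auto simp: trunclog_def fun_eq_iff mult.commute)
  finally show ?thesis .
qed

text \<open>The left side is the derivative of s * \<open>trunclog1 k s\<close>, and this product is
  (\<open>step (s / k\<^sup>2)\<close> - \<open>step (s * k\<^sup>2)\<close>) / 2. The logarithmic
  part is harmonic, so only the two cut-off layers remain, each a rescaled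
  \<open>bump\<close>.\<close>

lemma trunclog_laplace:
  assumes k: "k > 0"
  shows "trunclog2 k s * s + trunclog1 k s = (bump (s / k\<^sup>2) / k\<^sup>2 - k\<^sup>2 * bump (s * k\<^sup>2)) / 2"
proof (cases "s = 0")
  case True
  then show ?thesis by (simp add: trunclog1_def stepdiv_zero bump_zero)
next
  case False
  have aux: "q * (A / q - B / q / q) = A - B / q" if "q \<noteq> 0" for q A B :: real
    using that by (simp add: field_simps)
  have "s * ((bump (s / k\<^sup>2) / (s / k\<^sup>2) - step (s / k\<^sup>2) / (s / k\<^sup>2) / (s / k\<^sup>2)) / k\<^sup>2 / k\<^sup>2)
    = (s / k\<^sup>2 * (bump (s / k\<^sup>2) / (s / k\<^sup>2) - step (s / k\<^sup>2) / (s / k\<^sup>2) / (s / k\<^sup>2))) / k\<^sup>2" by simp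
  also have "\<dots> = (bump (s / k\<^sup>2) - stepdiv (s / k\<^sup>2)) / k\<^sup>2"
    unfolding stepdiv_def using False k by (subst aux) auto
  finally have 1: "s * ((bump (s / k\<^sup>2) / (s / k\<^sup>2) - step (s / k\<^sup>2) / (s / k\<^sup>2) / (s / k\<^sup>2)) / k\<^sup>2 / k\<^sup>2) =
    (bump (s / k\<^sup>2) - stepdiv (s / k\<^sup>2)) / k\<^sup>2" .
  have "s * (k\<^sup>2 * (k\<^sup>2 * (bump (s * k\<^sup>2) / (s * k\<^sup>2) - step (s * k\<^sup>2) / (s * k\<^sup>2) / (s * k\<^sup>2)))) =
    k\<^sup>2 * ((s * k\<^sup>2) * (bump (s * k\<^sup>2) / (s * k\<^sup>2) - step (s * k\<^sup>2) / (s * k\<^sup>2) / (s * k\<^sup>2)))"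
    by (simp only: mult_ac)
  also have "\<dots> = k\<^sup>2 * (bump (s * k\<^sup>2) - stepdiv (s * k\<^sup>2))"
    unfolding stepdiv_def using False k by (subst aux) auto
  finally have 2: "s * (k\<^sup>2 * (k\<^sup>2 * (bump (s * k\<^sup>2) / (s * k\<^sup>2) - step (s * k\<^sup>2) / (s * k\<^sup>2) / (s * k\<^sup>2)))) =
    k\<^sup>2 * (bump (s * k\<^sup>2) - stepdiv (s * k\<^sup>2))" .
  have "trunclog2 k s * s = ((bump (s / k\<^sup>2) - stepdiv (s / k\<^sup>2)) / k\<^sup>2 - k\<^sup>2 * (bump (s * k\<^sup>2) - stepdiv (s * k\<^sup>2))) / 2"
    unfolding trunclog2_def 1[symmetric] 2[symmetric] by (simp only: left_diff_distrib right_diff_distrib times_divide_eq_left times_divide_eq_right mult.commute[of _ s])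
  then show ?thesis unfolding trunclog1_def by (simp add: diff_divide_distrib right_diff_distrib)
qed

text \<open>The additive constant in \<open>trunclog\<close> is made for this: far out both pieces
  are logarithmic and differ by -4 ln k, which is multiplied by kap / 2.\<close>

lemma trunclog_vanish:
  assumes k: "k \<ge> 1" and s: "s \<ge> 2 * k\<^sup>2"
  shows "trunclog k s = 0"
proof -
  have k2: "k\<^sup>2 \<ge> 1" using k by simp
  have kp: "0 < k\<^sup>2" using k2 by linarith
  have s1: "s / k\<^sup>2 \<ge> 2" using s kp by (simp add: pos_le_divide_eq)
  have "s \<ge> 2" using s k2 by linarith
  then have s2: "s * k\<^sup>2 \<ge> 2" using k2 mult_mono[of 2 s 1 "k\<^sup>2"] by simp
  have sp: "s > 0" using \<open>s \<ge> 2\<close> by simp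
  have "trunclog k s = kap * (ln (s / k\<^sup>2) - ln (s * k\<^sup>2)) / 2 + 2 * kap * ln k"
    unfolding trunclog_def logcut_ln[OF s1] logcut_ln[OF s2] by (simp add: algebra_simps)
  also have "ln (s / k\<^sup>2) - ln (s * k\<^sup>2) = - 4 * ln k"
    using sp k by (simp add: ln_div ln_mult ln_realpow)
  finally show ?thesis by simp
qed

lemma trunclog_mid:
  assumes k: "k \<ge> 1" and s: "2 / k\<^sup>2 \<le> s" "s < k\<^sup>2"
  shows "trunclog k s = - (logcut 2) / 2 + kap * ln 2 / 2 + kap * ln k - kap * ln s / 2"
proof -
  have k2: "k\<^sup>2 \<ge> 1" using k by simp
  have kp: "0 < k\<^sup>2" using k2 by linarith
  have s1: "s / k\<^sup>2 < 1" using s kp by (simp add: pos_divide_less_eq)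
  have s2: "s * k\<^sup>2 \<ge> 2" using s kp by (simp add: pos_divide_le_eq)
  have sp: "s > 0" using s2 k2 by (smt (verit) mult_nonpos_nonneg)
  show ?thesis
    unfolding trunclog_def logcut_ln[OF s2] logcut_zero[OF s1]
    using sp k by (simp add: ln_mult ln_realpow field_simps)
qed

text \<open>The derivative lies between -kap / (2 s) and 0, so \<open>trunclog k\<close> is
  nonincreasing while its sum with kap / 2 * ln is nondecreasing. The bound does not depend on
  \<open>k\<close> and serves as the dominating function when k tends to infinity.\<close>

lemma trunclog_lipschitz:
  assumes k: "k \<ge> 1" and s: "0 < s" "0 < s'"
  shows "\<bar>trunclog k s - trunclog k s'\<bar> \<le> kap / 2 * \<bar>ln s - ln s'\<bar>"
proof -
  have main: "\<bar>trunclog k s - trunclog k s'\<bar> \<le> kap / 2 * \<bar>ln s - ln s'\<bar>" if s: "0 < s" "s \<le> s'" for s s'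
  proof -
    have k2: "k\<^sup>2 \<ge> 1" using k by simp
    have d1: "trunclog1 k t = (step (t / k\<^sup>2) - step (t * k\<^sup>2)) / (2 * t)" if "t > 0" for t
      using that k unfolding trunclog1_def stepdiv_def by (simp add: divide_simps)
    have le0: "trunclog1 k t \<le> 0" if "t > 0" for t
    proof -
      have "t / k\<^sup>2 \<le> t / 1" using that k2 by (intro divide_left_mono) auto
      also have "\<dots> \<le> t * k\<^sup>2" using that k2 by (simp add: mult_le_cancel_left1)
      finally have "step (t / k\<^sup>2) \<le> step (t * k\<^sup>2)" by (rule step_mono)
      then show ?thesis unfolding d1[OF that] using that by (simp add: divide_nonpos_pos)
    qed
    have ge: "- kap / (2 * t) \<le> trunclog1 k t" if "t > 0" for t
    proof -
      have "- kap \<le> step (t / k\<^sup>2) - step (t * k\<^sup>2)" using step_bounds[of "t / k\<^sup>2"] step_bounds[of "t * k\<^sup>2"] by linarith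
      then show ?thesis unfolding d1[OF that] using that by (intro divide_right_mono) auto
    qed
    have 1: "trunclog k s' \<le> trunclog k s"
    proof (rule DERIV_nonpos_imp_nonincreasing[OF s(2)])
      fix t assume "s \<le> t" "t \<le> s'"
      then show "\<exists>y. (trunclog k has_real_derivative y) (at t) \<and> y \<le> 0" using trunclog_deriv le0 s by force
    qed
    have 2: "trunclog k s + kap / 2 * ln s \<le> trunclog k s' + kap / 2 * ln s'"
    proof (rule DERIV_nonneg_imp_nondecreasing[OF s(2)])
      fix t assume t: "s \<le> t" "t \<le> s'"
      then have tp: "t > 0" using s by simp
      have "((\<lambda>t. trunclog k t + kap / 2 * ln t) has_real_derivative trunclog1 k t + kap / (2 * t)) (at t)"
        using tp by (auto intro!: derivative_eq_intros trunclog_deriv simp: divide_simps)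
      then show "\<exists>y. ((\<lambda>t. trunclog k t + kap / 2 * ln t) has_real_derivative y) (at t) \<and> 0 \<le> y"
        using ge[OF tp] by (intro exI conjI) auto
    qed
    have "ln s \<le> ln s'" using s by simp
    then have "\<bar>ln s - ln s'\<bar> = ln s' - ln s" "\<bar>trunclog k s - trunclog k s'\<bar> = trunclog k s - trunclog k s'" using 1 by simp_all
    then show ?thesis using 2 by (simp add: right_diff_distrib)
  qed
  show ?thesis
  proof (cases "s \<le> s'")
    case False
    then show ?thesis using main[of s' s] s by (simp add: abs_minus_commute)
  qed (use main s in auto)
qed

text \<open>A difference of two centres, because the outer cut-off layers then nearly cancel for
  large \<open>k\<close>; a single truncated logarithm would leave an uncontrolled average of the
  solution at infinity.\<close>

definition trunctest :: "real \<Rightarrow> plane \<Rightarrow> plane \<Rightarrow> plane \<Rightarrow> real" where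
  "trunctest k x x' y = trunclog k ((y - x) \<bullet> (y - x)) - trunclog k ((y - x') \<bullet> (y - x'))"

lemma test_function_trunctest:
  assumes k: "k \<ge> 1"
  shows "test_function (trunctest k x x')"
  unfolding test_function_def
proof (intro conjI allI)
  fix j
  have "C_k j (\<lambda>y. trunclog k ((y - x) \<bullet> (y - x)) + (-1) * trunclog k ((y - x') \<bullet> (y - x')))"
    by (intro C_k_add C_k_mult C_k_const C_k_radial Ck1_trunclog)
  then show "C_k j (trunctest k x x')" by (simp add: trunctest_def[abs_def])
next
  define R where "R = 2 * k + norm x + norm x'"
  have "{y. trunctest k x x' y \<noteq> 0} \<subseteq> cball 0 R"
  proof safe
    fix y assume nz: "trunctest k x x' y \<noteq> 0"
    show "y \<in> cball 0 R"
    proof (rule ccontr)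
      assume "y \<notin> cball 0 R"
      then have R: "norm y > 2 * k + norm x + norm x'" by (simp add: R_def)
      have z: "trunclog k ((y - z) \<bullet> (y - z)) = 0" if "norm z \<le> norm x + norm x'" for z
      proof (rule trunclog_vanish[OF k])
        have "2 * k \<le> norm (y - z)" using R that norm_triangle_ineq2[of y z] by linarith
        then have "(2 * k)\<^sup>2 \<le> (norm (y - z))\<^sup>2" using k by (intro power_mono) auto
        then have "4 * k\<^sup>2 \<le> (y - z) \<bullet> (y - z)" by (simp add: power2_norm_eq_inner power_mult_distrib)
        then show "2 * k\<^sup>2 \<le> (y - z) \<bullet> (y - z)" by (smt (verit) zero_le_power2)
      qed
      show False using nz z[of x] z[of x'] by (simp add: trunctest_def)
    qed
  qed
  then have "closure {y. trunctest k x x' y \<noteq> 0} \<subseteq> cball 0 R" by (rule closure_minimal) simp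
  then show "compact (closure {y. trunctest k x x' y \<noteq> 0})"
    by (meson bounded_cball bounded_subset closed_closure compact_eq_bounded_closed)
qed

text \<open>A mollifier supported in an annulus around \<open>x\<close>, with integral
  \<open>c0\<close> for every r > 0. Radius 1/k recovers the value at \<open>x\<close>; radius
  \<open>k\<close> is the layer at infinity.\<close>

definition mollk :: "real \<Rightarrow> plane \<Rightarrow> plane \<Rightarrow> real" where
  "mollk r x y = bump ((y - x) \<bullet> (y - x) / r\<^sup>2) / r\<^sup>2"

lemma laplacian_trunctest:
  assumes k: "k \<ge> 1"
  shows "- laplacian (trunctest k x x') y =
     2 * ((mollk (1/k) x y - mollk (1/k) x' y) - (mollk k x y - mollk k x' y))"
proof -
  have "laplacian (trunctest k x x') y =
    4 * (trunclog2 k ((y - x) \<bullet> (y - x)) * ((y - x) \<bullet> (y - x)) + trunclog1 k ((y - x) \<bullet> (y - x))) -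
    4 * (trunclog2 k ((y - x') \<bullet> (y - x')) * ((y - x') \<bullet> (y - x')) + trunclog1 k ((y - x') \<bullet> (y - x')))"
    unfolding trunctest_def[abs_def] by (rule laplacian_radial_diff[OF trunclog_deriv trunclog1_deriv])
  also have "\<dots> = 2 * (bump ((y - x) \<bullet> (y - x) / k\<^sup>2) / k\<^sup>2 - k\<^sup>2 * bump ((y - x) \<bullet> (y - x) * k\<^sup>2)) -
    2 * (bump ((y - x') \<bullet> (y - x') / k\<^sup>2) / k\<^sup>2 - k\<^sup>2 * bump ((y - x') \<bullet> (y - x') * k\<^sup>2))"
  proof -
    have kp: "0 < k" using k by simp
    have gen: "A = P / 2 \<Longrightarrow> B = Q / 2 \<Longrightarrow> 4 * A - 4 * B = 2 * P - 2 * Q" for A B P Q :: real by simp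
    show ?thesis by (rule gen[OF trunclog_laplace[OF kp] trunclog_laplace[OF kp]])
  qed
  finally show ?thesis using k by (simp add: mollk_def power_divide algebra_simps diff_divide_distrib)
qed

section \<open>Mollification at small and at large scale\<close>

lemma lebesgue_integral_affine:
  fixes f :: "plane \<Rightarrow> real"
  assumes [measurable]: "f \<in> borel_measurable borel" and r: "0 < r"
  shows "(LINT y|lborel. f y) = r\<^sup>2 * (LINT z|lborel. f (x + r *\<^sub>R z))"
proof -
  have lb: "lborel = density (distr lborel borel (\<lambda>z::plane. x + r *\<^sub>R z)) (\<lambda>_. ennreal (\<bar>r\<bar>^DIM(plane)))"
    using r by (intro lborel_affine) auto
  have "(LINT y|lborel. f y) = (LINT y|density (distr lborel borel (\<lambda>z::plane. x + r *\<^sub>R z)) (\<lambda>_. ennreal (\<bar>r\<bar>^DIM(plane))). f y)"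
    using lb by (rule arg_cong)
  also have "\<dots> = (LINT y|distr lborel borel (\<lambda>z::plane. x + r *\<^sub>R z). (\<bar>r\<bar>^DIM(plane)) * f y)"
    by (subst integral_density) auto
  also have "\<dots> = (LINT z|lborel. (\<bar>r\<bar>^DIM(plane)) * f (x + r *\<^sub>R z))"
    by (subst integral_distr) auto
  finally show ?thesis using r by simp
qed

definition c0 :: real where "c0 = (LINT z|lborel. bump (z \<bullet> (z::plane)))"
text \<open>The constant 1 / (2 pi) of the fundamental solution: polar coordinates give c0 = pi *
  kap. It enters as a positive constant absorbed into the densities.\<close>

definition cn :: real where "cn = kap / (2 * c0)"

lemma bump_measurable [measurable]: "bump \<in> borel_measurable borel"
  using bump_continuous by (rule borel_measurable_continuous_onI)

lemma bump_radial_support: "bump (z \<bullet> z) \<noteq> 0 \<Longrightarrow> norm z \<le> 2"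
proof (rule ccontr)
  assume nz: "bump (z \<bullet> z) \<noteq> 0" and "\<not> norm z \<le> 2"
  then have "2\<^sup>2 \<le> (norm z)\<^sup>2" by (intro power_mono) auto
  then have "2 \<le> z \<bullet> z" by (simp add: power2_norm_eq_inner)
  then show False using nz bump_zero by auto
qed

lemma bump_radial_integrable: "integrable lborel (\<lambda>z::plane. bump (z \<bullet> z))"
proof (rule Bochner_Integration.integrable_bound)
  show "integrable lborel (\<lambda>z::plane. indicator (cball 0 2) z :: real)"
    by (rule integrable_real_indicator) (auto simp: emeasure_cball_plane)
  show "AE z::plane in lborel. norm (bump (z \<bullet> z)) \<le> norm (indicator (cball 0 2) z :: real)"
  proof (rule AE_I2)
    fix z :: plane
    show "norm (bump (z \<bullet> z)) \<le> norm (indicator (cball 0 2) z :: real)"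
      using bump_radial_support[of z] bump_nonneg bump_le_one by (cases "bump (z \<bullet> z) = 0") auto
  qed
qed measurable

lemma c0_pos: "0 < c0"
proof -
  have "c0 \<noteq> 0"
  proof
    assume "c0 = 0"
    then have ae: "AE z::plane in lborel. bump (z \<bullet> z) = 0"
      unfolding c0_def using integral_nonneg_eq_0_iff_AE[OF bump_radial_integrable] bump_nonneg by auto
    define A where "A = {z::plane. 1 < z \<bullet> z \<and> z \<bullet> z < 2}"
    have "open A" unfolding A_def by (intro open_Collect_conj open_Collect_less continuous_intros)
    obtain u :: plane where u: "norm u = 5/4" using vector_choose_size[of "5/4"] by auto
    have "u \<bullet> u = (5/4)\<^sup>2" unfolding u[symmetric] by (rule power2_norm_eq_inner[symmetric])
    then have "u \<in> A" unfolding A_def by (simp add: power2_eq_square)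
    have "AE z in lborel. z \<notin> A" using ae
    proof eventually_elim
      case (elim z)
      then show ?case using bump_pos[of "z \<bullet> z"] by (auto simp: A_def)
    qed
    then have "A \<in> null_sets lborel" using \<open>open A\<close> by (simp add: AE_iff_null_sets)
    then have "emeasure lborel A = 0" by auto
    moreover obtain e where "e > 0" "ball u e \<subseteq> A" using \<open>open A\<close> \<open>u \<in> A\<close> openE by blast
    then have "emeasure lborel (ball u e) \<le> emeasure lborel A" using \<open>open A\<close> by (intro emeasure_mono) auto
    ultimately show False using \<open>e > 0\<close> by (simp add: emeasure_ball_plane)
  qed
  moreover have "0 \<le> c0" unfolding c0_def using bump_nonneg by simp
  ultimately show ?thesis by simp
qed

lemma cn_pos: "0 < cn"
  unfolding cn_def using c0_pos kap_pos by simp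

lemma mollk_measurable [measurable]: "mollk r x \<in> borel_measurable borel"
  unfolding mollk_def[abs_def] by measurable

lemma moll_eq:
  fixes u :: "plane \<Rightarrow> real"
  assumes [measurable]: "u \<in> borel_measurable borel" and r: "0 < r"
  shows "(LINT y|lborel. u y * mollk r x y) = (LINT z|lborel. u (x + r *\<^sub>R z) * bump (z \<bullet> z))"
proof -
  have "(LINT y|lborel. u y * mollk r x y) = r\<^sup>2 * (LINT z|lborel. u (x + r *\<^sub>R z) * mollk r x (x + r *\<^sub>R z))"
    using r by (intro lebesgue_integral_affine) auto
  also have "\<dots> = (LINT z|lborel. r\<^sup>2 * (u (x + r *\<^sub>R z) * mollk r x (x + r *\<^sub>R z)))" by simp
  also have "\<dots> = (LINT z|lborel. u (x + r *\<^sub>R z) * bump (z \<bullet> z))"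
    using r by (intro Bochner_Integration.integral_cong) (auto simp: mollk_def power2_eq_square)
  finally show ?thesis .
qed

lemma mollk_support: "mollk r x y \<noteq> 0 \<Longrightarrow> r > 0 \<Longrightarrow> norm (y - x) \<le> 2 * r"
proof -
  assume nz: "mollk r x y \<noteq> 0" and r: "r > 0"
  have "((1 / r) *\<^sub>R (y - x)) \<bullet> ((1 / r) *\<^sub>R (y - x)) = (y - x) \<bullet> (y - x) / r\<^sup>2"
    by (simp only: inner_scaleR_left inner_scaleR_right) (simp add: power2_eq_square)
  then have "bump (((1 / r) *\<^sub>R (y - x)) \<bullet> ((1 / r) *\<^sub>R (y - x))) \<noteq> 0"
    using nz by (simp only: mollk_def) auto
  then have "norm ((1 / r) *\<^sub>R (y - x)) \<le> 2" by (rule bump_radial_support)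
  then show ?thesis using r by (simp only: norm_scaleR) (simp add: field_simps)
qed

lemma moll_integrable:
  fixes u :: "plane \<Rightarrow> real"
  assumes c: "continuous_on UNIV u" and r: "0 < r"
  shows "integrable lborel (\<lambda>y. u y * mollk r x y)"
proof -
  have "bounded (u ` cball x (2 * r))"
    by (intro compact_imp_bounded compact_continuous_image continuous_on_subset[OF c]) auto
  then obtain B where B: "\<And>y. y \<in> cball x (2 * r) \<Longrightarrow> \<bar>u y\<bar> \<le> B" unfolding bounded_iff real_norm_def by blast
  have [measurable]: "u \<in> borel_measurable borel" using c by (rule borel_measurable_continuous_onI)
  have B0: "0 \<le> B" using B[of x] r by (auto intro: order_trans[OF abs_ge_zero])
  show ?thesis
  proof (rule Bochner_Integration.integrable_bound)
    show "integrable lborel (\<lambda>y. (B / r\<^sup>2) * indicator (cball x (2 * r)) y :: real)"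
      using r by (intro integrable_mult_right integrable_real_indicator) (auto simp: emeasure_cball_plane)
    show "AE y in lborel. norm (u y * mollk r x y) \<le> norm ((B / r\<^sup>2) * indicator (cball x (2 * r)) y :: real)"
    proof (rule AE_I2)
      fix y
      show "norm (u y * mollk r x y) \<le> norm ((B / r\<^sup>2) * indicator (cball x (2 * r)) y :: real)"
      proof (cases "mollk r x y = 0")
        case False
        then have y: "y \<in> cball x (2 * r)" using mollk_support[OF False r] by (simp add: dist_norm norm_minus_commute)
        have "\<bar>mollk r x y\<bar> \<le> 1 / r\<^sup>2" unfolding mollk_def using bump_nonneg bump_le_one by (simp add: divide_right_mono)
        then have "\<bar>u y\<bar> * \<bar>mollk r x y\<bar> \<le> B * (1 / r\<^sup>2)" using B[OF y] B0 by (intro mult_mono) auto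
        then show ?thesis using y B0 by (simp add: abs_mult)
      qed simp
    qed
  qed measurable
qed

lemma moll_small:
  fixes u :: "plane \<Rightarrow> real"
  assumes c: "continuous_on UNIV u"
  shows "(\<lambda>k. LINT y|lborel. u y * mollk (1 / real (Suc k)) x y) \<longlonglongrightarrow> u x * c0"
proof -
  have [measurable]: "u \<in> borel_measurable borel" using c by (rule borel_measurable_continuous_onI)
  have "bounded (u ` cball x 2)"
    by (intro compact_imp_bounded compact_continuous_image continuous_on_subset[OF c]) auto
  then obtain B where B: "\<And>y. y \<in> cball x 2 \<Longrightarrow> \<bar>u y\<bar> \<le> B" unfolding bounded_iff real_norm_def by blast
  have "(\<lambda>k. LINT z|lborel. u (x + (1 / real (Suc k)) *\<^sub>R z) * bump (z \<bullet> z)) \<longlonglongrightarrow> (LINT z|lborel. u x * bump (z \<bullet> (z::plane)))"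
  proof (rule integral_dominated_convergence)
    show "integrable lborel (\<lambda>z::plane. B * bump (z \<bullet> z))" using bump_radial_integrable by simp
    show "AE z in lborel. (\<lambda>k. u (x + (1 / real (Suc k)) *\<^sub>R z) * bump (z \<bullet> z)) \<longlonglongrightarrow> u x * bump (z \<bullet> z)"
    proof (intro AE_I2 tendsto_mult tendsto_const)
      fix z :: plane
      have "(\<lambda>k. x + (1 / real (Suc k)) *\<^sub>R z) \<longlonglongrightarrow> x + 0 *\<^sub>R z"
        by (intro tendsto_intros LIMSEQ_Suc[OF lim_1_over_n])
      moreover have "isCont u x" using c by (simp add: continuous_on_eq_continuous_at)
      ultimately show "(\<lambda>k. u (x + (1 / real (Suc k)) *\<^sub>R z)) \<longlonglongrightarrow> u x"
        by (intro isCont_tendsto_compose[of _ u]) auto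
    qed
    show "AE z in lborel. norm (u (x + (1 / real (Suc k)) *\<^sub>R z) * bump (z \<bullet> z)) \<le> B * bump (z \<bullet> z)" for k
    proof (rule AE_I2)
      fix z :: plane
      show "norm (u (x + (1 / real (Suc k)) *\<^sub>R z) * bump (z \<bullet> z)) \<le> B * bump (z \<bullet> z)"
      proof (cases "bump (z \<bullet> z) = 0")
        case False
        have "norm z / real (Suc k) \<le> norm z / 1" by (intro divide_left_mono) auto
        then have "x + (1 / real (Suc k)) *\<^sub>R z \<in> cball x 2"
          using bump_radial_support[OF False] by (simp add: dist_norm)
        then show ?thesis using B bump_nonneg by (auto simp: abs_mult intro: mult_right_mono)
      qed simp
    qed
  qed measurable
  then show ?thesis by (subst moll_eq) (auto simp: c0_def)
qed

text \<open>The range up to 16 is what \<open>moll_large\<close> meets: |y| \<le> 3k and |x| \<le> k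
  give |y - x|^2 / k^2 \<le> 16.\<close>

lemma bump_lipschitz: "\<exists>L\<ge>0. \<forall>s t. 0 \<le> s \<longrightarrow> s \<le> 16 \<longrightarrow> 0 \<le> t \<longrightarrow> t \<le> 16 \<longrightarrow> \<bar>bump s - bump t\<bar> \<le> L * \<bar>s - t\<bar>"
proof -
  obtain b' where b': "\<And>t. (bump has_real_derivative b' t) (at t)" "continuous_on UNIV b'"
    using Ck1_bump[of 1] by auto
  have "bounded (b' ` {0..16})"
    by (intro compact_imp_bounded compact_continuous_image continuous_on_subset[OF b'(2)]) auto
  then obtain L where L: "\<And>t. t \<in> {0..16} \<Longrightarrow> norm (b' t) \<le> L" unfolding bounded_iff by blast
  have "0 \<le> L" using L[of 0] by (auto intro: order_trans[OF abs_ge_zero])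
  moreover have "\<bar>bump s - bump t\<bar> \<le> L * \<bar>s - t\<bar>" if "0 \<le> s" "s \<le> 16" "0 \<le> t" "t \<le> 16" for s t
    using field_differentiable_bound[of "{0..16}" bump b' L s t] L that b'(1)
    by (auto intro: has_field_derivative_at_within simp: abs_minus_commute)
  ultimately show ?thesis by blast
qed

text \<open>Moving the centre from x to x' changes the mollifier of radius k by O(1/k) / k^2 on a
  disc of area 9 pi k^2. Against logarithmic growth of \<open>u\<close> the result is O(ln k /
  k).\<close>

lemma moll_large:
  fixes u :: "plane \<Rightarrow> real"
  assumes c: "continuous_on UNIV u" and g: "\<And>y. \<bar>u y\<bar> \<le> B0 + B1 * ln (1 + norm y)" and B: "0 \<le> B0" "0 \<le> B1"
  shows "(\<lambda>k. LINT y|lborel. u y * (mollk (real (Suc k)) x y - mollk (real (Suc k)) x' y)) \<longlonglongrightarrow> 0"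
proof -
  have [measurable]: "u \<in> borel_measurable borel" using c by (rule borel_measurable_continuous_onI)
  obtain L where L: "L \<ge> 0" "\<And>s t. 0 \<le> s \<Longrightarrow> s \<le> 16 \<Longrightarrow> 0 \<le> t \<Longrightarrow> t \<le> 16 \<Longrightarrow> \<bar>bump s - bump t\<bar> \<le> L * \<bar>s - t\<bar>"
    using bump_lipschitz by blast
  define D where "D = norm (x - x')"
  define b where "b k = (B0 + B1 * ln (1 + 3 * k)) * (L * (8 * D / k)) * (9 * pi)" for k :: real
  have bound: "norm (LINT y|lborel. u y * (mollk k x y - mollk k x' y)) \<le> b k"
    if k: "k \<ge> 1" "norm x \<le> k" "norm x' \<le> k" for k
  proof -
    define K where "K = (B0 + B1 * ln (1 + 3 * k)) * (L * (8 * D / k) / k\<^sup>2)"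
    have K0: "0 \<le> K" unfolding K_def D_def using B L k by simp
    have pw: "\<bar>u y * (mollk k x y - mollk k x' y)\<bar> \<le> K * indicator (cball 0 (3 * k)) y" for y
    proof (cases "y \<in> cball 0 (3 * k)")
      case True
      then have y: "norm y \<le> 3 * k" by simp
      have sm: "0 \<le> (y - z) \<bullet> (y - z) / k\<^sup>2" "(y - z) \<bullet> (y - z) / k\<^sup>2 \<le> 16" if "norm z \<le> k" for z
      proof -
        have "norm (y - z) \<le> 4 * k" using y that norm_triangle_ineq4[of y z] by linarith
        then have "(norm (y - z))\<^sup>2 \<le> (4 * k)\<^sup>2" by (intro power_mono) auto
        then show "(y - z) \<bullet> (y - z) / k\<^sup>2 \<le> 16" using k by (simp add: power2_norm_eq_inner power_mult_distrib field_simps)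
      qed simp
      have "(y - x) \<bullet> (y - x) - (y - x') \<bullet> (y - x') = (x' - x) \<bullet> (2 *\<^sub>R y - x - x')"
        by (simp add: inner_diff inner_commute algebra_simps)
      also have "\<bar>\<dots>\<bar> \<le> norm (x' - x) * norm (2 *\<^sub>R y - x - x')" by (rule Cauchy_Schwarz_ineq2)
      also have "norm (2 *\<^sub>R y - x - x') \<le> 8 * k"
        using y k norm_triangle_ineq4[of "2 *\<^sub>R y - x" x'] norm_triangle_ineq4[of "2 *\<^sub>R y" x] by simp
      finally have "\<bar>(y - x) \<bullet> (y - x) - (y - x') \<bullet> (y - x')\<bar> \<le> D * (8 * k)"
        unfolding D_def by (simp add: norm_minus_commute mult_left_mono)
      then have "\<bar>(y - x) \<bullet> (y - x) / k\<^sup>2 - (y - x') \<bullet> (y - x') / k\<^sup>2\<bar> \<le> D * (8 * k) / k\<^sup>2"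
        by (simp add: diff_divide_distrib[symmetric] abs_divide divide_right_mono)
      also have "D * (8 * k) / k\<^sup>2 = 8 * D / k" using k by (simp add: power2_eq_square)
      finally have "\<bar>bump ((y - x) \<bullet> (y - x) / k\<^sup>2) - bump ((y - x') \<bullet> (y - x') / k\<^sup>2)\<bar> \<le> L * (8 * D / k)"
        using L(2)[OF sm[of x] sm[of x']] k L(1) by (meson mult_left_mono order_trans)
      then have "\<bar>bump ((y - x) \<bullet> (y - x) / k\<^sup>2) - bump ((y - x') \<bullet> (y - x') / k\<^sup>2)\<bar> / k\<^sup>2 \<le> L * (8 * D / k) / k\<^sup>2"
        by (rule divide_right_mono) simp
      then have "\<bar>mollk k x y - mollk k x' y\<bar> \<le> L * (8 * D / k) / k\<^sup>2"
        unfolding mollk_def diff_divide_distrib[symmetric] abs_divide by simp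
      moreover have "\<bar>u y\<bar> \<le> B0 + B1 * ln (1 + 3 * k)"
      proof -
        have "ln (1 + norm y) \<le> ln (1 + 3 * k)" using y by (intro ln_mono) auto
        then show ?thesis using g[of y] B mult_left_mono[of "ln (1 + norm y)" "ln (1 + 3 * k)" B1] by linarith
      qed
      ultimately have "\<bar>u y\<bar> * \<bar>mollk k x y - mollk k x' y\<bar> \<le> K"
        unfolding K_def by (intro mult_mono) (use B k in auto)
      then show ?thesis using True by (simp add: abs_mult)
    next
      case False
      have "mollk k z y = 0" if "norm z \<le> k" for z
        using mollk_support[of k z y] False that k norm_triangle_ineq2[of y z] by force
      then show ?thesis using False k by simp
    qed
    have "norm (LINT y|lborel. u y * (mollk k x y - mollk k x' y)) \<le> (LINT y|lborel. \<bar>u y * (mollk k x y - mollk k x' y)\<bar>)"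
      using integral_norm_bound[of lborel "\<lambda>y. u y * (mollk k x y - mollk k x' y)"] by simp
    also have "\<dots> \<le> (LINT y|lborel. K * indicator (cball 0 (3 * k)) (y::plane))"
    proof (rule integral_mono_AE)
      show "integrable lborel (\<lambda>y. \<bar>u y * (mollk k x y - mollk k x' y)\<bar>)"
        using moll_integrable[OF c, of k x] moll_integrable[OF c, of k x'] k by (auto simp: right_diff_distrib)
      show "integrable lborel (\<lambda>y::plane. K * indicator (cball 0 (3 * k)) y)"
        using k by (intro integrable_mult_right integrable_real_indicator) (auto simp: emeasure_cball_plane)
    qed (use pw in auto)
    also have "\<dots> = K * (pi * (3 * k)\<^sup>2)" using k by (simp add: measure_def emeasure_cball_plane)
    also have "\<dots> = b k" using k by (simp add: K_def b_def power2_eq_square)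
    finally show ?thesis .
  qed
  have "(\<lambda>k. b (real (Suc k))) \<longlonglongrightarrow> 0"
    unfolding b_def by real_asymp
  moreover have "\<forall>\<^sub>F k in sequentially. norm (LINT y|lborel. u y * (mollk (real (Suc k)) x y - mollk (real (Suc k)) x' y)) \<le> b (real (Suc k))"
  proof -
    obtain N :: nat where N: "norm x + norm x' \<le> real N" using real_arch_simple by blast
    have "norm x \<le> real N" "norm x' \<le> real N" using N norm_ge_zero[of x] norm_ge_zero[of x'] by linarith+
    then show ?thesis
      by (intro eventually_sequentiallyI[of N] bound) auto
  qed
  ultimately show ?thesis by (rule Lim_null_comparison[rotated])
qed

section \<open>Representation by potentials\<close>

text \<open>The distributional equation is tested with \<open>trunctest\<close>. On the left the
  small mollifiers give 2 * c0 times the difference of values of u and the large ones vanish thanks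
  to the logarithmic growth. On the right the test function is eventually equal to kap times the
  kernel difference for each fixed y, and \<open>trunclog_lipschitz\<close> permits dominated
  convergence.\<close>

lemma representation:
  fixes u g :: "plane \<Rightarrow> real"
  assumes c: "continuous_on UNIV u" and gr: "\<And>y. \<bar>u y\<bar> \<le> B0 + B1 * ln (1 + norm y)" and B: "0 \<le> B0" "0 \<le> B1"
    and [measurable]: "g \<in> borel_measurable borel"
    and distr: "neg_laplacian_distr u g"
    and int: "integrable lborel (\<lambda>y. g y * (ln (ratio x y) - ln (ratio x' y)))"
  shows "u x - u x' = cn * (LINT y|lborel. g y * (ln (ratio x y) - ln (ratio x' y)))"
proof -
  have um[measurable]: "u \<in> borel_measurable borel" using c by (rule borel_measurable_continuous_onI)
  define k where "k n = real (Suc n)" for n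
  have k1: "k n \<ge> 1" for n by (simp add: k_def)
  define lhs where "lhs n = (LINT y|lborel. u y * (- laplacian (trunctest (k n) x x') y))" for n
  have tm[measurable]: "trunctest a x x' \<in> borel_measurable borel" for a
    unfolding trunctest_def[abs_def] using Ck1_trunclog[of 0 a]
    by (auto intro!: borel_measurable_continuous_onI continuous_intros continuous_on_compose2[of UNIV "trunclog a"])
  have id: "lhs n = (LINT y|lborel. g y * trunctest (k n) x x' y)" for n
  proof -
    have lm: "(\<lambda>y. u y * (- laplacian (trunctest (k n) x x') y)) \<in> borel_measurable lborel"
      unfolding laplacian_trunctest[OF k1] by measurable
    have "(LINT y|lebesgue. u y * (- laplacian (trunctest (k n) x x') y)) = (LINT y|lebesgue. g y * trunctest (k n) x x' y)"
      using distr test_function_trunctest[OF k1] unfolding neg_laplacian_distr_def by blast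
    then show ?thesis unfolding lhs_def
      by (subst (asm) integral_completion[OF lm], subst (asm) integral_completion) auto
  qed
  have "lhs n = 2 * (((LINT y|lborel. u y * mollk (1 / k n) x y) - (LINT y|lborel. u y * mollk (1 / k n) x' y))
      - (LINT y|lborel. u y * (mollk (k n) x y - mollk (k n) x' y)))" for n
  proof -
    have kp: "0 < k n" "0 < 1 / k n" using k1[of n] by auto
    have i: "integrable lborel (\<lambda>y. u y * mollk (1 / k n) x y)" "integrable lborel (\<lambda>y. u y * mollk (1 / k n) x' y)"
      "integrable lborel (\<lambda>y. u y * (mollk (k n) x y - mollk (k n) x' y))"
      using moll_integrable[OF c kp(1)] moll_integrable[OF c kp(2)] by (auto simp: right_diff_distrib)
    have "lhs n = (LINT y|lborel. 2 * ((u y * mollk (1 / k n) x y - u y * mollk (1 / k n) x' y) - u y * (mollk (k n) x y - mollk (k n) x' y)))"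
      unfolding lhs_def laplacian_trunctest[OF k1]
      by (intro Bochner_Integration.integral_cong) (auto simp: algebra_simps)
    then show ?thesis using i by simp
  qed
  moreover have "(\<lambda>n. 2 * (((LINT y|lborel. u y * mollk (1 / k n) x y) - (LINT y|lborel. u y * mollk (1 / k n) x' y))
      - (LINT y|lborel. u y * (mollk (k n) x y - mollk (k n) x' y)))) \<longlonglongrightarrow> 2 * ((u x * c0 - u x' * c0) - 0)"
    unfolding k_def by (intro tendsto_intros moll_small[OF c] moll_large[OF c gr B])
  ultimately have l1: "lhs \<longlonglongrightarrow> 2 * ((u x * c0 - u x' * c0) - 0)" by presburger
  have l2: "lhs \<longlonglongrightarrow> (LINT y|lborel. kap * (g y * (ln (ratio x y) - ln (ratio x' y))))"
    unfolding id
  proof (rule integral_dominated_convergence)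
    show "integrable lborel (\<lambda>y. kap * \<bar>g y * (ln (ratio x y) - ln (ratio x' y))\<bar>)" using int by simp
    have lnsq: "ln ((y - z) \<bullet> (y - z)) = 2 * ln (norm (z - y))" if "y \<noteq> z" for y z :: plane
      using that by (simp add: power2_norm_eq_inner[symmetric] ln_realpow norm_minus_commute)
    have lnr: "ln (ratio x y) - ln (ratio x' y) = ln (norm (x' - y)) - ln (norm (x - y))" if "y \<noteq> x" "y \<noteq> x'" for y
      using that unfolding ratio_def by (simp add: ln_div)
    show "AE y in lborel. norm (g y * trunctest (k n) x x' y) \<le> kap * \<bar>g y * (ln (ratio x y) - ln (ratio x' y))\<bar>" for n
      using AE_lborel_neq[of x] AE_lborel_neq[of x']
    proof eventually_elim
      case (elim y)
      have "\<bar>trunctest (k n) x x' y\<bar> \<le> kap / 2 * \<bar>ln ((y - x) \<bullet> (y - x)) - ln ((y - x') \<bullet> (y - x'))\<bar>"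
        unfolding trunctest_def using elim by (intro trunclog_lipschitz k1) auto
      also have "\<dots> = kap * \<bar>ln (ratio x y) - ln (ratio x' y)\<bar>"
        unfolding lnsq[OF elim(1)] lnsq[OF elim(2)] lnr[OF elim] by (simp add: abs_if)
      finally have "\<bar>g y\<bar> * \<bar>trunctest (k n) x x' y\<bar> \<le> \<bar>g y\<bar> * (kap * \<bar>ln (ratio x y) - ln (ratio x' y)\<bar>)"
        by (intro mult_left_mono) auto
      then show ?case by (simp add: abs_mult mult_ac)
    qed
    show "AE y in lborel. (\<lambda>n. g y * trunctest (k n) x x' y) \<longlonglongrightarrow> kap * (g y * (ln (ratio x y) - ln (ratio x' y)))"
      using AE_lborel_neq[of x] AE_lborel_neq[of x']
    proof eventually_elim
      case (elim y)
      define s s' where "s = (y - x) \<bullet> (y - x)" and "s' = (y - x') \<bullet> (y - x')"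
      have sp: "s > 0" "s' > 0" using elim by (auto simp: s_def s'_def)
      have lim: "\<forall>\<^sub>F n in sequentially. 2 / (k n)\<^sup>2 \<le> t \<and> t < (k n)\<^sup>2" if "t > 0" for t
      proof -
        have "(\<lambda>n. 2 / (k n)\<^sup>2) \<longlonglongrightarrow> 0" unfolding k_def by real_asymp
        then have "\<forall>\<^sub>F n in sequentially. 2 / (k n)\<^sup>2 < t" using that by (rule order_tendstoD)
        moreover have "filterlim (\<lambda>n. (k n)\<^sup>2) at_top sequentially" unfolding k_def by real_asymp
        then have "\<forall>\<^sub>F n in sequentially. t < (k n)\<^sup>2" by (simp add: filterlim_at_top_dense)
        ultimately show ?thesis by eventually_elim auto
      qed
      have "\<forall>\<^sub>F n in sequentially. kap * (g y * (ln (ratio x y) - ln (ratio x' y))) = g y * trunctest (k n) x x' y"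
        using lim[OF sp(1)] lim[OF sp(2)]
      proof eventually_elim
        case (elim n)
        have "trunctest (k n) x x' y = kap / 2 * (ln s' - ln s)"
          unfolding trunctest_def s_def[symmetric] s'_def[symmetric]
          using trunclog_mid[OF k1, of n s] trunclog_mid[OF k1, of n s'] elim by (simp add: algebra_simps)
        also have "\<dots> = kap * (ln (ratio x y) - ln (ratio x' y))"
          unfolding s_def s'_def lnsq[OF \<open>y \<noteq> x\<close>] lnsq[OF \<open>y \<noteq> x'\<close>] lnr[OF \<open>y \<noteq> x\<close> \<open>y \<noteq> x'\<close>] by simp
        finally show ?case by simp
      qed
      then show ?case by (rule Lim_transform_eventually[OF tendsto_const])
    qed
  qed measurable
  have "2 * c0 * (u x - u x') = kap * (LINT y|lborel. g y * (ln (ratio x y) - ln (ratio x' y)))"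
    using LIMSEQ_unique[OF l1 l2] unfolding integral_mult_right_zero by (simp only: diff_0_right left_diff_distrib right_diff_distrib mult.assoc mult.commute[of c0])
  then have "u x - u x' = kap * (LINT y|lborel. g y * (ln (ratio x y) - ln (ratio x' y))) / (2 * c0)" using c0_pos
    by (metis less_irrefl mult_eq_0_iff nonzero_mult_div_cancel_left zero_neq_numeral)
  then show ?thesis unfolding cn_def by simp
qed

section \<open>Singular weights, Riesz bounds of the densities and their masses\<close>

lemma sing_weight_powr:
  "sing_weight I P b x = (\<Prod>l\<in>I. norm (x - P l) powr (-2 * b l))"
  unfolding sing_weight_def by (intro prod.cong) (simp_all add: powr_minus_divide)

lemma sing_weight_nonneg [simp]: "0 \<le> sing_weight I P b x"
  unfolding sing_weight_powr by (intro prod_nonneg) auto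

lemma sing_weight_measurable [measurable]:
  "sing_weight I P b \<in> borel_measurable (borel :: 'a::euclidean_space measure)"
  unfolding sing_weight_powr[abs_def] by measurable

text \<open>Near any point at most one factor is singular, since the points are separated by 2 d;
  all other near parts are bounded by the constant \<open>Cd\<close>. So the product of poles is at
  most a constant times their sum, while the far parts together give the full decay.\<close>

lemma sing_weight_bound:
  fixes P :: "nat \<Rightarrow> plane"
  assumes I: "finite I" "I \<noteq> {}" and inj: "inj_on P I" and b: "\<And>l. l \<in> I \<Longrightarrow> 0 \<le> b l"
  shows "\<exists>C\<ge>0. \<forall>x. sing_weight I P b x \<le>
    C * ((1 + norm x) powr (- (\<Sum>l\<in>I. 2 * b l)) * (\<Sum>l\<in>I. min 1 (norm (x - P l)) powr (-2 * b l)))"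
proof -
  \<comment> \<open>Half of the smallest distance; inserting 1 keeps the minimum defined when there
    are no pairs and ensures that d is at most 1.\<close>
  define d where "d = Min (insert 1 ((\<lambda>(k, l). dist (P k) (P l) / 2) ` {p \<in> I \<times> I. fst p \<noteq> snd p}))"
  have fin: "finite {p \<in> I \<times> I. fst p \<noteq> snd p}" using I by simp
  have d: "0 < d" "d \<le> 1"
  proof -
    show "d \<le> 1" unfolding d_def using fin by (intro Min_le) auto
    show "0 < d" unfolding d_def using fin inj by (subst Min_gr_iff) (auto simp: inj_on_def)
  qed
  have dd: "2 * d \<le> dist (P k) (P l)" if "k \<in> I" "l \<in> I" "k \<noteq> l" for k l
  proof -
    have "d \<le> dist (P k) (P l) / 2" unfolding d_def using fin that by (intro Min_le) force+
    then show ?thesis by simp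
  qed
  define Cd where "Cd = (\<Prod>l\<in>I. d powr (-2 * b l))"
  have dl: "1 \<le> d powr (-2 * b l)" if "l \<in> I" for l
    using powr_neg_ge_one[of d "2 * b l"] d b[OF that] by simp
  have Cd: "1 \<le> Cd" unfolding Cd_def using dl by (intro prod_ge_1) auto
  define E where "E = (\<Prod>l\<in>I. (2 + norm (P l)) powr (2 * b l))"
  have E: "0 \<le> E" unfolding E_def by (intro prod_nonneg) auto
  have "sing_weight I P b x \<le> E * Cd * ((1 + norm x) powr (- (\<Sum>l\<in>I. 2 * b l)) * (\<Sum>l\<in>I. min 1 (norm (x - P l)) powr (-2 * b l)))" for x
  proof (cases "\<exists>l\<in>I. x = P l")
    case True
    then have "sing_weight I P b x = 0" unfolding sing_weight_powr using I by auto
    then show ?thesis using E Cd by (auto intro!: mult_nonneg_nonneg sum_nonneg)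
  next
    case False
    then have q: "0 < norm (x - P l)" if "l \<in> I" for l using that by auto
    define mn where "mn l = min 1 (norm (x - P l)) powr (-2 * b l)" for l
    have mn1: "1 \<le> mn l" if "l \<in> I" for l
      using powr_neg_ge_one[of "min 1 (norm (x - P l))" "2 * b l"] q[OF that] b[OF that] unfolding mn_def by simp
    have mx: "max 1 (norm (x - P l)) powr (-2 * b l) \<le> (2 + norm (P l)) powr (2 * b l) * (1 + norm x) powr (-2 * b l)" if "l \<in> I" for l
    proof -
      have "1 + norm x \<le> 1 + norm (P l) + norm (x - P l)" using norm_triangle_sub[of x "P l"] by simp
      also have "\<dots> \<le> (2 + norm (P l)) * max 1 (norm (x - P l))"
        by (auto simp: max_def algebra_simps) (smt (verit) mult_left_le norm_ge_zero mult_left_mono mult_cancel_left1)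
      finally have "(1 + norm x) / (2 + norm (P l)) \<le> max 1 (norm (x - P l))"
        by (simp add: divide_le_eq add_pos_nonneg mult.commute)
      then have "max 1 (norm (x - P l)) powr (-2 * b l) \<le> ((1 + norm x) / (2 + norm (P l))) powr (-2 * b l)"
        using b[OF that] by (intro powr_mono2') (auto simp: add_pos_nonneg)
      also have "\<dots> = (2 + norm (P l)) powr (2 * b l) * (1 + norm x) powr (-2 * b l)"
        by (simp add: powr_divide add_pos_nonneg powr_minus divide_simps)
      finally show ?thesis .
    qed
    have "sing_weight I P b x = (\<Prod>l\<in>I. mn l) * (\<Prod>l\<in>I. max 1 (norm (x - P l)) powr (-2 * b l))"
      unfolding sing_weight_powr mn_def prod.distrib[symmetric]
      by (intro prod.cong) (auto simp: powr_split_min_max[symmetric])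
    also have "\<dots> \<le> (Cd * (\<Sum>l\<in>I. mn l)) * (E * (1 + norm x) powr (- (\<Sum>l\<in>I. 2 * b l)))"
    proof (intro mult_mono)
      have "(\<Prod>l\<in>I. max 1 (norm (x - P l)) powr (-2 * b l)) \<le> (\<Prod>l\<in>I. (2 + norm (P l)) powr (2 * b l) * (1 + norm x) powr (-2 * b l))"
        using mx by (intro prod_mono) auto
      also have "\<dots> = E * (\<Prod>l\<in>I. (1 + norm x) powr (-2 * b l))" unfolding E_def by (simp add: prod.distrib)
      also have "(\<Prod>l\<in>I. (1 + norm x) powr (-2 * b l)) = (1 + norm x) powr (\<Sum>l\<in>I. -2 * b l)"
        using I by (intro powr_sum[symmetric]) auto
      finally show "(\<Prod>l\<in>I. max 1 (norm (x - P l)) powr (-2 * b l)) \<le> E * (1 + norm x) powr (- (\<Sum>l\<in>I. 2 * b l))"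
        by (simp add: sum_negf)
      show "(\<Prod>l\<in>I. mn l) \<le> Cd * (\<Sum>l\<in>I. mn l)"
      proof (cases "\<exists>k\<in>I. norm (x - P k) < d")
        case True
        then obtain k where k: "k \<in> I" "norm (x - P k) < d" by blast
        have oth: "mn l \<le> d powr (-2 * b l)" if "l \<in> I - {k}" for l
        proof -
          have "2 * d \<le> norm (P k - x) + norm (x - P l)"
            using dd[OF k(1), of l] that norm_triangle_ineq[of "P k - x" "x - P l"] by (simp add: dist_norm)
          then have "d \<le> min 1 (norm (x - P l))" using k d by (simp add: norm_minus_commute)
          then show ?thesis unfolding mn_def using d b that by (intro powr_mono2') auto
        qed
        have "(\<Prod>l\<in>I. mn l) = mn k * (\<Prod>l\<in>I-{k}. mn l)" using I k by (simp add: prod.remove)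
        also have "\<dots> \<le> (\<Sum>l\<in>I. mn l) * Cd"
        proof (intro mult_mono)
          show "mn k \<le> (\<Sum>l\<in>I. mn l)" using I k mn1 by (intro member_le_sum) (auto intro: order_trans[OF zero_le_one])
          have "(\<Prod>l\<in>I-{k}. mn l) \<le> (\<Prod>l\<in>I-{k}. d powr (-2 * b l))"
            using oth by (intro prod_mono) (auto simp: mn_def)
          also have "\<dots> \<le> d powr (-2 * b k) * (\<Prod>l\<in>I-{k}. d powr (-2 * b l))"
            using mult_right_mono[OF dl[OF k(1)], of "\<Prod>l\<in>I-{k}. d powr (-2 * b l)"] by (simp add: prod_nonneg)
          also have "\<dots> = Cd" unfolding Cd_def using I k by (simp add: prod.remove)
          finally show "(\<Prod>l\<in>I-{k}. mn l) \<le> Cd" .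
        qed (auto intro!: prod_nonneg sum_nonneg simp: mn_def)
        finally show ?thesis by (simp add: mult.commute)
      next
        case False
        have "(\<Prod>l\<in>I. mn l) \<le> Cd" unfolding Cd_def
        proof (intro prod_mono conjI)
          fix l assume l: "l \<in> I"
          then have "d \<le> min 1 (norm (x - P l))" using False d by force
          then show "mn l \<le> d powr (-2 * b l)" unfolding mn_def using d b[OF l] by (intro powr_mono2') auto
        qed (auto simp: mn_def)
        also have "1 \<le> (\<Sum>l\<in>I. mn l)"
        proof -
          obtain k where "k \<in> I" using I by blast
          have "mn k \<le> (\<Sum>l\<in>I. mn l)" using I \<open>k \<in> I\<close> by (intro member_le_sum) (auto simp: mn_def)
          then show ?thesis using mn1[OF \<open>k \<in> I\<close>] by linarith
        qed
        then have "Cd \<le> Cd * (\<Sum>l\<in>I. mn l)" using Cd by (simp add: mult_le_cancel_left1)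
        finally show ?thesis .
      qed
    qed (use Cd in \<open>auto intro!: mult_nonneg_nonneg prod_nonneg sum_nonneg simp: mn_def\<close>)
    finally show ?thesis unfolding mn_def by (simp add: mult_ac)
  qed
  then show ?thesis using E Cd by (intro exI[of _ "E * Cd"]) auto
qed

text \<open>Decay of order 4 leaves order 4 - a after the moment weight, which is still more than 2,
  and each summand has a single pole. The factor with exponent 0 only adapts the integrand to the
  kernel estimate, where it switches off the third pole.\<close>

lemma riesz_of_singular_bound:
  fixes P :: "nat \<Rightarrow> plane" and f :: "plane \<Rightarrow> real"
  assumes I: "finite I" and C: "0 \<le> C" and a: "0 < a" "a \<le> 1" and b: "\<And>l. l \<in> I \<Longrightarrow> 0 \<le> b l \<and> 2 * b l + a < 2"
    and [measurable]: "f \<in> borel_measurable borel" and nn: "\<And>x. 0 \<le> f x"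
    and le: "\<And>x. f x \<le> C * ((1 + norm x) powr (-4) * (\<Sum>l\<in>I. min 1 (norm (x - P l)) powr (-2 * b l)))"
  shows "\<exists>C\<ge>0. riesz a C f"
proof -
  define bd where "bd l K \<longleftrightarrow> 0 \<le> K \<and> (\<forall>P x z. (\<integral>\<^sup>+y. ennreal (ratio x y powr a * (1 + norm y) powr (-(4 - a))
     * min 1 (norm (y - P)) powr (-(2 * b l)) * ratio y z powr 0) \<partial>lborel) \<le> ennreal K)" for l K
  have "\<exists>K. bd l K" if "l \<in> I" for l
    unfolding bd_def using a b[OF that] by (intro ratio_kernel_bound) auto
  then obtain K where bd: "\<forall>l\<in>I. bd l (K l)" using bchoice[of I bd] by blast
  have K: "\<And>l. l \<in> I \<Longrightarrow> 0 \<le> K l" "\<And>l P x z. l \<in> I \<Longrightarrow> (\<integral>\<^sup>+y. ennreal (ratio x y powr a * (1 + norm y) powr (-(4 - a))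
     * min 1 (norm (y - P)) powr (-(2 * b l)) * ratio y z powr 0) \<partial>lborel) \<le> ennreal (K l)"
    using bd unfolding bd_def by simp_all
  have "(\<integral>\<^sup>+y. ennreal (ratio x y powr a * (1 + norm y) powr a * f y) \<partial>lborel) \<le> ennreal (C * (\<Sum>l\<in>I. K l))" for x
  proof -
    have "(\<integral>\<^sup>+y. ennreal (ratio x y powr a * (1 + norm y) powr a * f y) \<partial>lborel)
      \<le> (\<integral>\<^sup>+y. ennreal C * (\<Sum>l\<in>I. ennreal (ratio x y powr a * (1 + norm y) powr (-(4 - a))
     * min 1 (norm (y - P l)) powr (-(2 * b l)) * ratio y 0 powr 0)) \<partial>lborel)"
    proof (rule nn_integral_mono_AE)
      show "AE y in lborel. ennreal (ratio x y powr a * (1 + norm y) powr a * f y) \<le> ennreal C * (\<Sum>l\<in>I. ennreal (ratio x y powr a * (1 + norm y) powr (-(4 - a))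
     * min 1 (norm (y - P l)) powr (-(2 * b l)) * ratio y 0 powr 0))"
        using AE_lborel_neq[of 0]
      proof eventually_elim
        case (elim y)
        have e: "(1 + norm y) powr (-(4 - a)) = (1 + norm y) powr a * (1 + norm y) powr (-4)"
          by (simp add: powr_add[symmetric])
        have "ratio x y powr a * (1 + norm y) powr a * f y \<le> ratio x y powr a * (1 + norm y) powr a * (C * ((1 + norm y) powr (-4) * (\<Sum>l\<in>I. min 1 (norm (y - P l)) powr (-2 * b l))))"
          using le[of y] by (intro mult_left_mono) auto
        also have "\<dots> = C * (\<Sum>l\<in>I. ratio x y powr a * (1 + norm y) powr (-(4 - a)) * min 1 (norm (y - P l)) powr (-(2 * b l)) * ratio y 0 powr 0)"
          unfolding e using ratio_pos[of y 0] elim by (simp add: sum_distrib_left mult_ac)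
        finally show ?case using C by (simp add: ennreal_mult[symmetric] sum_nonneg ennreal_leI)
      qed
    qed
    also have "\<dots> = ennreal C * (\<Sum>l\<in>I. \<integral>\<^sup>+y. ennreal (ratio x y powr a * (1 + norm y) powr (-(4 - a))
     * min 1 (norm (y - P l)) powr (-(2 * b l)) * ratio y 0 powr 0) \<partial>lborel)"
      by (subst nn_integral_cmult, measurable) (subst nn_integral_sum, auto)
    also have "\<dots> \<le> ennreal C * (\<Sum>l\<in>I. ennreal (K l))"
      by (intro mult_left_mono sum_mono K(2)) auto
    also have "\<dots> = ennreal (C * (\<Sum>l\<in>I. K l))"
      using C K(1) by (simp add: ennreal_mult sum_nonneg)
    finally show ?thesis .
  qed
  moreover have "0 \<le> C * (\<Sum>l\<in>I. K l)" using C K(1) by (intro mult_nonneg_nonneg sum_nonneg) auto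
  ultimately show ?thesis unfolding riesz_def using nn assms(6) by blast
qed

text \<open>Replacing \<open>ln (norm x)\<close> by \<open>ln (1 + norm x)\<close> removes the
  singularity at the origin, so continuity on a compact disc turns an asymptotic statement into a
  global bound.\<close>

lemma log_asymptotics_bound:
  fixes u :: "plane \<Rightarrow> real"
  assumes c: "continuous_on UNIV u" and l: "log_asymptotics \<gamma> u"
  shows "\<exists>B\<ge>0. \<forall>y. \<bar>u y - \<gamma> * ln (1 + norm y)\<bar> \<le> B"
proof -
  obtain K where K: "\<forall>\<^sub>F x in at_infinity. norm (u x - \<gamma> * ln (norm x)) \<le> K * norm (1::real)"
    using l unfolding log_asymptotics_def by (elim landau_o.bigE) auto
  then obtain R where R: "\<And>x. R \<le> norm x \<Longrightarrow> \<bar>u x - \<gamma> * ln (norm x)\<bar> \<le> K"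
    unfolding eventually_at_infinity by auto
  define v where "v y = u y - \<gamma> * ln (1 + norm y)" for y
  have vc: "continuous_on UNIV v" unfolding v_def
    by (intro continuous_intros c) auto
  have "bounded (v ` cball 0 (max R 1))"
    by (intro compact_imp_bounded compact_continuous_image continuous_on_subset[OF vc]) auto
  then obtain B1 where B1: "\<And>y. y \<in> cball 0 (max R 1) \<Longrightarrow> \<bar>v y\<bar> \<le> B1" unfolding bounded_iff real_norm_def by blast
  have "\<bar>v y\<bar> \<le> \<bar>B1\<bar> + \<bar>K\<bar> + \<bar>\<gamma>\<bar> * ln 2" for y
  proof (cases "y \<in> cball 0 (max R 1)")
    case True
    have "0 \<le> \<bar>\<gamma>\<bar> * ln 2" by simp
    then show ?thesis using B1[OF True] by linarith
  next
    case False
    then have y: "R \<le> norm y" "1 \<le> norm y" by auto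
    have "ln (norm y) \<le> ln (1 + norm y)" using y by (intro ln_mono) auto
    moreover have "ln (1 + norm y) \<le> ln (2 * norm y)" using y by (intro ln_mono) auto
    moreover have "ln (2 * norm y) = ln 2 + ln (norm y)" using y by (subst ln_mult) auto
    ultimately have "\<bar>ln (norm y) - ln (1 + norm y)\<bar> \<le> ln 2" by linarith
    then have "\<bar>\<gamma> * (ln (norm y) - ln (1 + norm y))\<bar> \<le> \<bar>\<gamma>\<bar> * ln 2" unfolding abs_mult by (intro mult_left_mono) auto
    moreover have "v y = (u y - \<gamma> * ln (norm y)) + \<gamma> * (ln (norm y) - ln (1 + norm y))"
      by (simp add: v_def algebra_simps)
    ultimately show ?thesis using R[OF y(1)] by linarith
  qed
  moreover have "0 \<le> \<bar>B1\<bar> + \<bar>K\<bar> + \<bar>\<gamma>\<bar> * ln 2" by simp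
  ultimately show ?thesis unfolding v_def by blast
qed

text \<open>The balance of exponents is exactly the decay (1 + |x|)^(-4): the weight contributes the
  sum of 2 * b l and the exponential contributes 2 * m.\<close>

lemma density_riesz:
  fixes P :: "nat \<Rightarrow> plane"
  assumes I: "finite I" "I \<noteq> {}" and inj: "inj_on P I" and b: "\<And>l. l \<in> I \<Longrightarrow> 0 \<le> b l \<and> 2 * b l + a < 2"
    and a: "0 < a" "a \<le> 1" and s: "(\<Sum>l\<in>I. 2 * b l) + 2 * m = 4"
    and c: "continuous_on UNIV u" and l: "log_asymptotics (-m) u" and k: "0 \<le> k"
  shows "\<exists>C\<ge>0. riesz a C (\<lambda>y. k * sing_weight I P b y * exp (2 * u y))"
proof -
  obtain C where C: "C \<ge> 0" "\<And>x. sing_weight I P b x \<le>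
    C * ((1 + norm x) powr (- (\<Sum>l\<in>I. 2 * b l)) * (\<Sum>l\<in>I. min 1 (norm (x - P l)) powr (-2 * b l)))"
    using sing_weight_bound[OF I inj, of b] b by auto
  obtain B where B: "B \<ge> 0" "\<And>y. \<bar>u y - (-m) * ln (1 + norm y)\<bar> \<le> B"
    using log_asymptotics_bound[OF c l] by auto
  have [measurable]: "u \<in> borel_measurable borel" using c by (rule borel_measurable_continuous_onI)
  have e: "exp (2 * u x) \<le> exp (2 * B) * (1 + norm x) powr (-2 * m)" for x
  proof -
    have "exp (2 * u x) \<le> exp (2 * B + (-2 * m) * ln (1 + norm x))" using B(2)[of x] by (simp add: abs_le_iff)
    also have "\<dots> = exp (2 * B) * (1 + norm x) powr (-2 * m)" unfolding exp_add powr_def by simp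
    finally show ?thesis .
  qed
  show ?thesis
  proof (rule riesz_of_singular_bound[OF I(1) _ a b, of "k * C * exp (2 * B)"])
    fix x
    define S where "S = (\<Sum>l\<in>I. min 1 (norm (x - P l)) powr (-2 * b l))"
    have S0: "0 \<le> S" unfolding S_def by (intro sum_nonneg) auto
    have "k * sing_weight I P b x * exp (2 * u x) \<le> k * (C * ((1 + norm x) powr (- (\<Sum>l\<in>I. 2 * b l)) * S)) * (exp (2 * B) * (1 + norm x) powr (-2 * m))"
      using C(2)[of x] e[of x] k C(1) S0 unfolding S_def[symmetric]
      by (intro mult_mono mult_left_mono) auto
    also have "\<dots> = k * C * exp (2 * B) * (((1 + norm x) powr (- (\<Sum>l\<in>I. 2 * b l)) * (1 + norm x) powr (-2 * m)) * S)"
      by (simp add: mult_ac)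
    also have "(1 + norm x) powr (- (\<Sum>l\<in>I. 2 * b l)) * (1 + norm x) powr (-2 * m) = (1 + norm x) powr (-4)"
      unfolding powr_add[symmetric] using s by (intro arg_cong[of _ _ "\<lambda>e. (1 + norm x) powr e"]) linarith
    finally show "k * sing_weight I P b x * exp (2 * u x) \<le> k * C * exp (2 * B) * ((1 + norm x) powr (-4) * S)" .
  qed (use k C B in auto)
qed

text \<open>Factors with exponent 0 are 1 away from their point but 0 at the point itself, so the
  two forms of the weight agree off a finite set only.\<close>

lemma sing_weight_sing_exponent:
  assumes "\<And>l. l \<in> {1..7} \<Longrightarrow> x \<noteq> P l"
  shows "sing_weight {1..7} P (sing_exponent \<beta> 1) x = sing_weight {1..4} P \<beta> x"
    and "sing_weight {1..7} P (sing_exponent \<beta> 2) x = sing_weight {5..7} P \<beta> x"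
  unfolding sing_weight_def sing_exponent_def using assms
  by (intro prod.mono_neutral_cong_right; auto)+

lemma riesz_mono: "riesz a C f \<Longrightarrow> C \<le> C' \<Longrightarrow> riesz a C' f"
  unfolding riesz_def by (meson ennreal_leI order_trans)

lemma ln_coeff_zero:
  assumes "\<And>x::plane. norm x \<ge> 1 \<Longrightarrow> \<bar>c * ln (norm x)\<bar> \<le> K"
  shows "c = 0"
proof (rule ccontr)
  assume c: "c \<noteq> 0"
  define t where "t = exp (\<bar>(\<bar>K\<bar> + 1) / c\<bar>)"
  have "t \<ge> 1" by (simp add: t_def)
  then obtain x :: plane where x: "norm x = t" using vector_choose_size[of t] by auto
  have "\<bar>c * ln (norm x)\<bar> = \<bar>K\<bar> + 1" using c unfolding x t_def by (simp add: abs_mult abs_divide)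
  then show False using assms[of x] x \<open>t \<ge> 1\<close> by linarith
qed

text \<open>Once the solutions are combinations of potentials, comparing coefficients of
  \<open>ln (norm x)\<close> at infinity gives 2 * M1 - M2 = 2 * M2 - M1 = \<beta> 4, which forces
  both masses to be \<beta> 4.\<close>

lemma toda_potential:
  fixes P :: "nat \<Rightarrow> plane"
  assumes sol: "toda_solution \<beta> P u1 u2" and inj: "inj_on P {1..4}" "inj_on P {5..7}"
    and \<beta>: "\<And>l. l \<in> {1..7} \<Longrightarrow> 0 < \<beta> l \<and> \<beta> l < 1"
    and s: "\<beta> 4 + (\<Sum>l=1..4. \<beta> l) = 2" "\<beta> 4 + (\<Sum>l=5..7. \<beta> l) = 2"
    and a: "0 < a" "a \<le> 1" "\<And>l. l \<in> {1..7} \<Longrightarrow> 2 * \<beta> l + a < 2"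
  defines "f1 \<equiv> (\<lambda>y. cn * sing_weight {1..4} P \<beta> y * exp (2 * u1 y))"
    and "f2 \<equiv> (\<lambda>y. cn * sing_weight {5..7} P \<beta> y * exp (2 * u2 y))"
  shows "\<exists>C A1 A2. 0 \<le> C \<and> riesz a C f1 \<and> riesz a C f2 \<and> (LINT y|lborel. f1 y) = \<beta> 4 \<and> (LINT y|lborel. f2 y) = \<beta> 4
    \<and> (\<forall>x. u1 x = A1 + 2 * pot f1 x - pot f2 x) \<and> (\<forall>x. u2 x = A2 + 2 * pot f2 x - pot f1 x)"
proof -
  define K where "K i = sing_weight {1..7} P (sing_exponent \<beta> i)" for i
  have c: "continuous_on UNIV u1" "continuous_on UNIV u2"
    and D: "neg_laplacian_distr u1 (\<lambda>x. 2 * K 1 x * exp (2 * u1 x) - K 2 x * exp (2 * u2 x))"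
      "neg_laplacian_distr u2 (\<lambda>x. 2 * K 2 x * exp (2 * u2 x) - K 1 x * exp (2 * u1 x))"
    and l: "log_asymptotics (- \<beta> 4) u1" "log_asymptotics (- \<beta> 4) u2"
    using sol unfolding toda_solution_def Let_def K_def by auto
  have [measurable]: "u1 \<in> borel_measurable borel" "u2 \<in> borel_measurable borel"
    using c by (simp_all add: borel_measurable_continuous_onI)
  have [measurable]: "K i \<in> borel_measurable borel" for i unfolding K_def by measurable
  have "\<exists>C\<ge>0. riesz a C f1" unfolding f1_def
    by (rule density_riesz[OF _ _ inj(1) _ a(1,2) _ c(1) l(1)])
      (use \<beta> a s cn_pos in \<open>auto simp: sum_distrib_left[symmetric] intro: less_imp_le\<close>)
  then obtain C1 where C1: "0 \<le> C1" "riesz a C1 f1" by blast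
  have "\<exists>C\<ge>0. riesz a C f2" unfolding f2_def
    by (rule density_riesz[OF _ _ inj(2) _ a(1,2) _ c(2) l(2)])
      (use \<beta> a s cn_pos in \<open>auto simp: sum_distrib_left[symmetric] intro: less_imp_le\<close>)
  then obtain C2 where C2: "0 \<le> C2" "riesz a C2 f2" by blast
  define C where "C = max C1 C2"
  have C: "0 \<le> C" using C1 C2 by (simp add: C_def)
  have r: "riesz a C f1" "riesz a C f2"
    using riesz_mono[OF C1(2), of C] riesz_mono[OF C2(2), of C] by (simp_all add: C_def)
  note lg = riesz_log[OF r(1) a(1,2) C] riesz_log[OF r(2) a(1,2) C]
  note [measurable] = riesz_measurable[OF r(1) a(1,2) C] riesz_measurable[OF r(2) a(1,2) C]
  have K_ae: "AE y in lborel. cn * (K 1 y * exp (2 * u1 y)) = f1 y \<and> cn * (K 2 y * exp (2 * u2 y)) = f2 y"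
  proof -
    have "AE y in lborel. \<forall>l\<in>{1..7}. y \<noteq> P l"
      using AE_lborel_neq by (intro AE_finite_allI) auto
    then show ?thesis
    proof eventually_elim
      case (elim y)
      then show ?case using sing_weight_sing_exponent[of y P \<beta>] by (auto simp: K_def f1_def f2_def)
    qed
  qed
  have rep: "u x - u x' = 2 * (pot f x - pot f x') - (pot g x - pot g x')"
    if c: "continuous_on UNIV u" and D: "neg_laplacian_distr u (\<lambda>x. 2 * k1 x - k2 x)" and l: "log_asymptotics (-m) u"
      and ae: "AE y in lborel. cn * k1 y = f y \<and> cn * k2 y = g y"
      and meas[measurable]: "k1 \<in> borel_measurable borel" "k2 \<in> borel_measurable borel" and rf: "riesz a C f" and rg: "riesz a C g"
    for u k1 k2 f g x x' m
  proof -
    note [measurable] = riesz_measurable[OF rf a(1,2) C] riesz_measurable[OF rg a(1,2) C]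
    define e where "e y = ln (ratio x y) - ln (ratio x' y)" for y
    have [measurable]: "e \<in> borel_measurable borel" unfolding e_def by measurable
    have i: "integrable lborel (\<lambda>y. f y * e y)" "integrable lborel (\<lambda>y. g y * e y)"
      using riesz_log[OF rf a(1,2) C] riesz_log[OF rg a(1,2) C] unfolding e_def by (auto simp: right_diff_distrib)
    have ae': "AE y in lborel. 2 * (f y * e y) - g y * e y = cn * ((2 * k1 y - k2 y) * e y)"
      using ae
    proof eventually_elim
      case (elim y)
      then have "f y = cn * k1 y" "g y = cn * k2 y" by auto
      then show ?case by (simp add: algebra_simps)
    qed
    have i2: "integrable lborel (\<lambda>y. 2 * (f y * e y) - g y * e y)" using i by simp
    have "integrable lborel (\<lambda>y. cn * ((2 * k1 y - k2 y) * e y))"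
      by (rule integrable_cong_AE_imp[OF i2]) (use ae' in \<open>auto simp: eq_commute\<close>)
    then have i3: "integrable lborel (\<lambda>y. (2 * k1 y - k2 y) * e y)" using cn_pos by simp
    obtain B where B: "B \<ge> 0" "\<And>y. \<bar>u y - (-m) * ln (1 + norm y)\<bar> \<le> B" using log_asymptotics_bound[OF c l] by auto
    have gr: "\<bar>u y\<bar> \<le> B + \<bar>m\<bar> * ln (1 + norm y)" for y
    proof -
      have "\<bar>m * ln (1 + norm y)\<bar> = \<bar>m\<bar> * ln (1 + norm y)" by (simp add: abs_mult)
      then show ?thesis using B(2)[of y] by linarith
    qed
    have "u x - u x' = cn * (LINT y|lborel. (2 * k1 y - k2 y) * e y)"
      unfolding e_def by (rule representation[OF c gr B(1) _ _ D i3[unfolded e_def]]) auto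
    also have "\<dots> = (LINT y|lborel. cn * ((2 * k1 y - k2 y) * e y))" by simp
    also have "\<dots> = (LINT y|lborel. 2 * (f y * e y) - g y * e y)"
      using ae' by (intro integral_cong_AE) (auto simp: eq_commute)
    also have "\<dots> = 2 * (LINT y|lborel. f y * e y) - (LINT y|lborel. g y * e y)" using i by simp
    also have "(LINT y|lborel. f y * e y) = pot f x - pot f x'" unfolding e_def by (rule pot_diff_eq[OF rf a(1,2) C, symmetric])
    also have "(LINT y|lborel. g y * e y) = pot g x - pot g x'" unfolding e_def by (rule pot_diff_eq[OF rg a(1,2) C, symmetric])
    finally show ?thesis .
  qed
  have rep1: "u1 x - u1 0 = 2 * (pot f1 x - pot f1 0) - (pot f2 x - pot f2 0)" for x
    by (rule rep[OF c(1) _ l(1) _ _ _ r(1) r(2), of "\<lambda>y. K 1 y * exp (2 * u1 y)" "\<lambda>y. K 2 y * exp (2 * u2 y)"])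
      (use D(1) K_ae in \<open>auto simp: mult.assoc\<close>)
  have rep2: "u2 x - u2 0 = 2 * (pot f2 x - pot f2 0) - (pot f1 x - pot f1 0)" for x
    by (rule rep[OF c(2) _ l(2) _ _ _ r(2) r(1), of "\<lambda>y. K 2 y * exp (2 * u2 y)" "\<lambda>y. K 1 y * exp (2 * u1 y)"])
      (use D(2) K_ae in \<open>auto simp: mult.assoc\<close>)
  define A1 where "A1 = u1 0 - 2 * pot f1 0 + pot f2 0"
  define A2 where "A2 = u2 0 - 2 * pot f2 0 + pot f1 0"
  have A: "u1 x = A1 + 2 * pot f1 x - pot f2 x" "u2 x = A2 + 2 * pot f2 x - pot f1 x" for x
    using rep1[of x] rep2[of x] by (simp_all add: A1_def A2_def)
  define M1 where "M1 = (LINT y|lborel. f1 y)"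
  define M2 where "M2 = (LINT y|lborel. f2 y)"
  \<comment> \<open>\<open>pot_far\<close> says that each potential is minus its mass times the
    logarithm up to a bounded term, so a nonzero coefficient would contradict the prescribed
    asymptotics.\<close>
  have mass: "2 * M - N = m"
    if c: "continuous_on UNIV u" and l: "log_asymptotics (-m) u" and A: "\<And>x. u x = A + 2 * pot f x - pot g x"
      and rf: "riesz a C f" and rg: "riesz a C g" and M: "M = (LINT y|lborel. f y)" and N: "N = (LINT y|lborel. g y)"
    for u f g A m M N
  proof -
    obtain B where B: "B \<ge> 0" "\<And>y. \<bar>u y - (-m) * ln (1 + norm y)\<bar> \<le> B" using log_asymptotics_bound[OF c l] by auto
    have "2 * M - N - m = 0"
    proof (rule ln_coeff_zero)
      fix x :: plane assume x: "norm x \<ge> 1"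
      have "0 \<le> pot f x + ln (norm x) * M" "pot f x + ln (norm x) * M \<le> 2 * C / a"
        using pot_far[OF rf a(1,2) C x] M by auto
      moreover have "0 \<le> pot g x + ln (norm x) * N" "pot g x + ln (norm x) * N \<le> 2 * C / a"
        using pot_far[OF rg a(1,2) C x] N by auto
      moreover have "\<bar>m * (ln (1 + norm x) - ln (norm x))\<bar> \<le> \<bar>m\<bar> * ln 2"
      proof -
        have "ln (norm x) \<le> ln (1 + norm x)" "ln (1 + norm x) \<le> ln (2 * norm x)" using x by (auto intro!: ln_mono)
        moreover have "ln (2 * norm x) = ln 2 + ln (norm x)" using x by (subst ln_mult) auto
        ultimately show ?thesis unfolding abs_mult by (intro mult_left_mono) auto
      qed
      moreover have "(2 * M - N - m) * ln (norm x) = 2 * (pot f x + ln (norm x) * M) - (pot g x + ln (norm x) * N)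
        - (u x - (-m) * ln (1 + norm x)) + A + m * (ln (1 + norm x) - ln (norm x))"
        unfolding A[of x] by (simp add: algebra_simps)
      moreover have "0 \<le> p \<Longrightarrow> p \<le> D \<Longrightarrow> 0 \<le> q \<Longrightarrow> q \<le> D \<Longrightarrow> \<bar>t\<bar> \<le> T \<Longrightarrow> X = 2 * p - q - v + A + t \<Longrightarrow> \<bar>v\<bar> \<le> B \<Longrightarrow>
         \<bar>X\<bar> \<le> 3 * D + B + \<bar>A\<bar> + T" for p q D t T X v :: real by linarith
      ultimately show "\<bar>(2 * M - N - m) * ln (norm x)\<bar> \<le> 3 * (2 * C / a) + B + \<bar>A\<bar> + \<bar>m\<bar> * ln 2"
        using B(2)[of x] by blast
    qed
    then show ?thesis by simp
  qed
  have "2 * M1 - M2 = \<beta> 4" by (rule mass[OF c(1) l(1) A(1) r M1_def M2_def])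
  moreover have "2 * M2 - M1 = \<beta> 4" by (rule mass[OF c(2) l(2) A(2) r(2) r(1) M2_def M1_def])
  ultimately have "M1 = \<beta> 4" "M2 = \<beta> 4" by linarith+
  then show ?thesis using C r A unfolding M1_def M2_def by blast
qed

section \<open>Local estimates for potentials\<close>

lemma restrict_integral_le:
  assumes r: "riesz a C f" and a: "0 < a" "a \<le> 1" and C: "0 \<le> C" and S: "S \<in> sets borel"
  shows "(LINT y|lborel. indicator S y * f y) \<le> (LINT y|lborel. f y)"
  using riesz_integrable[OF r a C] riesz_integrable[OF riesz_restrict[OF r S] a C] riesz_nonneg[OF r a C]
  by (intro integral_mono) (auto simp: indicator_def)

lemma ratio_le_separated:
  assumes "0 < d" "d \<le> norm (x - y)"
  shows "ratio x y \<le> 1 + (1 + norm x) / d"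
proof -
  have n: "0 < norm (x - y)" using assms by linarith
  have "1 + norm y \<le> norm (x - y) + (1 + norm x)" using norm_triangle_sub[of y x] by (simp add: norm_minus_commute)
  then have "ratio x y \<le> (norm (x - y) + (1 + norm x)) / norm (x - y)"
    unfolding ratio_def by (intro divide_right_mono) auto
  also have "\<dots> = 1 + (1 + norm x) / norm (x - y)" using n by (simp add: add_divide_distrib)
  also have "\<dots> \<le> 1 + (1 + norm x) / d" using assms n by (intro add_left_mono divide_left_mono) auto
  finally show ?thesis .
qed

lemma pot_separated:
  assumes r: "riesz a C f" and a: "0 < a" "a \<le> 1" and C: "0 \<le> C"
    and d: "0 < d" and sep: "\<And>y. y \<in> S \<Longrightarrow> d \<le> norm (x - y)" and S: "S \<in> sets borel"
  shows "pot (\<lambda>y. indicator S y * f y) x \<le> ln (1 + (1 + norm x) / d) * (LINT y|lborel. f y)"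
proof -
  have f0: "0 \<le> f y" for y by (rule riesz_nonneg[OF r a C])
  have ln0: "0 \<le> ln (1 + (1 + norm x) / d)" using d by simp
  have "pot (\<lambda>y. indicator S y * f y) x \<le> (LINT y|lborel. ln (1 + (1 + norm x) / d) * f y)"
    unfolding pot_def
  proof (rule integral_mono)
    show "integrable lborel (\<lambda>y. indicator S y * f y * ln (ratio x y))"
      by (rule riesz_log[OF riesz_restrict[OF r S] a C])
    show "integrable lborel (\<lambda>y. ln (1 + (1 + norm x) / d) * f y)" using riesz_integrable[OF r a C] by simp
    show "indicator S y * f y * ln (ratio x y) \<le> ln (1 + (1 + norm x) / d) * f y" for y
    proof (cases "y \<in> S")
      case True
      have "x \<noteq> y" using sep[OF True] d by auto
      then have "ln (ratio x y) \<le> ln (1 + (1 + norm x) / d)"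
        using ratio_le_separated[OF d sep[OF True]] ratio_pos by (intro ln_mono) auto
      then have "f y * ln (ratio x y) \<le> f y * ln (1 + (1 + norm x) / d)" by (intro mult_left_mono f0)
      then show ?thesis using True by (simp add: mult.commute)
    qed (use f0 ln0 in simp)
  qed
  then show ?thesis by simp
qed

lemma nn_integral_restrict_le:
  assumes r: "riesz a C f" and a: "0 < a" "a \<le> 1" and C: "0 \<le> C" and S: "S \<in> sets borel"
    and M: "(LINT y|lborel. indicator S y * f y) \<le> M"
  shows "(\<integral>\<^sup>+y. ennreal (indicator S y * f y) \<partial>lborel) \<le> ennreal M"
  using M riesz_integrable[OF riesz_restrict[OF r S] a C] riesz_nonneg[OF r a C]
  by (subst nn_integral_eq_integral) (auto intro: ennreal_leI)

text \<open>Mass outside the disc of radius r stays at distance r/2 from the smaller disc and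
  changes \<open>exp (4 * pot f y)\<close> only by a bounded factor \<open>exp (4 * c1)\<close>.
  Hence only the local mass \<open>M0\<close>, not the total one, enters the integrability
  condition.\<close>

lemma local_jensen:
  fixes Q :: plane
  assumes nn: "0 \<le> \<tau>" "0 \<le> a" "0 < M0" "0 < r" "0 \<le> m" and t: "\<tau> + a + 4 * M0 < 2"
  shows "\<exists>C\<ge>0. \<forall>f a0 C0 k Ck x. riesz a0 C0 f \<longrightarrow> 0 < a0 \<longrightarrow> a0 \<le> 1 \<longrightarrow> 0 \<le> C0 \<longrightarrow>
    (LINT y|lborel. f y) \<le> m \<longrightarrow> (LINT y|lborel. indicator (ball Q r) y * f y) \<le> M0 \<longrightarrow> 0 \<le> Ck \<longrightarrow>
    (\<forall>y. y \<in> ball Q (r/2) \<longrightarrow> y \<noteq> Q \<longrightarrow> 0 \<le> k y \<and> k y \<le> Ck * norm (y - Q) powr (-\<tau>)) \<longrightarrow>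
    (\<integral>\<^sup>+y. indicator (ball Q (r/2)) y * ennreal (ratio x y powr a * k y * exp (4 * pot f y)) \<partial>lborel) \<le> ennreal (C * Ck)"
proof -
  define K where "K = 1 + norm Q + r"
  have K: "K \<ge> 1" using nn by (simp add: K_def)
  define c1 where "c1 = ln (1 + K / (r/2)) * m"
  obtain C where C: "C \<ge> 0" and J: "\<And>f P k D Ck x. f \<in> borel_measurable borel \<Longrightarrow> (\<forall>y. 0 \<le> f y) \<Longrightarrow>
     (\<integral>\<^sup>+y. ennreal (f y) \<partial>lborel) \<le> ennreal M0 \<Longrightarrow> 0 \<le> Ck \<Longrightarrow>
     (\<forall>y. y \<in> D \<longrightarrow> y \<noteq> P \<longrightarrow> k y \<le> Ck * ((1 + norm y) powr (-3) * min 1 (norm (y - P)) powr (-\<tau>))) \<Longrightarrow>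
     (\<integral>\<^sup>+y. indicator D y * ennreal (ratio x y powr a * k y * exp (4 * pot f y)) \<partial>lborel) \<le> ennreal (C * Ck)"
    using jensen_kernel[of \<tau> a M0 3] nn t by auto
  define E where "E = exp (4 * c1) * K powr 3"
  have E: "0 \<le> E" by (simp add: E_def)
  show ?thesis
  proof (intro exI[of _ "C * E"] conjI allI impI)
    fix f :: "plane \<Rightarrow> real" and a0 C0 and k :: "plane \<Rightarrow> real" and Ck x
    assume r: "riesz a0 C0 f" and a0: "0 < a0" "a0 \<le> 1" and C0: "0 \<le> C0" and m: "(LINT y|lborel. f y) \<le> m"
      and M: "(LINT y|lborel. indicator (ball Q r) y * f y) \<le> M0" and Ck: "0 \<le> Ck"
      and k: "\<forall>y. y \<in> ball Q (r/2) \<longrightarrow> y \<noteq> Q \<longrightarrow> 0 \<le> k y \<and> k y \<le> Ck * norm (y - Q) powr (-\<tau>)"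
    define g where "g y = indicator (ball Q r) y * f y" for y
    have rg: "riesz a0 C0 g" unfolding g_def by (rule riesz_restrict[OF r]) simp
    have pw: "pot f y \<le> pot g y + c1" if y: "y \<in> ball Q (r/2)" for y
    proof -
      have "norm y \<le> norm Q + r/2" using y norm_triangle_sub[of y Q] by (simp add: dist_norm norm_minus_commute)
      then have ny: "1 + norm y \<le> K" using nn unfolding K_def by linarith
      have "pot f y = pot g y + pot (\<lambda>z. indicator (- ball Q r) z * f z) y"
        unfolding g_def by (rule pot_split[OF r a0 C0]) simp
      also have "pot (\<lambda>z. indicator (- ball Q r) z * f z) y \<le> ln (1 + (1 + norm y) / (r/2)) * (LINT y|lborel. f y)"
      proof (rule pot_separated[OF r a0 C0])
        fix z assume "z \<in> - ball Q r"
        then show "r/2 \<le> norm (y - z)" using y dist_triangle[of Q z y] by (simp add: dist_norm)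
      qed (use nn in auto)
      also have "\<dots> \<le> c1" unfolding c1_def
        using ny nn m K riesz_nonneg[OF r a0 C0]
        by (intro mult_mono ln_mono add_left_mono divide_right_mono) (auto simp: add_pos_nonneg)
      finally show ?thesis by simp
    qed
    have "(\<integral>\<^sup>+y. indicator (ball Q (r/2)) y * ennreal (ratio x y powr a * k y * exp (4 * pot f y)) \<partial>lborel) \<le>
      (\<integral>\<^sup>+y. indicator (ball Q (r/2)) y * ennreal (ratio x y powr a * (k y * exp (4 * c1)) * exp (4 * pot g y)) \<partial>lborel)"
    proof (rule nn_integral_mono_AE)
      show "AE y in lborel. indicator (ball Q (r/2)) y * ennreal (ratio x y powr a * k y * exp (4 * pot f y))
         \<le> indicator (ball Q (r/2)) y * ennreal (ratio x y powr a * (k y * exp (4 * c1)) * exp (4 * pot g y))"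
        using AE_lborel_neq[of Q]
      proof eventually_elim
        case (elim y)
        show ?case
        proof (cases "y \<in> ball Q (r/2)")
          case True
          have "exp (4 * pot f y) \<le> exp (4 * c1) * exp (4 * pot g y)" using pw[OF True] by (simp add: exp_add[symmetric])
          then have "ratio x y powr a * k y * exp (4 * pot f y) \<le> ratio x y powr a * k y * (exp (4 * c1) * exp (4 * pot g y))"
            using k True elim by (intro mult_left_mono mult_nonneg_nonneg) auto
          then show ?thesis using True by (simp add: ennreal_leI mult_ac)
        qed simp
      qed
    qed
    also have "\<dots> \<le> ennreal (C * (Ck * E))"
    proof (rule J[where P = Q])
      show "(\<integral>\<^sup>+y. ennreal (g y) \<partial>lborel) \<le> ennreal M0"
        unfolding g_def using M by (intro nn_integral_restrict_le[OF r a0 C0]) auto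
      show "\<forall>y. y \<in> ball Q (r/2) \<longrightarrow> y \<noteq> Q \<longrightarrow> k y * exp (4 * c1) \<le> Ck * E * ((1 + norm y) powr (-3) * min 1 (norm (y - Q)) powr (-\<tau>))"
      proof (intro allI impI)
        fix y assume y: "y \<in> ball Q (r/2)" "y \<noteq> Q"
        have "norm y \<le> norm Q + r/2" using y norm_triangle_sub[of y Q] by (simp add: dist_norm norm_minus_commute)
        then have ny: "1 + norm y \<le> K" using nn unfolding K_def by linarith
        then have "(1 + norm y) powr 3 \<le> K powr 3" by (intro powr_mono2) auto
        then have K3: "1 \<le> K powr 3 * (1 + norm y) powr (-3)" by (simp add: powr_minus field_simps)
        have "norm (y - Q) powr (-\<tau>) \<le> min 1 (norm (y - Q)) powr (-\<tau>)"
          using y nn by (intro powr_mono2') auto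
        then have "k y \<le> Ck * (1 * min 1 (norm (y - Q)) powr (-\<tau>))"
          using k y Ck by (smt (verit, best) mult_left_mono mult_1)
        also have "\<dots> \<le> Ck * ((K powr 3 * (1 + norm y) powr (-3)) * min 1 (norm (y - Q)) powr (-\<tau>))"
          using K3 Ck by (intro mult_left_mono mult_right_mono) auto
        finally have "k y * exp (4 * c1) \<le> Ck * ((K powr 3 * (1 + norm y) powr (-3)) * min 1 (norm (y - Q)) powr (-\<tau>)) * exp (4 * c1)"
          by (intro mult_right_mono) auto
        then show "k y * exp (4 * c1) \<le> Ck * E * ((1 + norm y) powr (-3) * min 1 (norm (y - Q)) powr (-\<tau>))"
          by (simp add: E_def mult_ac)
      qed
    qed (use riesz_measurable[OF rg a0 C0] riesz_nonneg[OF rg a0 C0] Ck E in auto)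
    finally show "(\<integral>\<^sup>+y. indicator (ball Q (r/2)) y * ennreal (ratio x y powr a * k y * exp (4 * pot f y)) \<partial>lborel) \<le> ennreal (C * E * Ck)"
      by (simp add: mult_ac)
  qed (use C E in simp)
qed

text \<open>Near part: the sup bound \<open>S\<close> times the integral of the kernel 1/|x - y|
  over the disc. Far part: the mass divided by the distance \<open>d\<close>. The set
  \<open>D\<close> allows cutting out a disc on which \<open>f\<close> is not bounded.\<close>

lemma newtonian_bound:
  fixes Q :: plane
  assumes r: "riesz a C f" and a: "0 < a" "a \<le> 1" and C: "0 \<le> C" and m: "(LINT y|lborel. f y) \<le> m"
    and D: "D \<in> sets borel" and d: "0 < d" and S: "0 \<le> S" "\<And>y. y \<in> D \<Longrightarrow> y \<in> ball Q \<rho> \<Longrightarrow> f y \<le> S"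
    and far: "\<And>y. y \<notin> ball Q \<rho> \<Longrightarrow> d \<le> norm (x - y)"
    and K: "0 \<le> K" "(\<integral>\<^sup>+y. indicator (ball Q \<rho>) y * ennreal (norm (x - y) powr (-1)) \<partial>lborel) \<le> ennreal K"
  shows "(\<integral>\<^sup>+y. ennreal (indicator D y * f y / norm (x - y)) \<partial>lborel) \<le> ennreal (S * K + m / d)"
proof -
  note [measurable] = riesz_measurable[OF r a C] D
  have f0: "0 \<le> f y" for y by (rule riesz_nonneg[OF r a C])
  have "0 \<le> (LINT y|lborel. f y)" using f0 by simp
  then have m0: "0 \<le> m" using m by linarith
  have "(\<integral>\<^sup>+y. ennreal (indicator D y * f y / norm (x - y)) \<partial>lborel) \<le>
    (\<integral>\<^sup>+y. ennreal S * (indicator (ball Q \<rho>) y * ennreal (norm (x - y) powr (-1))) + ennreal (1 / d) * ennreal (f y) \<partial>lborel)"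
  proof (rule nn_integral_mono_AE)
    show "AE y in lborel. ennreal (indicator D y * f y / norm (x - y)) \<le>
      ennreal S * (indicator (ball Q \<rho>) y * ennreal (norm (x - y) powr (-1))) + ennreal (1 / d) * ennreal (f y)"
      using AE_lborel_neq[of x]
    proof eventually_elim
      case (elim y)
      show ?case
      proof (cases "y \<in> D")
        case True
        show ?thesis
        proof (cases "y \<in> ball Q \<rho>")
          case yb: True
          have "indicator D y * f y / norm (x - y) \<le> S * norm (x - y) powr (-1)"
            using S(2)[OF True yb] elim True by (simp add: powr_minus_divide divide_right_mono)
          then have "ennreal (indicator D y * f y / norm (x - y)) \<le> ennreal S * ennreal (norm (x - y) powr (-1))"
            using S by (subst ennreal_mult[symmetric]) (auto intro: ennreal_leI)
          then show ?thesis using yb by (simp add: add_increasing2)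
        next
          case False
          have "indicator D y * f y / norm (x - y) \<le> (1 / d) * f y"
            using far[OF False] True d f0[of y] by (simp add: frac_le)
          then have "ennreal (indicator D y * f y / norm (x - y)) \<le> ennreal (1 / d) * ennreal (f y)"
            using d f0 by (subst ennreal_mult[symmetric]) (auto intro: ennreal_leI)
          then show ?thesis by (simp add: add_increasing)
        qed
      qed simp
    qed
  qed
  also have "\<dots> = ennreal S * (\<integral>\<^sup>+y. indicator (ball Q \<rho>) y * ennreal (norm (x - y) powr (-1)) \<partial>lborel) + ennreal (1 / d) * (\<integral>\<^sup>+y. ennreal (f y) \<partial>lborel)"
    by (subst nn_integral_add) (auto simp: nn_integral_cmult)
  also have "\<dots> \<le> ennreal S * ennreal K + ennreal (1 / d) * ennreal m"
  proof (intro add_mono mult_left_mono K(2))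
    show "(\<integral>\<^sup>+y. ennreal (f y) \<partial>lborel) \<le> ennreal m"
      using m riesz_integrable[OF r a C] f0 by (subst nn_integral_eq_integral) (auto intro: ennreal_leI)
  qed auto
  also have "\<dots> = ennreal (S * K + m / d)" using S K d m0 by (simp add: ennreal_mult[symmetric] ennreal_plus[symmetric] del: ennreal_plus)
  finally show ?thesis .
qed

text \<open>The integral of f / |x - y| plays the part of a gradient bound; using it from both end
  points avoids differentiating the potential.\<close>

lemma pot_lipschitz:
  assumes r: "riesz a C f" and a: "0 < a" "a \<le> 1" and C: "0 \<le> C" and K: "0 \<le> K"
    and n: "(\<integral>\<^sup>+y. ennreal (f y / norm (x - y)) \<partial>lborel) \<le> ennreal K" "(\<integral>\<^sup>+y. ennreal (f y / norm (x' - y)) \<partial>lborel) \<le> ennreal K"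
  shows "\<bar>pot f x - pot f x'\<bar> \<le> K * norm (x - x')"
proof -
  note [measurable] = riesz_measurable[OF r a C]
  have f0: "0 \<le> f y" for y by (rule riesz_nonneg[OF r a C])
  have one: "pot f x - pot f x' \<le> K * norm (x - x')" if n: "(\<integral>\<^sup>+y. ennreal (f y / norm (x - y)) \<partial>lborel) \<le> ennreal K" for x x'
  proof -
    have J: "integrable lborel (\<lambda>y. f y / norm (x - y))" "(LINT y|lborel. f y / norm (x - y)) \<le> K"
      using nn_le_integral[of "\<lambda>y. f y / norm (x - y)" lborel K] n K f0 by auto
    have "pot f x - pot f x' = (LINT y|lborel. f y * (ln (ratio x y) - ln (ratio x' y)))"
      by (rule pot_diff_eq[OF r a C])
    also have "\<dots> \<le> (LINT y|lborel. norm (x - x') * (f y / norm (x - y)))"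
    proof (rule integral_mono_AE)
      show "integrable lborel (\<lambda>y. f y * (ln (ratio x y) - ln (ratio x' y)))"
        using riesz_log[OF r a C, of x] riesz_log[OF r a C, of x'] by (simp add: right_diff_distrib)
      show "integrable lborel (\<lambda>y. norm (x - x') * (f y / norm (x - y)))" using J by (intro integrable_mult_right)
      show "AE y in lborel. f y * (ln (ratio x y) - ln (ratio x' y)) \<le> norm (x - x') * (f y / norm (x - y))"
        using AE_lborel_neq[of x] AE_lborel_neq[of x']
      proof eventually_elim
        case (elim y)
        have "ln (ratio x y) - ln (ratio x' y) \<le> norm (x - x') powr 1 * (1 / norm (x - y)) powr 1 / 1"
          using elim by (intro ln_ratio_diff_le) auto
        then have "f y * (ln (ratio x y) - ln (ratio x' y)) \<le> f y * (norm (x - x') powr 1 * (1 / norm (x - y)) powr 1 / 1)"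
          by (intro mult_left_mono f0)
        then show ?case by (simp add: mult_ac)
      qed
    qed
    also have "\<dots> = norm (x - x') * (LINT y|lborel. f y / norm (x - y))" by (rule integral_mult_right_zero)
    also have "\<dots> \<le> norm (x - x') * K" using J by (intro mult_left_mono) auto
    finally show ?thesis by (simp add: mult.commute)
  qed
  show ?thesis using one[OF n(1), of x'] one[OF n(2), of x] by (simp add: abs_le_iff norm_minus_commute)
qed

text \<open>Supplies the constant \<open>C1\<close> of \<open>pohozaev\<close>: the part of
  \<open>f\<close> between radii \<delta> and 4 * \<rho> is bounded by \<open>S\<close>, and the
  rest is at distance at least \<rho>. With \<rho> fixed, the error is proportional to \<delta> as
  soon as \<open>S * K\<close> is bounded.\<close>

lemma pohozaev_local:
  fixes Q :: plane
  assumes r: "riesz a C f" and a: "0 < a" "a \<le> 1" and C: "0 \<le> C" and b: "0 < b" "b < 1"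
    and d: "0 < \<delta>" "\<delta> \<le> \<rho>" and m: "(LINT y|lborel. f y) \<le> m"
    and eq: "\<And>x. x \<in> ball Q (2 * \<rho>) \<Longrightarrow> x \<noteq> Q \<Longrightarrow> f x = norm (x - Q) powr (-2*b) * exp (G x + 4 * pot f x)"
    and lip: "\<And>x y. x \<in> ball Q (2 * \<rho>) \<Longrightarrow> y \<in> ball Q (2 * \<rho>) \<Longrightarrow> \<bar>G x - G y\<bar> \<le> L * norm (x - y)"
    and S: "0 \<le> S" "\<And>x. \<delta> \<le> norm (x - Q) \<Longrightarrow> norm (x - Q) < 4 * \<rho> \<Longrightarrow> f x \<le> S"
    and K: "0 \<le> K" "\<And>x. (\<integral>\<^sup>+y. indicator (ball Q (4 * \<rho>)) y * ennreal (norm (x - y) powr (-1)) \<partial>lborel) \<le> ennreal K"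
  defines "M \<equiv> (LINT x|lborel. indicator (ball Q \<delta>) x * f x)"
  shows "M * (1 - b) - M\<^sup>2 \<le> \<delta> * (L + 4 * (S * K + m / \<rho>)) * M / 2 + pi * \<delta>\<^sup>2 * S"
    and "M\<^sup>2 - M * (1 - b) \<le> \<delta> * (L + 4 * (S * K + m / \<rho>)) * M / 2"
proof -
  have rho: "0 < \<rho>" using d by simp
  have sub: "x \<in> ball Q (2 * \<rho>)" if "x \<in> ball Q (2 * \<delta>)" for x using that d by auto
  have "0 \<le> (LINT y|lborel. f y)" using riesz_nonneg[OF r a C] by simp
  then have m0: "0 \<le> m" using m by linarith
  have C1: "0 \<le> S * K + m / \<rho>" using S K m0 rho by simp
  have outer: "(\<integral>\<^sup>+y. ennreal (indicator (- ball Q \<delta>) y * f y / norm (x - y)) \<partial>lborel) \<le> ennreal (S * K + m / \<rho>)"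
    if x: "x \<in> ball Q \<delta>" for x
  proof (rule newtonian_bound[OF r a C m _ rho S(1) _ _ K(1) K(2), of "- ball Q \<delta>"])
    show "f y \<le> S" if "y \<in> - ball Q \<delta>" "y \<in> ball Q (4 * \<rho>)" for y
      using that by (intro S(2)) (auto simp: dist_norm norm_minus_commute)
    show "\<rho> \<le> norm (x - y)" if "y \<notin> ball Q (4 * \<rho>)" for y
      using that x d dist_triangle[of Q y x] by (simp add: dist_norm)
  qed auto
  have S': "f x \<le> S" if "\<delta> \<le> norm (x - Q)" "norm (x - Q) < 2 * \<delta>" for x
    using that d by (intro S(2)) auto
  show "M * (1 - b) - M\<^sup>2 \<le> \<delta> * (L + 4 * (S * K + m / \<rho>)) * M / 2 + pi * \<delta>\<^sup>2 * S"
    "M\<^sup>2 - M * (1 - b) \<le> \<delta> * (L + 4 * (S * K + m / \<rho>)) * M / 2"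
    unfolding M_def
    using pohozaev[OF r a C b d(1) eq[OF sub] lip[OF sub sub] C1 outer S(1) S'] by auto
qed

lemma ln_ratio_shift_le:
  assumes y: "y \<noteq> x" and a: "0 < a" "a \<le> 1"
  shows "ln (ratio x y) + ln (1 + norm x) \<le> (1 + norm y) powr a / a + ratio x y powr a / a"
    and "ln (ratio x y) + ln (1 + norm x) \<le> ln ((1 + norm y) * (1 + ratio x y))"
proof -
  have n: "norm (x - y) > 0" using y by auto
  have "1 + norm x \<le> (1 + norm y) + norm (x - y)" using norm_triangle_sub[of x y] by simp
  then have "(1 + norm x) / norm (x - y) \<le> ((1 + norm y) + norm (x - y)) / norm (x - y)" by (intro divide_right_mono) auto
  also have "\<dots> = 1 + ratio x y" using n unfolding ratio_def by (simp add: add_divide_distrib)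
  finally have "(1 + norm x) / norm (x - y) \<le> 1 + ratio x y" .
  then have le: "ratio x y * (1 + norm x) \<le> (1 + norm y) * (1 + ratio x y)"
    unfolding ratio_def by (metis (no_types, opaque_lifting) add_nonneg_nonneg mult_left_mono norm_ge_zero times_divide_eq_left times_divide_eq_right zero_le_one)
  have rp: "ratio x y > 0" using ratio_pos[of x y] y by simp
  have "ln (ratio x y) + ln (1 + norm x) = ln (ratio x y * (1 + norm x))"
    using rp by (subst ln_mult) auto
  also have "\<dots> \<le> ln ((1 + norm y) * (1 + ratio x y))"
    using le rp by (intro ln_mono) (auto intro: mult_pos_pos)
  finally show 1: "ln (ratio x y) + ln (1 + norm x) \<le> ln ((1 + norm y) * (1 + ratio x y))" .
  also have "\<dots> = ln (1 + norm y) + ln (1 + ratio x y)"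
    using rp by (subst ln_mult) auto
  also have "\<dots> \<le> (1 + norm y) powr a / a + ratio x y powr a / a"
    using a ln_le_powr[of "1 + norm y" a] by (intro add_mono ln_one_plus_le_powr) auto
  finally show "ln (ratio x y) + ln (1 + norm x) \<le> (1 + norm y) powr a / a + ratio x y powr a / a" .
qed

text \<open>On \<open>S\<close> the Riesz bound controls the kernel shifted by
  \<open>ln (1 + norm x)\<close>; off \<open>S\<close> the shifted kernel is bounded pointwise by
  \<open>c1\<close>. So concentration outside \<open>S\<close> does not matter at points
  \<open>x\<close> that are far from it.\<close>

lemma pot_upper:
  assumes r: "riesz a0 C0 f" and a0: "0 < a0" "a0 \<le> 1" and C0: "0 \<le> C0"
    and rS: "riesz a D (\<lambda>y. indicator S y * f y)" and a: "0 < a" "a \<le> 1" and D: "0 \<le> D" and S: "S \<in> sets borel"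
    and c1: "0 \<le> c1" "\<And>y. y \<notin> S \<Longrightarrow> y \<noteq> x \<Longrightarrow> (1 + norm y) * (1 + ratio x y) \<le> exp c1"
  shows "pot f x + ln (1 + norm x) * (LINT y|lborel. f y) \<le> c1 * (LINT y|lborel. f y) + 2 * D / a"
proof -
  define g where "g y = indicator S y * f y" for y
  have rg: "riesz a D g" using rS unfolding g_def .
  have f0: "0 \<le> f y" for y by (rule riesz_nonneg[OF r a0 C0])
  note fi = riesz_integrable[OF r a0 C0]
  note fl = riesz_log[OF r a0 C0, of x]
  note gm = riesz_moment[OF rg a D] riesz_ratio[OF rg a D, of x]
  have "pot f x + ln (1 + norm x) * (LINT y|lborel. f y) = (LINT y|lborel. f y * (ln (ratio x y) + ln (1 + norm x)))"
    unfolding pot_def using fl fi by (simp add: ring_distribs mult.commute)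
  also have "\<dots> \<le> (LINT y|lborel. c1 * f y + ((1 + norm y) powr a * g y / a + ratio x y powr a * g y / a))"
  proof (rule integral_mono_AE)
    show "integrable lborel (\<lambda>y. f y * (ln (ratio x y) + ln (1 + norm x)))"
      using fl fi by (simp add: ring_distribs)
    show "integrable lborel (\<lambda>y. c1 * f y + ((1 + norm y) powr a * g y / a + ratio x y powr a * g y / a))"
      using fi gm by (intro Bochner_Integration.integrable_add integrable_mult_right integrable_divide)
    show "AE y in lborel. f y * (ln (ratio x y) + ln (1 + norm x)) \<le> c1 * f y + ((1 + norm y) powr a * g y / a + ratio x y powr a * g y / a)"
      using AE_lborel_neq[of x]
    proof eventually_elim
      case (elim y)
      show ?case
      proof (cases "y \<in> S")
        case True
        have "f y * (ln (ratio x y) + ln (1 + norm x)) \<le> f y * ((1 + norm y) powr a / a + ratio x y powr a / a)"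
          using elim a by (intro mult_left_mono ln_ratio_shift_le f0) auto
        also have "\<dots> = (1 + norm y) powr a * g y / a + ratio x y powr a * g y / a" using True by (simp add: g_def algebra_simps)
        also have "\<dots> \<le> c1 * f y + \<dots>" using c1(1) f0 by simp
        finally show ?thesis .
      next
        case False
        have rp: "ratio x y > 0" using ratio_pos[of x y] elim by simp
        have "ln (ratio x y) + ln (1 + norm x) \<le> ln ((1 + norm y) * (1 + ratio x y))"
          using elim a by (intro ln_ratio_shift_le(2)) auto
        also have "\<dots> \<le> ln (exp c1)" using c1(2)[OF False elim] rp by (intro ln_mono) (auto intro: mult_pos_pos)
        finally have "ln (ratio x y) + ln (1 + norm x) \<le> c1" by simp
        then have "f y * (ln (ratio x y) + ln (1 + norm x)) \<le> f y * c1" by (intro mult_left_mono f0)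
        then show ?thesis using False by (simp add: g_def mult.commute)
      qed
    qed
  qed
  also have "\<dots> = c1 * (LINT y|lborel. f y) + ((LINT y|lborel. (1 + norm y) powr a * g y) / a + (LINT y|lborel. ratio x y powr a * g y) / a)"
    using fi gm by simp
  also have "\<dots> \<le> c1 * (LINT y|lborel. f y) + (D / a + D / a)"
    using a by (intro add_left_mono add_mono divide_right_mono riesz_moment_le[OF rg a D] riesz_ratio_le[OF rg a D]) auto
  finally show ?thesis by simp
qed

lemma riesz_union:
  assumes f: "f \<in> borel_measurable borel" "\<And>y. 0 \<le> f y" and S: "S \<in> sets borel" "T \<in> sets borel" "U \<in> sets borel" and sub: "U \<subseteq> S \<union> T"
    and r: "riesz a C (\<lambda>y. indicator S y * f y)" "riesz a D (\<lambda>y. indicator T y * f y)" and C: "0 \<le> C" "0 \<le> D"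
  shows "riesz a (C + D) (\<lambda>y. indicator U y * f y)"
  unfolding riesz_def
proof (intro conjI allI)
  note [measurable] = f(1) S
  show "(\<lambda>y. indicator U y * f y) \<in> borel_measurable borel" by measurable
  show "0 \<le> indicator U y * f y" for y using f(2) by simp
  fix x
  have "(\<integral>\<^sup>+y. ennreal (ratio x y powr a * (1 + norm y) powr a * (indicator U y * f y)) \<partial>lborel) \<le>
    (\<integral>\<^sup>+y. ennreal (ratio x y powr a * (1 + norm y) powr a * (indicator S y * f y)) + ennreal (ratio x y powr a * (1 + norm y) powr a * (indicator T y * f y)) \<partial>lborel)"
    using sub f(2) by (intro nn_integral_mono) (auto simp: indicator_def ennreal_plus[symmetric] intro!: ennreal_leI simp del: ennreal_plus)
  also have "\<dots> = (\<integral>\<^sup>+y. ennreal (ratio x y powr a * (1 + norm y) powr a * (indicator S y * f y)) \<partial>lborel) + (\<integral>\<^sup>+y. ennreal (ratio x y powr a * (1 + norm y) powr a * (indicator T y * f y)) \<partial>lborel)"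
    by (rule nn_integral_add) simp_all
  also have "\<dots> \<le> ennreal C + ennreal D" using r unfolding riesz_def by (intro add_mono) blast+
  finally show "(\<integral>\<^sup>+y. ennreal (ratio x y powr a * (1 + norm y) powr a * (indicator U y * f y)) \<partial>lborel) \<le> ennreal (C + D)"
    using C by (simp add: ennreal_plus)
qed

lemma norm_powr_off_le:
  fixes x Q :: "'a::real_normed_vector"
  assumes "0 < \<delta>" "\<delta> \<le> norm (x - Q)" "0 \<le> b"
  shows "norm (x - Q) powr (-2*b) \<le> (1 + (1 + norm Q) / \<delta>) powr (2*b) * (1 + norm x) powr (-2*b)"
proof -
  define K where "K = 1 + (1 + norm Q) / \<delta>"
  have K: "K > 0" unfolding K_def using assms by (simp add: add_pos_nonneg)
  have "1 + norm x \<le> (1 + norm Q) * 1 + norm (x - Q)" using norm_triangle_sub[of x Q] by simp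
  also have "\<dots> \<le> (1 + norm Q) * (norm (x - Q) / \<delta>) + norm (x - Q)"
    using assms by (intro add_right_mono mult_left_mono) auto
  also have "\<dots> = K * norm (x - Q)" by (simp add: K_def algebra_simps)
  finally have "(1 + norm x) / K \<le> norm (x - Q)" using K by (simp add: pos_divide_le_eq mult.commute)
  then have "norm (x - Q) powr (-2*b) \<le> ((1 + norm x) / K) powr (-2*b)"
    using K assms by (intro powr_mono2') auto
  also have "\<dots> = K powr (2*b) * (1 + norm x) powr (-2*b)" using K by (simp add: powr_divide powr_minus divide_simps)
  finally show ?thesis unfolding K_def .
qed

section \<open>Two points escaping to infinity\<close>

text \<open>The sequence of solutions after normalisation. \<open>H n\<close> is the product of the
  two escaping factors, rescaled so that it stays between fixed bounds and has a controlled
  logarithm on the disc of radius \<open>L n\<close>; the rescaling constants are in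
  \<open>B n\<close>. The small exponent \<open>a\<close> leaves room in every kernel condition, in
  particular at \<open>P 4\<close> with the full mass.\<close>

locale toda_family =
  fixes \<beta> :: "nat \<Rightarrow> real" and P :: "nat \<Rightarrow> plane" and a :: real
    and f h :: "nat \<Rightarrow> plane \<Rightarrow> real" and A B L :: "nat \<Rightarrow> real" and H :: "nat \<Rightarrow> plane \<Rightarrow> real"
  assumes \<beta>: "\<And>l. l \<in> {1..5} \<Longrightarrow> 0 < \<beta> l \<and> \<beta> l < 1"
    and sum_\<beta>: "\<beta> 1 + \<beta> 2 + \<beta> 3 = 2 - 2 * \<beta> 4"
    and \<beta>23: "\<beta> 2 + \<beta> 3 < \<beta> 1" and \<beta>4: "\<beta> 4 < 1/3" and \<beta>5: "\<beta> 4 + \<beta> 5 < 1"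
    and inj: "inj_on P {1..5}"
    and a: "0 < a" "a \<le> 1/2" "a + 6 * \<beta> 4 < 2" "\<And>l. l \<in> {1..5} \<Longrightarrow> 2 * \<beta> l + a < 2"
    and riesz_ex: "\<And>n. \<exists>C\<ge>0. riesz a C (f n) \<and> riesz a C (h n)"
    and mass: "\<And>n. (LINT y|lborel. f n y) = \<beta> 4" "\<And>n. (LINT y|lborel. h n y) = \<beta> 4"
    and f_eq: "\<And>n x. f n x = exp (A n) * sing_weight {1..4} P \<beta> x * exp (4 * pot (f n) x - 2 * pot (h n) x)"
    and h_eq: "\<And>n x. h n x = exp (B n) * norm (x - P 5) powr (-2 * \<beta> 5) * H n x * exp (4 * pot (h n) x - 2 * pot (f n) x)"
    and H_bounds: "\<And>n x. norm x \<le> L n \<Longrightarrow> 1/16 \<le> H n x \<and> H n x \<le> 16"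
    and H_lip: "\<And>n x y. norm x \<le> L n \<Longrightarrow> norm y \<le> L n \<Longrightarrow> \<bar>ln (H n x) - ln (H n y)\<bar> \<le> 4 * norm (x - y)"
    and L: "filterlim L at_top sequentially"
begin

abbreviation m :: real where "m \<equiv> \<beta> 4"
abbreviation W :: "plane \<Rightarrow> real" where "W \<equiv> sing_weight {1..4} P \<beta>"
abbreviation V :: "nat \<Rightarrow> plane \<Rightarrow> real" where "V n \<equiv> pot (f n)"
abbreviation U :: "nat \<Rightarrow> plane \<Rightarrow> real" where "U n \<equiv> pot (h n)"

lemma a1: "a \<le> 1" using a by simp
lemma m_pos: "0 < m" using \<beta>[of 4] by simp

lemma \<beta>_simps: "0 < \<beta> 1" "\<beta> 1 < 1" "0 < \<beta> 2" "\<beta> 2 < 1" "0 < \<beta> 3" "\<beta> 3 < 1" "0 < \<beta> 5" "\<beta> 5 < 1"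
  using \<beta> by auto

lemma f_measurable [measurable]: "f n \<in> borel_measurable borel"
  and h_measurable [measurable]: "h n \<in> borel_measurable borel"
  and f_nonneg: "0 \<le> f n y" and h_nonneg: "0 \<le> h n y"
  using riesz_ex[of n] unfolding riesz_def by blast+

lemma f_integrable: "integrable lborel (f n)" and h_integrable: "integrable lborel (h n)"
proof -
  obtain C where "C \<ge> 0" "riesz a C (f n)" "riesz a C (h n)" using riesz_ex by blast
  then show "integrable lborel (f n)" "integrable lborel (h n)" using riesz_integrable a a1 by blast+
qed

lemma nn_mass: "(\<integral>\<^sup>+y. ennreal (f n y) \<partial>lborel) \<le> ennreal m" "(\<integral>\<^sup>+y. ennreal (h n y) \<partial>lborel) \<le> ennreal m"
  using f_integrable[of n] h_integrable[of n] f_nonneg h_nonneg mass[of n]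
  by (simp_all add: nn_integral_eq_integral)

lemma V_ge: "- m * ln (1 + norm x) \<le> V n x" and U_ge: "- m * ln (1 + norm x) \<le> U n x"
proof -
  obtain C where C: "C \<ge> 0" "riesz a C (f n)" "riesz a C (h n)" using riesz_ex by blast
  show "- m * ln (1 + norm x) \<le> V n x" using pot_ge[OF C(2) a(1) a1 C(1), of x] mass by (simp add: mult.commute)
  show "- m * ln (1 + norm x) \<le> U n x" using pot_ge[OF C(3) a(1) a1 C(1), of x] mass by (simp add: mult.commute)
qed

lemma exp_V_le: "exp (-2 * V n x) \<le> (1 + norm x) powr (2 * m)" and exp_U_le: "exp (-2 * U n x) \<le> (1 + norm x) powr (2 * m)"
  using V_ge[of x n] U_ge[of x n] by (simp_all add: powr_def algebra_simps)

lemma W_prod: "W x = norm (x - P 1) powr (-2 * \<beta> 1) * norm (x - P 2) powr (-2 * \<beta> 2) * norm (x - P 3) powr (-2 * \<beta> 3) * norm (x - P 4) powr (-2 * m)"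
proof -
  have "{1..4::nat} = {1, 2, 3, 4}" by auto
  then show ?thesis unfolding sing_weight_powr by (simp add: mult_ac)
qed

text \<open>Away from \<open>P 1\<close>, \<open>P 2\<close>, \<open>P 3\<close> only the mild pole
  at \<open>P 4\<close> is left. The exponents add up to 2 * (\<beta> 1 + \<beta> 2 + \<beta> 3 +
  \<beta> 4) = 4 - 2 * m, which is the decay.\<close>

lemma W_off:
  assumes d: "0 < \<delta>"
  shows "\<exists>C\<ge>0. \<forall>x. (\<forall>l\<in>{1..3}. \<delta> \<le> norm (x - P l)) \<longrightarrow>
    W x \<le> C * ((1 + norm x) powr (-(4 - 2 * m)) * min 1 (norm (x - P 4)) powr (-2 * m))"
proof -
  define K where "K l = (1 + (1 + norm (P l)) / \<delta>) powr (2 * \<beta> l)" for l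
  define K4 where "K4 = (1 + (1 + norm (P 4)) / 1) powr (2 * m)"
  have "W x \<le> (K 1 * K 2 * K 3 * K4) * ((1 + norm x) powr (-(4 - 2 * m)) * min 1 (norm (x - P 4)) powr (-2 * m))"
    if x: "\<forall>l\<in>{1..3}. \<delta> \<le> norm (x - P l)" for x
  proof -
    have b: "norm (x - P l) powr (-2 * \<beta> l) \<le> K l * (1 + norm x) powr (-2 * \<beta> l)" if "l \<in> {1..3}" for l
      unfolding K_def using x that d \<beta>[of l] by (intro norm_powr_off_le) auto
    have b4: "norm (x - P 4) powr (-2 * m) \<le> min 1 (norm (x - P 4)) powr (-2 * m) * (K4 * (1 + norm x) powr (-2 * m))"
    proof (cases "x = P 4")
      case False
      have "norm (x - P 4) powr (-2 * m) = min 1 (norm (x - P 4)) powr (-2 * m) * max 1 (norm (x - P 4)) powr (-2 * m)"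
        by (rule powr_split_min_max)
      also have "max 1 (norm (x - P 4)) powr (-2 * m) \<le> K4 * (1 + norm x) powr (-2 * m)"
      proof (cases "1 \<le> norm (x - P 4)")
        case True
        then show ?thesis unfolding K4_def using norm_powr_off_le[of 1 x "P 4" m] m_pos by (simp add: max_def)
      next
        case False
        have "1 + norm x \<le> 2 + norm (P 4)" using norm_triangle_sub[of x "P 4"] False by simp
        then have "(1 + norm x) powr (2 * m) \<le> K4" unfolding K4_def using m_pos by (intro powr_mono2) auto
        then have "1 \<le> K4 * (1 + norm x) powr (-2 * m)" by (simp add: powr_minus field_simps)
        then show ?thesis using False by (simp add: max_def)
      qed
      finally show ?thesis by (simp add: mult_left_mono)
    qed simp
    have "W x \<le> (K 1 * (1 + norm x) powr (-2 * \<beta> 1)) * (K 2 * (1 + norm x) powr (-2 * \<beta> 2)) * (K 3 * (1 + norm x) powr (-2 * \<beta> 3))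
      * (min 1 (norm (x - P 4)) powr (-2 * m) * (K4 * (1 + norm x) powr (-2 * m)))"
      unfolding W_prod using b[of 1] b[of 2] b[of 3] b4 by (intro mult_mono) (auto simp: K_def K4_def)
    also have "\<dots> = (K 1 * K 2 * K 3 * K4) * (((1 + norm x) powr (-2 * \<beta> 1) * (1 + norm x) powr (-2 * \<beta> 2) * (1 + norm x) powr (-2 * \<beta> 3) * (1 + norm x) powr (-2 * m)) * min 1 (norm (x - P 4)) powr (-2 * m))"
      by (simp only: mult_ac)
    also have "(1 + norm x) powr (-2 * \<beta> 1) * (1 + norm x) powr (-2 * \<beta> 2) * (1 + norm x) powr (-2 * \<beta> 3) * (1 + norm x) powr (-2 * m)
      = (1 + norm x) powr (-(4 - 2 * m))"
      unfolding powr_add[symmetric] using sum_\<beta> by (intro arg_cong[of _ _ "\<lambda>e. (1 + norm x) powr e"]) linarith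
    finally show ?thesis .
  qed
  moreover have "0 \<le> K 1 * K 2 * K 3 * K4" unfolding K_def K4_def by simp
  ultimately show ?thesis by blast
qed

lemma W_lower:
  assumes R: "0 \<le> R"
  shows "\<exists>w>0. \<forall>x. norm x \<le> R \<longrightarrow> (\<forall>l\<in>{1..4}. x \<noteq> P l) \<longrightarrow> w \<le> W x"
proof -
  define w where "w = (\<Prod>l\<in>{1..4}. (R + 1 + norm (P l)) powr (-2 * \<beta> l))"
  have pos: "0 < R + 1 + norm (P l)" for l using R norm_ge_zero[of "P l"] by linarith
  have "w \<le> W x" if "norm x \<le> R" "\<forall>l\<in>{1..4}. x \<noteq> P l" for x
    unfolding w_def sing_weight_powr
  proof (intro prod_mono conjI)
    fix l :: nat assume l: "l \<in> {1..4}"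
    have "norm (x - P l) \<le> R + 1 + norm (P l)" using that norm_triangle_ineq4[of x "P l"] by simp
    then show "(R + 1 + norm (P l)) powr (-2 * \<beta> l) \<le> norm (x - P l) powr (-2 * \<beta> l)"
      using that l \<beta>[of l] by (intro powr_mono2') auto
  qed auto
  moreover have "0 < w" unfolding w_def using pos by (intro prod_pos) (auto simp: less_le)
  ultimately show ?thesis by blast
qed

text \<open>\<open>P 4\<close> is not cut out: its exponent is small enough for Jensen's inequality
  with the full mass.\<close>

definition E :: "real \<Rightarrow> plane set" where "E \<delta> = {y. \<forall>l\<in>{1..3}. \<delta> \<le> norm (y - P l)}"

lemma E_borel [measurable]: "E \<delta> \<in> sets borel"
proof -
  have "E \<delta> = (\<Inter>l\<in>{1..3}. {y. \<delta> \<le> norm (y - P l)})" by (auto simp: E_def)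
  then have "closed (E \<delta>)" by (auto intro!: closed_INT closed_Collect_le continuous_intros)
  then show ?thesis by simp
qed

text \<open>\<open>jensen_kernel\<close> with pole 2 * m at \<open>P 4\<close> and mass m; the
  hypothesis a + 6 * \<beta> 4 < 2 is its condition. The factor \<open>exp (-2 * U n y)\<close>
  costs only (1 + |y|)^(2 m), so the decay left is 4 - 4 * m - a. The bound is linear in
  \<open>exp (A n)\<close>, hence small when that factor is.\<close>

lemma f_off:
  assumes d: "0 < \<delta>"
  shows "\<exists>C\<ge>0. \<forall>n. riesz a (C * exp (A n)) (\<lambda>y. indicator (E \<delta>) y * f n y)"
proof -
  obtain CW where CW: "CW \<ge> 0" "\<And>x. (\<forall>l\<in>{1..3}. \<delta> \<le> norm (x - P l)) \<Longrightarrow>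
    W x \<le> CW * ((1 + norm x) powr (-(4 - 2 * m)) * min 1 (norm (x - P 4)) powr (-2 * m))"
    using W_off[OF d] by auto
  obtain C where C: "C \<ge> 0" and J: "\<And>f P k D Ck x. f \<in> borel_measurable borel \<Longrightarrow> (\<forall>y. 0 \<le> f y) \<Longrightarrow>
     (\<integral>\<^sup>+y. ennreal (f y) \<partial>lborel) \<le> ennreal m \<Longrightarrow> 0 \<le> Ck \<Longrightarrow>
     (\<forall>y. y \<in> D \<longrightarrow> y \<noteq> P \<longrightarrow> k y \<le> Ck * ((1 + norm y) powr (-(4 - 4 * m - a)) * min 1 (norm (y - P)) powr (-(2 * m)))) \<Longrightarrow>
     (\<integral>\<^sup>+y. indicator D y * ennreal (ratio x y powr a * k y * exp (4 * pot f y)) \<partial>lborel) \<le> ennreal (C * Ck)"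
    using jensen_kernel[of "2 * m" a m "4 - 4 * m - a"] a m_pos \<beta>4 by auto
  have "riesz a (C * CW * exp (A n)) (\<lambda>y. indicator (E \<delta>) y * f n y)" for n
    unfolding riesz_def
  proof (intro conjI allI)
    show "(\<lambda>y. indicator (E \<delta>) y * f n y) \<in> borel_measurable borel" by measurable
    show "0 \<le> indicator (E \<delta>) y * f n y" for y by (simp add: f_nonneg)
    fix x
    define k where "k y = (1 + norm y) powr a * (exp (A n) * W y * exp (-2 * U n y))" for y
    have "(\<integral>\<^sup>+y. ennreal (ratio x y powr a * (1 + norm y) powr a * (indicator (E \<delta>) y * f n y)) \<partial>lborel)
      = (\<integral>\<^sup>+y. indicator (E \<delta>) y * ennreal (ratio x y powr a * k y * exp (4 * V n y)) \<partial>lborel)"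
      by (intro nn_integral_cong, subst f_eq) (auto simp: indicator_def k_def exp_diff exp_minus divide_inverse mult_ac)
    also have "\<dots> \<le> ennreal (C * (CW * exp (A n)))"
    proof (rule J[where P = "P 4"])
      show "\<forall>y. y \<in> E \<delta> \<longrightarrow> y \<noteq> P 4 \<longrightarrow> k y \<le> CW * exp (A n) * ((1 + norm y) powr (-(4 - 4 * m - a)) * min 1 (norm (y - P 4)) powr (-(2 * m)))"
      proof (intro allI impI)
        fix y assume "y \<in> E \<delta>"
        then have Wy: "W y \<le> CW * ((1 + norm y) powr (-(4 - 2 * m)) * min 1 (norm (y - P 4)) powr (-2 * m))"
          by (intro CW) (auto simp: E_def)
        have "k y \<le> (1 + norm y) powr a * (exp (A n) * (CW * ((1 + norm y) powr (-(4 - 2 * m)) * min 1 (norm (y - P 4)) powr (-2 * m))) * (1 + norm y) powr (2 * m))"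
          unfolding k_def using Wy exp_U_le[of n y] CW(1) by (intro mult_left_mono mult_mono) auto
        also have "\<dots> = CW * exp (A n) * (((1 + norm y) powr a * (1 + norm y) powr (-(4 - 2 * m)) * (1 + norm y) powr (2 * m)) * min 1 (norm (y - P 4)) powr (-2 * m))"
          by (simp only: mult_ac)
        also have "(1 + norm y) powr a * (1 + norm y) powr (-(4 - 2 * m)) * (1 + norm y) powr (2 * m) = (1 + norm y) powr (-(4 - 4 * m - a))"
          unfolding powr_add[symmetric] by (intro arg_cong[of _ _ "\<lambda>e. (1 + norm y) powr e"]) linarith
        finally show "k y \<le> CW * exp (A n) * ((1 + norm y) powr (-(4 - 4 * m - a)) * min 1 (norm (y - P 4)) powr (-(2 * m)))" by simp
      qed
    qed (use CW f_nonneg nn_mass in auto)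
    finally show "(\<integral>\<^sup>+y. ennreal (ratio x y powr a * (1 + norm y) powr a * (indicator (E \<delta>) y * f n y)) \<partial>lborel) \<le> ennreal (C * CW * exp (A n))"
      by (simp add: mult.assoc)
  qed
  then show ?thesis using C CW by (intro exI[of _ "C * CW"]) auto
qed

lemma V_continuous: "continuous_on UNIV (V n)" and U_continuous: "continuous_on UNIV (U n)"
proof -
  obtain C where "C \<ge> 0" "riesz a C (f n)" "riesz a C (h n)" using riesz_ex by blast
  then show "continuous_on UNIV (V n)" "continuous_on UNIV (U n)" using pot_continuous a a1 by blast+
qed

lemma V_measurable [measurable]: "V n \<in> borel_measurable borel"
  and U_measurable [measurable]: "U n \<in> borel_measurable borel"
  by (rule borel_measurable_continuous_onI[OF V_continuous]) (rule borel_measurable_continuous_onI[OF U_continuous])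

text \<open>On the unit disc f is at least a constant times \<open>exp (A n)\<close> times
  \<open>exp (-2 * U n x)\<close>, and its mass is m. A lower bound for the integral of
  \<open>exp (-2 * U n x)\<close> comes from the Jensen upper bound for that of
  \<open>exp (4 * U n x)\<close>, since one exponential cannot be small where the other is not
  large.\<close>

lemma A_upper: "\<exists>CA. \<forall>n. A n \<le> CA"
proof -
  obtain w where w: "w > 0" "\<And>x. norm x \<le> 1 \<Longrightarrow> (\<forall>l\<in>{1..4}. x \<noteq> P l) \<Longrightarrow> w \<le> W x"
    using W_lower[of 1] by auto
  obtain C where C: "C \<ge> 0" and J: "\<And>f P k D Ck x. f \<in> borel_measurable borel \<Longrightarrow> (\<forall>y. 0 \<le> f y) \<Longrightarrow>
     (\<integral>\<^sup>+y. ennreal (f y) \<partial>lborel) \<le> ennreal m \<Longrightarrow> 0 \<le> Ck \<Longrightarrow>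
     (\<forall>y. y \<in> D \<longrightarrow> y \<noteq> P \<longrightarrow> k y \<le> Ck * ((1 + norm y) powr (-3) * min 1 (norm (y - P)) powr (-0))) \<Longrightarrow>
     (\<integral>\<^sup>+y. indicator D y * ennreal (ratio x y powr 0 * k y * exp (4 * pot f y)) \<partial>lborel) \<le> ennreal (C * Ck)"
    using jensen_kernel[of 0 0 m 3] m_pos \<beta>4 by auto
  define D where "D = ball (0::plane) 1"
  have Dm [measurable]: "D \<in> sets borel" unfolding D_def by simp
  have De: "emeasure lborel D = ennreal pi" unfolding D_def by (simp add: emeasure_ball_plane)
  define C1 where "C1 = C * 8"
  have C1: "0 \<le> C1" using C by (simp add: C1_def)
  have eU: "(\<integral>\<^sup>+x. indicator D x * ennreal (exp (4 * U n x)) \<partial>lborel) \<le> ennreal C1" for n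
  proof -
    have "(\<integral>\<^sup>+x. indicator D x * ennreal (exp (4 * U n x)) \<partial>lborel) = (\<integral>\<^sup>+x. indicator D x * ennreal (ratio 0 x powr 0 * 1 * exp (4 * U n x)) \<partial>lborel)"
    proof (rule nn_integral_cong_AE)
      show "AE x in lborel. indicator D x * ennreal (exp (4 * U n x)) = indicator D x * ennreal (ratio 0 x powr 0 * 1 * exp (4 * U n x))"
        using AE_lborel_neq[of 0]
      proof eventually_elim
        case (elim x)
        then show ?case using ratio_pos[of 0 x] by simp
      qed
    qed
    also have "\<dots> \<le> ennreal (C * 8)"
    proof (rule J[where P = 0])
      show "\<forall>y. y \<in> D \<longrightarrow> y \<noteq> 0 \<longrightarrow> 1 \<le> 8 * ((1 + norm y) powr (-3) * min 1 (norm (y - 0)) powr (-0))"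
      proof (intro allI impI)
        fix y assume y: "y \<in> D" "y \<noteq> 0"
        have "(1 + norm y) powr 3 \<le> 2 powr 3" using y by (intro powr_mono2) (auto simp: D_def)
        then have "1 \<le> 8 * (1 + norm y) powr (-3)" by (simp add: powr_minus field_simps)
        moreover have "min 1 (norm (y - 0)) powr (-0) = (1::real)" using y by (simp add: min_def)
        ultimately show "1 \<le> 8 * ((1 + norm y) powr (-3) * min 1 (norm (y - 0)) powr (-0))" by simp
      qed
    qed (use h_nonneg nn_mass in auto)
    finally show ?thesis by (simp add: C1_def)
  qed
  \<comment> \<open>The weight that maximises 2 * s * pi - s^2 * (pi + C1), the lower bound obtained
    by integrating the next inequality.\<close>
  define s where "s = pi / (pi + C1)"
  have s: "0 < s" unfolding s_def using C1 by (simp add: add_pos_nonneg)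
  have s2: "s\<^sup>2 * (pi + C1) = s * pi"
  proof -
    have "pi + C1 > 0" using C1 pi_gt_zero by linarith
    then show ?thesis by (simp add: s_def power2_eq_square)
  qed
  define I where "I n = (\<integral>\<^sup>+x. indicator D x * ennreal (exp (-2 * U n x)) \<partial>lborel)" for n
  have I_ge: "ennreal (s * pi) \<le> I n" for n
  proof -
    \<comment> \<open>With z = exp (2 u): 1/z + s^2 z \<ge> 2 s by the arithmetic-geometric mean
      inequality, and z \<le> 1 + z^2.\<close>
    have pw: "2 * s \<le> exp (-2 * u) + s\<^sup>2 * (1 + exp (4 * u))" for u :: real
    proof -
      define z where "z = exp (2 * u)"
      have z: "0 < z" "exp (-2 * u) = 1 / z" "exp (4 * u) = z\<^sup>2" unfolding z_def
        by (auto simp: exp_minus divide_inverse power2_eq_square exp_add[symmetric])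
      have "0 \<le> (1 - s * z)\<^sup>2 / z" using z by simp
      also have "\<dots> = 1 / z - 2 * s + s\<^sup>2 * z" using z by (simp add: power2_eq_square field_simps)
      finally have "2 * s \<le> 1 / z + s\<^sup>2 * z" by simp
      moreover have "z \<le> 1 + z\<^sup>2" using sum_squares_bound[of 1 z] z by (simp add: power2_eq_square)
      then have "s\<^sup>2 * z \<le> s\<^sup>2 * (1 + z\<^sup>2)" by (intro mult_left_mono) auto
      ultimately show ?thesis using z by simp
    qed
    have "ennreal (2 * s * pi) = (\<integral>\<^sup>+x. ennreal (2 * s) * indicator D x \<partial>lborel)"
      using s by (subst nn_integral_cmult_indicator) (auto simp: De ennreal_mult)
    also have "\<dots> \<le> (\<integral>\<^sup>+x. indicator D x * ennreal (exp (-2 * U n x)) + ennreal (s\<^sup>2) * (indicator D x + indicator D x * ennreal (exp (4 * U n x))) \<partial>lborel)"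
    proof (rule nn_integral_mono)
      fix x
      show "ennreal (2 * s) * indicator D x \<le> indicator D x * ennreal (exp (-2 * U n x)) + ennreal (s\<^sup>2) * (indicator D x + indicator D x * ennreal (exp (4 * U n x)))"
      proof (cases "x \<in> D")
        case True
        have "ennreal (2 * s) \<le> ennreal (exp (-2 * U n x) + s\<^sup>2 * (1 + exp (4 * U n x)))" by (intro ennreal_leI pw)
        also have "\<dots> = ennreal (exp (-2 * U n x)) + ennreal (s\<^sup>2) * (1 + ennreal (exp (4 * U n x)))"
          by (subst ennreal_plus, simp, simp, subst ennreal_mult, simp, simp, subst ennreal_plus) auto
        finally show ?thesis using True by simp
      qed simp
    qed
    also have "\<dots> = I n + ennreal (s\<^sup>2) * (ennreal pi + (\<integral>\<^sup>+x. indicator D x * ennreal (exp (4 * U n x)) \<partial>lborel))"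
      unfolding I_def De[symmetric] by (simp add: nn_integral_add nn_integral_cmult)
    also have "\<dots> \<le> I n + ennreal (s\<^sup>2) * (ennreal pi + ennreal C1)"
      by (intro add_left_mono mult_left_mono eU) auto
    also have "ennreal (s\<^sup>2) * (ennreal pi + ennreal C1) = ennreal (s * pi)"
      using C1 s2 by (simp add: ennreal_plus[symmetric] ennreal_mult[symmetric] del: ennreal_plus)
    finally have le: "ennreal (2 * s * pi) \<le> I n + ennreal (s * pi)" .
    show ?thesis
    proof (cases "I n")
      case (real i)
      then have "2 * s * pi \<le> i + s * pi" using le s by (simp add: ennreal_plus[symmetric] del: ennreal_plus)
      then show ?thesis using real by (simp add: ennreal_leI mult.commute)
    qed simp
  qed
  define w' where "w' = w * 2 powr (-4 * m)"
  have w': "0 < w'" using w by (simp add: w'_def)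
  have "exp (A n) * w' * (s * pi) \<le> m" for n
  proof -
    have aePl: "AE x in lborel. \<forall>l\<in>{1..4}. x \<noteq> P l" using AE_lborel_neq by (intro AE_finite_allI) auto
    have "ennreal (exp (A n) * w') * ennreal (s * pi) \<le> ennreal (exp (A n) * w') * I n"
      by (intro mult_left_mono I_ge) auto
    also have "\<dots> = (\<integral>\<^sup>+x. ennreal (exp (A n) * w') * (indicator D x * ennreal (exp (-2 * U n x))) \<partial>lborel)"
      unfolding I_def by (rule nn_integral_cmult[symmetric]) measurable
    also have "\<dots> \<le> (\<integral>\<^sup>+x. ennreal (f n x) \<partial>lborel)"
    proof (rule nn_integral_mono_AE)
      show "AE x in lborel. ennreal (exp (A n) * w') * (indicator D x * ennreal (exp (-2 * U n x))) \<le> ennreal (f n x)"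
        using aePl
      proof eventually_elim
        case (elim x)
        show ?case
        proof (cases "x \<in> D")
          case True
          then have nx: "norm x \<le> 1" by (simp add: D_def)
          have "2 powr (-4 * m) \<le> (1 + norm x) powr (-4 * m)" using nx m_pos by (intro powr_mono2') auto
          also have "(1 + norm x) powr (-4 * m) = exp (4 * (- m * ln (1 + norm x)))" by (simp add: powr_def)
          also have "\<dots> \<le> exp (4 * V n x)"
            by (subst exp_le_cancel_iff, rule mult_left_mono[OF V_ge]) simp
          finally have e: "2 powr (-4 * m) \<le> exp (4 * V n x)" .
          have "exp (A n) * w' * exp (-2 * U n x) \<le> exp (A n) * (W x * exp (4 * V n x)) * exp (-2 * U n x)"
            unfolding w'_def using w(2)[OF nx elim] w(1) e by (intro mult_right_mono mult_left_mono mult_mono) auto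
          also have "\<dots> = f n x" by (subst f_eq) (simp add: exp_diff exp_minus divide_inverse mult_ac)
          finally show ?thesis using True w' by (simp add: ennreal_mult[symmetric] ennreal_leI)
        qed simp
      qed
    qed
    also have "\<dots> \<le> ennreal m" by (rule nn_mass)
    finally show ?thesis using w' s m_pos by (simp add: ennreal_mult[symmetric])
  qed
  then have "exp (A n) \<le> m / (w' * (s * pi))" for n using w' s by (simp add: field_simps)
  then have "A n \<le> ln (m / (w' * (s * pi)))" for n using w' s m_pos by (subst ln_ge_iff) auto
  then show ?thesis by blast
qed

text \<open>\<open>f_off\<close> bounds the part of f on \<open>E \<delta>\<close>, uniformly
  because \<open>A n\<close> is bounded above; the rest lies within \<delta> of \<open>P 1\<close>,
  \<open>P 2\<close>, \<open>P 3\<close>, hence at distance at least \<delta> from x. So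
  \<open>pot_upper\<close> holds regardless of concentration at these points.\<close>

lemma V_upper:
  assumes d: "0 < \<delta>"
  shows "\<exists>C. \<forall>n x. (\<forall>l\<in>{1..3}. 2 * \<delta> \<le> norm (x - P l)) \<longrightarrow> V n x + m * ln (1 + norm x) \<le> C"
proof -
  obtain CA where CA: "\<And>n. A n \<le> CA" using A_upper by blast
  obtain C where C: "C \<ge> 0" "\<And>n. riesz a (C * exp (A n)) (\<lambda>y. indicator (E \<delta>) y * f n y)" using f_off[OF d] by blast
  define D where "D = C * exp CA"
  have D: "0 \<le> D" using C by (simp add: D_def)
  have rD: "riesz a D (\<lambda>y. indicator (E \<delta>) y * f n y)" for n
    using riesz_mono[OF C(2)[of n], of D] CA[of n] C(1) unfolding D_def by (simp add: mult_left_mono)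
  define Pm where "Pm = norm (P 1) + norm (P 2) + norm (P 3)"
  define K where "K = 1 + Pm + \<delta>"
  have K: "1 \<le> K" unfolding K_def Pm_def using d by simp
  define c1 where "c1 = ln (K * (1 + K / \<delta>))"
  have K2: "1 \<le> K * (1 + K / \<delta>)" using K d mult_mono[of 1 K 1 "1 + K / \<delta>"] by simp
  have ec1: "exp c1 = K * (1 + K / \<delta>)" unfolding c1_def using K2 by simp
  have "V n x + m * ln (1 + norm x) \<le> c1 * m + 2 * D / a" if x: "\<forall>l\<in>{1..3}. 2 * \<delta> \<le> norm (x - P l)" for n x
  proof -
    obtain C0 where C0: "C0 \<ge> 0" "riesz a C0 (f n)" using riesz_ex by blast
    have "V n x + ln (1 + norm x) * (LINT y|lborel. f n y) \<le> c1 * (LINT y|lborel. f n y) + 2 * D / a"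
    proof (rule pot_upper[OF C0(2) a(1) a1 C0(1) rD a(1) a1 D E_borel])
      show "0 \<le> c1" unfolding c1_def using K2 by simp
      fix y assume "y \<notin> E \<delta>" "y \<noteq> x"
      then obtain l where l: "l \<in> {1..3}" "norm (y - P l) < \<delta>" by (auto simp: E_def not_le)
      have "norm (x - P l) \<le> norm (x - y) + norm (y - P l)" using norm_triangle_ineq[of "x - y" "y - P l"] by simp
      then have xy: "\<delta> \<le> norm (x - y)" using x l by force
      have "l = 1 \<or> l = 2 \<or> l = 3" using l(1) by auto
      then have "norm (P l) \<le> Pm" unfolding Pm_def by auto
      moreover have "norm y \<le> norm (P l) + norm (y - P l)" using norm_triangle_sub[of y "P l"] by simp
      ultimately have ny: "1 + norm y \<le> K" using l(2) unfolding K_def by linarith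
      have "ratio x y \<le> K / \<delta>" unfolding ratio_def using ny xy d K by (intro frac_le) auto
      then show "(1 + norm y) * (1 + ratio x y) \<le> exp c1"
        unfolding ec1 using ny K by (intro mult_mono) auto
    qed
    then show ?thesis by (simp add: mass mult.commute)
  qed
  then show ?thesis by blast
qed

text \<open>On the annulus L/2 \<le> |x| < L one has 4 U - 2 V \<ge> -2 m ln (1 + |x|) - 2 C, so h
  is at least \<open>exp (B n)\<close> times a constant times L^(-2 \<beta> 5 - 2 m). The annulus
  has area of order L^2 and h has mass m, which leaves exp (B n) = O(L^(2 \<beta> 5 + 2 m - 2)), a
  negative power since \<beta> 4 + \<beta> 5 < 1.\<close>

lemma exp_B_tendsto: "(\<lambda>n. exp (B n)) \<longlonglongrightarrow> 0"
proof -
  obtain C where C: "\<And>n x. (\<forall>l\<in>{1..3}. 2 * 1 \<le> norm (x - P l)) \<Longrightarrow> V n x + m * ln (1 + norm x) \<le> C"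
    using V_upper[of 1] by auto
  define Pm where "Pm = norm (P 1) + norm (P 2) + norm (P 3) + norm (P 5)"
  define R0 where "R0 = 2 * (Pm + 2)"
  define K where "K = 16 * m * exp (2 * C) * 2 powr (2 * \<beta> 5 + 2 * m) * 4 / (3 * pi)"
  have bound: "exp (B n) \<le> K * L n powr (2 * \<beta> 5 + 2 * m - 2)" if n: "L n \<ge> R0" for n
  proof -
    define l where "l = L n"
    have Pm0: "0 \<le> Pm" by (simp add: Pm_def)
    have l: "l \<ge> R0" "l \<ge> 4" "l > 0" "l/2 \<ge> Pm + 2" using n Pm0 unfolding l_def R0_def by auto
    \<comment> \<open>An annulus rather than a disc, so that x is far from \<open>P 1\<close>,
      \<open>P 2\<close>, \<open>P 3\<close>, where no upper bound on V is available.\<close>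
    define S where "S = ball (0::plane) l - ball 0 (l/2)"
    have [measurable]: "S \<in> sets borel" unfolding S_def by auto
    have "measure lborel S = measure lborel (ball (0::plane) l) - measure lborel (ball (0::plane) (l/2))"
      unfolding S_def using l by (intro measure_Diff) (auto simp: emeasure_ball_plane)
    also have "\<dots> = pi * l\<^sup>2 - pi * (l/2)\<^sup>2" using l by (simp add: measure_def emeasure_ball_plane)
    finally have Sm: "measure lborel S = 3 * pi / 4 * l\<^sup>2" by (simp add: power2_eq_square)
    have Sf: "emeasure lborel S < \<infinity>"
      using emeasure_mono[of S "ball (0::plane) l" lborel] l unfolding S_def by (auto simp: emeasure_ball_plane intro: le_less_trans)
    define c where "c = exp (B n) * (2 * l) powr (-2 * \<beta> 5) * (1/16) * (exp (-2 * C) * (2 * l) powr (-2 * m))"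
    have pw: "c * indicator S x \<le> h n x" if xP: "x \<noteq> P 5" for x
    proof (cases "x \<in> S")
      case True
      then have x: "norm x < l" "l/2 \<le> norm x" by (auto simp: S_def)
      have PmP: "norm (P i) \<le> Pm" if "i \<in> {1,2,3,5}" for i using that by (auto simp: Pm_def)
      have far: "\<forall>i\<in>{1..3}. 2 * 1 \<le> norm (x - P i)"
      proof
        fix i :: nat assume "i \<in> {1..3}"
        then have "i \<in> {1,2,3,5}" by auto
        then show "2 * 1 \<le> norm (x - P i)" using PmP[of i] x l norm_triangle_ineq2[of x "P i"] by linarith
      qed
      have "norm (x - P 5) \<le> 2 * l" using PmP[of 5] x l norm_triangle_ineq4[of x "P 5"] by simp
      then have 1: "(2 * l) powr (-2 * \<beta> 5) \<le> norm (x - P 5) powr (-2 * \<beta> 5)"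
        using xP \<beta>_simps by (intro powr_mono2') auto
      have 2: "1/16 \<le> H n x" using H_bounds[of x n] x unfolding l_def by auto
      have "exp (-2 * C) * (2 * l) powr (-2 * m) \<le> exp (-2 * C) * (1 + norm x) powr (-2 * m)"
        using x l m_pos by (intro mult_left_mono powr_mono2') auto
      also have "\<dots> = exp (- 4 * (m * ln (1 + norm x)) - 2 * (C - m * ln (1 + norm x)))"
        by (simp add: powr_def exp_add[symmetric] algebra_simps)
      also have "\<dots> \<le> exp (4 * U n x - 2 * V n x)"
      proof -
        have "v + t \<le> c \<Longrightarrow> - t \<le> u \<Longrightarrow> - 4 * t - 2 * (c - t) \<le> 4 * u - 2 * v" for v t c u :: real by (simp add: algebra_simps)
        from this[OF C[OF far, of n], of "U n x"] show ?thesis using U_ge[of x n] by simp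
      qed
      finally have 3: "exp (-2 * C) * (2 * l) powr (-2 * m) \<le> exp (4 * U n x - 2 * V n x)" .
      have "c \<le> h n x" unfolding c_def h_eq[of n x]
        using 1 2 3 by (intro mult_mono mult_left_mono mult_nonneg_nonneg) auto
      then show ?thesis using True by simp
    qed (simp add: h_nonneg)
    have ae: "AE x in lborel. c * indicator S x \<le> h n x"
      using AE_lborel_neq[of "P 5"] by eventually_elim (rule pw)
    have "c * measure lborel S = (LINT x|lborel. c * indicator S x)" by simp
    also have "\<dots> \<le> (LINT x|lborel. h n x)"
      using ae Sf h_integrable by (intro integral_mono_AE integrable_mult_right) auto
    finally have le: "c * (3 * pi / 4 * l\<^sup>2) \<le> m" by (simp add: Sm mass)
    have "(2 * l) powr (-2 * \<beta> 5) * (2 * l) powr (-2 * m) * l\<^sup>2 = 2 powr (- (2 * \<beta> 5 + 2 * m)) * l powr (- (2 * \<beta> 5 + 2 * m - 2))"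
    proof -
      have "(2 * l) powr (-2 * \<beta> 5) * (2 * l) powr (-2 * m) = (2 * l) powr (- (2 * \<beta> 5 + 2 * m))"
        unfolding powr_add[symmetric] by simp
      also have "\<dots> = 2 powr (- (2 * \<beta> 5 + 2 * m)) * l powr (- (2 * \<beta> 5 + 2 * m))" using l by (subst powr_mult) auto
      moreover have "l powr (- (2 * \<beta> 5 + 2 * m)) * l\<^sup>2 = l powr (- (2 * \<beta> 5 + 2 * m - 2))"
      proof -
        have "l\<^sup>2 = l powr 2" using l by (simp add: powr_numeral)
        then show ?thesis by (simp only: powr_add[symmetric]) (simp add: algebra_simps)
      qed
      ultimately show ?thesis by (simp add: mult.assoc)
    qed
    then have "c * (3 * pi / 4 * l\<^sup>2) = exp (B n) * (1/16) * exp (-2 * C) * (3 * pi / 4) * (2 powr (- (2 * \<beta> 5 + 2 * m)) * l powr (- (2 * \<beta> 5 + 2 * m - 2)))"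
      unfolding c_def by (simp add: mult_ac)
    with le have "exp (B n) * ((1/16) * exp (-2 * C) * (3 * pi / 4) * (2 powr (- (2 * \<beta> 5 + 2 * m)) * l powr (- (2 * \<beta> 5 + 2 * m - 2)))) \<le> m"
      by (simp only: mult.assoc)
    moreover have "0 < (1/16) * exp (-2 * C) * (3 * pi / 4) * (2 powr (- (2 * \<beta> 5 + 2 * m)) * l powr (- (2 * \<beta> 5 + 2 * m - 2)))"
      using l by simp
    ultimately have "exp (B n) \<le> m / ((1/16) * exp (-2 * C) * (3 * pi / 4) * (2 powr (- (2 * \<beta> 5 + 2 * m)) * l powr (- (2 * \<beta> 5 + 2 * m - 2))))"
      by (simp only: pos_le_divide_eq)
    also have "\<dots> = K * l powr (2 * \<beta> 5 + 2 * m - 2)"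
    proof -
      have gen: "M / ((1/16) * (1 / e) * (3 * pi / 4) * ((1 / p) * (1 / q))) = 16 * M * e * p * 4 / (3 * pi) * q"
        if "0 < p" "0 < q" "0 < e" for M p q e :: real using that by simp
      have e: "exp (-2 * C) = 1 / exp (2 * C)" by (simp add: exp_minus divide_inverse)
      show ?thesis unfolding K_def e powr_minus_divide using l by (intro gen) auto
    qed
    finally show ?thesis by (simp add: l_def)
  qed
  have "(\<lambda>n. L n powr (2 * \<beta> 5 + 2 * m - 2)) \<longlonglongrightarrow> 0"
    using \<beta>5 by (intro tendsto_neg_powr L) auto
  then have "(\<lambda>n. K * L n powr (2 * \<beta> 5 + 2 * m - 2)) \<longlonglongrightarrow> 0" by (rule tendsto_mult_right_zero)
  moreover have "\<forall>\<^sub>F n in sequentially. norm (exp (B n)) \<le> K * L n powr (2 * \<beta> 5 + 2 * m - 2)"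
    using L[unfolded filterlim_at_top, rule_format, of R0] by eventually_elim (use bound in auto)
  ultimately show ?thesis by (rule Lim_null_comparison[rotated])
qed

lemma L_eventually: "\<forall>\<^sub>F n in sequentially. R \<le> L n"
  using L unfolding filterlim_at_top by blast

lemma exp_B_small: "0 < e \<Longrightarrow> \<forall>\<^sub>F n in sequentially. exp (B n) < e"
  using order_tendstoD(2)[OF exp_B_tendsto] by blast

text \<open>Off \<open>P 5\<close> the weight of h is bounded on the disc, so Jensen's inequality is
  applied without a pole. Compactness of the disc supplies an artificial decay of order 3.\<close>

lemma h_off:
  assumes d: "0 < \<delta>" and R: "0 \<le> R"
  shows "\<exists>C\<ge>0. \<forall>n. R \<le> L n \<longrightarrow> riesz a (C * exp (B n)) (\<lambda>y. indicator (cball 0 R - ball (P 5) \<delta>) y * h n y)"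
proof -
  define S where "S = cball 0 R - ball (P 5) \<delta>"
  have [measurable]: "S \<in> sets borel" unfolding S_def by auto
  obtain C where C: "C \<ge> 0" and J: "\<And>f P k D Ck x. f \<in> borel_measurable borel \<Longrightarrow> (\<forall>y. 0 \<le> f y) \<Longrightarrow>
     (\<integral>\<^sup>+y. ennreal (f y) \<partial>lborel) \<le> ennreal m \<Longrightarrow> 0 \<le> Ck \<Longrightarrow>
     (\<forall>y. y \<in> D \<longrightarrow> y \<noteq> P \<longrightarrow> k y \<le> Ck * ((1 + norm y) powr (-3) * min 1 (norm (y - P)) powr (-0))) \<Longrightarrow>
     (\<integral>\<^sup>+y. indicator D y * ennreal (ratio x y powr a * k y * exp (4 * pot f y)) \<partial>lborel) \<le> ennreal (C * Ck)"
    using jensen_kernel[of 0 a m 3] a m_pos \<beta>4 by auto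
  define K where "K = (1 + R) powr a * (\<delta> powr (-2 * \<beta> 5) * 16 * (1 + R) powr (2 * m)) * (1 + R) powr 3"
  have K: "0 \<le> K" by (simp add: K_def)
  have "riesz a (C * K * exp (B n)) (\<lambda>y. indicator S y * h n y)" if n: "R \<le> L n" for n
    unfolding riesz_def
  proof (intro conjI allI)
    show "(\<lambda>y. indicator S y * h n y) \<in> borel_measurable borel" by measurable
    show "0 \<le> indicator S y * h n y" for y by (simp add: h_nonneg)
    fix x
    define k where "k y = (1 + norm y) powr a * (exp (B n) * norm (y - P 5) powr (-2 * \<beta> 5) * H n y * exp (-2 * V n y))" for y
    have "(\<integral>\<^sup>+y. ennreal (ratio x y powr a * (1 + norm y) powr a * (indicator S y * h n y)) \<partial>lborel)
      = (\<integral>\<^sup>+y. indicator S y * ennreal (ratio x y powr a * k y * exp (4 * U n y)) \<partial>lborel)"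
      by (intro nn_integral_cong, subst h_eq) (auto simp: indicator_def k_def exp_diff exp_minus divide_inverse mult_ac)
    also have "\<dots> \<le> ennreal (C * (K * exp (B n)))"
    proof (rule J[where P = 0])
      show "\<forall>y. y \<in> S \<longrightarrow> y \<noteq> 0 \<longrightarrow> k y \<le> K * exp (B n) * ((1 + norm y) powr (-3) * min 1 (norm (y - 0)) powr (-0))"
      proof (intro allI impI)
        fix y assume "y \<in> S" "y \<noteq> 0"
        then have y: "norm y \<le> R" "\<delta> \<le> norm (y - P 5)" by (auto simp: S_def dist_norm norm_minus_commute)
        have 1: "norm (y - P 5) powr (-2 * \<beta> 5) \<le> \<delta> powr (-2 * \<beta> 5)" using y d \<beta>_simps by (intro powr_mono2') auto
        have 2: "0 \<le> H n y" "H n y \<le> 16" using H_bounds[of y n] y n by auto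
        have 3: "exp (-2 * V n y) \<le> (1 + R) powr (2 * m)"
          using exp_V_le[of n y] y m_pos powr_mono2[of "2 * m" "1 + norm y" "1 + R"] by auto
        have 4: "(1 + norm y) powr a \<le> (1 + R) powr a" using y a by (intro powr_mono2) auto
        have "k y \<le> (1 + R) powr a * (exp (B n) * \<delta> powr (-2 * \<beta> 5) * 16 * (1 + R) powr (2 * m))"
          unfolding k_def using 1 2 3 4 by (intro mult_mono) auto
        also have "\<dots> = (1 + R) powr a * (exp (B n) * \<delta> powr (-2 * \<beta> 5) * 16 * (1 + R) powr (2 * m)) * 1" by simp
        also have "\<dots> \<le> (1 + R) powr a * (exp (B n) * \<delta> powr (-2 * \<beta> 5) * 16 * (1 + R) powr (2 * m)) * ((1 + R) powr 3 * (1 + norm y) powr (-3))"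
        proof (intro mult_left_mono)
          have "(1 + norm y) powr 3 \<le> (1 + R) powr 3" using y by (intro powr_mono2) auto
          then show "1 \<le> (1 + R) powr 3 * (1 + norm y) powr (-3)" by (simp add: powr_minus field_simps)
        qed auto
        also have "\<dots> = K * exp (B n) * (1 + norm y) powr (-3)" by (simp only: K_def mult_ac)
        finally have "k y \<le> K * exp (B n) * (1 + norm y) powr (-3)" .
        moreover have "min 1 (norm (y - 0)) powr (-0) = (1::real)" using \<open>y \<noteq> 0\<close> by (simp add: min_def)
        ultimately show "k y \<le> K * exp (B n) * ((1 + norm y) powr (-3) * min 1 (norm (y - 0)) powr (-0))"
          by simp
      qed
    qed (use K h_nonneg nn_mass in auto)
    finally show "(\<integral>\<^sup>+y. ennreal (ratio x y powr a * (1 + norm y) powr a * (indicator S y * h n y)) \<partial>lborel) \<le> ennreal (C * K * exp (B n))"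
      by (simp add: mult.assoc)
  qed
  then show ?thesis unfolding S_def using C K by (intro exI[of _ "C * K"]) auto
qed

end

lemma abs_ln_le_twice:
  assumes "\<bar>r - 1\<bar> \<le> \<eta>" "\<eta> \<le> (1/2::real)" shows "\<bar>ln r\<bar> \<le> 2 * \<eta>"
proof -
  have r: "1/2 \<le> r" "r > 0" using assms by linarith+
  have 1: "ln r \<le> r - 1" using r by (intro ln_le_minus_one)
  have "- ln r = ln (1 / r)" using r by (simp add: ln_div)
  also have "\<dots> \<le> 1 / r - 1" using r by (intro ln_le_minus_one) simp
  also have "\<dots> = (1 - r) / r" using r by (simp add: diff_divide_distrib)
  also have "\<dots> \<le> \<eta> / r" using assms r by (intro divide_right_mono) auto
  also have "\<dots> \<le> \<eta> / (1/2)" using assms r by (intro divide_left_mono) auto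
  finally have "- ln r \<le> 2 * \<eta>" by simp
  moreover have "0 \<le> \<eta>" using assms by linarith
  ultimately show ?thesis using 1 assms by (simp add: abs_le_iff)
qed

context toda_family
begin

text \<open>The factor 8 keeps the open discs of radius 4 * \<rho> around the five points disjoint,
  with \<rho> \<le> 1 to stay inside the common disc of radius \<open>Rp\<close>.\<close>

lemma separation: "\<exists>\<rho>>0. \<rho> \<le> 1 \<and> (\<forall>k\<in>{1..5}. \<forall>l\<in>{1..5}. k \<noteq> l \<longrightarrow> 8 * \<rho> \<le> norm (P k - P l))"
proof -
  define S where "S = insert 1 ((\<lambda>(k, l). norm (P k - P l) / 8) ` {p \<in> {1..5} \<times> {1..5}. fst p \<noteq> snd p})"
  have fin: "finite S" "S \<noteq> {}" unfolding S_def by auto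
  have "0 < Min S" using fin inj by (subst Min_gr_iff) (auto simp: S_def inj_on_def)
  moreover have "Min S \<le> 1" using fin by (intro Min_le) (auto simp: S_def)
  moreover have "8 * Min S \<le> norm (P k - P l)" if "k \<in> {1..5}" "l \<in> {1..5}" "k \<noteq> l" for k l
  proof -
    have "Min S \<le> norm (P k - P l) / 8" using fin that by (intro Min_le) (force simp: S_def)+
    then show ?thesis by simp
  qed
  ultimately show ?thesis by blast
qed

definition Rp :: real where "Rp = (\<Sum>l\<in>{1..5}. norm (P l)) + 8"

lemma norm_near_P:
  assumes "l \<in> {1..5}" "norm (x - P l) < 8" shows "norm x \<le> Rp"
proof -
  have "norm (P l) \<le> (\<Sum>l\<in>{1..5}. norm (P l))" using assms by (intro member_le_sum) auto
  then show ?thesis using assms norm_triangle_sub[of x "P l"] unfolding Rp_def by linarith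
qed

lemma Rp_nonneg: "0 \<le> Rp"
  unfolding Rp_def by (intro add_nonneg_nonneg sum_nonneg) auto

lemma f_upper:
  assumes d: "0 < \<delta>" and R: "0 \<le> R"
  shows "\<exists>C\<ge>0. \<forall>n x. norm x \<le> R \<longrightarrow> (\<forall>l\<in>{1..4}. 2 * \<delta> \<le> norm (x - P l)) \<longrightarrow> f n x \<le> C * exp (A n)"
proof -
  obtain CV where CV: "\<And>n x. (\<forall>l\<in>{1..3}. 2 * \<delta> \<le> norm (x - P l)) \<Longrightarrow> V n x + m * ln (1 + norm x) \<le> CV"
    using V_upper[OF d] by blast
  obtain CW where CW: "CW \<ge> 0" "\<And>x. (\<forall>l\<in>{1..3}. 2 * \<delta> \<le> norm (x - P l)) \<Longrightarrow>
    W x \<le> CW * ((1 + norm x) powr (-(4 - 2 * m)) * min 1 (norm (x - P 4)) powr (-2 * m))"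
    using W_off[of "2 * \<delta>"] d by auto
  define C where "C = CW * (1 * min 1 (2 * \<delta>) powr (-2 * m)) * (exp (4 * CV) * (1 + R) powr (2 * m))"
  have "f n x \<le> C * exp (A n)" if x: "norm x \<le> R" "\<forall>l\<in>{1..4}. 2 * \<delta> \<le> norm (x - P l)" for n x
  proof -
    have x3: "\<forall>l\<in>{1..3}. 2 * \<delta> \<le> norm (x - P l)" using x by auto
    have x4: "2 * \<delta> \<le> norm (x - P 4)" using x(2) by simp
    have "(1 + norm x) powr (-(4 - 2 * m)) \<le> 1" using \<beta>4 by (intro powr_neg_le_one) auto
    moreover have "min 1 (norm (x - P 4)) powr (-2 * m) \<le> min 1 (2 * \<delta>) powr (-2 * m)"
      using x4 d m_pos by (intro powr_mono2') auto
    ultimately have 1: "W x \<le> CW * (1 * min 1 (2 * \<delta>) powr (-2 * m))"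
      using CW(2)[OF x3] CW(1) by (intro order_trans[OF CW(2)[OF x3]] mult_left_mono mult_mono) auto
    have "0 \<le> m * ln (1 + norm x)" using m_pos by simp
    then have "V n x \<le> CV" using CV[OF x3, of n] by linarith
    then have 2: "exp (4 * V n x) \<le> exp (4 * CV)" by simp
    have 3: "exp (-2 * U n x) \<le> (1 + R) powr (2 * m)"
      using order_trans[OF exp_U_le powr_mono2[of "2 * m" "1 + norm x" "1 + R"]] x m_pos by auto
    have "f n x = exp (A n) * (W x * (exp (4 * V n x) * exp (-2 * U n x)))"
      by (subst f_eq) (simp add: exp_diff exp_minus divide_inverse mult_ac)
    also have "\<dots> \<le> exp (A n) * (CW * (1 * min 1 (2 * \<delta>) powr (-2 * m)) * (exp (4 * CV) * (1 + R) powr (2 * m)))"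
      using 1 2 3 CW(1) by (intro mult_left_mono mult_mono) auto
    finally show ?thesis by (simp add: C_def mult_ac)
  qed
  moreover have "0 \<le> C" unfolding C_def using CW by simp
  ultimately show ?thesis by blast
qed

text \<open>The density near x is covered by \<open>h_off\<close>; the mass near \<open>P 5\<close>
  and the mass beyond R + 1 are both at a fixed distance from x.\<close>

lemma U_upper:
  assumes d: "0 < \<delta>" and R: "0 \<le> R"
  shows "\<exists>C. \<forall>\<^sub>F n in sequentially. \<forall>x. norm x \<le> R \<longrightarrow> 2 * \<delta> \<le> norm (x - P 5) \<longrightarrow> U n x \<le> C"
proof -
  define S where "S = cball 0 (R + 1) - ball (P 5) \<delta>"
  have S: "S \<in> sets borel" unfolding S_def by auto
  obtain C where C: "C \<ge> 0" "\<And>n. R + 1 \<le> L n \<Longrightarrow> riesz a (C * exp (B n)) (\<lambda>y. indicator S y * h n y)"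
    using h_off[OF d, of "R + 1"] R unfolding S_def by auto
  define d' where "d' = min 1 \<delta>"
  have d': "0 < d'" using d by (simp add: d'_def)
  have "\<forall>\<^sub>F n in sequentially. \<forall>x. norm x \<le> R \<longrightarrow> 2 * \<delta> \<le> norm (x - P 5) \<longrightarrow> U n x \<le> C * 1 / a + ln (1 + (1 + R) / d') * m"
    using L_eventually[of "R + 1"] exp_B_small[of 1, OF zero_less_one]
  proof eventually_elim
    case (elim n)
    show ?case
    proof (intro allI impI)
      fix x :: plane assume x: "norm x \<le> R" "2 * \<delta> \<le> norm (x - P 5)"
      obtain C0 where C0: "C0 \<ge> 0" "riesz a C0 (h n)" using riesz_ex by blast
      have "U n x = pot (\<lambda>y. indicator S y * h n y) x + pot (\<lambda>y. indicator (- S) y * h n y) x"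
        by (rule pot_split[OF C0(2) a(1) a1 C0(1) S])
      moreover have "pot (\<lambda>y. indicator S y * h n y) x \<le> C * exp (B n) / a"
        using C by (intro pot_le[OF C(2)[OF elim(1)] a(1) a1]) simp
      moreover have "C * exp (B n) / a \<le> C * 1 / a" using elim C a by (intro divide_right_mono mult_left_mono) auto
      moreover have "pot (\<lambda>y. indicator (- S) y * h n y) x \<le> ln (1 + (1 + norm x) / d') * (LINT y|lborel. h n y)"
      proof (rule pot_separated[OF C0(2) a(1) a1 C0(1) d'])
        show "- S \<in> sets borel" by (rule borel_comp[OF S])
        fix y assume "y \<in> - S"
        then consider "norm y > R + 1" | "norm (y - P 5) < \<delta>" by (auto simp: S_def dist_norm norm_minus_commute)
        then show "d' \<le> norm (x - y)"
        proof cases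
          case 1
          then show ?thesis using x norm_triangle_ineq2[of y x] unfolding d'_def by (simp add: norm_minus_commute)
        next
          case 2
          then show ?thesis using x norm_triangle_ineq[of "x - y" "y - P 5"] unfolding d'_def by simp
        qed
      qed
      moreover have "ln (1 + (1 + norm x) / d') * (LINT y|lborel. h n y) \<le> ln (1 + (1 + R) / d') * m"
        unfolding mass using x d' m_pos by (intro mult_right_mono ln_mono add_left_mono divide_right_mono) (auto simp: add_pos_nonneg)
      ultimately show "U n x \<le> C * 1 / a + ln (1 + (1 + R) / d') * m" by linarith
    qed
  qed
  then show ?thesis by blast
qed

lemma h_upper:
  assumes d: "0 < \<delta>" and R: "0 \<le> R"
  shows "\<exists>C\<ge>0. \<forall>\<^sub>F n in sequentially. \<forall>x. norm x \<le> R \<longrightarrow> 2 * \<delta> \<le> norm (x - P 5) \<longrightarrow> h n x \<le> C * exp (B n)"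
proof -
  obtain CU where CU: "\<forall>\<^sub>F n in sequentially. \<forall>x. norm x \<le> R \<longrightarrow> 2 * \<delta> \<le> norm (x - P 5) \<longrightarrow> U n x \<le> CU"
    using U_upper[OF d R] by blast
  define C where "C = (2 * \<delta>) powr (-2 * \<beta> 5) * 16 * (exp (4 * CU) * (1 + R) powr (2 * m))"
  have "\<forall>\<^sub>F n in sequentially. \<forall>x. norm x \<le> R \<longrightarrow> 2 * \<delta> \<le> norm (x - P 5) \<longrightarrow> h n x \<le> C * exp (B n)"
    using CU L_eventually[of R]
  proof eventually_elim
    case (elim n)
    show ?case
    proof (intro allI impI)
      fix x :: plane assume x: "norm x \<le> R" "2 * \<delta> \<le> norm (x - P 5)"
      have 1: "norm (x - P 5) powr (-2 * \<beta> 5) \<le> (2 * \<delta>) powr (-2 * \<beta> 5)" using x d \<beta>_simps by (intro powr_mono2') auto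
      have 2: "0 \<le> H n x" "H n x \<le> 16" using H_bounds[of x n] x elim by auto
      have 3: "exp (4 * U n x) \<le> exp (4 * CU)" using elim(1) x by simp
      have 4: "exp (-2 * V n x) \<le> (1 + R) powr (2 * m)"
        using order_trans[OF exp_V_le powr_mono2[of "2 * m" "1 + norm x" "1 + R"]] x m_pos by auto
      have "h n x = exp (B n) * (norm (x - P 5) powr (-2 * \<beta> 5) * H n x * (exp (4 * U n x) * exp (-2 * V n x)))"
        by (subst h_eq) (simp add: exp_diff exp_minus divide_inverse mult_ac)
      also have "\<dots> \<le> exp (B n) * ((2 * \<delta>) powr (-2 * \<beta> 5) * 16 * (exp (4 * CU) * (1 + R) powr (2 * m)))"
        using 1 2 3 4 by (intro mult_left_mono mult_mono) auto
      finally show "h n x \<le> C * exp (B n)" by (simp add: C_def mult_ac)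
    qed
  qed
  moreover have "0 \<le> C" unfolding C_def by simp
  ultimately show ?thesis by blast
qed

lemma kernel_ball_bound:
  fixes Q :: plane
  shows
  "\<exists>K\<ge>0. \<forall>x. (\<integral>\<^sup>+y. indicator (ball Q r) y * ennreal (norm (x - y) powr (-1)) \<partial>lborel) \<le> ennreal K"
  using local_singular_bound[of 1 Q r] by simp

text \<open>Pohozaev at \<open>P 5\<close>: the mass M of a small disc satisfies M (1 - \<beta> 5) -
  M^2 \<le> a small multiple of M plus a term of order \<open>exp (B n)\<close>. Since M \<le> m < 1
  - \<beta> 5, the left side is at least M (1 - \<beta> 5 - m), so M itself is O(exp (B n)).\<close>

lemma M5_small: "\<exists>\<delta>>0. \<delta> \<le> 1 \<and> (\<forall>e>0. \<forall>\<^sub>F n in sequentially. (LINT y|lborel. indicator (ball (P 5) \<delta>) y * h n y) < e)"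
proof -
  obtain \<rho> where \<rho>: "\<rho> > 0" "\<rho> \<le> 1" and sep: "\<And>k l. k \<in> {1..5} \<Longrightarrow> l \<in> {1..5} \<Longrightarrow> k \<noteq> l \<Longrightarrow> 8 * \<rho> \<le> norm (P k - P l)"
    using separation by blast
  obtain CA where CA: "\<And>n. A n \<le> CA" using A_upper by blast
  obtain Cf where Cf: "Cf \<ge> 0" "\<And>n x. norm x \<le> Rp \<Longrightarrow> (\<forall>l\<in>{1..4}. 2 * (2 * \<rho>) \<le> norm (x - P l)) \<Longrightarrow> f n x \<le> Cf * exp (A n)"
    using f_upper[of "2 * \<rho>" Rp] \<rho> Rp_nonneg by auto
  obtain K where K: "K \<ge> 0" "\<And>x. (\<integral>\<^sup>+y. indicator (ball (P 5) (4 * \<rho>)) y * ennreal (norm (x - y) powr (-1)) \<partial>lborel) \<le> ennreal K"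
    using kernel_ball_bound by blast
  have inRp: "norm x \<le> Rp" if "x \<in> ball (P 5) (4 * \<rho>)" for x
    using that \<rho> by (intro norm_near_P[of 5]) (auto simp: dist_norm norm_minus_commute)
  define KV where "KV = Cf * exp CA * K + m / (2 * \<rho>)"
  have KV: "0 \<le> KV" unfolding KV_def using Cf K m_pos \<rho> by simp
  \<comment> \<open>\<open>P 5\<close> is a regular point of f, which is bounded nearby; thus V is
    Lipschitz there with a constant independent of n, and -2 V can be part of \<open>G\<close> in
    the Pohozaev inequality.\<close>
  have newt: "(\<integral>\<^sup>+y. ennreal (f n y / norm (x - y)) \<partial>lborel) \<le> ennreal KV" if x: "x \<in> ball (P 5) (2 * \<rho>)" for n x
  proof -
    obtain C0 where C0: "C0 \<ge> 0" "riesz a C0 (f n)" using riesz_ex by blast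
    have "(\<integral>\<^sup>+y. ennreal (indicator UNIV y * f n y / norm (x - y)) \<partial>lborel) \<le> ennreal (Cf * exp CA * K + m / (2 * \<rho>))"
    proof (rule newtonian_bound[OF C0(2) a(1) a1 C0(1)])
      show "f n y \<le> Cf * exp CA" if y: "y \<in> ball (P 5) (4 * \<rho>)" for y
      proof -
        have "f n y \<le> Cf * exp (A n)"
        proof (rule Cf(2)[OF inRp[OF y]], intro ballI)
          fix l :: nat assume l: "l \<in> {1..4}"
          have "norm (P 5 - P l) \<le> norm (P 5 - y) + norm (y - P l)" using norm_triangle_ineq[of "P 5 - y" "y - P l"] by simp
          then show "2 * (2 * \<rho>) \<le> norm (y - P l)" using sep[of 5 l] l y by (auto simp: dist_norm)
        qed
        also have "\<dots> \<le> Cf * exp CA" using CA Cf by (intro mult_left_mono) auto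
        finally show ?thesis .
      qed
      show "2 * \<rho> \<le> norm (x - y)" if "y \<notin> ball (P 5) (4 * \<rho>)" for y
        using that x dist_triangle[of "P 5" y x] by (simp add: dist_norm)
    qed (use K Cf \<rho> mass in auto)
    then show ?thesis by (simp add: KV_def)
  qed
  define Lp where "Lp = 4 + 2 * KV"
  \<comment> \<open>Half of the gap 1 - \<beta> 5 - m: one half absorbs the error linear in M, the
    other half remains on the left.\<close>
  define g where "g = (1 - \<beta> 5 - m) / 2"
  have g: "0 < g" using \<beta>5 by (simp add: g_def)
  \<comment> \<open>Bounds the error coefficient once \<open>S * K\<close> \<le> 1, which holds
    eventually because \<open>S\<close> is a multiple of \<open>exp (B n)\<close>. So \<delta> can
    be fixed before n.\<close>
  define T where "T = Lp + 4 * (1 + m / \<rho>)"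
  have T: "0 < T" unfolding T_def Lp_def using KV m_pos \<rho> by (simp add: add_pos_nonneg)
  define \<delta> where "\<delta> = min \<rho> (2 * g / T)"
  have \<delta>: "0 < \<delta>" "\<delta> \<le> \<rho>" unfolding \<delta>_def using \<rho> g T by auto
  have "\<delta> \<le> 2 * g / T" unfolding \<delta>_def by simp
  then have dT: "\<delta> * T / 2 \<le> g" using T by (simp add: field_simps)
  obtain Ch where Ch: "Ch \<ge> 0" "\<forall>\<^sub>F n in sequentially. \<forall>x. norm x \<le> Rp \<longrightarrow> 2 * (\<delta> / 2) \<le> norm (x - P 5) \<longrightarrow> h n x \<le> Ch * exp (B n)"
    using h_upper[of "\<delta> / 2" Rp] \<delta> Rp_nonneg by auto
  have Kp: "0 < 1 / (Ch * K + 1)" using K Ch by (simp add: add_nonneg_pos)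
  have main: "\<forall>\<^sub>F n in sequentially. (LINT y|lborel. indicator (ball (P 5) \<delta>) y * h n y) \<le> (pi * \<delta>\<^sup>2 * Ch / g) * exp (B n)"
    using Ch(2) L_eventually[of Rp] exp_B_small[OF Kp]
  proof eventually_elim
    case (elim n)
    define M where "M = (LINT y|lborel. indicator (ball (P 5) \<delta>) y * h n y)"
    obtain C0 where C0: "C0 \<ge> 0" "riesz a C0 (f n)" "riesz a C0 (h n)" using riesz_ex by blast
    define S where "S = Ch * exp (B n)"
    have S: "0 \<le> S" using Ch by (simp add: S_def)
    have SK: "S * K \<le> 1"
    proof -
      have p: "0 < Ch * K + 1" using K Ch by (simp add: add_nonneg_pos)
      have "exp (B n) * (Ch * K + 1) \<le> 1" using p elim(3) by (simp add: less_divide_eq)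
      moreover have "exp (B n) * (Ch * K + 1) = Ch * exp (B n) * K + exp (B n)" by (simp add: algebra_simps)
      ultimately show ?thesis unfolding S_def using exp_gt_zero[of "B n"] by linarith
    qed
    have M: "0 \<le> M" "M \<le> m"
      unfolding M_def using h_nonneg restrict_integral_le[OF C0(3) a(1) a1 C0(1), of "ball (P 5) \<delta>"] mass by auto
    have "M * (1 - \<beta> 5) - M\<^sup>2 \<le> \<delta> * (Lp + 4 * (S * K + m / \<rho>)) * M / 2 + pi * \<delta>\<^sup>2 * S"
      unfolding M_def
    proof (rule pohozaev_local(1)[OF C0(3) a(1) a1 C0(1) _ _ \<delta>])
      show "(LINT y|lborel. h n y) \<le> m" by (simp add: mass)
      show "h n x = norm (x - P 5) powr (-2 * \<beta> 5) * exp ((B n + ln (H n x) - 2 * V n x) + 4 * pot (h n) x)"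
        if "x \<in> ball (P 5) (2 * \<rho>)" "x \<noteq> P 5" for x
      proof -
        have "x \<in> ball (P 5) (4 * \<rho>)" using that \<rho> by auto
        then have "0 < H n x" using H_bounds[of x n] inRp[of x] elim(2) by fastforce
        then have "exp ((B n + ln (H n x) - 2 * V n x) + 4 * pot (h n) x) = exp (B n) * H n x * exp (4 * U n x - 2 * V n x)"
          by (simp add: exp_add exp_diff)
        then show ?thesis by (subst h_eq) simp
      qed
      show "\<bar>(B n + ln (H n x) - 2 * V n x) - (B n + ln (H n y) - 2 * V n y)\<bar> \<le> Lp * norm (x - y)"
        if "x \<in> ball (P 5) (2 * \<rho>)" "y \<in> ball (P 5) (2 * \<rho>)" for x y
      proof -
        have "norm x \<le> L n" "norm y \<le> L n" using inRp[of x] inRp[of y] that \<rho> elim(2) by auto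
        then have "\<bar>ln (H n x) - ln (H n y)\<bar> \<le> 4 * norm (x - y)" by (rule H_lip)
        moreover have "\<bar>V n x - V n y\<bar> \<le> KV * norm (x - y)"
          by (rule pot_lipschitz[OF C0(2) a(1) a1 C0(1) KV newt[OF that(1)] newt[OF that(2)]])
        moreover have "Lp * norm (x - y) = 4 * norm (x - y) + 2 * (KV * norm (x - y))" by (simp add: Lp_def algebra_simps)
        ultimately show ?thesis by linarith
      qed
      show "h n x \<le> S" if "\<delta> \<le> norm (x - P 5)" "norm (x - P 5) < 4 * \<rho>" for x
        unfolding S_def using elim(1) inRp[of x] that by (auto simp: dist_norm norm_minus_commute)
    qed (use \<beta>_simps S K in auto)
    also have "\<delta> * (Lp + 4 * (S * K + m / \<rho>)) * M / 2 \<le> (\<delta> * T / 2) * M"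
    proof -
      have "Lp + 4 * (S * K + m / \<rho>) \<le> T" using SK by (simp add: T_def)
      then have "\<delta> * (Lp + 4 * (S * K + m / \<rho>)) * M \<le> \<delta> * T * M" using \<delta> M by (intro mult_right_mono mult_left_mono) auto
      then show ?thesis by simp
    qed
    also have "(\<delta> * T / 2) * M \<le> g * M" using dT M by (intro mult_right_mono) auto
    finally have 1: "M * (1 - \<beta> 5) - M\<^sup>2 \<le> g * M + pi * \<delta>\<^sup>2 * S" by simp
    have "M * M \<le> m * M" using M by (intro mult_right_mono) auto
    moreover have "2 * g * M = M * (1 - \<beta> 5) - m * M" by (simp add: g_def left_diff_distrib right_diff_distrib mult.commute)
    ultimately have "2 * g * M \<le> M * (1 - \<beta> 5) - M\<^sup>2" by (simp add: power2_eq_square)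
    then have "g * M \<le> pi * \<delta>\<^sup>2 * S" using 1 by linarith
    then have "M \<le> pi * \<delta>\<^sup>2 * S / g" using g by (simp add: pos_le_divide_eq mult.commute)
    then show ?case by (simp add: M_def S_def)
  qed
  have "\<forall>\<^sub>F n in sequentially. (LINT y|lborel. indicator (ball (P 5) \<delta>) y * h n y) < e" if e: "0 < e" for e
  proof -
    define c where "c = pi * \<delta>\<^sup>2 * Ch / g"
    have c: "0 \<le> c" using Ch g by (simp add: c_def)
    have cp: "0 < e / (c + 1)" using e c by simp
    show ?thesis using main exp_B_small[OF cp]
    proof eventually_elim
      case (elim n)
      have p: "0 < c + 1" using c by linarith
      have "exp (B n) * (c + 1) < e" using p elim(2) by (simp add: pos_less_divide_eq)
      moreover have "c * exp (B n) \<le> exp (B n) * (c + 1)" by (simp add: algebra_simps)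
      ultimately show ?case using elim(1) unfolding c_def by linarith
    qed
  qed
  then show ?thesis using \<delta> \<rho> by (intro exI[of _ \<delta>]) auto
qed

text \<open>Now that the mass near \<open>P 5\<close> is eventually below any threshold,
  \<open>local_jensen\<close> applies at the singular point itself.\<close>

lemma h_near: "\<exists>r>0. \<exists>C\<ge>0. \<forall>\<^sub>F n in sequentially. riesz a (C * exp (B n)) (\<lambda>y. indicator (ball (P 5) r) y * h n y)"
proof -
  obtain \<delta> where \<delta>: "\<delta> > 0" "\<delta> \<le> 1" "\<And>e. e > 0 \<Longrightarrow> \<forall>\<^sub>F n in sequentially. (LINT y|lborel. indicator (ball (P 5) \<delta>) y * h n y) < e"
    using M5_small by blast
  \<comment> \<open>Uses half of the room 2 - 2 * \<beta> 5 - a, so that 2 * \<beta> 5 + a + 4 * M0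
    remains below 2.\<close>
  define M0 where "M0 = (2 - 2 * \<beta> 5 - a) / 8"
  have M0: "0 < M0" "2 * \<beta> 5 + a + 4 * M0 < 2" using a(4)[of 5] by (auto simp: M0_def field_simps)
  obtain C where C: "C \<ge> 0" and J: "\<And>f a0 C0 k Ck x. riesz a0 C0 f \<Longrightarrow> 0 < a0 \<Longrightarrow> a0 \<le> 1 \<Longrightarrow> 0 \<le> C0 \<Longrightarrow>
    (LINT y|lborel. f y) \<le> m \<Longrightarrow> (LINT y|lborel. indicator (ball (P 5) \<delta>) y * f y) \<le> M0 \<Longrightarrow> 0 \<le> Ck \<Longrightarrow>
    (\<forall>y. y \<in> ball (P 5) (\<delta>/2) \<longrightarrow> y \<noteq> P 5 \<longrightarrow> 0 \<le> k y \<and> k y \<le> Ck * norm (y - P 5) powr (-(2 * \<beta> 5))) \<Longrightarrow>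
    (\<integral>\<^sup>+y. indicator (ball (P 5) (\<delta>/2)) y * ennreal (ratio x y powr a * k y * exp (4 * pot f y)) \<partial>lborel) \<le> ennreal (C * Ck)"
    using local_jensen[of "2 * \<beta> 5" a M0 \<delta> m "P 5"] M0 \<delta> a \<beta>_simps m_pos by auto
  define K where "K = (1 + Rp) powr a * (16 * (1 + Rp) powr (2 * m))"
  have K: "0 \<le> K" by (simp add: K_def)
  have "\<forall>\<^sub>F n in sequentially. riesz a (C * K * exp (B n)) (\<lambda>y. indicator (ball (P 5) (\<delta>/2)) y * h n y)"
    using \<delta>(3)[OF M0(1)] L_eventually[of Rp]
  proof eventually_elim
    case (elim n)
    show ?case unfolding riesz_def
    proof (intro conjI allI)
      show "(\<lambda>y. indicator (ball (P 5) (\<delta>/2)) y * h n y) \<in> borel_measurable borel" by measurable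
      show "0 \<le> indicator (ball (P 5) (\<delta>/2)) y * h n y" for y by (simp add: h_nonneg)
      fix x
      obtain C0 where C0: "C0 \<ge> 0" "riesz a C0 (h n)" using riesz_ex by blast
      define k where "k y = (1 + norm y) powr a * (exp (B n) * norm (y - P 5) powr (-2 * \<beta> 5) * H n y * exp (-2 * V n y))" for y
      have "(\<integral>\<^sup>+y. ennreal (ratio x y powr a * (1 + norm y) powr a * (indicator (ball (P 5) (\<delta>/2)) y * h n y)) \<partial>lborel)
        = (\<integral>\<^sup>+y. indicator (ball (P 5) (\<delta>/2)) y * ennreal (ratio x y powr a * k y * exp (4 * U n y)) \<partial>lborel)"
      proof (rule nn_integral_cong)
        fix y
        have "h n y = exp (B n) * norm (y - P 5) powr (-2 * \<beta> 5) * H n y * exp (-2 * V n y) * exp (4 * U n y)"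
          by (subst h_eq) (simp add: exp_diff exp_minus divide_inverse)
        then have "ratio x y powr a * (1 + norm y) powr a * h n y = ratio x y powr a * k y * exp (4 * U n y)"
          by (simp only: k_def mult.assoc)
        then show "ennreal (ratio x y powr a * (1 + norm y) powr a * (indicator (ball (P 5) (\<delta>/2)) y * h n y))
          = indicator (ball (P 5) (\<delta>/2)) y * ennreal (ratio x y powr a * k y * exp (4 * U n y))"
          by (cases "y \<in> ball (P 5) (\<delta>/2)") (simp_all only: indicator_simps mult_1_left mult_zero_left mult_zero_right ennreal_0 not_False_eq_True)
      qed
      also have "\<dots> \<le> ennreal (C * (K * exp (B n)))"
      proof (rule J[OF C0(2) a(1) a1 C0(1)])
        show "\<forall>y. y \<in> ball (P 5) (\<delta>/2) \<longrightarrow> y \<noteq> P 5 \<longrightarrow> 0 \<le> k y \<and> k y \<le> K * exp (B n) * norm (y - P 5) powr (-(2 * \<beta> 5))"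
        proof (intro allI impI)
          fix y assume y: "y \<in> ball (P 5) (\<delta>/2)" "y \<noteq> P 5"
          have ny: "norm y \<le> Rp" using y \<delta> by (intro norm_near_P[of 5]) (auto simp: dist_norm norm_minus_commute)
          have 2: "0 \<le> H n y" "H n y \<le> 16" using H_bounds[of y n] ny elim by auto
          have 3: "exp (-2 * V n y) \<le> (1 + Rp) powr (2 * m)"
            using order_trans[OF exp_V_le powr_mono2[of "2 * m" "1 + norm y" "1 + Rp"]] ny m_pos by auto
          have 4: "(1 + norm y) powr a \<le> (1 + Rp) powr a" using ny a by (intro powr_mono2) auto
          have "k y = (1 + norm y) powr a * (H n y * exp (-2 * V n y)) * (exp (B n) * norm (y - P 5) powr (-2 * \<beta> 5))"
            by (simp add: k_def mult_ac)
          also have "\<dots> \<le> K * (exp (B n) * norm (y - P 5) powr (-2 * \<beta> 5))"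
            unfolding K_def using 2 3 4 by (intro mult_right_mono mult_mono) auto
          finally have "k y \<le> K * exp (B n) * norm (y - P 5) powr (-(2 * \<beta> 5))" by (simp add: mult.assoc)
          moreover have "0 \<le> k y" unfolding k_def using 2 by simp
          ultimately show "0 \<le> k y \<and> k y \<le> K * exp (B n) * norm (y - P 5) powr (-(2 * \<beta> 5))" by simp
        qed
      qed (use K elim mass in auto)
      finally show "(\<integral>\<^sup>+y. ennreal (ratio x y powr a * (1 + norm y) powr a * (indicator (ball (P 5) (\<delta>/2)) y * h n y)) \<partial>lborel) \<le> ennreal (C * K * exp (B n))"
        by (simp add: mult.assoc)
    qed
  qed
  moreover have "0 \<le> C * K" using C K by simp
  ultimately show ?thesis using \<delta> by (intro exI[of _ "\<delta>/2"] conjI exI[of _ "C * K"]) auto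
qed

lemma h_ball:
  assumes R: "0 \<le> R"
  shows "\<exists>C\<ge>0. \<forall>\<^sub>F n in sequentially. riesz a (C * exp (B n)) (\<lambda>y. indicator (cball 0 R) y * h n y)"
proof -
  obtain r C1 where r: "r > 0" "C1 \<ge> 0" "\<forall>\<^sub>F n in sequentially. riesz a (C1 * exp (B n)) (\<lambda>y. indicator (ball (P 5) r) y * h n y)"
    using h_near by blast
  obtain C2 where C2: "C2 \<ge> 0" "\<And>n. R \<le> L n \<Longrightarrow> riesz a (C2 * exp (B n)) (\<lambda>y. indicator (cball 0 R - ball (P 5) r) y * h n y)"
    using h_off[OF r(1) R] by blast
  have "\<forall>\<^sub>F n in sequentially. riesz a ((C2 + C1) * exp (B n)) (\<lambda>y. indicator (cball 0 R) y * h n y)"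
    using r(3) L_eventually[of R]
  proof eventually_elim
    case (elim n)
    have "riesz a (C2 * exp (B n) + C1 * exp (B n)) (\<lambda>y. indicator (cball 0 R) y * h n y)"
      by (rule riesz_union[OF h_measurable h_nonneg _ _ _ _ C2(2)[OF elim(2)] elim(1)]) (use r C2 in auto)
    then show ?case by (simp add: algebra_simps)
  qed
  then show ?thesis using r C2 by (intro exI[of _ "C2 + C1"]) auto
qed

text \<open>The part of h in a large disc has Riesz bound O(exp (B n)). The remaining mass does not
  vanish, but it sits far away, where \<open>ratio x y\<close> is close to 1 and the normalised
  kernel close to 0.\<close>

lemma U_small:
  assumes R: "0 \<le> R" and e: "0 < e"
  shows "\<forall>\<^sub>F n in sequentially. \<forall>x. norm x \<le> R \<longrightarrow> \<bar>U n x\<bar> \<le> e"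
proof -
  define \<eta> where "\<eta> = min (1/2) (e / (4 * m))"
  have \<eta>: "0 < \<eta>" "\<eta> \<le> 1/2" "2 * \<eta> * m \<le> e / 2"
  proof -
    show "0 < \<eta>" "\<eta> \<le> 1/2" using e m_pos by (auto simp: \<eta>_def)
    have "\<eta> \<le> e / (4 * m)" by (simp add: \<eta>_def)
    then show "2 * \<eta> * m \<le> e / 2" using m_pos by (simp add: field_simps)
  qed
  \<comment> \<open>Chosen so that beyond R' the quotient (1 + R) / (R' - R), which bounds |ratio x
    y - 1|, equals \<eta>.\<close>
  define R' where "R' = R + (1 + R) / \<eta>"
  have R': "0 \<le> R'" "R < R'" using R \<eta> by (auto simp: R'_def add_nonneg_nonneg)
  define S where "S = cball (0::plane) R'"
  have S: "S \<in> sets borel" "- S \<in> sets borel" unfolding S_def by auto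
  obtain C where C: "C \<ge> 0" "\<forall>\<^sub>F n in sequentially. riesz a (C * exp (B n)) (\<lambda>y. indicator S y * h n y)"
    using h_ball[OF R'(1)] unfolding S_def by blast
  define T where "T = C / a + ln (1 + R) * C"
  have T: "0 \<le> T" unfolding T_def using C a R by simp
  have Tp: "0 < (e / 2) / (T + 1)" using T e by (intro divide_pos_pos) auto
  show ?thesis using C(2) exp_B_small[OF Tp]
  proof eventually_elim
    case (elim n)
    have p: "0 < T + 1" using T by linarith
    have "exp (B n) * (T + 1) < e / 2" using p elim(2) by (simp only: pos_less_divide_eq)
    then have TB: "T * exp (B n) \<le> e / 2" using exp_gt_zero[of "B n"] by (simp only: distrib_left mult.commute[of T] mult_1_right)
    define D where "D = C * exp (B n)"
    have D: "0 \<le> D" using C by (simp add: D_def)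
    show ?case
    proof (intro allI impI)
      fix x :: plane assume x: "norm x \<le> R"
      obtain C0 where C0: "C0 \<ge> 0" "riesz a C0 (h n)" using riesz_ex by blast
      define g1 where "g1 y = indicator S y * h n y" for y
      define g2 where "g2 y = indicator (- S) y * h n y" for y
      have r1: "riesz a D g1" using elim(1) unfolding g1_def D_def .
      have r2: "riesz a C0 g2" unfolding g2_def by (rule riesz_restrict[OF C0(2) S(2)])
      have eq: "U n x = pot g1 x + pot g2 x" unfolding g1_def g2_def by (rule pot_split[OF C0(2) a(1) a1 C0(1) S(1)])
      have "pot g1 x \<le> D / a" by (rule pot_le[OF r1 a(1) a1 D])
      moreover have "- (ln (1 + norm x) * (LINT y|lborel. g1 y)) \<le> pot g1 x" using pot_ge[OF r1 a(1) a1 D, of x] by simp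
      moreover have "ln (1 + norm x) * (LINT y|lborel. g1 y) \<le> ln (1 + R) * D"
        using x R riesz_integral_le[OF r1 a(1) a1 D] riesz_nonneg[OF r1 a(1) a1 D]
        by (intro mult_mono ln_mono) auto
      moreover have "D / a + ln (1 + R) * D \<le> e / 2"
        using TB by (simp add: T_def D_def algebra_simps)
      moreover have "0 \<le> D / a" "0 \<le> ln (1 + R) * D" using D a R by auto
      ultimately have 1: "\<bar>pot g1 x\<bar> \<le> e / 2" by linarith
      have "\<bar>pot g2 x\<bar> \<le> (LINT y|lborel. \<bar>g2 y * ln (ratio x y)\<bar>)"
        unfolding pot_def using integral_norm_bound[of lborel "\<lambda>y. g2 y * ln (ratio x y)"] by simp
      also have "\<dots> \<le> (LINT y|lborel. 2 * \<eta> * h n y)"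
      proof (rule integral_mono)
        show "integrable lborel (\<lambda>y. \<bar>g2 y * ln (ratio x y)\<bar>)" using riesz_log[OF r2 a(1) a1 C0(1)] by simp
        show "integrable lborel (\<lambda>y. 2 * \<eta> * h n y)" using h_integrable by simp
        show "\<bar>g2 y * ln (ratio x y)\<bar> \<le> 2 * \<eta> * h n y" for y
        proof (cases "y \<in> S")
          case True
          then show ?thesis using h_nonneg \<eta> by (simp add: g2_def)
        next
          case False
          then have y: "R' < norm y" by (simp add: S_def)
          have n: "R' - R \<le> norm (x - y)" using x y norm_triangle_ineq2[of y x] by (simp add: norm_minus_commute)
          have n0: "0 < norm (x - y)" using n R' by linarith
          have "\<bar>norm y - norm (x - y)\<bar> \<le> norm x" using norm_triangle_ineq3[of y "y - x"] by (simp add: norm_minus_commute)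
          then have "\<bar>1 + norm y - norm (x - y)\<bar> \<le> 1 + R" using x by linarith
          moreover have "ratio x y - 1 = (1 + norm y - norm (x - y)) / norm (x - y)" using n0 by (simp add: ratio_def diff_divide_distrib)
          ultimately have "\<bar>ratio x y - 1\<bar> \<le> (1 + R) / (R' - R)" using n R' by (simp add: abs_divide frac_le)
          also have "\<dots> = \<eta>" using R \<eta> by (simp add: R'_def)
          finally have "\<bar>ln (ratio x y)\<bar> \<le> 2 * \<eta>" using \<eta> by (intro abs_ln_le_twice)
          then show ?thesis using False h_nonneg[of n y] by (simp add: g2_def abs_mult mult.commute mult_left_mono)
        qed
      qed
      also have "\<dots> = 2 * \<eta> * m" by (simp add: mass)
      finally have 2: "\<bar>pot g2 x\<bar> \<le> e / 2" using \<eta> by linarith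
      show "\<bar>U n x\<bar> \<le> e" unfolding eq using 1 2 by linarith
    qed
  qed
qed

end

section \<open>Concentration of mass\<close>

lemma ln_norm_lipschitz:
  fixes x y Q :: "'a::real_normed_vector"
  assumes "0 < c" "c \<le> norm (x - Q)" "c \<le> norm (y - Q)"
  shows "\<bar>ln (norm (x - Q)) - ln (norm (y - Q))\<bar> \<le> norm (x - y) / c"
proof -
  have one: "ln (norm (x - Q)) - ln (norm (y - Q)) \<le> norm (x - y) / c"
    if "c \<le> norm (x - Q)" "c \<le> norm (y - Q)" for x y :: 'a
  proof -
    have p: "0 < norm (x - Q)" "0 < norm (y - Q)" using that assms by linarith+
    have "ln (norm (x - Q)) - ln (norm (y - Q)) = ln (norm (x - Q) / norm (y - Q))" using p by (simp add: ln_div)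
    also have "\<dots> \<le> norm (x - Q) / norm (y - Q) - 1" using p by (intro ln_le_minus_one) simp
    also have "\<dots> = (norm (x - Q) - norm (y - Q)) / norm (y - Q)" using p by (simp add: diff_divide_distrib)
    also have "\<dots> \<le> norm (x - y) / norm (y - Q)"
      using p norm_triangle_ineq2[of "x - Q" "y - Q"] by (intro divide_right_mono) auto
    also have "\<dots> \<le> norm (x - y) / c" using that assms p by (intro divide_left_mono) auto
    finally show ?thesis .
  qed
  show ?thesis using one[OF assms(2,3)] one[OF assms(3,2)] by (simp add: abs_le_iff norm_minus_commute)
qed

text \<open>Each dyadic annulus r/2 \<le> |x - Q| < r has area 3 pi / 4 * r^2 and integrand at least
  r^(-2), hence contributes at least 3 pi / 4. This quantifies the divergence of the
  integral.\<close>

lemma dyadic_log_divergence: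
  fixes Q :: plane
  assumes \<rho>: "0 < \<rho>"
  shows "ennreal (real N * (3 * pi / 4)) \<le>
    (\<integral>\<^sup>+x. indicator (ball Q \<rho> - ball Q (\<rho> / 2 ^ N)) x * ennreal (norm (x - Q) powr (-2)) \<partial>lborel)"
proof (induction N)
  case (Suc N)
  define S where "S k = ball Q \<rho> - ball Q (\<rho> / 2 ^ k)" for k :: nat
  define r where "r = \<rho> / 2 ^ N"
  have r: "0 < r" using \<rho> by (simp add: r_def)
  define A where "A = ball Q r - ball Q (r / 2)"
  have [measurable]: "S k \<in> sets borel" "A \<in> sets borel" for k unfolding S_def A_def by auto
  have sub: "ball Q (r / 2) \<subseteq> ball Q r" using r by (intro subset_ball) auto
  have "measure lborel A = measure lborel (ball Q r) - measure lborel (ball Q (r / 2))"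
    unfolding A_def using r sub by (intro measure_Diff) (auto simp: emeasure_ball_plane)
  also have "\<dots> = pi * r\<^sup>2 - pi * (r / 2)\<^sup>2" using r by (simp add: measure_def emeasure_ball_plane)
  finally have mA: "measure lborel A = 3 * pi / 4 * r\<^sup>2" by (simp add: power2_eq_square)
  have "emeasure lborel A \<le> emeasure lborel (ball Q r)" by (intro emeasure_mono) (auto simp: A_def)
  then have "emeasure lborel A < \<infinity>" using r by (simp add: emeasure_ball_plane le_less_trans)
  then have eA: "emeasure lborel A = ennreal (3 * pi / 4 * r\<^sup>2)" using mA by (simp add: emeasure_eq_ennreal_measure)
  have "ennreal (3 * pi / 4) = ennreal (1 / r\<^sup>2) * emeasure lborel A"
    unfolding eA using r by (subst ennreal_mult[symmetric]) auto
  also have "\<dots> = (\<integral>\<^sup>+x. ennreal (1 / r\<^sup>2) * indicator A x \<partial>lborel)" by (rule nn_integral_cmult_indicator[symmetric]) simp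
  also have "\<dots> \<le> (\<integral>\<^sup>+x. indicator A x * ennreal (norm (x - Q) powr (-2)) \<partial>lborel)"
  proof (rule nn_integral_mono)
    fix x
    show "ennreal (1 / r\<^sup>2) * indicator A x \<le> indicator A x * ennreal (norm (x - Q) powr (-2))"
    proof (cases "x \<in> A")
      case True
      then have x: "norm (x - Q) < r" "r / 2 \<le> norm (x - Q)" by (auto simp: A_def dist_norm norm_minus_commute)
      have "1 / r\<^sup>2 = r powr (-2)" using r by (simp add: powr_minus_divide powr_numeral)
      also have "\<dots> \<le> norm (x - Q) powr (-2)" using x r by (intro powr_mono2') auto
      finally show ?thesis using True by (simp add: ennreal_leI)
    qed simp
  qed
  finally have step: "ennreal (3 * pi / 4) \<le> (\<integral>\<^sup>+x. indicator A x * ennreal (norm (x - Q) powr (-2)) \<partial>lborel)" .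
  have ind: "indicator (S (Suc N)) x = (indicator (S N) x + indicator A x :: ennreal)" for x
  proof -
    have "r \<le> \<rho>" using \<rho> by (simp add: r_def field_simps)
    then have "ball Q r \<subseteq> ball Q \<rho>" by (intro subset_ball)
    moreover have "S N = ball Q \<rho> - ball Q r" "S (Suc N) = ball Q \<rho> - ball Q (r / 2)" by (auto simp: S_def r_def mult.commute)
    ultimately show ?thesis using sub unfolding A_def by (auto simp del: mem_ball simp: indicator_def)
  qed
  have "ennreal (real (Suc N) * (3 * pi / 4)) = ennreal (real N * (3 * pi / 4)) + ennreal (3 * pi / 4)"
    by (simp add: ennreal_plus[symmetric] ring_distribs del: ennreal_plus)
  also have "\<dots> \<le> (\<integral>\<^sup>+x. indicator (S N) x * ennreal (norm (x - Q) powr (-2)) \<partial>lborel) + (\<integral>\<^sup>+x. indicator A x * ennreal (norm (x - Q) powr (-2)) \<partial>lborel)"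
    using Suc step unfolding S_def by (intro add_mono)
  also have "\<dots> = (\<integral>\<^sup>+x. indicator (S N) x * ennreal (norm (x - Q) powr (-2)) + indicator A x * ennreal (norm (x - Q) powr (-2)) \<partial>lborel)"
    by (rule nn_integral_add[symmetric]) measurable
  also have "\<dots> = (\<integral>\<^sup>+x. indicator (S (Suc N)) x * ennreal (norm (x - Q) powr (-2)) \<partial>lborel)"
    unfolding ind by (simp add: distrib_right)
  finally show ?case unfolding S_def .
qed simp

text \<open>From t^a' \<le> 1 + t^a with t = \<open>ratio x y\<close> * (1 + |y|); the 1 is paid by
  the mass, hence the factor 2.\<close>

lemma riesz_exponent_mono:
  assumes r: "riesz a C f" and a: "0 < a" "a \<le> 1" and C: "0 \<le> C" and a': "0 < a'" "a' \<le> a"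
  shows "riesz a' (2 * C) f"
  unfolding riesz_def
proof (intro conjI allI)
  show [measurable]: "f \<in> borel_measurable borel" by (rule riesz_measurable[OF r a C])
  show f0: "0 \<le> f y" for y by (rule riesz_nonneg[OF r a C])
  fix x
  have "(\<integral>\<^sup>+y. ennreal (ratio x y powr a' * (1 + norm y) powr a' * f y) \<partial>lborel) \<le>
    (\<integral>\<^sup>+y. ennreal (f y) + ennreal (ratio x y powr a * (1 + norm y) powr a * f y) \<partial>lborel)"
  proof (rule nn_integral_mono)
    fix y
    define t where "t = ratio x y * (1 + norm y)"
    have t0: "0 \<le> t" by (simp add: t_def)
    have "t powr a' \<le> 1 + t powr a"
    proof (cases "t \<le> 1")
      case True
      have "t powr a' \<le> 1 powr a'" using True t0 a' by (intro powr_mono2) auto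
      then have "t powr a' \<le> 1" by simp
      moreover have "0 \<le> t powr a" by simp
      ultimately show ?thesis by linarith
    next
      case False
      then show ?thesis using a' powr_mono[of a' a t] by (simp add: add_increasing)
    qed
    then have "t powr a' * f y \<le> (1 + t powr a) * f y" by (intro mult_right_mono f0)
    then have "ennreal (t powr a' * f y) \<le> ennreal (f y + t powr a * f y)" by (intro ennreal_leI) (simp add: algebra_simps)
    then show "ennreal (ratio x y powr a' * (1 + norm y) powr a' * f y) \<le> ennreal (f y) + ennreal (ratio x y powr a * (1 + norm y) powr a * f y)"
      by (simp add: t_def powr_mult f0 ennreal_plus[symmetric] del: ennreal_plus)
  qed
  also have "\<dots> = (\<integral>\<^sup>+y. ennreal (f y) \<partial>lborel) + (\<integral>\<^sup>+y. ennreal (ratio x y powr a * (1 + norm y) powr a * f y) \<partial>lborel)"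
    by (rule nn_integral_add) simp_all
  also have "\<dots> \<le> ennreal C + ennreal C"
  proof (rule add_mono)
    show "(\<integral>\<^sup>+y. ennreal (f y) \<partial>lborel) \<le> ennreal C"
      using riesz_integrable[OF r a C] riesz_integral_le[OF r a C] f0
      by (subst nn_integral_eq_integral) (auto intro: ennreal_leI)
    show "(\<integral>\<^sup>+y. ennreal (ratio x y powr a * (1 + norm y) powr a * f y) \<partial>lborel) \<le> ennreal C"
      using r unfolding riesz_def by blast
  qed
  finally show "(\<integral>\<^sup>+y. ennreal (ratio x y powr a' * (1 + norm y) powr a' * f y) \<partial>lborel) \<le> ennreal (2 * C)"
    using C by (simp add: ennreal_plus[symmetric] del: ennreal_plus)
qed

context toda_family
begin

lemma Rp_ge: "8 \<le> Rp"
  unfolding Rp_def using sum_nonneg[of "{1..5}" "\<lambda>l. norm (P l)"] by simp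

text \<open>The weight of f without its factor at \<open>P l\<close>, which is smooth and positive
  near \<open>P l\<close>.\<close>

definition W' :: "nat \<Rightarrow> plane \<Rightarrow> real" where
  "W' l x = (\<Prod>k\<in>{1..4}-{l}. norm (x - P k) powr (-2 * \<beta> k))"

lemma W_split: "l \<in> {1..4} \<Longrightarrow> W x = norm (x - P l) powr (-2 * \<beta> l) * W' l x"
  unfolding W'_def sing_weight_powr using prod.remove[of "{1..4}" l "\<lambda>k. norm (x - P k) powr (-2 * \<beta> k)"] by (simp only: finite_atLeastAtMost simp_thms)

lemma f_split: "l \<in> {1..4} \<Longrightarrow> f n x = norm (x - P l) powr (-2 * \<beta> l) * (exp (A n) * W' l x * exp (-2 * U n x)) * exp (4 * V n x)"
  by (subst f_eq, subst W_split, assumption) (simp add: exp_diff exp_minus divide_inverse)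

text \<open>All remaining distances lie between \<rho> and 2 * \<open>Rp\<close>, and the exponents
  2 * \<beta> k over at most four indices sum to at most 8.\<close>

lemma W'_bounds:
  assumes l: "l \<in> {1..3}" and \<rho>: "0 < \<rho>" "\<rho> \<le> 1" and sep: "\<And>k l. k \<in> {1..5} \<Longrightarrow> l \<in> {1..5} \<Longrightarrow> k \<noteq> l \<Longrightarrow> 8 * \<rho> \<le> norm (P k - P l)"
    and x: "norm (x - P l) < 4 * \<rho>"
  shows "(2 * Rp) powr (-8) \<le> W' l x" "W' l x \<le> \<rho> powr (-8)"
proof -
  have nx: "norm x \<le> Rp" using x l \<rho> by (intro norm_near_P[of l]) auto
  have dk: "4 * \<rho> \<le> norm (x - P k)" "norm (x - P k) \<le> 2 * Rp" if "k \<in> {1..4} - {l}" for k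
  proof -
    have "norm (P k - P l) \<le> norm (x - P k) + norm (x - P l)" using norm_triangle_ineq4[of "x - P l" "x - P k"] by simp
    then show "4 * \<rho> \<le> norm (x - P k)" using sep[of k l] that l x by auto
    have "norm (P k) \<le> Rp" using that by (intro norm_near_P[of k]) auto
    then show "norm (x - P k) \<le> 2 * Rp" using nx norm_triangle_ineq4[of x "P k"] by simp
  qed
  have Rp1: "1 \<le> 2 * Rp" unfolding Rp_def by (simp add: sum_nonneg add_increasing)
  have le2: "(\<Sum>k\<in>{1..4}-{l}. 2 * \<beta> k) \<le> 8"
  proof -
    have "(\<Sum>k\<in>{1..4}-{l}. 2 * \<beta> k) \<le> (\<Sum>k\<in>{1..4}. 2 * \<beta> k)" using \<beta> by (intro sum_mono2) (auto intro: less_imp_le)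
    also have "\<dots> \<le> (\<Sum>k\<in>{1..4::nat}. 2)" using \<beta> by (intro sum_mono) (auto intro: less_imp_le)
    finally show ?thesis by simp
  qed
  have prod_powr: "(\<Prod>k\<in>{1..4}-{l}. c powr (-2 * \<beta> k)) = c powr (- (\<Sum>k\<in>{1..4}-{l}. 2 * \<beta> k))" if "c > 0" for c
  proof -
    have "(\<Prod>k\<in>{1..4}-{l}. c powr (-2 * \<beta> k)) = c powr (\<Sum>k\<in>{1..4}-{l}. -2 * \<beta> k)"
      using that by (intro powr_sum[symmetric]) auto
    then show ?thesis by (simp add: sum_negf)
  qed
  have "(2 * Rp) powr (-8) \<le> (2 * Rp) powr (- (\<Sum>k\<in>{1..4}-{l}. 2 * \<beta> k))" using le2 Rp1 by (intro powr_mono) auto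
  also have "\<dots> = (\<Prod>k\<in>{1..4}-{l}. (2 * Rp) powr (-2 * \<beta> k))" using Rp1 by (intro prod_powr[symmetric]) simp
  also have "\<dots> \<le> W' l x" unfolding W'_def
  proof (intro prod_mono conjI)
    fix k assume k: "k \<in> {1..4} - {l}"
    then show "(2 * Rp) powr (-2 * \<beta> k) \<le> norm (x - P k) powr (-2 * \<beta> k)"
      using dk[OF k] \<rho> \<beta>[of k] by (intro powr_mono2') auto
  qed auto
  finally show "(2 * Rp) powr (-8) \<le> W' l x" .
  have "W' l x \<le> (\<Prod>k\<in>{1..4}-{l}. \<rho> powr (-2 * \<beta> k))" unfolding W'_def
  proof (intro prod_mono conjI)
    fix k assume k: "k \<in> {1..4} - {l}"
    then show "norm (x - P k) powr (-2 * \<beta> k) \<le> \<rho> powr (-2 * \<beta> k)"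
      using dk[OF k] \<rho> \<beta>[of k] by (intro powr_mono2') auto
  qed auto
  also have "\<dots> = \<rho> powr (- (\<Sum>k\<in>{1..4}-{l}. 2 * \<beta> k))" using \<rho> by (intro prod_powr) simp
  also have "\<dots> \<le> \<rho> powr (-8)" using le2 \<rho> by (intro powr_mono') auto
  finally show "W' l x \<le> \<rho> powr (-8)" .
qed

text \<open>The order of quantifiers matters: \<open>Lp\<close> and \<open>K\<close> belong to the
  fixed scale \<rho>, so \<delta> can later be chosen small against them, while the sup constant
  \<open>C\<close> depends on \<delta> and is compensated by the smallness of
  \<open>exp (A n)\<close>.\<close>

lemma f_pohozaev:
  assumes l: "l \<in> {1..3}" and \<rho>: "0 < \<rho>" "\<rho> \<le> 1" and sep: "\<And>k l. k \<in> {1..5} \<Longrightarrow> l \<in> {1..5} \<Longrightarrow> k \<noteq> l \<Longrightarrow> 8 * \<rho> \<le> norm (P k - P l)"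
  shows "\<exists>Lp\<ge>0. \<exists>K\<ge>0. \<forall>\<delta>. 0 < \<delta> \<longrightarrow> \<delta> \<le> \<rho> \<longrightarrow> (\<exists>C\<ge>0. \<forall>\<^sub>F n in sequentially.
    (let M = (LINT y|lborel. indicator (ball (P l) \<delta>) y * f n y); S = C * exp (A n) in
      M * (1 - \<beta> l) - M\<^sup>2 \<le> \<delta> * (Lp + 4 * (S * K + m / \<rho>)) * M / 2 + pi * \<delta>\<^sup>2 * S \<and>
      M\<^sup>2 - M * (1 - \<beta> l) \<le> \<delta> * (Lp + 4 * (S * K + m / \<rho>)) * M / 2))"
proof -
  have l4: "l \<in> {1..4}" "l \<in> {1..5}" "l \<noteq> 5" using l by auto
  have \<beta>l: "0 < \<beta> l" "\<beta> l < 1" using \<beta>[of l] l4 by auto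
  obtain K where K: "K \<ge> 0" "\<And>x. (\<integral>\<^sup>+y. indicator (ball (P l) (4 * \<rho>)) y * ennreal (norm (x - y) powr (-1)) \<partial>lborel) \<le> ennreal K"
    using kernel_ball_bound by blast
  have inRp: "norm x \<le> Rp" if "x \<in> ball (P l) (4 * \<rho>)" for x
    using that \<rho> l4 by (intro norm_near_P[of l]) (auto simp: dist_norm norm_minus_commute)
  have far: "4 * \<rho> \<le> norm (x - P k)" if "x \<in> ball (P l) (4 * \<rho>)" "k \<in> {1..5}" "k \<noteq> l" for x k
  proof -
    have "norm (P k - P l) \<le> norm (x - P k) + norm (x - P l)" using norm_triangle_ineq4[of "x - P l" "x - P k"] by simp
    then show ?thesis using sep[of k l] that l4 by (auto simp: dist_norm norm_minus_commute)
  qed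
  obtain Ch where Ch: "Ch \<ge> 0" "\<forall>\<^sub>F n in sequentially. \<forall>x. norm x \<le> Rp \<longrightarrow> 2 * (2 * \<rho>) \<le> norm (x - P 5) \<longrightarrow> h n x \<le> Ch * exp (B n)"
    using h_upper[of "2 * \<rho>" Rp] \<rho> Rp_nonneg by auto
  define KU where "KU = Ch * K + m / (2 * \<rho>)"
  have KU: "0 \<le> KU" unfolding KU_def using Ch K m_pos \<rho> by simp
  \<comment> \<open>8 / \<rho> covers the logarithm of \<open>W'\<close> (at most four terms,
    coefficient at most 2, each logarithm 1/\<rho>-Lipschitz); 2 * KU covers -2 U, Lipschitz because
    h is eventually bounded near \<open>P l\<close>.\<close>
  define Lp where "Lp = 8 / \<rho> + 2 * KU"
  have Lp: "0 \<le> Lp" using KU \<rho> by (simp add: Lp_def)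
  have "\<exists>C\<ge>0. \<forall>\<^sub>F n in sequentially.
    (let M = (LINT y|lborel. indicator (ball (P l) \<delta>) y * f n y); S = C * exp (A n) in
      M * (1 - \<beta> l) - M\<^sup>2 \<le> \<delta> * (Lp + 4 * (S * K + m / \<rho>)) * M / 2 + pi * \<delta>\<^sup>2 * S \<and>
      M\<^sup>2 - M * (1 - \<beta> l) \<le> \<delta> * (Lp + 4 * (S * K + m / \<rho>)) * M / 2)" if \<delta>: "0 < \<delta>" "\<delta> \<le> \<rho>" for \<delta>
  proof -
    obtain C where C: "C \<ge> 0" "\<And>n x. norm x \<le> Rp \<Longrightarrow> (\<forall>k\<in>{1..4}. 2 * (\<delta> / 2) \<le> norm (x - P k)) \<Longrightarrow> f n x \<le> C * exp (A n)"
      using f_upper[of "\<delta> / 2" Rp] \<delta> Rp_nonneg by auto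
    have "\<forall>\<^sub>F n in sequentially.
    (let M = (LINT y|lborel. indicator (ball (P l) \<delta>) y * f n y); S = C * exp (A n) in
      M * (1 - \<beta> l) - M\<^sup>2 \<le> \<delta> * (Lp + 4 * (S * K + m / \<rho>)) * M / 2 + pi * \<delta>\<^sup>2 * S \<and>
      M\<^sup>2 - M * (1 - \<beta> l) \<le> \<delta> * (Lp + 4 * (S * K + m / \<rho>)) * M / 2)"
      using Ch(2) exp_B_small[OF zero_less_one]
    proof eventually_elim
      case (elim n)
      obtain C0 where C0: "C0 \<ge> 0" "riesz a C0 (f n)" "riesz a C0 (h n)" using riesz_ex by blast
      have newt: "(\<integral>\<^sup>+y. ennreal (h n y / norm (x - y)) \<partial>lborel) \<le> ennreal KU" if x: "x \<in> ball (P l) (2 * \<rho>)" for x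
      proof -
        have "(\<integral>\<^sup>+y. ennreal (indicator UNIV y * h n y / norm (x - y)) \<partial>lborel) \<le> ennreal (Ch * K + m / (2 * \<rho>))"
        proof (rule newtonian_bound[OF C0(3) a(1) a1 C0(1)])
          show "h n y \<le> Ch" if y: "y \<in> ball (P l) (4 * \<rho>)" for y
          proof -
            have "h n y \<le> Ch * exp (B n)" using elim(1) inRp[OF y] far[OF y, of 5] l4 by auto
            also have "\<dots> \<le> Ch * 1" using elim(2) Ch by (intro mult_left_mono) auto
            finally show ?thesis by simp
          qed
          show "2 * \<rho> \<le> norm (x - y)" if "y \<notin> ball (P l) (4 * \<rho>)" for y
            using that x dist_triangle[of "P l" y x] by (simp add: dist_norm)
        qed (use K Ch \<rho> mass in auto)
        then show ?thesis by (simp add: KU_def)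
      qed
      define G where "G x = A n + ln (W' l x) - 2 * U n x" for x
      have W'pos: "0 < W' l x" if "x \<in> ball (P l) (4 * \<rho>)" for x
      proof -
        have 0: "0 < (2 * Rp) powr (-8)" using Rp_ge by simp
        have "norm (x - P l) < 4 * \<rho>" using that by (simp add: dist_norm norm_minus_commute)
        then show ?thesis using less_le_trans[OF 0 W'_bounds(1)[OF l \<rho> sep]] by blast
      qed
      have sub: "x \<in> ball (P l) (4 * \<rho>)" if "x \<in> ball (P l) (2 * \<rho>)" for x using that \<rho> by auto
      have geq: "f n x = norm (x - P l) powr (-2 * \<beta> l) * exp (G x + 4 * pot (f n) x)"
        if "x \<in> ball (P l) (2 * \<rho>)" "x \<noteq> P l" for x
        using W'pos[OF sub[OF that(1)]] by (subst f_split[OF l4(1)]) (simp add: G_def exp_add exp_diff exp_minus divide_inverse)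
      have glip: "\<bar>G x - G y\<bar> \<le> Lp * norm (x - y)" if xy: "x \<in> ball (P l) (2 * \<rho>)" "y \<in> ball (P l) (2 * \<rho>)" for x y
      proof -
        have lnW: "ln (W' l x) = (\<Sum>k\<in>{1..4}-{l}. -2 * \<beta> k * ln (norm (x - P k)))" if "x \<in> ball (P l) (4 * \<rho>)" for x
        proof -
          have pos: "norm (x - P k) \<noteq> 0" if "k \<in> {1..4} - {l}" for k
            using far[OF \<open>x \<in> ball (P l) (4 * \<rho>)\<close>, of k] that \<rho> by auto
          have "ln (W' l x) = (\<Sum>k\<in>{1..4}-{l}. ln (norm (x - P k) powr (-2 * \<beta> k)))"
            unfolding W'_def using pos by (intro ln_prod) auto
          also have "\<dots> = (\<Sum>k\<in>{1..4}-{l}. -2 * \<beta> k * ln (norm (x - P k)))"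
            using pos by (intro sum.cong refl) (simp add: ln_powr)
          finally show ?thesis .
        qed
        have "\<bar>ln (W' l x) - ln (W' l y)\<bar> = \<bar>\<Sum>k\<in>{1..4}-{l}. -2 * \<beta> k * (ln (norm (x - P k)) - ln (norm (y - P k)))\<bar>"
          unfolding lnW[OF sub[OF xy(1)]] lnW[OF sub[OF xy(2)]] sum_subtractf[symmetric] by (simp add: right_diff_distrib)
        also have "\<dots> \<le> (\<Sum>k\<in>{1..4}-{l}. \<bar>-2 * \<beta> k * (ln (norm (x - P k)) - ln (norm (y - P k)))\<bar>)" by (rule sum_abs)
        also have "\<dots> \<le> (\<Sum>k\<in>{1..4}-{l}. 2 * (norm (x - y) / \<rho>))"
        proof (rule sum_mono)
          fix k assume k: "k \<in> {1..4} - {l}"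
          have "\<bar>ln (norm (x - P k)) - ln (norm (y - P k))\<bar> \<le> norm (x - y) / \<rho>"
            using far[OF sub[OF xy(1)], of k] far[OF sub[OF xy(2)], of k] k \<rho> by (intro ln_norm_lipschitz) auto
          then show "\<bar>-2 * \<beta> k * (ln (norm (x - P k)) - ln (norm (y - P k)))\<bar> \<le> 2 * (norm (x - y) / \<rho>)"
            unfolding abs_mult using \<beta>[of k] k by (intro mult_mono) auto
        qed
        also have "\<dots> \<le> 4 * (2 * (norm (x - y) / \<rho>))"
        proof -
          have "card ({1..4} - {l}) \<le> card {1..4::nat}" by (intro card_mono) auto
          then have "real (card ({1..4} - {l})) \<le> 4" by simp
          then show ?thesis using \<rho> by (simp only: sum_constant) (intro mult_right_mono, auto)
        qed
        finally have 1: "\<bar>ln (W' l x) - ln (W' l y)\<bar> \<le> 8 / \<rho> * norm (x - y)" by simp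
        have 2: "\<bar>U n x - U n y\<bar> \<le> KU * norm (x - y)"
          by (rule pot_lipschitz[OF C0(3) a(1) a1 C0(1) KU newt[OF xy(1)] newt[OF xy(2)]])
        have "Lp * norm (x - y) = 8 / \<rho> * norm (x - y) + 2 * (KU * norm (x - y))" by (simp add: Lp_def algebra_simps)
        then show ?thesis using 1 2 unfolding G_def by linarith
      qed
      have S: "f n x \<le> C * exp (A n)" if x: "\<delta> \<le> norm (x - P l)" "norm (x - P l) < 4 * \<rho>" for x
      proof (rule C(2))
        have xb: "x \<in> ball (P l) (4 * \<rho>)" using x by (simp add: dist_norm norm_minus_commute)
        show "norm x \<le> Rp" by (rule inRp[OF xb])
        show "\<forall>k\<in>{1..4}. 2 * (\<delta> / 2) \<le> norm (x - P k)"
        proof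
          fix k :: nat assume k: "k \<in> {1..4}"
          show "2 * (\<delta> / 2) \<le> norm (x - P k)"
          proof (cases "k = l")
            case False
            then have "4 * \<rho> \<le> norm (x - P k)" using far[OF xb, of k] k by auto
            then show ?thesis using \<delta> by simp
          qed (use x in simp)
        qed
      qed
      have Sn: "0 \<le> C * exp (A n)" using C by simp
      have mm: "(LINT y|lborel. f n y) \<le> m" by (simp add: mass)
      show ?case unfolding Let_def
        using pohozaev_local[OF C0(2) a(1) a1 C0(1) \<beta>l \<delta> mm geq glip Sn S K] by blast
    qed
    then show ?thesis using C(1) by blast
  qed
  then show ?thesis using Lp K(1) by blast
qed

text \<open>From \<beta> 1 + \<beta> 2 + \<beta> 3 = 2 - 2 m and \<beta> 2 + \<beta> 3 < \<beta> 1
  follow \<beta> 1 > 1 - m and \<beta> 2 + \<beta> 3 < 1 - m. This places m between the admissible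
  concentrated masses 1 - \<beta> l.\<close>

lemma \<beta>_gaps: "0 < m - (1 - \<beta> 1)" "0 < 1 - \<beta> 2 - m" "0 < 1 - \<beta> 3 - m"
  using sum_\<beta> \<beta>23 \<beta>_simps by linarith+

lemma f_local_mass:
  assumes [measurable]: "S \<in> sets borel"
  shows "integrable lborel (\<lambda>y. indicator S y * f n y)"
    and "0 \<le> (LINT y|lborel. indicator S y * f n y)" "(LINT y|lborel. indicator S y * f n y) \<le> m"
proof -
  show i: "integrable lborel (\<lambda>y. indicator S y * f n y)"
    by (rule Bochner_Integration.integrable_bound[OF f_integrable[of n]]) (auto simp: indicator_def)
  show "0 \<le> (LINT y|lborel. indicator S y * f n y)" by (intro Bochner_Integration.integral_nonneg) (simp add: f_nonneg)
  have "(LINT y|lborel. indicator S y * f n y) \<le> (LINT y|lborel. f n y)"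
    by (intro integral_mono i f_integrable) (simp add: f_nonneg indicator_def)
  then show "(LINT y|lborel. indicator S y * f n y) \<le> m" by (simp add: mass)
qed

text \<open>First \<delta> makes the linear error at most e / 2, then a small
  \<open>exp (A n)\<close> makes the sup bound negligible. The conclusion is stated for all smaller
  \<delta> so that three points can share one radius.\<close>

lemma f_pohozaev_small:
  assumes l: "l \<in> {1..3}" and e: "0 < e"
  shows "\<exists>\<delta>0>0. \<forall>\<delta>. 0 < \<delta> \<longrightarrow> \<delta> \<le> \<delta>0 \<longrightarrow> (\<exists>\<eta>>0. \<forall>\<^sub>F n in sequentially. exp (A n) < \<eta> \<longrightarrow>
    (let M = (LINT y|lborel. indicator (ball (P l) \<delta>) y * f n y) in M * (1 - \<beta> l) - M\<^sup>2 \<le> 2 * e \<and> M\<^sup>2 - M * (1 - \<beta> l) \<le> 2 * e))"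
proof -
  obtain \<rho> where \<rho>: "\<rho> > 0" "\<rho> \<le> 1" and sep: "\<And>k l. k \<in> {1..5} \<Longrightarrow> l \<in> {1..5} \<Longrightarrow> k \<noteq> l \<Longrightarrow> 8 * \<rho> \<le> norm (P k - P l)"
    using separation by blast
  obtain Lp K where LK: "Lp \<ge> 0" "K \<ge> 0" and Poh: "\<And>\<delta>. 0 < \<delta> \<Longrightarrow> \<delta> \<le> \<rho> \<Longrightarrow> (\<exists>C\<ge>0. \<forall>\<^sub>F n in sequentially.
    (let M = (LINT y|lborel. indicator (ball (P l) \<delta>) y * f n y); S = C * exp (A n) in
      M * (1 - \<beta> l) - M\<^sup>2 \<le> \<delta> * (Lp + 4 * (S * K + m / \<rho>)) * M / 2 + pi * \<delta>\<^sup>2 * S \<and>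
      M\<^sup>2 - M * (1 - \<beta> l) \<le> \<delta> * (Lp + 4 * (S * K + m / \<rho>)) * M / 2))"
    using f_pohozaev[OF l \<rho> sep] by blast
  define Q where "Q = Lp + 4 * (1 + m / \<rho>)"
  have Q: "0 < Q" using LK m_pos \<rho> by (simp add: Q_def add_nonneg_pos add_pos_pos)
  define \<delta>0 where "\<delta>0 = min \<rho> (e / (Q * m))"
  have "0 < \<delta>0" using \<rho> e Q m_pos by (simp add: \<delta>0_def)
  moreover have "\<exists>\<eta>>0. \<forall>\<^sub>F n in sequentially. exp (A n) < \<eta> \<longrightarrow>
    (let M = (LINT y|lborel. indicator (ball (P l) \<delta>) y * f n y) in M * (1 - \<beta> l) - M\<^sup>2 \<le> 2 * e \<and> M\<^sup>2 - M * (1 - \<beta> l) \<le> 2 * e)"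
    if \<delta>: "0 < \<delta>" "\<delta> \<le> \<delta>0" for \<delta>
  proof -
    have \<delta>\<rho>: "\<delta> \<le> \<rho>" using \<delta> by (simp add: \<delta>0_def)
    have "\<delta> \<le> e / (Q * m)" using \<delta> by (simp add: \<delta>0_def)
    then have \<delta>Q: "\<delta> * Q * m \<le> e" using Q m_pos by (simp add: pos_le_divide_eq mult.assoc)
    obtain C where C: "C \<ge> 0" "\<forall>\<^sub>F n in sequentially.
    (let M = (LINT y|lborel. indicator (ball (P l) \<delta>) y * f n y); S = C * exp (A n) in
      M * (1 - \<beta> l) - M\<^sup>2 \<le> \<delta> * (Lp + 4 * (S * K + m / \<rho>)) * M / 2 + pi * \<delta>\<^sup>2 * S \<and>
      M\<^sup>2 - M * (1 - \<beta> l) \<le> \<delta> * (Lp + 4 * (S * K + m / \<rho>)) * M / 2)"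
      using Poh[OF \<delta>(1) \<delta>\<rho>] by blast
    \<comment> \<open>Ensures \<open>S * K\<close> \<le> 1 and pi * \<delta>^2 * S \<le> e
      simultaneously when \<open>exp (A n)\<close> < 1 / T.\<close>
    define T where "T = C * (K + pi * \<delta>\<^sup>2 / e) + 1"
    have p0: "0 \<le> pi * \<delta>\<^sup>2 / e" using e by simp
    have T: "0 < T" unfolding T_def using C LK p0 by (simp add: add_nonneg_pos)
    have "\<forall>\<^sub>F n in sequentially. exp (A n) < 1 / T \<longrightarrow>
      (let M = (LINT y|lborel. indicator (ball (P l) \<delta>) y * f n y) in M * (1 - \<beta> l) - M\<^sup>2 \<le> 2 * e \<and> M\<^sup>2 - M * (1 - \<beta> l) \<le> 2 * e)"
      using C(2)
    proof eventually_elim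
      case (elim n)
      define M where "M = (LINT y|lborel. indicator (ball (P l) \<delta>) y * f n y)"
      define S where "S = C * exp (A n)"
      have M: "0 \<le> M" "M \<le> m" unfolding M_def by (intro f_local_mass; simp)+
      have S0: "0 \<le> S" using C by (simp add: S_def)
      have "M * (1 - \<beta> l) - M\<^sup>2 \<le> 2 * e \<and> M\<^sup>2 - M * (1 - \<beta> l) \<le> 2 * e" if small: "exp (A n) < 1 / T"
      proof -
        have "exp (A n) * T \<le> 1" using small T by (simp add: pos_less_divide_eq less_imp_le)
        moreover have "exp (A n) * T = S * K + S * (pi * \<delta>\<^sup>2 / e) + exp (A n)" by (simp add: S_def T_def algebra_simps)
        moreover have "0 \<le> S * K" "0 \<le> S * (pi * \<delta>\<^sup>2 / e)" "0 \<le> exp (A n)"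
          using mult_nonneg_nonneg[OF S0 LK(2)] mult_nonneg_nonneg[OF S0 p0] by simp_all
        ultimately have SK: "S * K \<le> 1" "S * (pi * \<delta>\<^sup>2 / e) \<le> 1" by linarith+
        have "pi * \<delta>\<^sup>2 * S \<le> e" using SK(2) e by (simp add: pos_divide_le_eq mult_ac)
        moreover have "\<delta> * (Lp + 4 * (S * K + m / \<rho>)) * M \<le> \<delta> * Q * m"
          unfolding Q_def using SK(1) \<delta> LK M m_pos \<rho> S0 by (intro mult_mono mult_nonneg_nonneg add_mono add_nonneg_nonneg) auto
        moreover have "M * (1 - \<beta> l) - M\<^sup>2 \<le> \<delta> * (Lp + 4 * (S * K + m / \<rho>)) * M / 2 + pi * \<delta>\<^sup>2 * S"
           "M\<^sup>2 - M * (1 - \<beta> l) \<le> \<delta> * (Lp + 4 * (S * K + m / \<rho>)) * M / 2" using elim unfolding Let_def M_def S_def by auto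
        moreover have "Y \<le> 2 * e \<and> Y' \<le> 2 * e" if "Z \<le> e" "X \<le> D" "Y \<le> X / 2 + Z" "Y' \<le> X / 2" "D \<le> e" for X Y Y' Z D
          using that e by linarith
        ultimately show ?thesis using \<delta>Q by blast
      qed
      then show ?case unfolding Let_def M_def by blast
    qed
    then show ?thesis using T by (intro exI[of _ "1 / T"]) simp
  qed
  ultimately show ?thesis by blast
qed

text \<open>A contradiction with the mass balance: when \<open>exp (A n)\<close> is tiny, the part
  off the discs has mass at most e, the second and third discs at most 2 e / \<gamma> each, so
  nearly all of m sits at \<open>P 1\<close>. There M (M - (1 - \<beta> 1)) would be at least m *
  \<theta> / 4, against the Pohozaev bound 2 e.\<close>

lemma A_lower: "\<exists>C. \<forall>\<^sub>F n in sequentially. C \<le> A n"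
proof -
  define \<theta> where "\<theta> = m - (1 - \<beta> 1)"
  define \<gamma> where "\<gamma> = min (1 - \<beta> 2 - m) (1 - \<beta> 3 - m)"
  have pos: "0 < \<theta>" "0 < \<gamma>" using \<beta>_gaps by (auto simp: \<theta>_def \<gamma>_def)
  \<comment> \<open>The first bound keeps the total loss e + 4 e / \<gamma> below \<theta> / 2 and m
    / 2; the second makes 2 e smaller than m * \<theta> / 4.\<close>
  define e where "e = min (min (\<theta> / 2) (m / 2) / (1 + 4 / \<gamma>)) (m * \<theta> / 16)"
  have g: "0 < 1 + 4 / \<gamma>" using pos by (simp add: add_pos_pos)
  have e: "0 < e" using pos m_pos g by (simp add: e_def)
  have "e \<le> min (\<theta> / 2) (m / 2) / (1 + 4 / \<gamma>)" by (simp add: e_def)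
  then have "e * (1 + 4 / \<gamma>) \<le> min (\<theta> / 2) (m / 2)" using g by (simp only: pos_le_divide_eq)
  then have e1: "e + 4 * e / \<gamma> \<le> \<theta> / 2" "e + 4 * e / \<gamma> \<le> m / 2" by (auto simp: algebra_simps)
  have e2: "4 * e \<le> m * \<theta> / 4" unfolding e_def by auto
  have "\<forall>l\<in>{1..3}. \<exists>\<delta>0>0. \<forall>\<delta>. 0 < \<delta> \<longrightarrow> \<delta> \<le> \<delta>0 \<longrightarrow> (\<exists>\<eta>>0. \<forall>\<^sub>F n in sequentially. exp (A n) < \<eta> \<longrightarrow>
    (let M = (LINT y|lborel. indicator (ball (P l) \<delta>) y * f n y) in M * (1 - \<beta> l) - M\<^sup>2 \<le> 2 * e \<and> M\<^sup>2 - M * (1 - \<beta> l) \<le> 2 * e))"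
    using f_pohozaev_small e by blast
  from bchoice[OF this] obtain d where d: "\<And>l. l \<in> {1..3} \<Longrightarrow> d l > 0" "\<And>l \<delta>. l \<in> {1..3} \<Longrightarrow> 0 < \<delta> \<Longrightarrow> \<delta> \<le> d l \<Longrightarrow> (\<exists>\<eta>>0. \<forall>\<^sub>F n in sequentially. exp (A n) < \<eta> \<longrightarrow>
    (let M = (LINT y|lborel. indicator (ball (P l) \<delta>) y * f n y) in M * (1 - \<beta> l) - M\<^sup>2 \<le> 2 * e \<and> M\<^sup>2 - M * (1 - \<beta> l) \<le> 2 * e))"
    by blast
  define \<delta> where "\<delta> = min (d 1) (min (d 2) (d 3))"
  have \<delta>: "0 < \<delta>" using d(1) by (simp add: \<delta>_def)
  have "\<delta> \<le> d l" if "l \<in> {1..3}" for l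
  proof -
    have "l = 1 \<or> l = 2 \<or> l = 3" using that by auto
    then show ?thesis by (auto simp: \<delta>_def)
  qed
  then have ex: "\<exists>\<eta>>0. \<forall>\<^sub>F n in sequentially. exp (A n) < \<eta> \<longrightarrow>
    (let M = (LINT y|lborel. indicator (ball (P l) \<delta>) y * f n y) in M * (1 - \<beta> l) - M\<^sup>2 \<le> 2 * e \<and> M\<^sup>2 - M * (1 - \<beta> l) \<le> 2 * e)" if "l \<in> {1..3}" for l
    using d(2)[OF that \<delta>] that by blast
  define M where "M n l = (LINT y|lborel. indicator (ball (P l) \<delta>) y * f n y)" for n l
  have M: "0 \<le> M n l" "M n l \<le> m" for n l unfolding M_def by (intro f_local_mass; simp)+
  have three: "1 \<in> {1..3::nat}" "2 \<in> {1..3::nat}" "3 \<in> {1..3::nat}" by auto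
  from ex[OF three(1)] ex[OF three(2)] ex[OF three(3)] obtain \<eta>1 \<eta>2 \<eta>3 where \<eta>: "\<eta>1 > 0" "\<eta>2 > 0" "\<eta>3 > 0"
    and h1: "\<forall>\<^sub>F n in sequentially. exp (A n) < \<eta>1 \<longrightarrow> M n 1 * (1 - \<beta> 1) - (M n 1)\<^sup>2 \<le> 2 * e \<and> (M n 1)\<^sup>2 - M n 1 * (1 - \<beta> 1) \<le> 2 * e"
    and h2: "\<forall>\<^sub>F n in sequentially. exp (A n) < \<eta>2 \<longrightarrow> M n 2 * (1 - \<beta> 2) - (M n 2)\<^sup>2 \<le> 2 * e \<and> (M n 2)\<^sup>2 - M n 2 * (1 - \<beta> 2) \<le> 2 * e"
    and h3: "\<forall>\<^sub>F n in sequentially. exp (A n) < \<eta>3 \<longrightarrow> M n 3 * (1 - \<beta> 3) - (M n 3)\<^sup>2 \<le> 2 * e \<and> (M n 3)\<^sup>2 - M n 3 * (1 - \<beta> 3) \<le> 2 * e"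
    unfolding Let_def M_def by blast
  obtain Co where Co: "Co \<ge> 0" "\<And>n. riesz a (Co * exp (A n)) (\<lambda>y. indicator (E \<delta>) y * f n y)"
    using f_off[OF \<delta>] by blast
  define \<eta> where "\<eta> = min (min \<eta>1 \<eta>2) (min \<eta>3 (e / (Co + 1)))"
  have \<eta>0: "0 < \<eta>" using \<eta> e Co by (simp add: \<eta>_def)
  have "\<forall>\<^sub>F n in sequentially. ln \<eta> \<le> A n"
    using h1 h2 h3
  proof eventually_elim
    case (elim n)
    have "\<not> exp (A n) < \<eta>"
    proof
      assume small: "exp (A n) < \<eta>"
      then have s: "exp (A n) < \<eta>1" "exp (A n) < \<eta>2" "exp (A n) < \<eta>3" "exp (A n) < e / (Co + 1)" by (auto simp: \<eta>_def)
      have IE: "(LINT y|lborel. indicator (E \<delta>) y * f n y) \<le> e"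
      proof -
        have "(LINT y|lborel. indicator (E \<delta>) y * f n y) \<le> Co * exp (A n)"
          using Co by (intro riesz_integral_le[OF Co(2) a(1) a1]) simp
        moreover have "exp (A n) * (Co + 1) \<le> e" using s(4) Co by (simp add: pos_less_divide_eq less_imp_le)
        moreover have "exp (A n) * (Co + 1) = Co * exp (A n) + exp (A n)" by (simp add: algebra_simps)
        moreover have "0 \<le> exp (A n)" by simp
        ultimately show ?thesis by linarith
      qed
      have "m = (LINT y|lborel. f n y)" by (simp add: mass)
      also have "\<dots> \<le> (LINT y|lborel. indicator (E \<delta>) y * f n y + (indicator (ball (P 1) \<delta>) y * f n y + (indicator (ball (P 2) \<delta>) y * f n y + indicator (ball (P 3) \<delta>) y * f n y)))"
      proof (rule integral_mono)
        show "f n y \<le> indicator (E \<delta>) y * f n y + (indicator (ball (P 1) \<delta>) y * f n y + (indicator (ball (P 2) \<delta>) y * f n y + indicator (ball (P 3) \<delta>) y * f n y))" for y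
        proof -
          have "y \<in> E \<delta> \<or> y \<in> ball (P 1) \<delta> \<or> y \<in> ball (P 2) \<delta> \<or> y \<in> ball (P 3) \<delta>"
          proof (rule ccontr)
            assume c: "\<not> ?thesis"
            have "\<delta> \<le> norm (y - P l)" if "l \<in> {1..3}" for l
            proof -
              have "l = 1 \<or> l = 2 \<or> l = 3" using that by auto
              then show ?thesis using c by (auto simp: dist_norm norm_minus_commute)
            qed
            then show False using c unfolding E_def by blast
          qed
          then have "1 \<le> indicator (E \<delta>) y + (indicator (ball (P 1) \<delta>) y + (indicator (ball (P 2) \<delta>) y + indicator (ball (P 3) \<delta>) y :: real))"
            by (auto simp: indicator_def simp del: mem_ball)
          from mult_right_mono[OF this f_nonneg[of n y]] show ?thesis by (simp only: mult_1_left distrib_right)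
        qed
      qed (intro Bochner_Integration.integrable_add f_integrable f_local_mass E_borel borel_open open_ball)+
      also have "\<dots> = (LINT y|lborel. indicator (E \<delta>) y * f n y) + (M n 1 + (M n 2 + M n 3))"
        unfolding M_def by (simp add: f_local_mass(1))
      finally have sum: "m \<le> e + M n 1 + M n 2 + M n 3" using IE by linarith
      \<comment> \<open>Since M \<le> m, the factor 1 - \<beta> l - M is at least \<gamma>; the
        equation M = 1 - \<beta> l is out of reach and only M close to 0 is left.\<close>
      have Ml: "M n l \<le> 2 * e / \<gamma>" if "M n l * (1 - \<beta> l) - (M n l)\<^sup>2 \<le> 2 * e" "\<gamma> \<le> 1 - \<beta> l - m" for l
      proof -
        have "M n l * \<gamma> \<le> M n l * (1 - \<beta> l - M n l)" using that M[of n l] by (intro mult_left_mono) auto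
        also have "\<dots> \<le> 2 * e" using that(1) by (simp add: algebra_simps power2_eq_square)
        finally show ?thesis using pos by (simp add: pos_le_divide_eq)
      qed
      have "M n 2 \<le> 2 * e / \<gamma>" "M n 3 \<le> 2 * e / \<gamma>"
        using elim s by (intro Ml; simp add: \<gamma>_def)+
      moreover have "4 * e / \<gamma> = 2 * e / \<gamma> + 2 * e / \<gamma>" by (simp add: add_divide_distrib[symmetric])
      ultimately have "m - (e + 4 * e / \<gamma>) \<le> M n 1" using sum by linarith
      then have "m / 2 \<le> M n 1" "\<theta> / 2 \<le> M n 1 - (1 - \<beta> 1)" using e1 \<theta>_def by linarith+
      then have "m / 2 * (\<theta> / 2) \<le> M n 1 * (M n 1 - (1 - \<beta> 1))" using pos m_pos M[of n 1] by (intro mult_mono) auto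
      also have "\<dots> \<le> 2 * e" using elim s by (simp add: algebra_simps power2_eq_square)
      finally show False using e2 e by simp
    qed
    then have "ln \<eta> \<le> ln (exp (A n))" using \<eta>0 by (intro ln_mono) auto
    then show ?case by simp
  qed
  then show ?thesis by blast
qed

text \<open>For y in the disc of radius r and x outside it, |x - y| \<le> 2 |x - P l|, so the mass
  in the disc acts at least like a point mass with the logarithm shifted by ln 2. All other mass
  costs at most m * ln (1 + |x|).\<close>

lemma V_annulus_ge:
  assumes r: "0 < r" "r \<le> norm (x - P l)" "norm (x - P l) \<le> 1/2" and M: "M \<le> (LINT y|lborel. indicator (ball (P l) r) y * f n y)"
  shows "M * ln (1 / (2 * norm (x - P l))) - m * ln (1 + norm x) \<le> V n x"
proof -
  obtain C where C: "C \<ge> 0" "riesz a C (f n)" using riesz_ex by blast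
  define S where "S = ball (P l) r"
  have S: "S \<in> sets borel" "- S \<in> sets borel" unfolding S_def by auto
  define t where "t = ln (1 / (2 * norm (x - P l)))"
  have d: "0 < norm (x - P l)" using r by linarith
  have t: "0 \<le> t" unfolding t_def using d r by (intro ln_ge_zero) (simp add: field_simps)
  have "t * (LINT y|lborel. indicator S y * f n y) = (LINT y|lborel. t * (indicator S y * f n y))" by simp
  also have "\<dots> \<le> pot (\<lambda>y. indicator S y * f n y) x" unfolding pot_def
  proof (rule integral_mono)
    show "t * (indicator S y * f n y) \<le> indicator S y * f n y * ln (ratio x y)" for y
    proof (cases "y \<in> S")
      case True
      have ny: "norm (y - P l) < r" using True by (simp add: S_def dist_norm norm_minus_commute)
      have "norm (x - y) \<le> norm (x - P l) + norm (y - P l)" using norm_triangle_ineq4[of "x - P l" "y - P l"] by simp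
      then have le: "norm (x - y) \<le> 2 * norm (x - P l)" using ny r by linarith
      have "x \<noteq> y" using ny r by auto
      then have xy: "0 < norm (x - y)" by simp
      have "1 / (2 * norm (x - P l)) \<le> 1 / norm (x - y)" using le xy d by (intro divide_left_mono) auto
      also have "\<dots> \<le> ratio x y" by (rule inverse_le_ratio)
      finally have "t \<le> ln (ratio x y)" unfolding t_def using d by (intro ln_mono) auto
      from mult_right_mono[OF this f_nonneg[of n y]] show ?thesis using True by (simp add: mult.commute)
    qed simp
  qed (use f_local_mass(1)[OF S(1)] riesz_log[OF riesz_restrict[OF C(2) S(1)] a(1) a1 C(1)] in auto)
  finally have 1: "t * (LINT y|lborel. indicator S y * f n y) \<le> pot (\<lambda>y. indicator S y * f n y) x" .
  have "t * M \<le> t * (LINT y|lborel. indicator S y * f n y)" using M t unfolding S_def by (intro mult_left_mono)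
  moreover have "ln (1 + norm x) * (LINT y|lborel. indicator (- S) y * f n y) \<le> ln (1 + norm x) * m"
    using f_local_mass(3)[OF S(2)] by (intro mult_left_mono) auto
  moreover have "- ln (1 + norm x) * (LINT y|lborel. indicator (- S) y * f n y) \<le> pot (\<lambda>y. indicator (- S) y * f n y) x"
    by (rule pot_ge[OF riesz_restrict[OF C(2) S(2)] a(1) a1 C(1)])
  ultimately show ?thesis using 1 pot_split[OF C(2) a(1) a1 C(1) S(1), of x] unfolding t_def[symmetric] by (simp add: mult.commute)
qed

text \<open>A mass exactly (1 - \<beta> l) / 2 gives the critical singularity of order 2, but Jensen
  needs a mass strictly below it. The gap is bridged by letting the deficit \<eta> depend on r: on
  the annulus r \<le> s < R the loss is at most a factor 2, and this annulus contains N dyadic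
  shells, enough to exceed the mass m.\<close>

lemma nonconcentration:
  assumes l: "l \<in> {1..3}" and \<rho>: "0 < \<rho>" "\<rho> \<le> 1" and sep: "\<And>k l. k \<in> {1..5} \<Longrightarrow> l \<in> {1..5} \<Longrightarrow> k \<noteq> l \<Longrightarrow> 8 * \<rho> \<le> norm (P k - P l)"
  shows "\<exists>r>0. r \<le> \<rho> \<and> (\<exists>M0>0. 2 * \<beta> l + 4 * M0 < 2 \<and>
    (\<forall>\<^sub>F n in sequentially. (LINT y|lborel. indicator (ball (P l) r) y * f n y) \<le> M0))"
proof -
  have l4: "l \<in> {1..4}" "l \<in> {1..5}" using l by auto
  have bl: "0 < \<beta> l" "\<beta> l < 1" using \<beta>[OF l4(2)] by auto
  define R where "R = min \<rho> (1/2)"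
  have R: "0 < R" "R \<le> 1/2" "R \<le> \<rho>" using \<rho> by (auto simp: R_def)
  obtain CA where CA: "\<forall>\<^sub>F n in sequentially. CA \<le> A n" using A_lower by blast
  \<comment> \<open>The constant in f \<ge> K / |x - P l|^2: lower bounds for
    \<open>exp (A n)\<close>, for \<open>W'\<close>, for \<open>exp (-2 * U n x)\<close> with |U|
    \<le> 1, and for the bounded part of V. The 1/8 is 1/4 from the shift by ln 2 times 1/2 from the
    deficit.\<close>
  define K where "K = exp CA * (2 * Rp) powr (-8) * exp (-2) * ((1 + Rp) powr (-4 * m) / 8)"
  have K: "0 < K" unfolding K_def using Rp_ge by simp
  \<comment> \<open>1 / (1 - \<beta> l) makes the deficit at most half of the threshold, m / K gives
    the final contradiction with the mass, and the summand 1 makes both usable strictly.\<close>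
  obtain N :: nat where N: "1 / (1 - \<beta> l) + m / K + 1 \<le> real N" using real_arch_simple by blast
  have "0 \<le> 1 / (1 - \<beta> l)" "0 \<le> m / K" using bl m_pos K by auto
  then have N': "1 / (1 - \<beta> l) \<le> real N" "m / K < real N" "1 \<le> real N" using N by linarith+
  define r where "r = R / 2 ^ N"
  have r: "0 < r" using R by (simp add: r_def)
  have r1: "r \<le> 1 / 2 ^ N" unfolding r_def using R by (intro divide_right_mono) auto
  have "r \<le> R / 1" unfolding r_def using R by (intro divide_left_mono) auto
  then have rR: "r \<le> R" by simp
  have "ln r \<le> ln (1 / 2 ^ N)" using r r1 by (intro ln_mono) auto
  also have "\<dots> = - (real N * ln 2)" by (simp add: ln_div ln_realpow)
  finally have lnr: "real N * ln 2 \<le> - ln r" by simp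
  have ln2: "0 < ln (2::real)" by simp
  have "1 * ln 2 \<le> real N * ln 2" using N' ln2 by (intro mult_right_mono) auto
  then have lnr0: "0 < - ln r" using lnr ln2 by linarith
  \<comment> \<open>Solves r^(4 \<eta>) = 1/2, the largest loss allowed on the annulus.\<close>
  define \<eta> where "\<eta> = ln 2 / (4 * (- ln r))"
  have \<eta>: "0 < \<eta>" "4 * \<eta> * (- ln r) = ln 2" using lnr0 by (simp_all add: \<eta>_def field_simps)
  have "\<eta> \<le> (1 - \<beta> l) / 4"
  proof -
    have "ln 2 \<le> (1 - \<beta> l) * (real N * ln 2)"
      using mult_right_mono[of 1 "(1 - \<beta> l) * real N" "ln 2"] N'(1) bl by (simp add: field_simps)
    also have "\<dots> \<le> (1 - \<beta> l) * (- ln r)" using lnr bl by (intro mult_left_mono) auto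
    finally have "ln 2 / (- ln r) \<le> 1 - \<beta> l" using lnr0 by (simp only: pos_divide_le_eq)
    then show ?thesis by (simp add: \<eta>_def)
  qed
  define M0 where "M0 = (1 - \<beta> l) / 2 - \<eta>"
  have M0: "0 < M0" "M0 \<le> 1/2" "2 * \<beta> l + 4 * M0 = 2 - 4 * \<eta>" using \<open>\<eta> \<le> _\<close> \<eta> bl by (auto simp: M0_def field_simps)
  have "\<forall>\<^sub>F n in sequentially. (LINT y|lborel. indicator (ball (P l) r) y * f n y) \<le> M0"
    using CA U_small[OF Rp_nonneg zero_less_one]
  proof eventually_elim
    case (elim n)
    show ?case
    proof (rule ccontr)
      assume "\<not> ?case"
      then have M: "M0 \<le> (LINT y|lborel. indicator (ball (P l) r) y * f n y)" by simp
      define S where "S = ball (P l) R - ball (P l) r"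
      have [measurable]: "S \<in> sets borel" unfolding S_def by auto
      have pw: "K * norm (x - P l) powr (-2) \<le> f n x" if x: "x \<in> S" for x
      proof -
        have d: "norm (x - P l) < R" "r \<le> norm (x - P l)" using x by (auto simp: S_def dist_norm norm_minus_commute)
        define s where "s = norm (x - P l)"
        have s: "0 < s" "s \<le> 1/2" "r \<le> s" "s \<le> 1" using d r R unfolding s_def by linarith+
        have nx: "norm x \<le> Rp" using d \<rho> R l4 by (intro norm_near_P[of l]) auto
        have V: "M0 * ln (1 / (2 * s)) - m * ln (1 + norm x) \<le> V n x"
          unfolding s_def using d R by (intro V_annulus_ge[OF r]) (use M in auto)
        have ln1: "ln (1 / (2 * s)) = - ln 2 - ln s" using s by (simp add: ln_div ln_mult)
        have "m * ln (1 + norm x) \<le> m * ln (1 + Rp)" using nx m_pos by (intro mult_left_mono ln_mono) (auto simp: add_pos_nonneg)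
        moreover have "M0 * ln 2 \<le> 1/2 * ln 2" using M0 ln2 by (intro mult_right_mono) auto
        moreover have "M0 * ln (1 / (2 * s)) = - (M0 * ln 2) - M0 * ln s" unfolding ln1 by (simp add: algebra_simps)
        ultimately have V': "- 2 * ln 2 - 4 * M0 * ln s - 4 * m * ln (1 + Rp) \<le> 4 * V n x" using V by linarith
        have e: "exp (- 2 * ln 2 - 4 * M0 * ln s - 4 * m * ln (1 + Rp)) = (1 + Rp) powr (-4 * m) / 4 * s powr (-4 * M0)"
        proof -
          have "exp (- 2 * ln 2 - 4 * M0 * ln s - 4 * m * ln (1 + Rp)) = exp (- 2 * ln 2) * (exp (-4 * M0 * ln s) * exp (-4 * m * ln (1 + Rp)))"
            by (simp add: exp_add[symmetric])
          moreover have "exp (- 2 * ln 2) = (2::real) powr (-2)" by (simp add: powr_def)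
          moreover have "(2::real) powr (-2) = 1 / 4" by (simp add: powr_minus_divide)
          moreover have "exp (-4 * M0 * ln s) = s powr (-4 * M0)" "exp (-4 * m * ln (1 + Rp)) = (1 + Rp) powr (-4 * m)"
            using s Rp_ge by (simp_all add: powr_def)
          ultimately show ?thesis by simp
        qed
        \<comment> \<open>The exponents add to -2 + 4 \<eta>, and s^(4 \<eta>) \<ge> r^(4 \<eta>) =
          1/2.\<close>
        have sr: "1 / 2 * s powr (-2) \<le> s powr (-2 * \<beta> l) * s powr (-4 * M0)"
        proof -
          have "exp (- ln 2) \<le> s powr (4 * \<eta>)"
          proof -
            have "- ln 2 = 4 * \<eta> * ln r" using \<eta>(2) by simp
            also have "\<dots> \<le> 4 * \<eta> * ln s" using s r \<eta> by (intro mult_left_mono ln_mono) auto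
            finally show ?thesis using s by (simp add: powr_def)
          qed
          then have "1 / 2 \<le> s powr (4 * \<eta>)" by (simp add: exp_minus)
          then have "1 / 2 * s powr (-2) \<le> s powr (4 * \<eta>) * s powr (-2)" by (intro mult_right_mono) auto
          also have "\<dots> = s powr (4 * \<eta> + (-2))" by (simp only: powr_add)
          also have "4 * \<eta> + (-2) = -2 * \<beta> l + (-4 * M0)" using M0(3) by linarith
          finally show ?thesis by (simp only: powr_add)
        qed
        have w: "(2 * Rp) powr (-8) \<le> W' l x" using d R by (intro W'_bounds(1)[OF l \<rho> sep]) auto
        have "0 \<le> (2 * Rp) powr (-8)" by simp
        then have w0: "0 \<le> W' l x" using w by linarith
        have u: "exp (-2) \<le> exp (-2 * U n x)" using elim(2) nx by (auto simp: abs_le_iff)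
        have "K * s powr (-2) = (exp CA * (2 * Rp) powr (-8) * exp (-2)) * ((1 + Rp) powr (-4 * m) / 4) * (1 / 2 * s powr (-2))"
          unfolding K_def by simp
        also have "\<dots> \<le> (exp (A n) * W' l x * exp (-2 * U n x)) * ((1 + Rp) powr (-4 * m) / 4) * (s powr (-2 * \<beta> l) * s powr (-4 * M0))"
          by (intro mult_mono[OF _ sr] mult_right_mono[of "exp CA * (2 * Rp) powr (-8) * exp (-2)"] mult_mono[OF mult_mono u]) (use elim(1) w w0 u in auto)
        also have "\<dots> = s powr (-2 * \<beta> l) * (exp (A n) * W' l x * exp (-2 * U n x)) * ((1 + Rp) powr (-4 * m) / 4 * s powr (-4 * M0))"
          by (simp only: mult_ac)
        also have "\<dots> \<le> s powr (-2 * \<beta> l) * (exp (A n) * W' l x * exp (-2 * U n x)) * exp (4 * V n x)"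
          unfolding e[symmetric] using V' w0 by (intro mult_left_mono mult_nonneg_nonneg) auto
        also have "\<dots> = f n x" unfolding s_def by (rule f_split[OF l4(1), symmetric])
        finally show ?thesis unfolding s_def .
      qed
      have "ennreal (K * (real N * (3 * pi / 4))) = ennreal K * ennreal (real N * (3 * pi / 4))"
        using K by (intro ennreal_mult) auto
      also have "\<dots> \<le> ennreal K * (\<integral>\<^sup>+x. indicator S x * ennreal (norm (x - P l) powr (-2)) \<partial>lborel)"
        unfolding S_def r_def by (intro mult_left_mono dyadic_log_divergence R) simp
      also have "\<dots> = (\<integral>\<^sup>+x. ennreal K * (indicator S x * ennreal (norm (x - P l) powr (-2))) \<partial>lborel)"
        by (rule nn_integral_cmult[symmetric]) measurable
      also have "\<dots> \<le> (\<integral>\<^sup>+x. ennreal (f n x) \<partial>lborel)"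
      proof (rule nn_integral_mono)
        fix x
        show "ennreal K * (indicator S x * ennreal (norm (x - P l) powr (-2))) \<le> ennreal (f n x)"
        proof (cases "x \<in> S")
          case True
          then show ?thesis using ennreal_leI[OF pw[OF True]] K by (simp add: ennreal_mult)
        qed simp
      qed
      also have "\<dots> \<le> ennreal m" by (rule nn_mass)
      finally have "K * (real N * (3 * pi / 4)) \<le> m" using m_pos by (simp only: ennreal_le_iff)
      moreover have "K * (real N * 1) \<le> K * (real N * (3 * pi / 4))" using pi_gt3 K by (intro mult_left_mono[of "real N * 1"] mult_left_mono[of 1]) simp_all
      moreover have "m < K * real N" using N'(2) K by (simp add: pos_divide_less_eq mult.commute)
      ultimately show False by simp
    qed
  qed
  moreover have "2 * \<beta> l + 4 * M0 < 2" using M0 \<eta> by simp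
  ultimately show ?thesis using r rR R M0(1) by (intro exI[of _ r] conjI exI[of _ M0]) auto
qed

text \<open>With the local mass below \<open>M0\<close>, Jensen's inequality works at
  \<open>P l\<close>. It is offered for all small exponents a', so that the three points can be
  treated with a common one.\<close>

lemma f_near:
  assumes l: "l \<in> {1..3}"
  shows "\<exists>r>0. \<exists>a0>0. \<forall>a'. 0 < a' \<longrightarrow> a' \<le> a0 \<longrightarrow>
    (\<exists>C\<ge>0. \<forall>\<^sub>F n in sequentially. riesz a' C (\<lambda>y. indicator (ball (P l) r) y * f n y))"
proof -
  obtain \<rho> where \<rho>: "\<rho> > 0" "\<rho> \<le> 1" and sep: "\<And>k l. k \<in> {1..5} \<Longrightarrow> l \<in> {1..5} \<Longrightarrow> k \<noteq> l \<Longrightarrow> 8 * \<rho> \<le> norm (P k - P l)"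
    using separation by blast
  have l4: "l \<in> {1..4}" "l \<in> {1..5}" using l by auto
  have bl: "0 < \<beta> l" "\<beta> l < 1" using \<beta>[OF l4(2)] by auto
  obtain r M0 where r: "r > 0" "r \<le> \<rho>" and M0: "M0 > 0" "2 * \<beta> l + 4 * M0 < 2"
    and mass0: "\<forall>\<^sub>F n in sequentially. (LINT y|lborel. indicator (ball (P l) r) y * f n y) \<le> M0"
    using nonconcentration[OF l \<rho> sep] by blast
  obtain CA where CA: "\<And>n. A n \<le> CA" using A_upper by blast
  define a0 where "a0 = (2 - (2 * \<beta> l + 4 * M0)) / 2"
  have a0: "0 < a0" using M0 by (simp add: a0_def)
  have "\<exists>C\<ge>0. \<forall>\<^sub>F n in sequentially. riesz a' C (\<lambda>y. indicator (ball (P l) (r/2)) y * f n y)" if a': "0 < a'" "a' \<le> a0" for a'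
  proof -
    have t: "2 * \<beta> l + a' + 4 * M0 < 2" using a' M0 by (simp add: a0_def)
    obtain C where C: "C \<ge> 0" and J: "\<And>f a0 C0 k Ck x. riesz a0 C0 f \<Longrightarrow> 0 < a0 \<Longrightarrow> a0 \<le> 1 \<Longrightarrow> 0 \<le> C0 \<Longrightarrow>
      (LINT y|lborel. f y) \<le> m \<Longrightarrow> (LINT y|lborel. indicator (ball (P l) r) y * f y) \<le> M0 \<Longrightarrow> 0 \<le> Ck \<Longrightarrow>
      (\<forall>y. y \<in> ball (P l) (r/2) \<longrightarrow> y \<noteq> P l \<longrightarrow> 0 \<le> k y \<and> k y \<le> Ck * norm (y - P l) powr (-(2 * \<beta> l))) \<Longrightarrow>
      (\<integral>\<^sup>+y. indicator (ball (P l) (r/2)) y * ennreal (ratio x y powr a' * k y * exp (4 * pot f y)) \<partial>lborel) \<le> ennreal (C * Ck)"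
      using local_jensen[of "2 * \<beta> l" a' M0 r m "P l"] M0 r a' bl m_pos t by auto
    define K where "K = (1 + Rp) powr a' * (exp CA * \<rho> powr (-8) * (1 + Rp) powr (2 * m))"
    have K: "0 \<le> K" by (simp add: K_def)
    have "\<forall>\<^sub>F n in sequentially. riesz a' (C * K) (\<lambda>y. indicator (ball (P l) (r/2)) y * f n y)"
      using mass0
    proof eventually_elim
      case (elim n)
      show ?case unfolding riesz_def
      proof (intro conjI allI)
        show "(\<lambda>y. indicator (ball (P l) (r/2)) y * f n y) \<in> borel_measurable borel" by measurable
        show "0 \<le> indicator (ball (P l) (r/2)) y * f n y" for y by (simp add: f_nonneg)
        fix x
        obtain C0 where C0: "C0 \<ge> 0" "riesz a C0 (f n)" using riesz_ex by blast
        define k where "k y = (1 + norm y) powr a' * (norm (y - P l) powr (-2 * \<beta> l) * (exp (A n) * W' l y * exp (-2 * U n y)))" for y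
        have "(\<integral>\<^sup>+y. ennreal (ratio x y powr a' * (1 + norm y) powr a' * (indicator (ball (P l) (r/2)) y * f n y)) \<partial>lborel)
          = (\<integral>\<^sup>+y. indicator (ball (P l) (r/2)) y * ennreal (ratio x y powr a' * k y * exp (4 * V n y)) \<partial>lborel)"
        proof (rule nn_integral_cong)
          fix y
          have "ratio x y powr a' * (1 + norm y) powr a' * f n y = ratio x y powr a' * k y * exp (4 * V n y)"
            using f_split[OF l4(1), of n y] by (simp only: k_def mult.assoc)
          then show "ennreal (ratio x y powr a' * (1 + norm y) powr a' * (indicator (ball (P l) (r/2)) y * f n y))
            = indicator (ball (P l) (r/2)) y * ennreal (ratio x y powr a' * k y * exp (4 * V n y))"
            by (cases "y \<in> ball (P l) (r/2)") (simp_all only: indicator_simps mult_1_left mult_zero_left mult_zero_right ennreal_0 not_False_eq_True)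
        qed
        also have "\<dots> \<le> ennreal (C * K)"
        proof (rule J[OF C0(2) a(1) a1 C0(1)])
          show "\<forall>y. y \<in> ball (P l) (r/2) \<longrightarrow> y \<noteq> P l \<longrightarrow> 0 \<le> k y \<and> k y \<le> K * norm (y - P l) powr (-(2 * \<beta> l))"
          proof (intro allI impI)
            fix y assume y: "y \<in> ball (P l) (r/2)" "y \<noteq> P l"
            have d: "norm (y - P l) < 4 * \<rho>" using y r by (simp add: dist_norm norm_minus_commute)
            have ny: "norm y \<le> Rp" using d \<rho> l4 by (intro norm_near_P[of l]) auto
            have 1: "exp (A n) \<le> exp CA" using CA by simp
            have 2: "0 \<le> W' l y" "W' l y \<le> \<rho> powr (-8)" using W'_bounds[OF l \<rho> sep d] by (auto intro: order_trans[rotated])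
            have 3: "exp (-2 * U n y) \<le> (1 + Rp) powr (2 * m)"
              using order_trans[OF exp_U_le powr_mono2[of "2 * m" "1 + norm y" "1 + Rp"]] ny m_pos by auto
            have 4: "(1 + norm y) powr a' \<le> (1 + Rp) powr a'" using ny a' by (intro powr_mono2) auto
            have "k y = (1 + norm y) powr a' * (exp (A n) * W' l y * exp (-2 * U n y)) * norm (y - P l) powr (-2 * \<beta> l)"
              by (simp only: k_def mult_ac)
            also have "\<dots> \<le> K * norm (y - P l) powr (-2 * \<beta> l)"
              unfolding K_def using 1 2 3 4 by (intro mult_right_mono mult_mono mult_nonneg_nonneg) auto
            finally have "k y \<le> K * norm (y - P l) powr (-(2 * \<beta> l))" by simp
            moreover have "0 \<le> k y" unfolding k_def using 2 by simp
            ultimately show "0 \<le> k y \<and> k y \<le> K * norm (y - P l) powr (-(2 * \<beta> l))" by simp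
          qed
        qed (use K elim mass in auto)
        finally show "(\<integral>\<^sup>+y. ennreal (ratio x y powr a' * (1 + norm y) powr a' * (indicator (ball (P l) (r/2)) y * f n y)) \<partial>lborel) \<le> ennreal (C * K)" .
      qed
    qed
    moreover have "0 \<le> C * K" using C K by simp
    ultimately show ?thesis by blast
  qed
  then show ?thesis using r a0 by (intro exI[of _ "r/2"] conjI exI[of _ a0]) auto
qed

text \<open>Three discs and their complement cover the plane; the exponent is the smallest of the
  four available ones and the bounds add. The resulting uniform Hoelder bound for V is what the
  passage to the limit needs.\<close>

lemma f_riesz: "\<exists>a'>0. a' \<le> 1 \<and> (\<exists>C\<ge>0. \<forall>\<^sub>F n in sequentially. riesz a' C (f n))"
proof -
  have three: "1 \<in> {1..3::nat}" "2 \<in> {1..3::nat}" "3 \<in> {1..3::nat}" by auto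
  obtain r1 a1' where 1: "r1 > 0" "a1' > 0" "\<And>a'. 0 < a' \<Longrightarrow> a' \<le> a1' \<Longrightarrow> \<exists>C\<ge>0. \<forall>\<^sub>F n in sequentially. riesz a' C (\<lambda>y. indicator (ball (P 1) r1) y * f n y)"
    using f_near[OF three(1)] by blast
  obtain r2 a2 where 2: "r2 > 0" "a2 > 0" "\<And>a'. 0 < a' \<Longrightarrow> a' \<le> a2 \<Longrightarrow> \<exists>C\<ge>0. \<forall>\<^sub>F n in sequentially. riesz a' C (\<lambda>y. indicator (ball (P 2) r2) y * f n y)"
    using f_near[OF three(2)] by blast
  obtain r3 a3 where 3: "r3 > 0" "a3 > 0" "\<And>a'. 0 < a' \<Longrightarrow> a' \<le> a3 \<Longrightarrow> \<exists>C\<ge>0. \<forall>\<^sub>F n in sequentially. riesz a' C (\<lambda>y. indicator (ball (P 3) r3) y * f n y)"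
    using f_near[OF three(3)] by blast
  define a' where "a' = min (min a a1') (min a2 a3)"
  have a': "0 < a'" "a' \<le> a1'" "a' \<le> a2" "a' \<le> a3" "a' \<le> a" using 1 2 3 a by (auto simp: a'_def)
  define \<delta> where "\<delta> = min r1 (min r2 r3)"
  have \<delta>: "0 < \<delta>" using 1 2 3 by (simp add: \<delta>_def)
  obtain C1 where C1: "C1 \<ge> 0" "\<forall>\<^sub>F n in sequentially. riesz a' C1 (\<lambda>y. indicator (ball (P 1) r1) y * f n y)" using 1(3) a' by blast
  obtain C2 where C2: "C2 \<ge> 0" "\<forall>\<^sub>F n in sequentially. riesz a' C2 (\<lambda>y. indicator (ball (P 2) r2) y * f n y)" using 2(3) a' by blast
  obtain C3 where C3: "C3 \<ge> 0" "\<forall>\<^sub>F n in sequentially. riesz a' C3 (\<lambda>y. indicator (ball (P 3) r3) y * f n y)" using 3(3) a' by blast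
  obtain Co where Co: "Co \<ge> 0" "\<And>n. riesz a (Co * exp (A n)) (\<lambda>y. indicator (E \<delta>) y * f n y)" using f_off[OF \<delta>] by blast
  obtain CA where CA: "\<And>n. A n \<le> CA" using A_upper by blast
  define D where "D = Co * exp CA"
  have D: "0 \<le> D" using Co by (simp add: D_def)
  have off: "riesz a' (2 * D) (\<lambda>y. indicator (E \<delta>) y * f n y)" for n
  proof (rule riesz_exponent_mono[OF _ a(1) a1 D a'(1,5)])
    have "Co * exp (A n) \<le> D" unfolding D_def using Co CA by (intro mult_left_mono) auto
    then show "riesz a D (\<lambda>y. indicator (E \<delta>) y * f n y)" by (rule riesz_mono[OF Co(2)])
  qed
  have cover: "y \<in> ball (P 1) r1 \<or> y \<in> ball (P 2) r2 \<or> y \<in> ball (P 3) r3 \<or> y \<in> E \<delta>" for y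
  proof (rule ccontr)
    assume c: "\<not> ?thesis"
    have "\<delta> \<le> norm (y - P l)" if "l \<in> {1..3}" for l
    proof -
      have "l = 1 \<or> l = 2 \<or> l = 3" using that by auto
      then show ?thesis using c by (auto simp: \<delta>_def dist_norm norm_minus_commute)
    qed
    then show False using c unfolding E_def by blast
  qed
  have "\<forall>\<^sub>F n in sequentially. riesz a' ((2 * D + C1) + (C2 + C3)) (f n)"
    using C1(2) C2(2) C3(2)
  proof eventually_elim
    case (elim n)
    have "riesz a' ((2 * D + C1) + (C2 + C3)) (\<lambda>y. indicator UNIV y * f n y)"
    proof (rule riesz_union[OF f_measurable f_nonneg])
      show "riesz a' (2 * D + C1) (\<lambda>y. indicator (E \<delta> \<union> ball (P 1) r1) y * f n y)"
        by (rule riesz_union[OF f_measurable f_nonneg _ _ _ _ off elim(1)]) (use D C1 in auto)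
      show "riesz a' (C2 + C3) (\<lambda>y. indicator (ball (P 2) r2 \<union> ball (P 3) r3) y * f n y)"
        by (rule riesz_union[OF f_measurable f_nonneg _ _ _ _ elim(2,3)]) (use C2 C3 in auto)
      show "UNIV \<subseteq> (E \<delta> \<union> ball (P 1) r1) \<union> (ball (P 2) r2 \<union> ball (P 3) r3)" using cover by blast
    qed (use D C1 C2 C3 in auto)
    then show ?case by simp
  qed
  moreover have "0 \<le> (2 * D + C1) + (C2 + C3)" using D C1 C2 C3 by simp
  ultimately show ?thesis using a' a1 by (intro exI[of _ a'] conjI exI[of _ "(2 * D + C1) + (C2 + C3)"]) auto
qed

end

section \<open>Passage to the limit\<close>

lemma partial_deriv_zero_on_open:
  assumes S: "open S" "x \<in> S" and z: "\<And>y. y \<in> S \<Longrightarrow> f y = (0::real)"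
  shows "partial_deriv b f x = 0"
  by (rule partial_deriv_eq[of _ "\<lambda>_. 0"], rule has_derivative_transform_within_open[OF has_derivative_const S]) (simp add: z)

lemma test_function_basics:
  fixes \<phi> :: "plane \<Rightarrow> real"
  assumes t: "test_function \<phi>"
  shows "continuous_on UNIV \<phi>" "continuous_on UNIV (laplacian \<phi>)"
    and "\<exists>R\<ge>0. (\<forall>x. R < norm x \<longrightarrow> \<phi> x = 0 \<and> (\<forall>b. partial_deriv b \<phi> x = 0) \<and> laplacian \<phi> x = 0)"
proof -
  have ck: "C_k k \<phi>" for k using t by (simp add: test_function_def)
  show "continuous_on UNIV \<phi>" using ck[of 0] by simp
  show "continuous_on UNIV (laplacian \<phi>)"
    using ck[of "Suc (Suc 0)"] unfolding laplacian_def[abs_def] by (auto intro!: continuous_on_sum)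
  have "bounded (closure {x. \<phi> x \<noteq> 0})" using t by (simp add: test_function_def compact_imp_bounded)
  then obtain R where R: "R > 0" "\<And>x. x \<in> closure {x. \<phi> x \<noteq> 0} \<Longrightarrow> norm x \<le> R" by (auto simp: bounded_pos)
  have z: "\<phi> x = 0" if "R < norm x" for x
    using R(2)[of x] that closure_subset[of "{x. \<phi> x \<noteq> 0}"] by force
  have o: "open {x::plane. R < norm x}" by (intro open_Collect_less continuous_intros)
  have d: "partial_deriv b \<phi> x = 0" if "R < norm x" for b x
    by (rule partial_deriv_zero_on_open[OF o]) (use that z in auto)
  have "laplacian \<phi> x = 0" if "R < norm x" for x
    unfolding laplacian_def by (intro sum.neutral ballI, rule partial_deriv_zero_on_open[OF o]) (use that d in simp_all)
  then show "\<exists>R\<ge>0. (\<forall>x. R < norm x \<longrightarrow> \<phi> x = 0 \<and> (\<forall>b. partial_deriv b \<phi> x = 0) \<and> laplacian \<phi> x = 0)"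
    using R(1) z d by (intro exI[of _ R]) auto
qed

lemma compact_support_bound:
  fixes g :: "plane \<Rightarrow> real"
  assumes c: "continuous_on UNIV g" and z: "\<And>x. R < norm x \<Longrightarrow> g x = 0"
  shows "\<exists>M\<ge>0. \<forall>x. \<bar>g x\<bar> \<le> M * indicator (cball 0 R) x"
proof -
  have "bounded (g ` cball 0 R)"
    by (intro compact_imp_bounded compact_continuous_image continuous_on_subset[OF c]) auto
  then obtain M where M: "M > 0" "\<And>x. x \<in> cball 0 R \<Longrightarrow> \<bar>g x\<bar> \<le> M" unfolding bounded_pos real_norm_def by blast
  have "\<bar>g x\<bar> \<le> M * indicator (cball 0 R) x" for x
    using M z[of x] by (cases "norm x \<le> R") auto
  then show ?thesis using M(1) by (intro exI[of _ M]) auto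
qed

lemma compact_support_integrable:
  fixes g :: "plane \<Rightarrow> real"
  assumes [measurable]: "g \<in> borel_measurable borel" and b: "\<And>x. \<bar>g x\<bar> \<le> M * indicator (cball 0 R) x"
  shows "integrable lborel g"
proof (rule Bochner_Integration.integrable_bound)
  show "integrable lborel (\<lambda>z::plane. M * indicator (cball 0 R) z)"
    by (intro integrable_mult_right integrable_real_indicator emeasure_bounded_finite) auto
  show "AE x in lborel. norm (g x) \<le> norm (M * indicator (cball 0 R) x)"
    using b by (intro AE_I2) (simp add: order_trans[OF _ abs_ge_self])
qed simp

text \<open>Difference quotients have integral 0 by translation invariance. The mean value theorem
  bounds them by the derivative at a nearby point, so dominated convergence applies on a slightly
  larger disc.\<close>

lemma partial_deriv_integral_zero:
  fixes \<psi> :: "plane \<Rightarrow> real"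
  assumes C1: "C_k 1 \<psi>" and b: "b \<in> Basis" and z: "\<And>x. R < norm x \<Longrightarrow> \<psi> x = 0"
  shows "(LINT x|lborel. partial_deriv b \<psi> x) = 0"
proof -
  define D where "D = partial_deriv b \<psi>"
  have c\<psi>: "continuous_on UNIV \<psi>" using C1 C_k_Suc_imp[of 0 \<psi>] by simp
  have [measurable]: "\<psi> \<in> borel_measurable borel" using c\<psi> by (rule borel_measurable_continuous_onI)
  have cD: "continuous_on UNIV D" using C1 b by (simp add: D_def)
  have o: "open {x::plane. R < norm x}" by (intro open_Collect_less continuous_intros)
  have zD: "D x = 0" if "R < norm x" for x
    unfolding D_def by (rule partial_deriv_zero_on_open[OF o]) (use that z in auto)
  obtain M where M: "M \<ge> 0" "\<And>x. \<bar>D x\<bar> \<le> M * indicator (cball 0 R) x" using compact_support_bound[OF cD zD] by blast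
  obtain M' where M': "M' \<ge> 0" "\<And>x. \<bar>\<psi> x\<bar> \<le> M' * indicator (cball 0 R) x" using compact_support_bound[OF c\<psi> z] by blast
  have i\<psi>: "integrable lborel \<psi>" by (rule compact_support_integrable[OF _ M'(2)]) simp
  define e where "e n = 1 / real (Suc n)" for n
  have e: "0 < e n" "e n \<le> 1" for n by (auto simp: e_def)
  define q where "q n x = (\<psi> (x + e n *\<^sub>R b) - \<psi> x) / e n" for n x
  have "\<exists>\<xi>. 0 < \<xi> \<and> \<xi> < e n \<and> q n x = D (x + \<xi> *\<^sub>R b)" for n x
  proof -
    have der: "((\<lambda>t. \<psi> (x + t *\<^sub>R b)) has_real_derivative D (x + t *\<^sub>R b)) (at t)" for t
    proof -
      define F where "F = frechet_derivative \<psi> (at (x + t *\<^sub>R b))"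
      have F: "(\<psi> has_derivative F) (at (x + t *\<^sub>R b))" unfolding F_def using C_k_SucD(1)[of 0 \<psi>] C1 by simp
      then have "F (s *\<^sub>R b) = F b * s" for s by (simp add: has_derivative_linear linear_cmul)
      then have lin: "(\<lambda>s. F (s *\<^sub>R b)) = (*) (F b)" by (simp add: fun_eq_iff)
      have i: "((\<lambda>t. x + t *\<^sub>R b) has_derivative (\<lambda>s. s *\<^sub>R b)) (at t)" by (auto intro!: derivative_eq_intros)
      have "((\<lambda>t. \<psi> (x + t *\<^sub>R b)) has_derivative (\<lambda>s. F (s *\<^sub>R b))) (at t)"
        using has_derivative_compose[OF i F] .
      moreover have "D (x + t *\<^sub>R b) = F b" by (simp add: D_def partial_deriv_def F_def)
      ultimately show ?thesis unfolding has_field_derivative_def lin by simp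
    qed
    from MVT2[OF e(1)[of n], of "\<lambda>t. \<psi> (x + t *\<^sub>R b)" "\<lambda>t. D (x + t *\<^sub>R b)"] der
    obtain \<xi> where "0 < \<xi>" "\<xi> < e n" "\<psi> (x + e n *\<^sub>R b) - \<psi> (x + 0 *\<^sub>R b) = (e n - 0) * D (x + \<xi> *\<^sub>R b)" by blast
    then show ?thesis using e(1)[of n] by (intro exI[of _ \<xi>]) (simp add: q_def)
  qed
  then obtain \<xi> where \<xi>: "\<And>n x. 0 < \<xi> n x" "\<And>n x. \<xi> n x < e n" "\<And>n x. q n x = D (x + \<xi> n x *\<^sub>R b)" by metis
  have "(\<lambda>n. LINT x|lborel. q n x) \<longlonglongrightarrow> (LINT x|lborel. D x)"
  proof (rule integral_dominated_convergence)
    show "D \<in> borel_measurable lborel" using cD by (simp add: borel_measurable_continuous_onI)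
    show "q n \<in> borel_measurable lborel" for n unfolding q_def by simp
    show "integrable lborel (\<lambda>x::plane. M * indicator (cball 0 (R + 1)) x)"
      by (intro integrable_mult_right integrable_real_indicator emeasure_bounded_finite) auto
    show "AE x in lborel. (\<lambda>n. q n x) \<longlonglongrightarrow> D x"
    proof (rule AE_I2)
      fix x
      have "e \<longlonglongrightarrow> 0" unfolding e_def using LIMSEQ_inverse_real_of_nat by (simp add: inverse_eq_divide)
      then have "(\<lambda>n. \<xi> n x) \<longlonglongrightarrow> 0"
        by (rule tendsto_sandwich[OF _ _ tendsto_const, rotated 2]) (use \<xi> in \<open>auto intro!: always_eventually less_imp_le\<close>)
      then have "(\<lambda>n. x + \<xi> n x *\<^sub>R b) \<longlonglongrightarrow> x + 0 *\<^sub>R b" by (intro tendsto_intros)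
      then have "(\<lambda>n. D (x + \<xi> n x *\<^sub>R b)) \<longlonglongrightarrow> D (x + 0 *\<^sub>R b)" by (intro continuous_on_tendsto_compose[OF cD]) auto
      then show "(\<lambda>n. q n x) \<longlonglongrightarrow> D x" by (simp add: \<xi>(3))
    qed
    show "AE x in lborel. norm (q n x) \<le> M * indicator (cball 0 (R + 1)) x" for n
    proof (rule AE_I2)
      fix x
      have "norm x \<le> norm (x + \<xi> n x *\<^sub>R b) + norm (\<xi> n x *\<^sub>R b)" using norm_triangle_ineq4[of "x + \<xi> n x *\<^sub>R b" "\<xi> n x *\<^sub>R b"] by simp
      moreover have "norm (\<xi> n x *\<^sub>R b) \<le> 1" using \<xi>(1,2)[of n x] e[of n] b by simp
      ultimately have "indicator (cball 0 R) (x + \<xi> n x *\<^sub>R b) \<le> (indicator (cball 0 (R + 1)) x :: real)"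
        by (auto simp: indicator_def)
      then have "M * indicator (cball 0 R) (x + \<xi> n x *\<^sub>R b) \<le> M * indicator (cball 0 (R + 1)) x" using M by (intro mult_left_mono)
      then show "norm (q n x) \<le> M * indicator (cball 0 (R + 1)) x" using M(2)[of "x + \<xi> n x *\<^sub>R b"] unfolding \<xi>(3) by simp
    qed
  qed
  moreover have "(LINT x|lborel. q n x) = 0" for n
  proof -
    have "\<bar>\<psi> (x + e n *\<^sub>R b)\<bar> \<le> M' * indicator (cball 0 (R + 1)) x" for x
    proof (cases "norm x \<le> R + 1")
      case True
      have "M' * indicator (cball 0 R) (x + e n *\<^sub>R b) \<le> M' * 1" using M'(1) by (intro mult_left_mono) (auto simp: indicator_def)
      then show ?thesis using M'(2)[of "x + e n *\<^sub>R b"] True by simp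
    next
      case False
      have "norm x \<le> norm (x + e n *\<^sub>R b) + norm (e n *\<^sub>R b)" using norm_triangle_ineq4[of "x + e n *\<^sub>R b" "e n *\<^sub>R b"] by simp
      moreover have "norm (e n *\<^sub>R b) \<le> 1" using e[of n] b by simp
      ultimately have "R < norm (x + e n *\<^sub>R b)" using False by linarith
      then show ?thesis using z M'(1) by simp
    qed
    then have i: "integrable lborel (\<lambda>x. \<psi> (x + e n *\<^sub>R b))" by (intro compact_support_integrable) simp_all
    have "(LINT x|lborel. \<psi> (x + e n *\<^sub>R b)) = (LINT x|lborel. \<psi> x)"
      using lebesgue_integral_affine[of \<psi> 1 "e n *\<^sub>R b"] by (simp add: add.commute)
    then show ?thesis unfolding q_def using i i\<psi> by simp
  qed
  ultimately have "(\<lambda>n. 0) \<longlonglongrightarrow> (LINT x|lborel. D x)" by simp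
  then show ?thesis unfolding D_def using LIMSEQ_unique tendsto_const by blast
qed

text \<open>Allows the additive constants between solutions and potentials to be dropped when
  testing.\<close>

lemma laplacian_integral_zero:
  fixes \<phi> :: "plane \<Rightarrow> real"
  assumes t: "test_function \<phi>"
  shows "(LINT x|lborel. laplacian \<phi> x) = 0"
proof -
  obtain R where R: "R \<ge> 0" "\<And>x b. R < norm x \<Longrightarrow> partial_deriv b \<phi> x = 0" using test_function_basics(3)[OF t] by blast
  have ck: "C_k 1 (partial_deriv b \<phi>)" if "b \<in> Basis" for b
  proof -
    have "C_k (Suc 1) \<phi>" using t unfolding test_function_def by blast
    then show ?thesis using that unfolding C_k.simps(2)[of 1] by blast
  qed
  have i: "integrable lborel (partial_deriv b (partial_deriv b \<phi>))" if b: "b \<in> Basis" for b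
  proof -
    have c: "continuous_on UNIV (partial_deriv b (partial_deriv b \<phi>))" using ck[OF b] b by simp
    have o: "open {x::plane. R < norm x}" by (intro open_Collect_less continuous_intros)
    have z: "partial_deriv b (partial_deriv b \<phi>) x = 0" if "R < norm x" for x
      by (rule partial_deriv_zero_on_open[OF o]) (use that R in auto)
    obtain M where M: "\<And>x. \<bar>partial_deriv b (partial_deriv b \<phi>) x\<bar> \<le> M * indicator (cball 0 R) x" using compact_support_bound[OF c z] by blast
    show ?thesis by (rule compact_support_integrable[OF borel_measurable_continuous_onI[OF c] M])
  qed
  have "(LINT x|lborel. laplacian \<phi> x) = (\<Sum>b\<in>Basis. LINT x|lborel. partial_deriv b (partial_deriv b \<phi>) x)"
    unfolding laplacian_def using i by (intro Bochner_Integration.integral_sum) auto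
  also have "\<dots> = 0" using ck R by (intro sum.neutral ballI partial_deriv_integral_zero) auto
  finally show ?thesis .
qed

lemma integral_laplacian_shift:
  fixes \<phi> w :: "plane \<Rightarrow> real"
  assumes t: "test_function \<phi>" and w: "continuous_on UNIV w"
  shows "(LINT x|lborel. (w x + c) * (- laplacian \<phi> x)) = (LINT x|lborel. w x * (- laplacian \<phi> x))"
proof -
  obtain R where R: "\<And>x. R < norm x \<Longrightarrow> laplacian \<phi> x = 0" using test_function_basics(3)[OF t] by blast
  have i: "integrable lborel (\<lambda>x. w x * (- laplacian \<phi> x))" if w: "continuous_on UNIV w" for w
  proof -
    have cw: "continuous_on UNIV (\<lambda>x. w x * (- laplacian \<phi> x))" by (intro continuous_intros w test_function_basics(2)[OF t])
    obtain M where "\<And>x. \<bar>w x * (- laplacian \<phi> x)\<bar> \<le> M * indicator (cball 0 R) x" using compact_support_bound[OF cw, of R] R by auto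
    then show ?thesis by (intro compact_support_integrable borel_measurable_continuous_onI[OF cw])
  qed
  have "(LINT x|lborel. (w x + c) * (- laplacian \<phi> x)) = (LINT x|lborel. w x * (- laplacian \<phi> x)) + (LINT x|lborel. c * (- laplacian \<phi> x))"
    unfolding distrib_right by (intro Bochner_Integration.integral_add i continuous_intros w)
  then show ?thesis using laplacian_integral_zero[OF t] by simp
qed

text \<open>A pointwise Arzela-Ascoli argument: a diagonal sequence on a countable dense set, then
  the equi-Hoelder bound makes the values Cauchy everywhere.\<close>

lemma equi_holder_subsequence:
  fixes F :: "nat \<Rightarrow> plane \<Rightarrow> real" and A :: "nat \<Rightarrow> real"
  assumes B: "\<And>n x. \<bar>F n x\<bar> \<le> B x" and A: "\<And>n. \<bar>A n\<bar> \<le> CA" and a: "0 < a" and K: "0 \<le> K"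
    and h: "\<And>n x y. \<bar>F n x - F n y\<bar> \<le> K * norm (x - y) powr a"
  shows "\<exists>k. strict_mono (k :: nat \<Rightarrow> nat) \<and> convergent (\<lambda>n. A (k n)) \<and> (\<forall>x. convergent (\<lambda>n. F (k n) x))"
proof -
  obtain D :: "plane set" where D: "countable D" "\<And>X. open X \<Longrightarrow> X \<noteq> {} \<Longrightarrow> \<exists>d\<in>D. d \<in> X"
    using countable_dense_exists by blast
  \<comment> \<open>The constants A n are carried along as an extra coordinate \<open>None\<close>.
    Dividing by \<open>B x + 1\<close> turns the bound depending on x into a uniform one, as the
    diagonal argument requires.\<close>
  define G where "G n p = (case p of None \<Rightarrow> A n | Some x \<Rightarrow> F n x / (B x + 1))" for n p
  have cS: "countable (insert None (Some ` D))" using D by simp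
  have bd: "norm (G n p) \<le> max CA 1" for n p
  proof (cases p)
    case None
    then show ?thesis using A[of n] by (auto simp: G_def)
  next
    case (Some x)
    have "\<bar>F n x\<bar> < B x + 1" using B[of n x] by linarith
    then have "norm (G n p) \<le> 1" using Some by (simp add: G_def abs_divide)
    then show ?thesis by simp
  qed
  obtain k where k: "strict_mono (k::nat\<Rightarrow>nat)" and l: "\<And>p. p \<in> insert None (Some ` D) \<Longrightarrow> \<exists>l. (\<lambda>n. G (k n) p) \<longlonglongrightarrow> l"
    using function_convergent_subsequence[OF cS, of G "max CA 1"] bd by blast
  have "convergent (\<lambda>n. A (k n))" using l[of None] by (simp add: convergent_def G_def)
  moreover have "convergent (\<lambda>n. F (k n) x)" for x
  proof -
    have "Cauchy (\<lambda>n. F (k n) x)"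
    proof (rule metric_CauchyI)
      fix e :: real assume e: "0 < e"
      \<comment> \<open>The radius at which the Hoelder bound with constant K + 1 equals e / 3;
        using K + 1 avoids division by zero.\<close>
      define r where "r = (e / (3 * (K + 1))) powr (1 / a)"
      have r: "0 < r" unfolding r_def using e K by simp
      obtain d where d: "d \<in> D" "d \<in> ball x r" using D(2)[of "ball x r"] r by auto
      have "norm (x - d) powr a \<le> r powr a" using d a by (intro powr_mono2) (auto simp: dist_norm)
      also have "\<dots> = e / (3 * (K + 1))" unfolding r_def using a e K by (simp add: powr_powr)
      finally have "(K + 1) * norm (x - d) powr a \<le> e / 3" using K by (simp add: field_simps)
      moreover have "(K + 1) * norm (x - d) powr a = K * norm (x - d) powr a + norm (x - d) powr a" by (simp add: algebra_simps)
      moreover have "0 \<le> norm (x - d) powr a" by simp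
      ultimately have near: "K * norm (x - d) powr a \<le> e / 3" by linarith
      obtain l' where l': "(\<lambda>n. G (k n) (Some d)) \<longlonglongrightarrow> l'" using l[of "Some d"] d by blast
      have "0 < B d + 1" using B[of 0 d] abs_ge_zero[of "F 0 d"] by linarith
      then have "(\<lambda>n. F (k n) d) = (\<lambda>n. (B d + 1) * G (k n) (Some d))" by (auto simp: G_def)
      then have "(\<lambda>n. F (k n) d) \<longlonglongrightarrow> (B d + 1) * l'" using tendsto_mult_left[OF l'] by simp
      then have "Cauchy (\<lambda>n. F (k n) d)" by (rule LIMSEQ_imp_Cauchy)
      moreover have "0 < e / 3" using e by simp
      ultimately obtain N where N: "\<And>i j. i \<ge> N \<Longrightarrow> j \<ge> N \<Longrightarrow> dist (F (k i) d) (F (k j) d) < e / 3" unfolding Cauchy_def by blast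
      have "dist (F (k i) x) (F (k j) x) < e" if "i \<ge> N" "j \<ge> N" for i j
        using N[OF that] h[of "k i" x d] h[of "k j" x d] near unfolding dist_real_def by linarith
      then show "\<exists>M. \<forall>i\<ge>M. \<forall>j\<ge>M. dist (F (k i) x) (F (k j) x) < e" by blast
    qed
    then show ?thesis by (simp add: Cauchy_convergent_iff)
  qed
  ultimately show ?thesis using k by blast
qed

lemma locally_integrable_lborel:
  fixes u :: "plane \<Rightarrow> real"
  assumes [measurable]: "u \<in> borel_measurable borel" and i: "\<And>S. compact S \<Longrightarrow> integrable lborel (\<lambda>x. indicator S x *\<^sub>R u x)"
  shows "locally_integrable u"
  unfolding locally_integrable_def set_integrable_def
proof (intro allI impI)
  fix S :: "plane set" assume S: "compact S"
  then have [measurable]: "S \<in> sets borel" by (simp add: borel_compact)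
  show "integrable lebesgue (\<lambda>x. indicator S x *\<^sub>R u x)" using i[OF S] by (subst integrable_completion) auto
qed

context toda_family
begin

text \<open>The finitely many indices at which the eventual bounds may fail are removed by the shift
  \<open>N\<close> before a subsequence is taken.\<close>

lemma limit_potential:
  "\<exists>s A' V' a' C. strict_mono (s :: nat \<Rightarrow> nat) \<and> (\<lambda>n. A (s n)) \<longlonglongrightarrow> A' \<and> (\<forall>x. (\<lambda>n. V (s n) x) \<longlonglongrightarrow> V' x) \<and>
    0 < a' \<and> a' \<le> 1 \<and> 0 \<le> C \<and> (\<forall>n. riesz a' C (f (s n)))"
proof -
  obtain a' C where a': "0 < a'" "a' \<le> 1" and C: "0 \<le> C" and r: "\<forall>\<^sub>F n in sequentially. riesz a' C (f n)" using f_riesz by blast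
  obtain CL where CL: "\<forall>\<^sub>F n in sequentially. CL \<le> A n" using A_lower by blast
  obtain CA where CA: "\<And>n. A n \<le> CA" using A_upper by blast
  obtain N where N: "\<And>n. n \<ge> N \<Longrightarrow> riesz a' C (f n)" "\<And>n. n \<ge> N \<Longrightarrow> CL \<le> A n"
    using eventually_conj[OF r CL] unfolding eventually_sequentially by blast
  define B where "B x = m * ln (1 + norm x) + C / a'" for x :: plane
  have rN: "riesz a' C (f (n + N))" for n by (rule N(1)) simp
  have "\<exists>k. strict_mono (k :: nat \<Rightarrow> nat) \<and> convergent (\<lambda>n. A (k n + N)) \<and> (\<forall>x. convergent (\<lambda>n. V (k n + N) x))"
  proof (rule equi_holder_subsequence[where B = B and CA = "\<bar>CL\<bar> + \<bar>CA\<bar>" and K = "C / a'" and a = a'])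
    show "\<bar>V (n + N) x\<bar> \<le> B x" for n x
    proof -
      have "0 \<le> m * ln (1 + norm x)" "0 \<le> C / a'" using m_pos a' C by auto
      then show ?thesis using V_ge[of x "n + N"] pot_le[OF rN[of n] a' C, of x] unfolding B_def abs_le_iff by linarith
    qed
    show "\<bar>A (n + N)\<bar> \<le> \<bar>CL\<bar> + \<bar>CA\<bar>" for n using N(2)[of "n + N"] CA[of "n + N"] by simp
    show "\<bar>V (n + N) x - V (n + N) y\<bar> \<le> C / a' * norm (x - y) powr a'" for n x y by (rule pot_holder[OF rN a' C])
  qed (use a' C in auto)
  then obtain k where k: "strict_mono (k :: nat \<Rightarrow> nat)" "convergent (\<lambda>n. A (k n + N))" "\<And>x. convergent (\<lambda>n. V (k n + N) x)" by blast
  define s where "s n = k n + N" for n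
  have "strict_mono s" using k(1) unfolding s_def strict_mono_def by simp
  moreover have "(\<lambda>n. A (s n)) \<longlonglongrightarrow> lim (\<lambda>n. A (s n))" "\<forall>x. (\<lambda>n. V (s n) x) \<longlonglongrightarrow> lim (\<lambda>n. V (s n) x)"
    using k(2,3) unfolding s_def by (simp_all add: convergent_LIMSEQ_iff)
  moreover have "\<forall>n. riesz a' C (f (s n))" using rN unfolding s_def by blast
  ultimately show ?thesis using a' C
    by (intro exI[of _ s] exI[of _ "lim (\<lambda>n. A (s n))"] exI[of _ "\<lambda>x. lim (\<lambda>n. V (s n) x)"] exI[of _ a'] exI[of _ C]) blast
qed

text \<open>Because U tends to 0, the coupled density f converges pointwise to the scalar density g,
  and the h-term in the tested equation vanishes. What survives is the scalar equation for 2 V',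
  with source 2 g / cn.\<close>

lemma limit_solution:
  assumes distr: "\<And>n \<phi>. test_function \<phi> \<Longrightarrow>
    (LINT x|lborel. (2 * V n x - U n x) * (- laplacian \<phi> x)) = (LINT x|lborel. (2 * f n x - h n x) / cn * \<phi> x)"
  shows "\<exists>u. liouville_solution \<beta> P u"
proof -
  obtain s A' V' a' C where s: "strict_mono (s :: nat \<Rightarrow> nat)" and Al: "(\<lambda>n. A (s n)) \<longlonglongrightarrow> A'" and Vl: "\<And>x. (\<lambda>n. V (s n) x) \<longlonglongrightarrow> V' x"
    and a': "0 < a'" "a' \<le> 1" and C: "0 \<le> C" and r: "\<And>n. riesz a' C (f (s n))"
    using limit_potential by blast
  obtain CA where CA: "\<And>n. A n \<le> CA" using A_upper by blast
  have ev: "\<forall>\<^sub>F n in sequentially. Q (s n)" if "\<forall>\<^sub>F n in sequentially. Q n" for Q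
    by (rule eventually_compose_filterlim[OF that filterlim_subseq[OF s]])
  have "\<bar>V' x - V' y\<bar> \<le> C / a' * norm (x - y) powr a'" for x y
    using pot_holder[OF r a' C] by (intro tendsto_upperbound[OF tendsto_rabs[OF tendsto_diff[OF Vl Vl]]] always_eventually allI trivial_limit_sequentially)
  then have cV: "continuous_on UNIV V'" by (rule holder_imp_continuous[OF a'(1)])
  have [measurable]: "V' \<in> borel_measurable borel" using cV by (rule borel_measurable_continuous_onI)
  have V'_ge: "- m * ln (1 + norm x) \<le> V' x" for x
    by (intro tendsto_lowerbound[OF Vl] always_eventually allI V_ge trivial_limit_sequentially)
  define g where "g x = exp A' * W x * exp (4 * V' x)" for x
  have [measurable]: "g \<in> borel_measurable borel" unfolding g_def[abs_def] by measurable
  have g0: "0 \<le> g x" for x by (simp add: g_def)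
  have Ul: "(\<lambda>n. U (s n) x) \<longlonglongrightarrow> 0" for x
  proof (rule tendstoI)
    fix e :: real assume e: "0 < e"
    then have "0 < e / 2" by simp
    from ev[OF U_small[OF norm_ge_zero[of x] this]] show "\<forall>\<^sub>F n in sequentially. dist (U (s n) x) 0 < e"
    proof eventually_elim
      case (elim n)
      then have "\<bar>U (s n) x\<bar> \<le> e / 2" by blast
      then show ?case using e by simp
    qed
  qed
  have fl: "(\<lambda>n. f (s n) x) \<longlonglongrightarrow> g x" for x
  proof -
    have "(\<lambda>n. exp (A (s n)) * W x * exp (4 * V (s n) x - 2 * U (s n) x)) \<longlonglongrightarrow> exp A' * W x * exp (4 * V' x - 2 * 0)"
      by (intro tendsto_intros Al Vl Ul)
    then show ?thesis unfolding g_def by (subst f_eq) simp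
  qed
  \<comment> \<open>Fatou's lemma; mass could be lost here, but only local integrability and a
    dominating function are taken from it.\<close>
  have gi: "integrable lborel g"
  proof (rule integrableI_nonneg)
    have "(\<integral>\<^sup>+x. ennreal (g x) \<partial>lborel) = (\<integral>\<^sup>+x. liminf (\<lambda>n. ennreal (f (s n) x)) \<partial>lborel)"
      using fl by (intro nn_integral_cong lim_imp_Liminf[symmetric] tendsto_ennrealI) auto
    also have "\<dots> \<le> liminf (\<lambda>n. \<integral>\<^sup>+x. ennreal (f (s n) x) \<partial>lborel)" by (rule nn_integral_liminf) simp
    also have "\<dots> \<le> ennreal m" using nn_mass(1) by (intro Liminf_le always_eventually) auto
    finally show "(\<integral>\<^sup>+x. ennreal (g x) \<partial>lborel) < \<infinity>" by (simp add: le_less_trans)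
  qed (use g0 in auto)
  \<comment> \<open>Half of A' + ln (2 / cn), so that exp (2 * c) supplies both the factor
    \<open>exp A'\<close> of g and the factor 2 / cn of the source.\<close>
  define c where "c = (A' + ln (2 / cn)) / 2"
  define u where "u x = 2 * V' x + c" for x
  have cu: "continuous_on UNIV u" unfolding u_def[abs_def] by (intro continuous_intros cV)
  have [measurable]: "u \<in> borel_measurable borel" using cu by (rule borel_measurable_continuous_onI)
  have Wu: "W x * exp (2 * u x) = 2 / cn * g x" for x
  proof -
    have "exp (2 * u x) = exp (4 * V' x) * (exp A' * exp (ln (2 / cn)))"
      unfolding exp_add[symmetric] u_def c_def by (simp add: algebra_simps)
    also have "exp (ln (2 / cn)) = 2 / cn" using cn_pos by simp
    finally show ?thesis unfolding g_def by simp
  qed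
  have id: "(LINT x|lborel. u x * (- laplacian \<phi> x)) = (LINT x|lborel. 2 / cn * g x * \<phi> x)" if t: "test_function \<phi>" for \<phi>
  proof -
    obtain R where R: "R \<ge> 0" "\<And>x. R < norm x \<Longrightarrow> \<phi> x = 0" "\<And>x. R < norm x \<Longrightarrow> laplacian \<phi> x = 0" using test_function_basics(3)[OF t] by blast
    note c\<phi> = test_function_basics(1,2)[OF t]
    have [measurable]: "\<phi> \<in> borel_measurable borel" "laplacian \<phi> \<in> borel_measurable borel"
      using c\<phi> by (auto intro: borel_measurable_continuous_onI)
    obtain M where M: "M \<ge> 0" "\<And>x. \<bar>\<phi> x\<bar> \<le> M * indicator (cball 0 R) x" using compact_support_bound[OF c\<phi>(1) R(2)] by blast
    obtain M2 where M2: "M2 \<ge> 0" "\<And>x. \<bar>laplacian \<phi> x\<bar> \<le> M2 * indicator (cball 0 R) x" using compact_support_bound[OF c\<phi>(2) R(3)] by blast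
    have M': "\<bar>\<phi> x\<bar> \<le> M" for x using M(2)[of x] M(1) by (cases "x \<in> cball 0 R") auto
    obtain N where N: "\<And>n x. n \<ge> N \<Longrightarrow> norm x \<le> R \<Longrightarrow> \<bar>U (s n) x\<bar> \<le> 1"
      using ev[OF U_small[OF R(1) zero_less_one]] unfolding eventually_sequentially by blast
    \<comment> \<open>A tail of the subsequence on which |U| \<le> 1 on the support of the test
      function.\<close>
    define q where "q n = s (n + N)" for n
    have U1: "\<bar>U (q n) x\<bar> \<le> 1" if "norm x \<le> R" for n x unfolding q_def using that by (intro N) auto
    have Vq: "(\<lambda>n. V (q n) x) \<longlonglongrightarrow> V' x" and Uq: "(\<lambda>n. U (q n) x) \<longlonglongrightarrow> 0" and fq: "(\<lambda>n. f (q n) x) \<longlonglongrightarrow> g x" for x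
      unfolding q_def using LIMSEQ_ignore_initial_segment[OF Vl] LIMSEQ_ignore_initial_segment[OF Ul] LIMSEQ_ignore_initial_segment[OF fl] by blast+
    have rq: "riesz a' C (f (q n))" for n unfolding q_def by (rule r)
    have X: "(\<lambda>n. LINT x|lborel. (2 * V (q n) x - U (q n) x) * (- laplacian \<phi> x)) \<longlonglongrightarrow> (LINT x|lborel. (2 * V' x - 0) * (- laplacian \<phi> x))"
    proof (rule integral_dominated_convergence)
      define T where "T = 2 * (m * ln (1 + R) + C / a') + 1"
      show "integrable lborel (\<lambda>x::plane. T * M2 * indicator (cball 0 R) x)"
        by (intro integrable_mult_right integrable_real_indicator emeasure_bounded_finite) auto
      show "AE x in lborel. (\<lambda>n. (2 * V (q n) x - U (q n) x) * (- laplacian \<phi> x)) \<longlonglongrightarrow> (2 * V' x - 0) * (- laplacian \<phi> x)"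
        by (intro AE_I2 tendsto_intros Vq Uq)
      show "AE x in lborel. norm ((2 * V (q n) x - U (q n) x) * (- laplacian \<phi> x)) \<le> T * M2 * indicator (cball 0 R) x" for n
      proof (rule AE_I2)
        fix x
        show "norm ((2 * V (q n) x - U (q n) x) * (- laplacian \<phi> x)) \<le> T * M2 * indicator (cball 0 R) x"
        proof (cases "norm x \<le> R")
          case True
          have "m * ln (1 + norm x) \<le> m * ln (1 + R)" using True m_pos by (intro mult_left_mono ln_mono) (auto simp: add_pos_nonneg)
          moreover have "0 \<le> m * ln (1 + norm x)" "0 \<le> C / a'" using m_pos a' C by auto
          moreover have "- (m * ln (1 + norm x)) \<le> V (q n) x" using V_ge[of x "q n"] by simp
          moreover have "\<bar>2 * v - w\<bar> \<le> 2 * (t' + k) + 1" if "t \<le> t'" "0 \<le> t" "0 \<le> k" "\<bar>w\<bar> \<le> 1" "- t \<le> v" "v \<le> k" for t t' k v w :: real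
            using that by (auto simp: abs_le_iff)
          ultimately have "\<bar>2 * V (q n) x - U (q n) x\<bar> \<le> T"
            using U1[OF True, of n] pot_le[OF rq[of n] a' C, of x] unfolding T_def by blast
          then have "\<bar>2 * V (q n) x - U (q n) x\<bar> * \<bar>laplacian \<phi> x\<bar> \<le> T * (M2 * indicator (cball 0 R) x)"
            using M2(2)[of x] by (intro mult_mono) auto
          then show ?thesis by (simp add: abs_mult mult.assoc)
        next
          case False
          then show ?thesis using R(3)[of x] by simp
        qed
      qed
    qed (simp_all add: measurable_lborel1)
    have J: "(\<lambda>n. LINT x|lborel. f (q n) x * \<phi> x) \<longlonglongrightarrow> (LINT x|lborel. g x * \<phi> x)"
    proof (rule integral_dominated_convergence)
      \<comment> \<open>The sequence is dominated by a multiple of its own limit: on the disc V is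
        bounded above uniformly and V' is bounded below, so the singular weight cancels from the
        comparison and integrability of g suffices.\<close>
      define T where "T = exp (CA + 4 * (C / a') + 2 - A' + 4 * (m * ln (1 + R)))"
      show "integrable lborel (\<lambda>x. T * M * g x)" by (intro integrable_mult_right gi)
      show "AE x in lborel. (\<lambda>n. f (q n) x * \<phi> x) \<longlonglongrightarrow> g x * \<phi> x" by (intro AE_I2 tendsto_intros fq)
      show "AE x in lborel. norm (f (q n) x * \<phi> x) \<le> T * M * g x" for n
      proof (rule AE_I2)
        fix x
        show "norm (f (q n) x * \<phi> x) \<le> T * M * g x"
        proof (cases "norm x \<le> R")
          case True
          have "m * ln (1 + norm x) \<le> m * ln (1 + R)" using True m_pos by (intro mult_left_mono ln_mono) (auto simp: add_pos_nonneg)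
          then have le: "A (q n) + (4 * V (q n) x - 2 * U (q n) x) \<le> (CA + 4 * (C / a') + 2 - A' + 4 * (m * ln (1 + R))) + (A' + 4 * V' x)"
            using CA[of "q n"] U1[OF True, of n] pot_le[OF rq[of n] a' C, of x] V'_ge[of x] by linarith
          have "f (q n) x = W x * exp (A (q n) + (4 * V (q n) x - 2 * U (q n) x))" unfolding exp_add by (subst f_eq) simp
          also have "\<dots> \<le> W x * exp ((CA + 4 * (C / a') + 2 - A' + 4 * (m * ln (1 + R))) + (A' + 4 * V' x))"
            using le by (intro mult_left_mono) auto
          also have "\<dots> = T * g x" unfolding T_def g_def exp_add by simp
          finally have "f (q n) x * \<bar>\<phi> x\<bar> \<le> T * g x * M" using M'[of x] f_nonneg g0[of x] by (intro mult_mono) (auto simp: T_def)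
          then show ?thesis by (simp add: abs_mult f_nonneg mult_ac)
        next
          case False
          then show ?thesis using R(2)[of x] g0[of x] M by (simp add: T_def)
        qed
      qed
    qed (simp_all add: measurable_lborel1)
    have fi: "integrable lborel (\<lambda>x. f n x * \<phi> x)" for n
      by (rule Bochner_Integration.integrable_bound[OF integrable_mult_right[OF f_integrable, of M n]])
        (auto simp: abs_mult f_nonneg M(1) mult.commute intro!: mult_right_mono M')
    have hi: "integrable lborel (\<lambda>x. h n x * \<phi> x)" for n
      by (rule Bochner_Integration.integrable_bound[OF integrable_mult_right[OF h_integrable, of M n]])
        (auto simp: abs_mult h_nonneg M(1) mult.commute intro!: mult_right_mono M')
    have Y: "(\<lambda>n. LINT x|lborel. h (q n) x * \<phi> x) \<longlonglongrightarrow> 0"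
    proof -
      obtain Ch where Ch: "Ch \<ge> 0" "\<forall>\<^sub>F n in sequentially. riesz a (Ch * exp (B n)) (\<lambda>y. indicator (cball 0 R) y * h n y)"
        using h_ball[OF R(1)] by blast
      have "\<forall>\<^sub>F n in sequentially. norm (LINT x|lborel. h n x * \<phi> x) \<le> M * (Ch * exp (B n))"
        using Ch(2)
      proof eventually_elim
        case (elim n)
        have C0: "0 \<le> Ch * exp (B n)" using Ch by simp
        have "norm (LINT x|lborel. h n x * \<phi> x) \<le> (LINT x|lborel. M * (indicator (cball 0 R) x * h n x))"
        proof (rule Bochner_Integration.integral_norm_bound_integral)
          show "integrable lborel (\<lambda>x. M * (indicator (cball 0 R) x * h n x))"
            by (intro integrable_mult_right riesz_integrable[OF elim a(1) a1 C0])
          show "norm (h n x * \<phi> x) \<le> M * (indicator (cball 0 R) x * h n x)" for x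
            using mult_left_mono[OF M(2)[of x] h_nonneg[of n x]] by (simp add: abs_mult h_nonneg mult_ac)
        qed (rule hi)
        also have "\<dots> \<le> M * (Ch * exp (B n))" using riesz_integral_le[OF elim a(1) a1 C0] M(1) by (simp add: mult_left_mono)
        finally show ?case .
      qed
      then have "\<forall>\<^sub>F n in sequentially. norm (LINT x|lborel. h (s n) x * \<phi> x) \<le> M * (Ch * exp (B (s n)))" by (rule ev)
      moreover have "(\<lambda>n. exp (B (s n))) \<longlonglongrightarrow> 0" by (rule filterlim_compose[OF exp_B_tendsto filterlim_subseq[OF s]])
      then have "(\<lambda>n. M * (Ch * exp (B (s n)))) \<longlonglongrightarrow> 0" by (intro tendsto_mult_right_zero)
      ultimately have "(\<lambda>n. LINT x|lborel. h (s n) x * \<phi> x) \<longlonglongrightarrow> 0" by (rule Lim_null_comparison)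
      then show ?thesis unfolding q_def by (rule LIMSEQ_ignore_initial_segment)
    qed
    have e: "(LINT x|lborel. (2 * V (q n) x - U (q n) x) * (- laplacian \<phi> x)) = (2 * (LINT x|lborel. f (q n) x * \<phi> x) - (LINT x|lborel. h (q n) x * \<phi> x)) / cn" for n
    proof -
      have "(LINT x|lborel. (2 * f (q n) x - h (q n) x) / cn * \<phi> x) = (LINT x|lborel. (2 * (f (q n) x * \<phi> x) - h (q n) x * \<phi> x) / cn)"
        by (intro Bochner_Integration.integral_cong refl) (simp add: left_diff_distrib)
      then show ?thesis unfolding distr[OF t] using fi hi by simp
    qed
    have Z: "(\<lambda>n. (2 * (LINT x|lborel. f (q n) x * \<phi> x) - (LINT x|lborel. h (q n) x * \<phi> x)) / cn) \<longlonglongrightarrow> (2 * (LINT x|lborel. g x * \<phi> x) - 0) / cn"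
      using cn_pos by (intro tendsto_intros J Y) auto
    have *: "(LINT x|lborel. (2 * V' x - 0) * (- laplacian \<phi> x)) = (2 * (LINT x|lborel. g x * \<phi> x) - 0) / cn"
      by (rule LIMSEQ_unique[OF X[unfolded e] Z])
    have "(LINT x|lborel. u x * (- laplacian \<phi> x)) = (LINT x|lborel. (2 * V' x) * (- laplacian \<phi> x))"
      unfolding u_def by (intro integral_laplacian_shift[OF t] continuous_intros cV)
    also have "\<dots> = (LINT x|lborel. 2 / cn * (g x * \<phi> x))"
      using * by simp
    finally show ?thesis by (simp only: mult.assoc)
  qed
  have "neg_laplacian_distr u (\<lambda>x. W x * exp (2 * u x))"
    unfolding neg_laplacian_distr_def
  proof (intro conjI allI impI)
    show "locally_integrable u"
      by (rule locally_integrable_lborel, simp, rule borel_integrable_compact, assumption, rule continuous_on_subset[OF cu subset_UNIV])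
    show "locally_integrable (\<lambda>x. W x * exp (2 * u x))"
      unfolding Wu by (rule locally_integrable_lborel, simp, rule integrable_mult_indicator) (simp_all add: borel_compact gi)
    fix \<phi> :: "plane \<Rightarrow> real" assume t: "test_function \<phi>"
    have [measurable]: "\<phi> \<in> borel_measurable borel" "laplacian \<phi> \<in> borel_measurable borel"
      using test_function_basics(1,2)[OF t] by (auto intro: borel_measurable_continuous_onI)
    show "(LINT x|lebesgue. u x * (- laplacian \<phi> x)) = (LINT x|lebesgue. W x * exp (2 * u x) * \<phi> x)"
      unfolding Wu using id[OF t] by (subst (1 2) integral_completion) (simp_all add: measurable_lborel1)
  qed
  moreover have "log_asymptotics (- 2 * m) u"
    unfolding log_asymptotics_def
  proof (rule bigoI)
    show "\<forall>\<^sub>F x in at_infinity. norm (u x - - 2 * m * ln (norm x)) \<le> (4 * C / a' + \<bar>c\<bar>) * norm (1::real)"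
      unfolding eventually_at_infinity
    proof (intro exI[of _ 1] allI impI)
      fix x :: plane assume x: "1 \<le> norm x"
      \<comment> \<open>The far-field bounds are taken before the limit, where the mass is exactly
        m, and then passed to the limit pointwise; thus no mass has to be computed for g.\<close>
      have "0 \<le> V' x + ln (norm x) * m"
        using pot_far(1)[OF r a' C x] by (intro tendsto_lowerbound[OF tendsto_add[OF Vl tendsto_const]]) (auto intro!: always_eventually simp: mass)
      moreover have "V' x + ln (norm x) * m \<le> 2 * C / a'"
        using pot_far(2)[OF r a' C x] by (intro tendsto_upperbound[OF tendsto_add[OF Vl tendsto_const]]) (auto intro!: always_eventually simp: mass)
      moreover have "u x - - 2 * m * ln (norm x) = 2 * (V' x + ln (norm x) * m) + c" by (simp add: u_def algebra_simps)
      moreover have "4 * C / a' = 2 * (2 * C / a')" by simp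
      moreover have "\<bar>d\<bar> \<le> k' + \<bar>c\<bar>" if "0 \<le> v" "v \<le> k" "d = 2 * v + c" "k' = 2 * k" for v k d k' :: real
        using that by (simp add: abs_le_iff abs_if)
      ultimately have "\<bar>u x - - 2 * m * ln (norm x)\<bar> \<le> 4 * C / a' + \<bar>c\<bar>" by blast
      then show "norm (u x - - 2 * m * ln (norm x)) \<le> (4 * C / a' + \<bar>c\<bar>) * norm (1::real)" by simp
    qed
  qed
  ultimately show ?thesis unfolding liouville_solution_def using cu by blast
qed

end

text \<open>For |x| \<le> |Q| / 2 the quotient |x - Q| / |Q| lies between 1/2 and 2, and the
  exponent between -2 and 0. The assumption |Q| \<ge> 2 gives |x - Q| \<ge> 1, where the logarithm
  of the distance is 1-Lipschitz.\<close>

lemma far_factor: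
  fixes Q :: plane
  assumes Q: "2 \<le> norm Q" and b: "0 < b" "b < 1"
  defines "G \<equiv> \<lambda>x. norm Q powr (2 * b) * norm (x - Q) powr (-2 * b)"
  shows "norm x \<le> norm Q / 2 \<Longrightarrow> 1/4 \<le> G x \<and> G x \<le> 4"
    and "norm x \<le> norm Q / 2 \<Longrightarrow> norm y \<le> norm Q / 2 \<Longrightarrow> \<bar>ln (G x) - ln (G y)\<bar> \<le> 2 * norm (x - y)"
proof -
  have d: "norm Q / 2 \<le> norm (x - Q)" "norm (x - Q) \<le> 2 * norm Q" if "norm x \<le> norm Q / 2" for x
    using that norm_triangle_ineq2[of Q x] norm_triangle_ineq4[of x Q] by (auto simp: norm_minus_commute)
  have pos: "0 < norm Q" "norm Q \<noteq> 0" using Q by linarith+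
  show "1/4 \<le> G x \<and> G x \<le> 4" if x: "norm x \<le> norm Q / 2"
  proof
    define r where "r = norm (x - Q) / norm Q"
    have r: "1/2 \<le> r" "r \<le> 2" using d[OF x] pos by (auto simp: r_def field_simps)
    have G: "G x = r powr (-2 * b)" unfolding G_def r_def using pos by (simp add: powr_divide powr_minus field_simps)
    have "1/4 = (2::real) powr (-2)" by (simp add: powr_minus_divide)
    also have "\<dots> \<le> 2 powr (-2 * b)" using b by (intro powr_mono) auto
    also have "\<dots> \<le> r powr (-2 * b)" using r b by (intro powr_mono2') auto
    finally show "1/4 \<le> G x" unfolding G .
    have "r powr (-2 * b) \<le> (1/2) powr (-2 * b)" using r b by (intro powr_mono2') auto
    also have "\<dots> \<le> (1/2) powr (-2)" using b by (intro powr_mono') auto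
    also have "(1/2::real) powr (-2) = 4" by (simp add: powr_minus_divide power_divide)
    finally show "G x \<le> 4" unfolding G .
  qed
  show "\<bar>ln (G x) - ln (G y)\<bar> \<le> 2 * norm (x - y)" if x: "norm x \<le> norm Q / 2" and y: "norm y \<le> norm Q / 2"
  proof -
    have lnG: "ln (G z) = 2 * b * ln (norm Q) - 2 * b * ln (norm (z - Q))" if "norm z \<le> norm Q / 2" for z
    proof -
      have "0 < norm (z - Q)" using d(1)[OF that] pos by linarith
      then show ?thesis unfolding G_def using pos by (simp add: ln_mult ln_powr)
    qed
    have "\<bar>ln (norm (x - Q)) - ln (norm (y - Q))\<bar> \<le> norm (x - y) / 1"
      using d(1)[OF x] d(1)[OF y] Q by (intro ln_norm_lipschitz) auto
    then have "2 * b * \<bar>ln (norm (x - Q)) - ln (norm (y - Q))\<bar> \<le> 2 * norm (x - y)" using b by (intro mult_mono) auto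
    moreover have "\<bar>ln (G x) - ln (G y)\<bar> = 2 * b * \<bar>ln (norm (x - Q)) - ln (norm (y - Q))\<bar>"
    proof -
      have "ln (G x) - ln (G y) = - (2 * b * (ln (norm (x - Q)) - ln (norm (y - Q))))" unfolding lnG[OF x] lnG[OF y] by (simp add: algebra_simps)
      then show ?thesis using b by (simp add: abs_mult)
    qed
    ultimately show ?thesis by linarith
  qed
qed

lemma toda_distr:
  fixes P :: "nat \<Rightarrow> plane"
  assumes sol: "toda_solution \<beta> P u1 u2" and t: "test_function \<phi>"
  shows "(LINT x|lborel. u1 x * (- laplacian \<phi> x)) =
    (LINT x|lborel. (2 * (sing_weight {1..4} P \<beta> x * exp (2 * u1 x)) - sing_weight {5..7} P \<beta> x * exp (2 * u2 x)) * \<phi> x)"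
proof -
  define K where "K i = sing_weight {1..7} P (sing_exponent \<beta> i)" for i
  have [measurable]: "u1 \<in> borel_measurable borel" "u2 \<in> borel_measurable borel"
    using sol unfolding toda_solution_def Let_def by (auto intro: borel_measurable_continuous_onI)
  have [measurable]: "\<phi> \<in> borel_measurable borel" "laplacian \<phi> \<in> borel_measurable borel"
    using test_function_basics(1,2)[OF t] by (auto intro: borel_measurable_continuous_onI)
  have [measurable]: "K i \<in> borel_measurable borel" for i unfolding K_def by measurable
  have "(LINT x|lebesgue. u1 x * (- laplacian \<phi> x)) = (LINT x|lebesgue. (2 * K 1 x * exp (2 * u1 x) - K 2 x * exp (2 * u2 x)) * \<phi> x)"
    using sol t unfolding toda_solution_def Let_def neg_laplacian_distr_def K_def by blast
  then have "(LINT x|lborel. u1 x * (- laplacian \<phi> x)) = (LINT x|lborel. (2 * K 1 x * exp (2 * u1 x) - K 2 x * exp (2 * u2 x)) * \<phi> x)"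
    by (subst (asm) (1 2) integral_completion) (simp_all add: measurable_lborel1)
  also have "\<dots> = (LINT x|lborel. (2 * (sing_weight {1..4} P \<beta> x * exp (2 * u1 x)) - sing_weight {5..7} P \<beta> x * exp (2 * u2 x)) * \<phi> x)"
  proof (rule integral_cong_AE)
    have "AE x in lborel. \<forall>l\<in>{1..7}. x \<noteq> P l" by (subst AE_finite_all) (auto intro: AE_lborel_neq)
    then show "AE x in lborel. (2 * K 1 x * exp (2 * u1 x) - K 2 x * exp (2 * u2 x)) * \<phi> x
      = (2 * (sing_weight {1..4} P \<beta> x * exp (2 * u1 x)) - sing_weight {5..7} P \<beta> x * exp (2 * u2 x)) * \<phi> x"
    proof eventually_elim
      case (elim x)
      then show ?case unfolding K_def using sing_weight_sing_exponent[of x P \<beta>] by simp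
    qed
  qed (simp_all add: measurable_lborel1)
  finally show ?thesis .
qed

text \<open>One solution in terms of its two densities, with the powers of |P 6| and |P 7| taken out
  of \<open>exp B\<close> so that the factors of the escaping points remain comparable to 1. The
  last clause keeps the first equation in tested form for the limit.\<close>

definition toda_densities ::
    "(nat \<Rightarrow> real) \<Rightarrow> (nat \<Rightarrow> plane) \<Rightarrow> real \<Rightarrow> (plane \<Rightarrow> real) \<Rightarrow> (plane \<Rightarrow> real) \<Rightarrow> real \<Rightarrow> real \<Rightarrow> bool" where
  "toda_densities \<beta> P a f h A B \<longleftrightarrow> (\<exists>C\<ge>0. riesz a C f \<and> riesz a C h) \<and> (LINT y|lborel. f y) = \<beta> 4 \<and> (LINT y|lborel. h y) = \<beta> 4
    \<and> (\<forall>x. f x = exp A * sing_weight {1..4} P \<beta> x * exp (4 * pot f x - 2 * pot h x))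
    \<and> (\<forall>x. h x = exp B * norm (x - P 5) powr (-2 * \<beta> 5) * ((norm (P 6) powr (2 * \<beta> 6) * norm (x - P 6) powr (-2 * \<beta> 6))
       * (norm (P 7) powr (2 * \<beta> 7) * norm (x - P 7) powr (-2 * \<beta> 7))) * exp (4 * pot h x - 2 * pot f x))
    \<and> (\<forall>\<phi>. test_function \<phi> \<longrightarrow> (LINT x|lborel. (2 * pot f x - pot h x) * (- laplacian \<phi> x)) = (LINT x|lborel. (2 * f x - h x) / cn * \<phi> x))"

lemma toda_density_eqs:
  fixes P :: "nat \<Rightarrow> plane"
  assumes sol: "toda_solution \<beta> P u1 u2" and inj: "inj_on P {1..4}" "inj_on P {5..7}"
    and \<beta>: "\<And>l. l \<in> {1..7} \<Longrightarrow> 0 < \<beta> l \<and> \<beta> l < 1"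
    and s: "\<beta> 4 + (\<Sum>l=1..4. \<beta> l) = 2" "\<beta> 4 + (\<Sum>l=5..7. \<beta> l) = 2"
    and a: "0 < a" "a \<le> 1" "\<And>l. l \<in> {1..7} \<Longrightarrow> 2 * \<beta> l + a < 2"
    and far: "0 < norm (P 6)" "0 < norm (P 7)"
  shows "\<exists>f h A B. toda_densities \<beta> P a f h A B"
proof -
  define f where "f y = cn * sing_weight {1..4} P \<beta> y * exp (2 * u1 y)" for y
  define h where "h y = cn * sing_weight {5..7} P \<beta> y * exp (2 * u2 y)" for y
  obtain C A1 A2 where C: "0 \<le> C" "riesz a C f" "riesz a C h" and mass: "(LINT y|lborel. f y) = \<beta> 4" "(LINT y|lborel. h y) = \<beta> 4"
    and u1: "\<And>x. u1 x = A1 + 2 * pot f x - pot h x" and u2: "\<And>x. u2 x = A2 + 2 * pot h x - pot f x"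
    using toda_potential[OF sol inj \<beta> s a] unfolding f_def[abs_def] h_def[abs_def] by blast
  define A where "A = ln cn + 2 * A1"
  \<comment> \<open>The last two terms compensate the normalising powers of |P 6| and |P 7|.\<close>
  define B where "B = ln cn + 2 * A2 - 2 * \<beta> 6 * ln (norm (P 6)) - 2 * \<beta> 7 * ln (norm (P 7))"
  have f: "f x = exp A * sing_weight {1..4} P \<beta> x * exp (4 * pot f x - 2 * pot h x)" for x
  proof -
    have "2 * u1 x = 2 * A1 + (4 * pot f x - 2 * pot h x)" unfolding u1 by simp
    then have "exp (2 * u1 x) = exp (2 * A1) * exp (4 * pot f x - 2 * pot h x)" by (simp only: exp_add)
    moreover have "exp A = cn * exp (2 * A1)" unfolding A_def exp_add using cn_pos by simp
    ultimately show ?thesis unfolding f_def[of x] by simp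
  qed
  have h: "h x = exp B * norm (x - P 5) powr (-2 * \<beta> 5) * ((norm (P 6) powr (2 * \<beta> 6) * norm (x - P 6) powr (-2 * \<beta> 6))
       * (norm (P 7) powr (2 * \<beta> 7) * norm (x - P 7) powr (-2 * \<beta> 7))) * exp (4 * pot h x - 2 * pot f x)" for x
  proof -
    have "2 * u2 x = 2 * A2 + (4 * pot h x - 2 * pot f x)" unfolding u2 by simp
    then have e: "exp (2 * u2 x) = exp (2 * A2) * exp (4 * pot h x - 2 * pot f x)" by (simp only: exp_add)
    have "{5..7::nat} = {5, 6, 7}" by auto
    then have w: "sing_weight {5..7} P \<beta> x = norm (x - P 5) powr (-2 * \<beta> 5) * (norm (x - P 6) powr (-2 * \<beta> 6) * norm (x - P 7) powr (-2 * \<beta> 7))"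
      unfolding sing_weight_powr by simp
    have p: "norm (P 6) powr (2 * \<beta> 6) = exp (2 * \<beta> 6 * ln (norm (P 6)))" "norm (P 7) powr (2 * \<beta> 7) = exp (2 * \<beta> 7 * ln (norm (P 7)))"
      using far by (simp_all add: powr_def)
    have "exp B * (norm (P 6) powr (2 * \<beta> 6) * norm (P 7) powr (2 * \<beta> 7)) = exp (ln cn + 2 * A2)"
      unfolding p exp_add[symmetric] B_def by simp
    also have "\<dots> = cn * exp (2 * A2)" using cn_pos by (simp add: exp_add)
    finally have "cn * exp (2 * A2) = exp B * (norm (P 6) powr (2 * \<beta> 6) * norm (P 7) powr (2 * \<beta> 7))" by simp
    moreover have "h x = (cn * exp (2 * A2)) * (norm (x - P 5) powr (-2 * \<beta> 5) * (norm (x - P 6) powr (-2 * \<beta> 6) * norm (x - P 7) powr (-2 * \<beta> 7)))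
       * exp (4 * pot h x - 2 * pot f x)"
      unfolding h_def[of x] e w by (simp only: mult_ac)
    ultimately show ?thesis by (simp only: mult_ac)
  qed
  have d: "(LINT x|lborel. (2 * pot f x - pot h x) * (- laplacian \<phi> x)) = (LINT x|lborel. (2 * f x - h x) / cn * \<phi> x)" if t: "test_function \<phi>" for \<phi>
  proof -
    have c: "continuous_on UNIV (\<lambda>x. 2 * pot f x - pot h x)"
      by (intro continuous_intros pot_continuous[OF C(2) a(1,2) C(1)] pot_continuous[OF C(3) a(1,2) C(1)])
    have "u1 x = 2 * pot f x - pot h x + A1" for x unfolding u1 by simp
    then have "(LINT x|lborel. (2 * pot f x - pot h x) * (- laplacian \<phi> x)) = (LINT x|lborel. u1 x * (- laplacian \<phi> x))"
      using integral_laplacian_shift[OF t c, of A1] by simp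
    also have "\<dots> = (LINT x|lborel. (2 * (sing_weight {1..4} P \<beta> x * exp (2 * u1 x)) - sing_weight {5..7} P \<beta> x * exp (2 * u2 x)) * \<phi> x)"
      by (rule toda_distr[OF sol t])
    also have "\<dots> = (LINT x|lborel. (2 * f x - h x) / cn * \<phi> x)"
      using cn_pos by (intro Bochner_Integration.integral_cong refl) (simp add: f_def h_def diff_divide_distrib)
    finally show ?thesis .
  qed
  have "toda_densities \<beta> P a f h A B" unfolding toda_densities_def using C mass f h d by blast
  then show ?thesis by blast
qed

theorem lemma3p2:
  fixes \<beta> :: "nat \<Rightarrow> real" and P :: "nat \<Rightarrow> real^2"
  assumes "\<forall>l\<in>{1..7}. 0 < \<beta> l \<and> \<beta> l < 1"
    and "\<beta> 4 + (\<Sum>l=1..4. \<beta> l) = 2"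
    and "\<beta> 2 + \<beta> 3 < \<beta> 1"
    and "\<beta> 4 < 1/3"
    and "\<beta> 4 + (\<Sum>l=5..7. \<beta> l) = 2"
    and "\<beta> 4 + \<beta> 5 < 1"
    and "inj_on P {1..4}"
    and "\<nexists>u. liouville_solution \<beta> P u"
    and "P 5 \<notin> P ` {1..4}"
  shows "\<exists>R>0. \<forall>P6 P7. P6 \<noteq> P7 \<and> norm P6 \<ge> R \<and> norm P7 \<ge> R \<longrightarrow>
           (\<nexists>u1 u2. toda_solution \<beta> (P(6 := P6, 7 := P7)) u1 u2)"
proof (rule ccontr)
  assume contra: "\<not> ?thesis"
  \<comment> \<open>More than |P 5|, so that the new points differ from \<open>P 5\<close>; at least
    2, as \<open>far_factor\<close> requires; and unbounded in n.\<close>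
  define R where "R n = real n + norm (P 5) + 2" for n :: nat
  have R: "0 < R n" for n by (simp add: R_def add_nonneg_pos)
  have \<beta>: "0 < \<beta> l \<and> \<beta> l < 1" if "l \<in> {1..7}" for l using assms(1) that by blast
  have "\<exists>P6 P7 u1 u2. P6 \<noteq> P7 \<and> norm P6 \<ge> R n \<and> norm P7 \<ge> R n \<and> toda_solution \<beta> (P(6 := P6, 7 := P7)) u1 u2" for n
    using contra R[of n] by blast
  then obtain P6 P7 u1 u2 where P67: "\<And>n. P6 n \<noteq> P7 n" "\<And>n. norm (P6 n) \<ge> R n" "\<And>n. norm (P7 n) \<ge> R n"
    and sol: "\<And>n. toda_solution \<beta> (P(6 := P6 n, 7 := P7 n)) (u1 n) (u2 n)" by metis
  \<comment> \<open>a \<le> 1 - \<beta> l gives 2 \<beta> l + a \<le> 1 + \<beta> l < 2, and a \<le>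
    1 - 3 \<beta> 4 gives a + 6 \<beta> 4 \<le> 1 + 3 \<beta> 4 < 2.\<close>
  define a where "a = min (1/2) (Min ((\<lambda>l. 1 - \<beta> l) ` {1..7} \<union> {1 - 3 * \<beta> 4}))"
  have "0 < a" unfolding a_def using \<beta> assms(4) by (auto simp: Min_gr_iff)
  have "a \<le> 1/2" unfolding a_def by (rule min.cobounded1)
  have aM: "a \<le> z" if "z \<in> (\<lambda>l. 1 - \<beta> l) ` {1..7} \<union> {1 - 3 * \<beta> 4}" for z
  proof -
    have "Min ((\<lambda>l. 1 - \<beta> l) ` {1..7} \<union> {1 - 3 * \<beta> 4}) \<le> z" using that by (intro Min_le) auto
    then show ?thesis unfolding a_def by linarith
  qed
  have "a + 6 * \<beta> 4 < 2" using aM[of "1 - 3 * \<beta> 4"] assms(4) by simp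
  have al: "2 * \<beta> l + a < 2" if "l \<in> {1..7}" for l using aM[of "1 - \<beta> l"] \<beta>[OF that] that by auto
  define Q where "Q n = P(6 := P6 n, 7 := P7 n)" for n
  have Q: "Q n l = P l" if "l \<in> {1..5}" for n l using that by (auto simp: Q_def)
  have Q67: "Q n 5 = P 5" "Q n 6 = P6 n" "Q n 7 = P7 n" for n by (simp_all add: Q_def)
  have QW: "sing_weight {1..4} (Q n) \<beta> = sing_weight {1..4} P \<beta>" for n
    unfolding sing_weight_def using Q by (intro ext prod.cong) auto
  have "\<exists>f h A B. toda_densities \<beta> (Q n) a f h A B" for n
  proof (rule toda_density_eqs)
    have far: "norm (P 5) < norm (P6 n)" "norm (P 5) < norm (P7 n)" using P67(2,3)[of n] by (auto simp: R_def)
    show "toda_solution \<beta> (Q n) (u1 n) (u2 n)" unfolding Q_def by (rule sol)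
    show "inj_on (Q n) {1..4}" using assms(7) Q[of _ n] by (auto simp: inj_on_def)
    have "{5..7::nat} = {5, 6, 7}" by auto
    then show "inj_on (Q n) {5..7}" using P67(1)[of n] far by (auto simp: inj_on_def Q67)
    show "0 < norm (Q n 6)" "0 < norm (Q n 7)" unfolding Q67 using far norm_ge_zero[of "P 5"] by linarith+
  qed (use \<beta> al assms(2,5) \<open>0 < a\<close> \<open>a \<le> 1/2\<close> in auto)
  then obtain f h A B where D: "\<And>n. toda_densities \<beta> (Q n) a (f n) (h n) (A n) (B n)" by metis
  note D' = D[unfolded toda_densities_def Q67 QW]
  define G where "G b Q x = norm Q powr (2 * b) * norm (x - Q) powr (-2 * b)" for b :: real and Q x :: plane
  \<comment> \<open>Half of the smaller distance, so that on the disc of radius \<open>L n\<close>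
    both escaping factors are within the range of \<open>far_factor\<close>.\<close>
  define L where "L n = min (norm (P6 n)) (norm (P7 n)) / 2" for n
  have big: "2 \<le> norm (P6 n)" "2 \<le> norm (P7 n)" "real n \<le> norm (P6 n)" "real n \<le> norm (P7 n)" for n
    using P67(2,3)[of n] norm_ge_zero[of "P 5"] unfolding R_def by linarith+
  have b67: "0 < \<beta> 6" "\<beta> 6 < 1" "0 < \<beta> 7" "\<beta> 7 < 1" using \<beta>[of 6] \<beta>[of 7] by auto
  note G6 = far_factor[OF big(1) b67(1,2), folded G_def] and G7 = far_factor[OF big(2) b67(3,4), folded G_def]
  interpret toda_family \<beta> P a f h A B L "\<lambda>n x. G (\<beta> 6) (P6 n) x * G (\<beta> 7) (P7 n) x"
  proof
    show "0 < \<beta> l \<and> \<beta> l < 1" if "l \<in> {1..5}" for l using that \<beta>[of l] by auto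
    have "{1..4::nat} = {1, 2, 3, 4}" by auto
    then show "\<beta> 1 + \<beta> 2 + \<beta> 3 = 2 - 2 * \<beta> 4" using assms(2) by simp
    have "P 5 \<noteq> P l" if "l \<in> {1..4}" for l using assms(9) that by auto
    moreover have "{1..5::nat} = insert 5 {1..4}" by auto
    ultimately show "inj_on P {1..5}" using assms(7,9) by simp
    show "2 * \<beta> l + a < 2" if "l \<in> {1..5}" for l using that al by auto
    have Lx: "norm x \<le> norm (P6 n) / 2" "norm x \<le> norm (P7 n) / 2" if "norm x \<le> L n" for n x using that by (auto simp: L_def)
    show "1 / 16 \<le> G (\<beta> 6) (P6 n) x * G (\<beta> 7) (P7 n) x \<and> G (\<beta> 6) (P6 n) x * G (\<beta> 7) (P7 n) x \<le> 16" if x: "norm x \<le> L n" for n x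
      using mult_mono[of "1/4" "G (\<beta> 6) (P6 n) x" "1/4" "G (\<beta> 7) (P7 n) x"] mult_mono[of "G (\<beta> 6) (P6 n) x" 4 "G (\<beta> 7) (P7 n) x" 4]
        G6(1)[OF Lx(1)[OF x]] G7(1)[OF Lx(2)[OF x]] by simp
    show "\<bar>ln (G (\<beta> 6) (P6 n) x * G (\<beta> 7) (P7 n) x) - ln (G (\<beta> 6) (P6 n) y * G (\<beta> 7) (P7 n) y)\<bar> \<le> 4 * norm (x - y)"
      if x: "norm x \<le> L n" and y: "norm y \<le> L n" for n x y
    proof -
      have ln: "ln (G (\<beta> 6) (P6 n) z * G (\<beta> 7) (P7 n) z) = ln (G (\<beta> 6) (P6 n) z) + ln (G (\<beta> 7) (P7 n) z)" if z: "norm z \<le> L n" for z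
      proof (rule ln_mult_pos)
        show "0 < G (\<beta> 6) (P6 n) z" "0 < G (\<beta> 7) (P7 n) z" using G6(1)[OF Lx(1)[OF z]] G7(1)[OF Lx(2)[OF z]] by linarith+
      qed
      show ?thesis unfolding ln[OF x] ln[OF y]
        using G6(2)[OF Lx(1)[OF x] Lx(1)[OF y]] G7(2)[OF Lx(2)[OF x] Lx(2)[OF y]] by linarith
    qed
    show "filterlim L at_top sequentially"
    proof (rule filterlim_at_top_mono)
      show "filterlim (\<lambda>n. real n / 2) at_top sequentially" by real_asymp
      show "\<forall>\<^sub>F n in sequentially. real n / 2 \<le> L n" unfolding L_def using big by (intro always_eventually) auto
    qed
    show "h n x = exp (B n) * norm (x - P 5) powr (-2 * \<beta> 5) * (G (\<beta> 6) (P6 n) x * G (\<beta> 7) (P7 n) x) * exp (4 * pot (h n) x - 2 * pot (f n) x)" for n x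
      unfolding G_def using D' by blast
  qed (use assms \<open>0 < a\<close> \<open>a \<le> 1/2\<close> \<open>a + 6 * \<beta> 4 < 2\<close> D' in blast)+
  show False using limit_solution D' assms(8) by blast
qed

end
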